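(* Let $\Omega\subset\mathbb{R}^n$ be a bounded Lipschitz domain. (i) Let $0<p,q,q_0,q_1\le\infty$, $s_0\ne s_1$ and $0<s_i<1$ ($i=0,1$). Then $$\left(\mathbf{B}^{s_0}_{p,q_0}(\Omega),\mathbf{B}^{s_1}_{p,q_1}(\Omega)\right)_{\theta,q}=\mathbf{B}^s_{p,q}(\Omega),$$ where $0<\theta<1$ and $s=(1-\theta)s_0+\theta s_1$. (ii) Let $0<p_i,q_i\le\infty$, $s_0\ne s_1$ and $0<s_i<1$ ($i=0,1$). Then for each $0<\theta<1$, with $s=(1-\theta)s_0+\theta s_1$, $\frac1p=\frac{1-\theta}{p_0}+\frac{\theta}{p_1}$ and $\frac1q=\frac{1-\theta}{q_0}+\frac{\theta}{q_1}$, we have $$\left(\mathbf{B}^{s_0}_{p_0,q_0}(\Omega),\mathbf{B}^{s_1}_{p_1,q_1}(\Omega)\right)_{\theta,q}=\mathbf{B}^s_{p,q}(\Omega),$$ provided $p=q$.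
   Context: $(\cdot,\cdot)_{\theta,q}$ denotes the real interpolation method (K-method) for quasi-Banach couples; equality of spaces is with equivalent quasi-norms. Notation: $\mathbb{N}_0=\{0,1,2,\dots\}$. For $j\in\mathbb{N}_0$, $m\in\mathbb{Z}^n$, $Q_{j,m}$ is the cube in $\mathbb{R}^n$ with sides parallel to the axes, centre $2^{-j}m$, side length $2^{-j+1}$; $dQ_{j,m}$ is the concentric cube with side length $d$ times as large. $[s]$ is the integer part of $s$. Besov spaces on domains. Let $\Omega\subset\mathbb{R}^n$ be a domain, $s>0$, $0<p,q\le\infty$. For complex $\lambda=\{\lambda_{j,m}\}$ put $\|\lambda|b^s_{p,q}(\Omega)\|=\big(\sum_{j=0}^\infty2^{j(s-n/p)q}(\sum_{m:\,Q_{j,m}\cap\Omega\ne\emptyset}|\lambda_{j,m}|^p)^{q/p}\big)^{1/q}$ (usual modification for $\infty$). Fix $d>1$ and $K\in\mathbb{N}_0$, $K\ge1+[s]$. A $K$-atom located at $Q_{j,m}$ is a $C^K$ function $a:\mathbb{R}^n\to\mathbb{C}$ with $\operatorname{supp}a\subset dQ_{j,m}$ and $|D^\alpha a|\le2^{|\alpha|j}$ for $|\alpha|\le K$. $\mathbf{B}^s_{p,q}(\Omega)$ is the set of $f\in L_p(\Omega)$ with $f=\sum_{j}\sum_{m:\,Q_{j,m}\cap\Omega\neq\emptyset}\lambda_{j,m}a_{j,m}$ (convergence in $L_p(\Omega)$), $a_{j,m}$ $K$-atoms located at $Q_{j,m}$, $\|\lambda|b^s_{p,q}(\Omega)\|<\infty$;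 its quasi-norm is the infimum of $\|\lambda|b^s_{p,q}(\Omega)\|$ over all such representations (independent of $d,K$ up to equivalence). For bounded Lipschitz $\Omega$ an equivalent quasi-norm is $\|f|L_p(\Omega)\|+\big(\int_0^1t^{-sq}\omega_r(f,t,\Omega)_p^q\frac{dt}{t}\big)^{1/q}$, $r\in\mathbb{N}$, $r>s$, where $\omega_r(f,t,\Omega)_p=\sup_{|h|\le t}\|\Delta^r_hf(\cdot,\Omega)|L_p(\Omega)\|$ and $\Delta_h^rf(x,\Omega)=\Delta^r_hf(x)$ if $x,x+h,\dots,x+rh\in\Omega$, and $0$ otherwise. Lipschitz domains. A Lipschitz diffeomorphism is a one-to-one map $\Phi$ of $\mathbb{R}^n$ onto itself with Lipschitz components and $|\Phi(x)-\Phi(y)|\sim|x-y|$ for $|x-y|\le1$. A bounded domain $\Omega\subset\mathbb{R}^n$ is a Lipschitz domain if its boundary $\Gamma=\partial\Omega$ is covered by finitely many open balls $K_1,\dots,K_N$, $K_j\cap\Gamma\ne\emptyset$, and there are Lipschitz diffeomorphisms $\psi^{(j)}$ with $\psi^{(j)}(K_j\cap\Omega)\subset\mathbb{R}^n_+=\{x_n>0\}$ and $\psi^{(j)}(K_j\cap\Gamma)\subset\mathbb{R}^{n-1}$ (identified with $\mathbb{R}^{n-1}\times\{0\}$). *)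

theory Defs
  imports "HOL-Analysis.Analysis" "HOL-Probability.Essential_Supremum"
begin

text \<open>
  Exponents \<open>0 < p \<le> \<infinity>\<close> are of type \<^typ>\<open>ennreal\<close>, so that \<open>1 / \<infinity> = 0\<close>.
  Euclidean space is \<^typ>\<open>real ^ 'n\<close>, with dimension \<^term>\<open>CARD('n)\<close>.
\<close>

section \<open>Sequence spaces and Lebesgue spaces\<close>

text \<open>The power \<open>x\<^sup>r\<close> for \<open>0 \<le> x \<le> \<infinity>\<close>; only used for \<open>r > 0\<close>.\<close>

definition enn_powr :: "ennreal \<Rightarrow> real \<Rightarrow> ennreal" where
  "enn_powr x r = (if x = \<infinity> then \<infinity> else ennreal (enn2real x powr r))"

definition ell_qnorm :: "ennreal \<Rightarrow> 'i set \<Rightarrow> ('i \<Rightarrow> ennreal) \<Rightarrow> ennreal" where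
  "ell_qnorm p I x =
     (if p = \<infinity> then (SUP i\<in>I. x i)
      else enn_powr (\<Sum>\<^sub>\<infinity>i\<in>I. enn_powr (x i) (enn2real p)) (1 / enn2real p))"

definition Lp_qnorm :: "ennreal \<Rightarrow> (real ^ 'n) set \<Rightarrow> (real ^ 'n \<Rightarrow> complex) \<Rightarrow> ennreal" where
  "Lp_qnorm p \<Omega> f =
     (if p = \<infinity> then esssup (lebesgue_on \<Omega>) (\<lambda>x. ennreal (norm (f x)))
      else enn_powr (\<integral>\<^sup>+x. ennreal (norm (f x) powr enn2real p) \<partial>lebesgue_on \<Omega>) (1 / enn2real p))"

text \<open>
  Functions on \<open>\<Omega>\<close> are represented by total functions on the whole space whose values outside
  \<open>\<Omega>\<close> are irrelevant, and classes modulo equality almost everywhere by their members: all the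
  function spaces below are closed under changing a function outside \<open>\<Omega>\<close> and on null sets, and
  their quasi-norms are invariant under such changes.
\<close>

definition Lp_fun :: "ennreal \<Rightarrow> (real ^ 'n) set \<Rightarrow> (real ^ 'n \<Rightarrow> complex) set" where
  "Lp_fun p \<Omega> = {f. f \<in> borel_measurable (lebesgue_on \<Omega>) \<and> Lp_qnorm p \<Omega> f < \<infinity>}"

section \<open>Atoms\<close>

definition partial_deriv :: "'n \<Rightarrow> (real ^ 'n \<Rightarrow> complex) \<Rightarrow> real ^ 'n \<Rightarrow> complex" where
  "partial_deriv i f x = vector_derivative (\<lambda>t. f (x + t *\<^sub>R axis i 1)) (at 0)"

fun C_k :: "nat \<Rightarrow> (real ^ 'n \<Rightarrow> complex) \<Rightarrow> bool" where
  "C_k 0 f = continuous_on UNIV f"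
| "C_k (Suc k) f = (f differentiable_on UNIV \<and> (\<forall>i. C_k k (partial_deriv i f)))"

text \<open>
  A list \<open>[i\<^sub>1, \<dots>, i\<^sub>l]\<close> of coordinates stands for the multi-index \<open>\<alpha>\<close> with \<open>|\<alpha>| = l\<close> in which
  \<open>\<alpha>\<^sub>i\<close> counts the occurrences of \<open>i\<close>. The order of the list does not matter for \<open>C\<^sup>K\<close>
  functions if \<open>|\<alpha>| \<le> K\<close>.
\<close>

definition D_multi :: "'n list \<Rightarrow> (real ^ 'n \<Rightarrow> complex) \<Rightarrow> real ^ 'n \<Rightarrow> complex" where
  "D_multi \<alpha> f = foldr partial_deriv \<alpha> f"

text \<open>\<open>cube d j m\<close> is \<open>d Q\<^sub>j\<^sub>,\<^sub>m\<close>, taken closed: the side length \<open>d 2\<^bsup>1-j\<^esup>\<close> is twice the bound here.\<close>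

definition cube :: "real \<Rightarrow> nat \<Rightarrow> int ^ 'n \<Rightarrow> (real ^ 'n) set" where
  "cube d j m = {x. \<forall>i. \<bar>x $ i - of_int (m $ i) / 2 ^ j\<bar> \<le> d / 2 ^ j}"

definition atom :: "real \<Rightarrow> nat \<Rightarrow> nat \<Rightarrow> int ^ 'n \<Rightarrow> (real ^ 'n \<Rightarrow> complex) \<Rightarrow> bool" where
  "atom d K j m a \<longleftrightarrow>
     C_k K a \<and> closure {x. a x \<noteq> 0} \<subseteq> cube d j m \<and>
     (\<forall>\<alpha> x. length \<alpha> \<le> K \<longrightarrow> norm (D_multi \<alpha> a x) \<le> 2 ^ (length \<alpha> * j))"

section \<open>Besov spaces on domains\<close>

definition meeting_cubes :: "(real ^ 'n) set \<Rightarrow> nat \<Rightarrow> (int ^ 'n) set" where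
  "meeting_cubes \<Omega> j = {m. cube 1 j m \<inter> \<Omega> \<noteq> {}}"

definition b_qnorm ::
    "real \<Rightarrow> ennreal \<Rightarrow> ennreal \<Rightarrow> (real ^ 'n) set \<Rightarrow> (nat \<Rightarrow> int ^ 'n \<Rightarrow> complex) \<Rightarrow> ennreal" where
  "b_qnorm s p q \<Omega> \<mu> =
     ell_qnorm q UNIV (\<lambda>j. ennreal (2 powr (real j * (s - real CARD('n) * enn2real (1 / p)))) *
       ell_qnorm p (meeting_cubes \<Omega> j) (\<lambda>m. ennreal (norm (\<mu> j m))))"

text \<open>
  The inner sum over \<open>m\<close> is taken pointwise; it is locally finite (and finite if \<open>\<Omega>\<close> is bounded).
\<close>

definition atomic_repr :: "real \<Rightarrow> nat \<Rightarrow> ennreal \<Rightarrow> (real ^ 'n) set \<Rightarrow>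
    (real ^ 'n \<Rightarrow> complex) \<Rightarrow> (nat \<Rightarrow> int ^ 'n \<Rightarrow> complex) \<Rightarrow> bool" where
  "atomic_repr d K p \<Omega> f \<mu> \<longleftrightarrow>
     (\<exists>a. (\<forall>j. \<forall>m\<in>meeting_cubes \<Omega> j. atom d K j m (a j m)) \<and>
          (\<lambda>J. Lp_qnorm p \<Omega> (\<lambda>x. f x - (\<Sum>j<J. \<Sum>\<^sub>\<infinity>m\<in>meeting_cubes \<Omega> j. \<mu> j m * a j m x)))
            \<longlonglongrightarrow> 0)"

record 'v qn_space =
  vecs :: "'v set"
  qn :: "'v \<Rightarrow> ennreal"

definition besov :: "real \<Rightarrow> nat \<Rightarrow> real \<Rightarrow> ennreal \<Rightarrow> ennreal \<Rightarrow> (real ^ 'n) set \<Rightarrow>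
    (real ^ 'n \<Rightarrow> complex) qn_space" where
  "besov d K s p q \<Omega> =
     \<lparr>vecs = {f \<in> Lp_fun p \<Omega>. \<exists>\<mu>. atomic_repr d K p \<Omega> f \<mu> \<and> b_qnorm s p q \<Omega> \<mu> < \<infinity>},
      qn = (\<lambda>f. INF \<mu>\<in>{\<mu>. atomic_repr d K p \<Omega> f \<mu> \<and> b_qnorm s p q \<Omega> \<mu> < \<infinity>}. b_qnorm s p q \<Omega> \<mu>)\<rparr>"

section \<open>Real interpolation\<close>

definition K_functional ::
    "('a \<Rightarrow> complex) qn_space \<Rightarrow> ('a \<Rightarrow> complex) qn_space \<Rightarrow> real \<Rightarrow> ('a \<Rightarrow> complex) \<Rightarrow> ennreal" where
  "K_functional A\<^sub>0 A\<^sub>1 t f =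
     (INF (f\<^sub>0, f\<^sub>1)\<in>{(f\<^sub>0, f\<^sub>1). f\<^sub>0 \<in> vecs A\<^sub>0 \<and> f\<^sub>1 \<in> vecs A\<^sub>1 \<and> f = (\<lambda>x. f\<^sub>0 x + f\<^sub>1 x)}.
        qn A\<^sub>0 f\<^sub>0 + ennreal t * qn A\<^sub>1 f\<^sub>1)"

definition interp_qnorm :: "real \<Rightarrow> ennreal \<Rightarrow>
    ('a \<Rightarrow> complex) qn_space \<Rightarrow> ('a \<Rightarrow> complex) qn_space \<Rightarrow> ('a \<Rightarrow> complex) \<Rightarrow> ennreal" where
  "interp_qnorm \<theta> q A\<^sub>0 A\<^sub>1 f =
     (if q = \<infinity> then (SUP t\<in>{0<..}. ennreal (t powr - \<theta>) * K_functional A\<^sub>0 A\<^sub>1 t f)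
      else enn_powr
        (\<integral>\<^sup>+t\<in>{0<..}. enn_powr (ennreal (t powr - \<theta>) * K_functional A\<^sub>0 A\<^sub>1 t f) (enn2real q)
           * ennreal (1 / t) \<partial>lborel)
        (1 / enn2real q))"

definition interp :: "real \<Rightarrow> ennreal \<Rightarrow>
    ('a \<Rightarrow> complex) qn_space \<Rightarrow> ('a \<Rightarrow> complex) qn_space \<Rightarrow> ('a \<Rightarrow> complex) qn_space" where
  "interp \<theta> q A\<^sub>0 A\<^sub>1 =
     \<lparr>vecs = {f. (\<exists>f\<^sub>0\<in>vecs A\<^sub>0. \<exists>f\<^sub>1\<in>vecs A\<^sub>1. f = (\<lambda>x. f\<^sub>0 x + f\<^sub>1 x)) \<and>
                 interp_qnorm \<theta> q A\<^sub>0 A\<^sub>1 f < \<infinity>},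
      qn = interp_qnorm \<theta> q A\<^sub>0 A\<^sub>1\<rparr>"

definition equal_spaces :: "'v qn_space \<Rightarrow> 'v qn_space \<Rightarrow> bool" where
  "equal_spaces A B \<longleftrightarrow>
     vecs A = vecs B \<and>
     (\<exists>c C. 0 < c \<and> 0 < C \<and>
        (\<forall>f\<in>vecs A. ennreal c * qn B f \<le> qn A f \<and> qn A f \<le> ennreal C * qn B f))"

section \<open>Lipschitz domains\<close>

definition lipschitz_diffeo :: "(real ^ 'n \<Rightarrow> real ^ 'n) \<Rightarrow> bool" where
  "lipschitz_diffeo \<Phi> \<longleftrightarrow>
     bij \<Phi> \<and> (\<forall>i. \<exists>L. L-lipschitz_on UNIV (\<lambda>x. \<Phi> x $ i)) \<and>
     (\<exists>c C. 0 < c \<and> 0 < C \<and>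
        (\<forall>x y. dist x y \<le> 1 \<longrightarrow>
           c * dist x y \<le> dist (\<Phi> x) (\<Phi> y) \<and> dist (\<Phi> x) (\<Phi> y) \<le> C * dist x y))"

text \<open>
  The index type \<open>'n\<close> carries no order, so an arbitrary coordinate \<open>k\<close> plays the role of the last
  one. Its choice does not matter, since a permutation of the coordinates can be absorbed in the \<open>\<psi> l\<close>.
\<close>

definition bounded_lipschitz_domain :: "(real ^ 'n) set \<Rightarrow> bool" where
  "bounded_lipschitz_domain \<Omega> \<longleftrightarrow>
     open \<Omega> \<and> connected \<Omega> \<and> \<Omega> \<noteq> {} \<and> bounded \<Omega> \<and>
     (\<exists>k. \<exists>(N::nat) z r \<psi>.
        (\<forall>l<N. 0 < r l \<and> ball (z l) (r l) \<inter> frontier \<Omega> \<noteq> {}) \<and>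
        frontier \<Omega> \<subseteq> (\<Union>l<N. ball (z l) (r l)) \<and>
        (\<forall>l<N. lipschitz_diffeo (\<psi> l) \<and>
           \<psi> l ` (ball (z l) (r l) \<inter> \<Omega>) \<subseteq> {x. 0 < x $ k} \<and>
           \<psi> l ` (ball (z l) (r l) \<inter> frontier \<Omega>) \<subseteq> {x. x $ k = 0}))"

end

theory Submission
  imports Defs
begin

text \<open>
  The interpolation problem is reduced to one for weighted sequence spaces, and solved there by cutting
  sequences and by Hoelder's inequality.

  Fix \<open>0 < u \<le> 1\<close> not larger than any of the integrability exponents. For a cube of side comparable to
  \<open>2\<^bsup>-l\<^esup>\<close> that meets \<open>\<Omega>\<close>, let the \<^emph>\<open>oscillation\<close> be the error of the best approximation of \<open>f\<close> by constants, as a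
  normalised \<open>L\<^sub>u\<close> mean over the part in \<open>\<Omega>\<close> of an enlarged cube (\<open>osc_seq\<close>). If \<open>0 < s < 1\<close>, then \<open>f\<close> belongs to the Besov space
  exactly if it belongs to \<open>L\<^sub>u\<close> and its oscillations belong to the sequence space that defines the quasi-norm of atomic
  coefficients:

  \<^item> Atoms finer than the cube contribute to its oscillation by their size, coarser atoms by their Lipschitz
  constants. So the coefficients control the oscillations through an almost diagonal operator, which is bounded for
  \<open>0 < s < 1\<close> (\<open>besov_osc_seq_le\<close>).

  \<^item> Conversely, near-best constants on the cubes of each level, glued by a smooth partition of unity, converge to \<open>f\<close>; the
  differences of consecutive levels consist of atoms whose coefficients are differences of constants of
  neighbouring cubes (\<open>atomic_analysis\<close>). Two such constants are compared on a ball inside \<open>\<Omega>\<close> of comparable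
  size that both enlarged cubes contain. This is where the Lipschitz boundary enters: it satisfies the interior
  corkscrew condition (\<open>bounded_lipschitz_domain_corkscrew\<close>). Every series of atoms with coefficients in the
  sequence space converges (\<open>atomic_synthesis\<close>).

  Cutting the coefficients in two splits a function, and a splitting of a function splits its oscillations, because they are
  subadditive up to constants. This leaves two statements on sequences for each part of the theorem.

  \<^item> A sequence can be cut at parameters \<open>t\<^sub>k\<close> of a geometric grid into parts bounded in the end point spaces as the
  interpolation quasi-norm requires. For equal integrability exponents one cuts at a level
  (\<open>splits_same_p\<close>). Otherwise one cuts each level at a height that depends on the level and balances the two end point
  quasi-norms (\<open>splits_diagonal\<close>).

  \<^item> A sequence that splits along with \<open>f\<close> is bounded by the interpolation quasi-norm of \<open>f\<close>. For equal
  integrability exponents the \<open>K\<close>-functional at \<open>t = 2\<^bsup>l(s\<^sub>0-s\<^sub>1)\<^esup>\<close> bounds the entries of level \<open>l\<close>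
  (\<open>sub_interp_same_p\<close>). Otherwise each entry is located at the parameter where its dominant part changes; there it is a
  product of powers of both parts, to which Hoelder's inequality applies, and since \<open>p = q\<close> the contributions of
  different parameters add up (\<open>sub_interp_diagonal\<close>).
\<close>

section \<open>Powers of extended non-negative reals\<close>

lemma enn_powr_top [simp]: "enn_powr top r = top"
  by (simp add: enn_powr_def)

lemma enn_powr_ennreal: "0 \<le> a \<Longrightarrow> enn_powr (ennreal a) r = ennreal (a powr r)"
  by (simp add: enn_powr_def)

lemma enn_powr_0 [simp]: "enn_powr 0 r = 0"
  by (simp add: enn_powr_def)

lemma enn_powr_one_left [simp]: "enn_powr 1 r = 1"
  by (simp add: enn_powr_def)

lemma enn_powr_one_right [simp]: "enn_powr x 1 = x"
  by (cases x) (auto simp: enn_powr_ennreal)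

lemma enn_powr_mono: "x \<le> y \<Longrightarrow> 0 \<le> r \<Longrightarrow> enn_powr x r \<le> enn_powr y r"
  by (cases x; cases y) (auto simp: enn_powr_ennreal top_unique powr_mono2)

lemma enn_powr_powr: "enn_powr (enn_powr x r) s = enn_powr x (r * s)"
  by (cases x) (auto simp: enn_powr_ennreal powr_powr)

lemma enn_powr_mult: "enn_powr (x * y) r = enn_powr x r * enn_powr y r"
proof (cases x; cases y)
  fix a b assume *: "x = ennreal a" "0 \<le> a" "y = ennreal b" "0 \<le> b"
  then show ?thesis by (simp add: enn_powr_ennreal powr_mult flip: ennreal_mult)
next
  fix a assume *: "x = ennreal a" "0 \<le> a" "y = top"
  then show ?thesis by (cases "a = 0") (auto simp: enn_powr_ennreal ennreal_mult_top)
next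
  fix b assume *: "y = ennreal b" "0 \<le> b" "x = top"
  then show ?thesis by (cases "b = 0") (auto simp: enn_powr_ennreal ennreal_top_mult)
qed simp

lemma enn_powr_inverse_cancel [simp]:
  "r \<noteq> 0 \<Longrightarrow> enn_powr (enn_powr x r) (1 / r) = x"
  "r \<noteq> 0 \<Longrightarrow> enn_powr (enn_powr x (1 / r)) r = x"
  by (simp_all add: enn_powr_powr)

lemma enn_powr_le_iff: "0 < r \<Longrightarrow> enn_powr x r \<le> enn_powr y r \<longleftrightarrow> x \<le> y"
  using enn_powr_mono[of x y r] enn_powr_mono[of "enn_powr x r" "enn_powr y r" "1/r"] by auto

lemma enn_powr_le_swap: "0 < r \<Longrightarrow> enn_powr x (1 / r) \<le> y \<longleftrightarrow> x \<le> enn_powr y r"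
  using enn_powr_le_iff[of r "enn_powr x (1/r)" y] by simp

lemma enn_powr_eq_0_iff [simp]: "enn_powr x r = 0 \<longleftrightarrow> x = 0"
  by (cases x) (auto simp: enn_powr_ennreal)

lemma enn_powr_eq_top_iff [simp]: "enn_powr x r = top \<longleftrightarrow> x = top"
  by (cases x) (auto simp: enn_powr_ennreal)

lemma enn_powr_less_top_iff [simp]: "enn_powr x r < top \<longleftrightarrow> x < top"
  by (metis enn_powr_eq_top_iff less_top)

lemma enn_powr_add_exp: "enn_powr x (r + s) = enn_powr x r * enn_powr x s"
  by (cases x) (auto simp: enn_powr_ennreal powr_add ennreal_mult)

lemma powr_add_le_powr:
  fixes a b :: real
  assumes "0 \<le> a" "0 \<le> b" "0 < u" "u \<le> 1"
  shows "(a + b) powr u \<le> a powr u + b powr u"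
proof (cases "a + b = 0")
  case False
  with assms have p: "a + b > 0" by simp
  have *: "c * (a+b) powr (u-1) \<le> c powr u" if "0 \<le> c" "c \<le> a + b" for c
  proof (cases "c = 0")
    case False
    with that have "(a+b) powr (u-1) \<le> c powr (u-1)"
      using assms by (intro powr_mono2') auto
    then have "c * (a+b) powr (u-1) \<le> c * c powr (u-1)" using that by (intro mult_left_mono) auto
    also have "\<dots> = c powr u" using that False by (simp add: powr_diff)
    finally show ?thesis .
  qed simp
  have "(a + b) powr u = (a+b) * (a+b) powr (u-1)" using p by (simp add: powr_diff)
  also have "\<dots> = a * (a+b) powr (u-1) + b * (a+b) powr (u-1)" by (simp add: algebra_simps)
  also have "\<dots> \<le> a powr u + b powr u" using * assms by (intro add_mono) auto
  finally show ?thesis .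
qed (use assms in auto)

lemma enn_powr_add_le:
  assumes "0 < u" "u \<le> 1"
  shows "enn_powr (x + y) u \<le> enn_powr x u + enn_powr y u"
  by (cases x; cases y)
     (auto simp: enn_powr_ennreal powr_add_le_powr assms ennreal_leI simp flip: ennreal_plus)

lemma enn_powr_sum_le:
  assumes "0 < u" "u \<le> 1" "finite S"
  shows "enn_powr (\<Sum>i\<in>S. x i) u \<le> (\<Sum>i\<in>S. enn_powr (x i) u)"
  using assms(3)
proof (induction S)
  case (insert i S)
  then show ?case
    using enn_powr_add_le[OF assms(1,2), of "x i" "\<Sum>i\<in>S. x i"]
    by (auto intro: order_trans add_left_mono)
qed simp

lemma measurable_enn_powr [measurable]:
  assumes [measurable]: "f \<in> borel_measurable M"
  shows "(\<lambda>x. enn_powr (f x) r) \<in> borel_measurable M"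
proof -
  have "(\<lambda>x. if f x = top then top else ennreal (enn2real (f x) powr r)) \<in> borel_measurable M"
    by measurable
  then show ?thesis by (simp add: enn_powr_def)
qed

lemma SUP_le_powr_sum:
  assumes "0 < r"
  shows "enn_powr (SUP j. z j) r \<le> (\<Sum>j. enn_powr (z (j::nat)) r)"
proof -
  have "z j \<le> enn_powr (\<Sum>j. enn_powr (z j) r) (1 / r)" for j
    using sum_le_suminf[of "\<lambda>j. enn_powr (z j) r" "{j}"] assms
      enn_powr_mono[of "enn_powr (z j) r" _ "1/r"] by simp
  then have "(SUP j. z j) \<le> enn_powr (\<Sum>j. enn_powr (z j) r) (1 / r)" by (rule SUP_least)
  then show ?thesis using enn_powr_mono[of _ _ r] assms by fastforce
qed

section \<open>Quasi-norms of sequences\<close>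

lemma exponent_cases:
  assumes "0 < (p::ennreal)"
  obtains "p = \<infinity>" | r where "0 < r" "p = ennreal r"
  using assms by (cases p) (auto simp: infinity_ennreal_def)

lemma nn_integral_count_space_mono_set:
  assumes "I \<subseteq> J"
  shows "(\<integral>\<^sup>+i. x i \<partial>count_space I) \<le> (\<integral>\<^sup>+i. x i \<partial>count_space J)"
proof -
  have *: "(\<integral>\<^sup>+i. x i \<partial>count_space A) = (\<integral>\<^sup>+i. x i * indicator A i \<partial>count_space UNIV)" for A
    by (rule nn_integral_count_space_indicator) simp
  show ?thesis
    unfolding * using assms by (intro nn_integral_mono) (auto simp: indicator_def)
qed

lemma infsum_ennreal_eq_nn_integral:
  "infsum x I = (\<integral>\<^sup>+i. x i \<partial>count_space I)" for x :: "'i \<Rightarrow> ennreal"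
proof -
  have "infsum x I = (SUP F\<in>{F. finite F \<and> F \<subseteq> I}. sum x F)"
    by (rule nonneg_infsum_complete) auto
  also have "\<dots> = (\<integral>\<^sup>+i. x i \<partial>count_space I)"
  proof (rule antisym)
    show "(SUP F\<in>{F. finite F \<and> F \<subseteq> I}. sum x F) \<le> (\<integral>\<^sup>+i. x i \<partial>count_space I)"
    proof (rule SUP_least)
      fix F assume F: "F \<in> {F. finite F \<and> F \<subseteq> I}"
      then have "sum x F = (\<integral>\<^sup>+i. x i \<partial>count_space F)" by (simp add: nn_integral_count_space_finite)
      also have "\<dots> \<le> (\<integral>\<^sup>+i. x i \<partial>count_space I)"
        using F by (intro nn_integral_count_space_mono_set) auto
      finally show "sum x F \<le> (\<integral>\<^sup>+i. x i \<partial>count_space I)" .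
    qed
    show "(\<integral>\<^sup>+i. x i \<partial>count_space I) \<le> (SUP F\<in>{F. finite F \<and> F \<subseteq> I}. sum x F)"
      unfolding nn_integral_def
    proof (rule SUP_least)
      fix g assume "g \<in> {g. simple_function (count_space I) g \<and> g \<le> x}"
      then have g: "simple_function (count_space I) g" "g \<le> x" by auto
      have "integral\<^sup>S (count_space I) g = (\<integral>\<^sup>+i. g i \<partial>count_space I)"
        using g by (simp add: nn_integral_eq_simple_integral)
      also have "\<dots> \<le> (SUP F\<in>{F. finite F \<and> F \<subseteq> I}. sum g F)"
      proof (cases "finite {i\<in>I. g i \<noteq> 0}")
        case True
        then have "(\<integral>\<^sup>+i. g i \<partial>count_space I) = sum g {i\<in>I. g i \<noteq> 0}"
          by (subst nn_integral_count_space) (auto simp: zero_less_iff_neq_zero)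
        then show ?thesis using True by (auto intro!: SUP_upper)
      next
        case False
        have fin: "finite (g ` I)" using g(1) by (simp add: simple_function_def)
        obtain v where v: "v \<noteq> 0" "infinite {i\<in>I. g i = v}"
        proof (rule ccontr)
          assume "\<not> thesis"
          then have "\<forall>v. v \<noteq> 0 \<longrightarrow> finite {i\<in>I. g i = v}" using that by blast
          then have "finite (\<Union>v\<in>g ` I - {0}. {i\<in>I. g i = v})" using fin by auto
          moreover have "{i\<in>I. g i \<noteq> 0} \<subseteq> (\<Union>v\<in>g ` I - {0}. {i\<in>I. g i = v})" by auto
          ultimately show False using False finite_subset by blast
        qed
        have "of_nat N * v \<le> (SUP F\<in>{F. finite F \<and> F \<subseteq> I}. sum g F)" for N
        proof -
          obtain F where F: "F \<subseteq> {i\<in>I. g i = v}" "finite F" "card F = N"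
            using infinite_arbitrarily_large[OF v(2)] by blast
          have "sum g F = (\<Sum>i\<in>F. v)" using F by (intro sum.cong) auto
          then have "of_nat N * v = sum g F" using F by simp
          then show ?thesis using F by (auto intro!: SUP_upper)
        qed
        then have "(SUP N. of_nat N * v) \<le> (SUP F\<in>{F. finite F \<and> F \<subseteq> I}. sum g F)"
          by (rule SUP_least)
        then have "(SUP F\<in>{F. finite F \<and> F \<subseteq> I}. sum g F) = top"
          using v(1) by (simp add: ennreal_SUP_of_nat_eq_top ennreal_top_mult top_unique
              flip: SUP_mult_right_ennreal)
        then show ?thesis by (metis top_greatest)
      qed
      also have "\<dots> \<le> (SUP F\<in>{F. finite F \<and> F \<subseteq> I}. sum x F)"
        using g(2) by (intro SUP_mono) (auto simp: le_fun_def intro!: sum_mono)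
      finally show "integral\<^sup>S (count_space I) g \<le> (SUP F\<in>{F. finite F \<and> F \<subseteq> I}. sum x F)" .
    qed
  qed
  finally show ?thesis .
qed

lemma ell_qnorm_infty: "ell_qnorm top I x = (SUP i\<in>I. x i)"
  by (simp add: ell_qnorm_def)

lemma ell_qnorm_real:
  "0 < r \<Longrightarrow> ell_qnorm (ennreal r) I x = enn_powr (\<integral>\<^sup>+i. enn_powr (x i) r \<partial>count_space I) (1 / r)"
  by (simp add: ell_qnorm_def infsum_ennreal_eq_nn_integral)

lemma ell_qnorm_powr:
  "0 < r \<Longrightarrow> enn_powr (ell_qnorm (ennreal r) I x) r = (\<integral>\<^sup>+i. enn_powr (x i) r \<partial>count_space I)"
  by (simp add: ell_qnorm_real)

lemma ell_qnorm_le_iff: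
  "0 < r \<Longrightarrow> ell_qnorm (ennreal r) I x \<le> A \<longleftrightarrow> (\<integral>\<^sup>+i. enn_powr (x i) r \<partial>count_space I) \<le> enn_powr A r"
  by (simp add: ell_qnorm_real enn_powr_le_swap)

lemma ell_qnorm_mono:
  assumes "0 < p" "\<And>i. i \<in> I \<Longrightarrow> x i \<le> y i"
  shows "ell_qnorm p I x \<le> ell_qnorm p I y"
  using assms(1)
proof (cases rule: exponent_cases)
  case 1
  then show ?thesis using assms by (auto simp: ell_qnorm_infty intro: SUP_mono)
next
  case (2 r)
  then show ?thesis using assms(2)
    by (auto simp: ell_qnorm_real intro!: enn_powr_mono nn_integral_mono)
qed

lemma ell_qnorm_cong:
  assumes "0 < p" "\<And>i. i \<in> I \<Longrightarrow> x i = y i"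
  shows "ell_qnorm p I x = ell_qnorm p I y"
  using assms by (intro antisym ell_qnorm_mono) auto

lemma ell_qnorm_cmult:
  assumes "0 < p"
  shows "ell_qnorm p I (\<lambda>i. c * x i) = c * ell_qnorm p I x"
  using assms
proof (cases rule: exponent_cases)
  case 1
  then show ?thesis by (auto simp: ell_qnorm_infty SUP_mult_left_ennreal)
next
  case (2 r)
  then show ?thesis by (simp add: ell_qnorm_real enn_powr_mult nn_integral_cmult)
qed

lemma ell_qnorm_0 [simp]: "0 < p \<Longrightarrow> ell_qnorm p I (\<lambda>i. 0) = 0"
  using ell_qnorm_cmult[of p I 0 "\<lambda>_. 0"] by simp

lemma ell_qnorm_ge:
  assumes "0 < p" "i \<in> I"
  shows "x i \<le> ell_qnorm p I x"
  using assms(1)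
proof (cases rule: exponent_cases)
  case 1
  then show ?thesis using assms by (auto simp: ell_qnorm_infty intro: SUP_upper)
next
  case (2 r)
  have "enn_powr (x i) r = (\<integral>\<^sup>+j. enn_powr (x j) r * indicator {i} j \<partial>count_space I)"
    using assms(2) by (subst nn_integral_indicator_singleton) auto
  also have "\<dots> \<le> (\<integral>\<^sup>+j. enn_powr (x j) r \<partial>count_space I)"
    by (rule nn_integral_mono) (auto simp: indicator_def)
  finally have "enn_powr (x i) r \<le> \<dots>" .
  then show ?thesis using 2 enn_powr_mono[of "enn_powr (x i) r" _ "1/r"] by (simp add: ell_qnorm_real)
qed

lemma ell_qnorm_reindex_le:
  assumes "0 < p" "inj_on h I" "h ` I \<subseteq> J"
  shows "ell_qnorm p I (\<lambda>i. x (h i)) \<le> ell_qnorm p J x"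
  using assms(1)
proof (cases rule: exponent_cases)
  case 1
  then show ?thesis using assms by (auto simp: ell_qnorm_infty intro!: SUP_mono)
next
  case (2 r)
  have "(\<integral>\<^sup>+i. enn_powr (x (h i)) r \<partial>count_space I) = (\<integral>\<^sup>+j. enn_powr (x j) r \<partial>count_space (h ` I))"
    using assms(2) by (intro nn_integral_bij_count_space) (auto simp: bij_betw_def)
  also have "\<dots> \<le> (\<integral>\<^sup>+j. enn_powr (x j) r \<partial>count_space J)"
    using assms(3) by (rule nn_integral_count_space_mono_set)
  finally show ?thesis using 2 by (simp add: ell_qnorm_real enn_powr_mono)
qed

lemma ell_qnorm_add_le:
  assumes "0 < p"
  obtains C where "0 < C"
    "\<And>(I::'i set) x y. ell_qnorm p I (\<lambda>i. x i + y i) \<le> ennreal C * (ell_qnorm p I x + ell_qnorm p I y)"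
  using assms
proof (cases rule: exponent_cases)
  case 1
  show ?thesis
  proof (rule that[of 1])
    show "ell_qnorm p I (\<lambda>i. x i + y i) \<le> ennreal 1 * (ell_qnorm p I x + ell_qnorm p I y)"
      for I :: "'i set" and x y
      using 1 by (auto simp: ell_qnorm_infty intro!: SUP_least add_mono SUP_upper)
  qed simp
next
  case (2 r)
  show ?thesis
  proof (rule that[of "2 * 2 powr (1/r)"])
    show "ell_qnorm p I (\<lambda>i. x i + y i) \<le> ennreal (2 * 2 powr (1/r)) * (ell_qnorm p I x + ell_qnorm p I y)"
      for I :: "'i set" and x y
    proof -
      let ?N = "\<lambda>x. \<integral>\<^sup>+i. enn_powr (x i) r \<partial>count_space I"
      have pt: "enn_powr (a + b) r \<le> enn_powr 2 r * (enn_powr a r + enn_powr b r)" for a b :: ennreal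
      proof -
        have "enn_powr (a + b) r \<le> enn_powr (2 * max a b) r"
          using 2 by (intro enn_powr_mono) (auto simp: mult_2 add_mono)
        also have "\<dots> \<le> enn_powr 2 r * (enn_powr a r + enn_powr b r)"
          unfolding enn_powr_mult by (intro mult_left_mono) (auto simp: max_def)
        finally show ?thesis .
      qed
      have A: "enn_powr 2 r * (enn_powr X r + enn_powr Y r) \<le> enn_powr (ennreal (2 * 2 powr (1/r)) * (X + Y)) r" for X Y
      proof -
        have "enn_powr X r + enn_powr Y r \<le> 2 * enn_powr (X + Y) r"
          unfolding mult_2 using 2 by (intro add_mono enn_powr_mono) auto
        then have "enn_powr 2 r * (enn_powr X r + enn_powr Y r) \<le> enn_powr 2 r * (2 * enn_powr (X + Y) r)"
          by (intro mult_left_mono) auto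
        also have "\<dots> = enn_powr (ennreal (2 * 2 powr (1/r)) * (X + Y)) r"
          using 2 enn_powr_ennreal[of 2 "1/r"] by (simp add: ennreal_mult' enn_powr_mult enn_powr_ennreal powr_powr ac_simps)
        finally show ?thesis .
      qed
      have "?N (\<lambda>i. x i + y i) \<le> (\<integral>\<^sup>+i. enn_powr 2 r * (enn_powr (x i) r + enn_powr (y i) r) \<partial>count_space I)"
        by (intro nn_integral_mono pt)
      also have "\<dots> = enn_powr 2 r * (?N x + ?N y)" by (simp add: nn_integral_cmult nn_integral_add)
      also have "\<dots> = enn_powr 2 r * (enn_powr (ell_qnorm p I x) r + enn_powr (ell_qnorm p I y) r)"
        using 2 by (simp add: ell_qnorm_powr)
      finally have "?N (\<lambda>i. x i + y i) \<le> enn_powr (ennreal (2 * 2 powr (1/r)) * (ell_qnorm p I x + ell_qnorm p I y)) r"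
        using A order_trans by blast
      then show ?thesis using 2 by (simp add: ell_qnorm_le_iff)
    qed
  qed simp
qed

subsection \<open>Geometric weights\<close>

definition geo_sum :: "real \<Rightarrow> ennreal" where
  "geo_sum a = (\<integral>\<^sup>+k. ennreal (2 powr (- a * \<bar>real_of_int k\<bar>)) \<partial>count_space UNIV)"

lemma geo_sum_finite: assumes "0 < a" shows "geo_sum a < top"
proof -
  let ?g = "\<lambda>k. ennreal (2 powr (- a * \<bar>real_of_int k\<bar>))"
  have A: "(\<integral>\<^sup>+k. ?g k \<partial>count_space (h ` UNIV)) < top"
    if "inj h" and h: "\<And>n. \<bar>real_of_int (h n)\<bar> = real n" for h :: "nat \<Rightarrow> int"
  proof -
    have "(\<integral>\<^sup>+k. ?g k \<partial>count_space (range h)) = (\<integral>\<^sup>+n. ?g (h n) \<partial>count_space UNIV)"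
      using that(1) by (intro nn_integral_bij_count_space[symmetric]) (auto simp: bij_betw_def)
    also have "\<dots> = (\<Sum>n. ennreal ((2 powr (- a)) ^ n))"
      by (simp add: nn_integral_count_space_nat h powr_powr mult.commute flip: powr_realpow)
    also have "\<dots> < top"
      using assms by (intro less_top[THEN iffD1] ennreal_suminf_neq_top summable_geometric) (auto simp: powr_less_one)
    finally show ?thesis .
  qed
  have "geo_sum a \<le> (\<integral>\<^sup>+k. ?g k * indicator (range int) k + ?g k * indicator (range (\<lambda>n. - int n)) k \<partial>count_space UNIV)"
    unfolding geo_sum_def
  proof (rule nn_integral_mono)
    fix k :: int
    show "?g k \<le> ?g k * indicator (range int) k + ?g k * indicator (range (\<lambda>n. - int n)) k"
      by (cases k rule: int_cases2) auto
  qed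
  also have "\<dots> = (\<integral>\<^sup>+k. ?g k \<partial>count_space (range int)) + (\<integral>\<^sup>+k. ?g k \<partial>count_space (range (\<lambda>n. - int n)))"
    by (subst nn_integral_add) (auto simp flip: nn_integral_count_space_indicator)
  also have "\<dots> < top"
    using A[of int] A[of "\<lambda>n. - int n"] by (auto simp: inj_def)
  finally show ?thesis .
qed

lemma geo_sum_inj_le:
  assumes "inj_on h I"
  shows "(\<integral>\<^sup>+i. ennreal (2 powr (- a * \<bar>real_of_int (h i)\<bar>)) \<partial>count_space I) \<le> geo_sum a"
proof -
  have "(\<integral>\<^sup>+i. ennreal (2 powr (- a * \<bar>real_of_int (h i)\<bar>)) \<partial>count_space I)
     = (\<integral>\<^sup>+k. ennreal (2 powr (- a * \<bar>real_of_int k\<bar>)) \<partial>count_space (h ` I))"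
    using assms by (intro nn_integral_bij_count_space) (auto simp: bij_betw_def)
  also have "\<dots> \<le> geo_sum a"
    unfolding geo_sum_def by (rule nn_integral_count_space_mono_set) auto
  finally show ?thesis .
qed

lemma geo_sum_inj_le_nat:
  "inj h \<Longrightarrow> (\<Sum>j. ennreal (2 powr (- a * \<bar>real_of_int (h (j::nat))\<bar>))) \<le> geo_sum a"
  unfolding nn_integral_count_space_nat[symmetric] by (rule geo_sum_inj_le)

lemma ell_qnorm_geometric:
  assumes "0 < p" "0 < a"
  obtains C where "0 < C"
    "\<And>(I::'i set) h. inj_on h I \<Longrightarrow> ell_qnorm p I (\<lambda>i. ennreal (2 powr (- a * \<bar>real_of_int (h i)\<bar>))) \<le> ennreal C"
  using assms(1)
proof (cases rule: exponent_cases)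
  case 1
  show ?thesis
  proof (rule that[of 1])
    show "ell_qnorm p I (\<lambda>i. ennreal (2 powr (- a * \<bar>real_of_int (h i)\<bar>))) \<le> ennreal 1" if "inj_on h I"
      for I :: "'i set" and h
    proof -
      have "2 powr (- a * \<bar>real_of_int (h i)\<bar>) \<le> 1" for i
        using assms powr_mono[of "- a * \<bar>real_of_int (h i)\<bar>" 0 2] by (simp add: mult_nonneg_nonneg)
      then show ?thesis using 1 by (auto simp: ell_qnorm_infty intro!: SUP_least)
    qed
  qed simp
next
  case (2 r)
  define G where "G = enn2real (geo_sum (a*r))"
  have G: "geo_sum (a*r) = ennreal G" "0 \<le> G"
    using geo_sum_finite[of "a*r"] assms 2 by (auto simp: G_def)
  show ?thesis
  proof (rule that[of "G powr (1/r) + 1"])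
    show "0 < G powr (1 / r) + 1" by (simp add: add_nonneg_pos)
    show "ell_qnorm p I (\<lambda>i. ennreal (2 powr (- a * \<bar>real_of_int (h i)\<bar>))) \<le> ennreal (G powr (1/r) + 1)"
      if "inj_on h I" for I :: "'i set" and h
    proof -
      have "(\<integral>\<^sup>+i. enn_powr (ennreal (2 powr (- a * \<bar>real_of_int (h i)\<bar>))) r \<partial>count_space I)
         = (\<integral>\<^sup>+i. ennreal (2 powr (- (a*r) * \<bar>real_of_int (h i)\<bar>)) \<partial>count_space I)"
        by (simp add: enn_powr_ennreal powr_powr ac_simps)
      also have "\<dots> \<le> ennreal G" using geo_sum_inj_le[OF that, of "a*r"] G by simp
      finally have "ell_qnorm p I (\<lambda>i. ennreal (2 powr (- a * \<bar>real_of_int (h i)\<bar>))) \<le> enn_powr (ennreal G) (1/r)"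
        using 2 by (simp add: ell_qnorm_real enn_powr_mono)
      also have "\<dots> \<le> ennreal (G powr (1/r) + 1)" using G by (simp add: enn_powr_ennreal ennreal_leI)
      finally show ?thesis .
    qed
  qed
qed

text \<open>
  A sum with two-sided geometric decay to spare is controlled by a supremum. Suprema commute with all
  quasi-norms up to constants, whatever the exponent is, which makes this form more convenient than sums.
\<close>

lemma suminf_le_SUP:
  assumes "0 < a"
  obtains C where "0 < C"
    "\<And>h x. inj h \<Longrightarrow> (\<Sum>j. x (j::nat)) \<le> ennreal C * (SUP j. ennreal (2 powr (a * \<bar>real_of_int (h j)\<bar>)) * x j)"
proof -
  define G where "G = enn2real (geo_sum a)"
  have G: "geo_sum a = ennreal G" "0 \<le> G"
    using geo_sum_finite[of "a"] assms by (auto simp: G_def)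
  show ?thesis
  proof (rule that[of "G + 1"])
    show "0 < G + 1" using G by simp
    show "(\<Sum>j. x (j::nat)) \<le> ennreal (G+1) * (SUP j. ennreal (2 powr (a * \<bar>real_of_int (h j)\<bar>)) * x j)"
      if "inj h" for h x
    proof -
      let ?S = "SUP j. ennreal (2 powr (a * \<bar>real_of_int (h j)\<bar>)) * x j"
      have "x j \<le> ennreal (2 powr (- a * \<bar>real_of_int (h j)\<bar>)) * ?S" for j
      proof -
        have "x j = ennreal (2 powr (- a * \<bar>real_of_int (h j)\<bar>)) * (ennreal (2 powr (a * \<bar>real_of_int (h j)\<bar>)) * x j)"
          by (simp add: mult.assoc[symmetric] flip: ennreal_mult powr_add)
        also have "\<dots> \<le> ennreal (2 powr (- a * \<bar>real_of_int (h j)\<bar>)) * ?S"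
          by (intro mult_left_mono SUP_upper) auto
        finally show ?thesis .
      qed
      then have "(\<Sum>j. x j) \<le> (\<Sum>j. ennreal (2 powr (- a * \<bar>real_of_int (h j)\<bar>)) * ?S)"
        by (intro suminf_le) auto
      also have "\<dots> = (\<Sum>j. ennreal (2 powr (- a * \<bar>real_of_int (h j)\<bar>))) * ?S" by simp
      also have "\<dots> \<le> ennreal (G+1) * ?S"
        using geo_sum_inj_le_nat[OF that, of a] G by (intro mult_right_mono) (auto intro: order_trans simp: ennreal_leI)
      finally show ?thesis .
    qed
  qed
qed

lemma ell_qnorm_SUP_le:
  assumes "0 < p" "0 < a"
  obtains C where "0 < C"
    "\<And>(I::'i set) h z. inj h \<Longrightarrow> ell_qnorm p I (\<lambda>i. SUP j. z (j::nat) i)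
       \<le> ennreal C * (SUP j. ennreal (2 powr (a * \<bar>real_of_int (h j)\<bar>)) * ell_qnorm p I (z j))"
  using assms(1)
proof (cases rule: exponent_cases)
  case 1
  show ?thesis
  proof (rule that[of 1])
    show "ell_qnorm p I (\<lambda>i. SUP j. z (j::nat) i)
       \<le> ennreal 1 * (SUP j. ennreal (2 powr (a * \<bar>real_of_int (h j)\<bar>)) * ell_qnorm p I (z j))"
      for I :: "'i set" and h z
    proof -
      have "z j i \<le> (SUP j. ennreal (2 powr (a * \<bar>real_of_int (h j)\<bar>)) * ell_qnorm p I (z j))" if "i \<in> I" for i j
      proof -
        have "1 \<le> 2 powr (a * \<bar>real_of_int (h j)\<bar>)" using assms by (simp add: ge_one_powr_ge_zero)
        then have "z j i \<le> ennreal (2 powr (a * \<bar>real_of_int (h j)\<bar>)) * z j i"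
          using mult_right_mono[of 1 "ennreal (2 powr (a * \<bar>real_of_int (h j)\<bar>))" "z j i"] by simp
        also have "\<dots> \<le> ennreal (2 powr (a * \<bar>real_of_int (h j)\<bar>)) * ell_qnorm p I (z j)"
          using that assms by (intro mult_left_mono ell_qnorm_ge) auto
        finally show ?thesis by (rule SUP_upper2[OF UNIV_I])
      qed
      then show ?thesis using 1 by (simp add: ell_qnorm_infty[of I "\<lambda>i. SUP j. z j i"] SUP_least)
    qed
  qed simp
next
  case (2 r)
  obtain G where G: "0 < G"
    "\<And>h x. inj h \<Longrightarrow> (\<Sum>j. x (j::nat)) \<le> ennreal G * (SUP j. ennreal (2 powr ((a*r) * \<bar>real_of_int (h j)\<bar>)) * x j)"
    using suminf_le_SUP[OF mult_pos_pos[OF assms(2) 2(1)]] by blast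
  show ?thesis
  proof (rule that[of "G powr (1/r)"])
    show "0 < G powr (1/r)" using G by simp
    show "ell_qnorm p I (\<lambda>i. SUP j. z (j::nat) i)
       \<le> ennreal (G powr (1/r)) * (SUP j. ennreal (2 powr (a * \<bar>real_of_int (h j)\<bar>)) * ell_qnorm p I (z j))"
       (is "_ \<le> ?C * ?S") if "inj h"
      for I :: "'i set" and h z
    proof -
      have "(\<integral>\<^sup>+i. enn_powr (SUP j. z j i) r \<partial>count_space I) \<le> (\<integral>\<^sup>+i. (\<Sum>j. enn_powr (z j i) r) \<partial>count_space I)"
        using 2 by (intro nn_integral_mono SUP_le_powr_sum)
      also have "\<dots> = (\<Sum>j. enn_powr (ell_qnorm p I (z j)) r)"
        using 2 by (subst nn_integral_suminf) (auto simp: ell_qnorm_powr)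
      also have "\<dots> \<le> ennreal G * (SUP j. ennreal (2 powr ((a*r) * \<bar>real_of_int (h j)\<bar>)) * enn_powr (ell_qnorm p I (z j)) r)"
        by (rule G(2)[OF that])
      also have "\<dots> = ennreal G * (SUP j. enn_powr (ennreal (2 powr (a * \<bar>real_of_int (h j)\<bar>)) * ell_qnorm p I (z j)) r)"
        by (simp add: enn_powr_mult enn_powr_ennreal powr_powr ac_simps)
      also have "\<dots> \<le> ennreal G * enn_powr ?S r"
        using 2 by (intro mult_left_mono SUP_least enn_powr_mono SUP_upper) auto
      also have "\<dots> = enn_powr (?C * ?S) r" using G 2 by (simp add: enn_powr_mult enn_powr_ennreal powr_powr)
      finally show ?thesis using 2 by (simp add: ell_qnorm_le_iff)
    qed
  qed
qed

lemma ell_qnorm_decay_le: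
  assumes "0 < p" "0 < a"
  obtains C where "0 < C"
    "\<And>(I::'i set) h x. inj_on h I \<Longrightarrow>
       ell_qnorm p I (\<lambda>i. SUP j. ennreal (2 powr (- a * \<bar>real_of_int (h i - int j)\<bar>)) * x j)
       \<le> ennreal C * ell_qnorm p UNIV x"
  using assms(1)
proof (cases rule: exponent_cases)
  case 1
  show ?thesis
  proof (rule that[of 1])
    show "ell_qnorm p I (\<lambda>i. SUP j. ennreal (2 powr (- a * \<bar>real_of_int (h i - int j)\<bar>)) * x j)
       \<le> ennreal 1 * ell_qnorm p UNIV x" for I :: "'i set" and h x
    proof -
      have "ennreal (2 powr (- a * \<bar>real_of_int (h i - int j)\<bar>)) * x j \<le> 1 * ell_qnorm p UNIV x" for i j
      proof (rule mult_mono)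
        show "ennreal (2 powr (- a * \<bar>real_of_int (h i - int j)\<bar>)) \<le> 1"
          using assms powr_mono[of "- a * \<bar>real_of_int (h i - int j)\<bar>" 0 2] by (simp add: mult_nonneg_nonneg)
      qed (use assms in \<open>auto intro: ell_qnorm_ge\<close>)
      then show ?thesis using 1 by (auto simp: ell_qnorm_infty intro!: SUP_least)
    qed
  qed simp
next
  case (2 r)
  define G where "G = enn2real (geo_sum (a*r))"
  have G: "geo_sum (a*r) = ennreal G" "0 \<le> G"
    using geo_sum_finite[of "a*r"] assms 2 by (auto simp: G_def)
  show ?thesis
  proof (rule that[of "(G+1) powr (1/r)"])
    show "0 < (G+1) powr (1/r)" using G by simp
    show "ell_qnorm p I (\<lambda>i. SUP j. ennreal (2 powr (- a * \<bar>real_of_int (h i - int j)\<bar>)) * x j)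
       \<le> ennreal ((G+1) powr (1/r)) * ell_qnorm p UNIV x" if "inj_on h I" for I :: "'i set" and h x
    proof -
      let ?w = "\<lambda>i j. ennreal (2 powr (- (a*r) * \<bar>real_of_int (h i - int j)\<bar>))"
      have "(\<integral>\<^sup>+i. enn_powr (SUP j. ennreal (2 powr (- a * \<bar>real_of_int (h i - int j)\<bar>)) * x j) r \<partial>count_space I)
         \<le> (\<integral>\<^sup>+i. (\<Sum>j. enn_powr (ennreal (2 powr (- a * \<bar>real_of_int (h i - int j)\<bar>)) * x j) r) \<partial>count_space I)"
        using 2 by (intro nn_integral_mono SUP_le_powr_sum)
      also have "\<dots> = (\<Sum>j. \<integral>\<^sup>+i. ?w i j * enn_powr (x j) r \<partial>count_space I)"
        by (subst nn_integral_suminf) (auto simp: enn_powr_mult enn_powr_ennreal powr_powr ac_simps)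
      also have "\<dots> = (\<Sum>j. (\<integral>\<^sup>+i. ?w i j \<partial>count_space I) * enn_powr (x j) r)"
        by (subst nn_integral_multc) auto
      also have "\<dots> \<le> (\<Sum>j. ennreal (G+1) * enn_powr (x j) r)"
      proof (intro suminf_le mult_right_mono)
        fix j
        have "(\<integral>\<^sup>+i. ?w i j \<partial>count_space I) \<le> geo_sum (a*r)"
          using geo_sum_inj_le[of "\<lambda>i. h i - int j" I "a*r"] that by (simp add: inj_on_def)
        also have "\<dots> \<le> ennreal (G+1)" using G by (simp add: ennreal_leI)
        finally show "(\<integral>\<^sup>+i. ?w i j \<partial>count_space I) \<le> ennreal (G+1)" .
      qed auto
      also have "\<dots> = ennreal (G+1) * enn_powr (ell_qnorm p UNIV x) r"
        using 2 by (simp add: ell_qnorm_powr nn_integral_count_space_nat)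
      also have "\<dots> = enn_powr (ennreal ((G+1) powr (1/r)) * ell_qnorm p UNIV x) r"
        using G 2 by (simp add: enn_powr_mult enn_powr_ennreal powr_powr)
      finally show ?thesis using 2 by (simp add: ell_qnorm_le_iff)
    qed
  qed
qed

subsection \<open>Inequalities between sums of powers\<close>

lemma nn_integral_Holder:
  assumes [measurable]: "f \<in> borel_measurable M" "g \<in> borel_measurable M"
    and ab: "0 < a" "0 < b" "a + b = 1"
  shows "(\<integral>\<^sup>+x. enn_powr (f x) a * enn_powr (g x) b \<partial>M) \<le> enn_powr (\<integral>\<^sup>+x. f x \<partial>M) a * enn_powr (\<integral>\<^sup>+x. g x \<partial>M) b"
proof -
  let ?A = "\<integral>\<^sup>+x. f x \<partial>M" and ?B = "\<integral>\<^sup>+x. g x \<partial>M"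
  have Young: "enn_powr c a * enn_powr d b \<le> ennreal a * c + ennreal b * d" for c d :: ennreal
  proof (cases "c = top \<or> d = top")
    case True
    then show ?thesis using ab by (auto simp: ennreal_mult_top)
  next
    case False
    then obtain c' d' where cd: "c = ennreal c'" "d = ennreal d'" "0 \<le> c'" "0 \<le> d'"
      by (metis ennreal_cases)
    have "c' powr a * d' powr b \<le> a * c' + b * d'"
    proof (cases "c' = 0 \<or> d' = 0")
      case False
      then show ?thesis using Youngs_inequality_0[of a b c' d'] ab cd by auto
    qed (use ab cd in auto)
    then show ?thesis using cd ab by (simp add: enn_powr_ennreal ennreal_leI flip: ennreal_mult ennreal_plus)
  qed
  consider "?A = 0" | "?B = 0" | "?A \<noteq> 0" "?B \<noteq> 0" "?A = top \<or> ?B = top"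
    | "?A \<noteq> 0" "?B \<noteq> 0" "?A \<noteq> top" "?B \<noteq> top" by blast
  then show ?thesis
  proof cases
    case 1
    then have "AE x in M. f x = 0" by (simp add: nn_integral_0_iff_AE)
    then have "(\<integral>\<^sup>+x. enn_powr (f x) a * enn_powr (g x) b \<partial>M) = (\<integral>\<^sup>+x. 0 \<partial>M)"
      by (intro nn_integral_cong_AE) (auto elim!: eventually_mono)
    then show ?thesis by simp
  next
    case 2
    then have "AE x in M. g x = 0" by (simp add: nn_integral_0_iff_AE)
    then have "(\<integral>\<^sup>+x. enn_powr (f x) a * enn_powr (g x) b \<partial>M) = (\<integral>\<^sup>+x. 0 \<partial>M)"
      by (intro nn_integral_cong_AE) (auto elim!: eventually_mono)
    then show ?thesis by simp
  next
    case 3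
    then show ?thesis by (auto simp: ennreal_mult_top ennreal_top_mult)
  next
    case 4
    have split: "enn_powr (f x) a * enn_powr (g x) b
        = (enn_powr (f x / ?A) a * enn_powr (g x / ?B) b) * (enn_powr ?A a * enn_powr ?B b)" for x
    proof -
      have "f x = f x / ?A * ?A" "g x = g x / ?B * ?B" using 4
        by (simp_all add: ennreal_divide_times less_top)
      then have "enn_powr (f x) a = enn_powr (f x / ?A) a * enn_powr ?A a"
        "enn_powr (g x) b = enn_powr (g x / ?B) b * enn_powr ?B b"
        by (metis enn_powr_mult)+
      then show ?thesis by (simp add: ac_simps)
    qed
    have "(\<integral>\<^sup>+x. enn_powr (f x / ?A) a * enn_powr (g x / ?B) b \<partial>M)
        \<le> (\<integral>\<^sup>+x. ennreal a * (f x / ?A) + ennreal b * (g x / ?B) \<partial>M)"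
      by (intro nn_integral_mono Young)
    also have "\<dots> = ennreal a * (?A / ?A) + ennreal b * (?B / ?B)"
      by (simp add: nn_integral_add nn_integral_cmult nn_integral_divide)
    also have "\<dots> = 1" using 4 ab by (simp add: less_top flip: ennreal_plus)
    finally have le1: "(\<integral>\<^sup>+x. enn_powr (f x / ?A) a * enn_powr (g x / ?B) b \<partial>M) \<le> 1" .
    have "(\<integral>\<^sup>+x. enn_powr (f x) a * enn_powr (g x) b \<partial>M)
      = (\<integral>\<^sup>+x. enn_powr (f x / ?A) a * enn_powr (g x / ?B) b \<partial>M) * (enn_powr ?A a * enn_powr ?B b)"
      unfolding split by (rule nn_integral_multc) measurable
    also have "\<dots> \<le> 1 * (enn_powr ?A a * enn_powr ?B b)" by (intro mult_right_mono le1) auto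
    finally show ?thesis by simp
  qed
qed

lemma enn_powr_mean_le:
  assumes "finite S" "1 \<le> t"
  shows "enn_powr (\<Sum>j\<in>S. a j) t \<le> ennreal (real (card S) powr (t - 1)) * (\<Sum>j\<in>S. enn_powr (a j) t)"
proof (cases "t = 1 \<or> S = {}")
  case False
  then have t: "t > 1" "card S > 0" using assms by (auto simp: card_gt_0_iff)
  have "(\<Sum>j\<in>S. a j) = (\<integral>\<^sup>+j. enn_powr (enn_powr (a j) t) (1/t) * enn_powr 1 (1 - 1/t) \<partial>count_space S)"
    using t assms by (simp add: nn_integral_count_space_finite)
  also have "\<dots> \<le> enn_powr (\<integral>\<^sup>+j. enn_powr (a j) t \<partial>count_space S) (1/t) * enn_powr (\<integral>\<^sup>+j. 1 \<partial>count_space S) (1 - 1/t)"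
    using t by (intro nn_integral_Holder) auto
  also have "\<dots> = enn_powr (\<Sum>j\<in>S. enn_powr (a j) t) (1/t) * enn_powr (ennreal (real (card S))) (1 - 1/t)"
    using assms by (simp add: nn_integral_count_space_finite ennreal_of_nat_eq_real_of_nat)
  finally have "enn_powr (\<Sum>j\<in>S. a j) t
      \<le> enn_powr (enn_powr (\<Sum>j\<in>S. enn_powr (a j) t) (1/t) * enn_powr (ennreal (real (card S))) (1 - 1/t)) t"
    using t by (intro enn_powr_mono) auto
  also have "\<dots> = (\<Sum>j\<in>S. enn_powr (a j) t) * ennreal (real (card S) powr (t - 1))"
    using t by (simp add: enn_powr_mult enn_powr_ennreal powr_powr algebra_simps)
  finally show ?thesis by (simp add: mult.commute)
qed (use assms in \<open>auto simp: card_gt_0_iff\<close>)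

definition inv_exp :: "ennreal \<Rightarrow> real" where
  "inv_exp p = enn2real (1 / p)"

lemma inv_exp_top [simp]: "inv_exp top = 0"
  by (simp add: inv_exp_def)

lemma inv_exp_ennreal [simp]: "0 < r \<Longrightarrow> inv_exp (ennreal r) = 1 / r"
  by (simp add: inv_exp_def divide_ennreal flip: ennreal_1)

lemma inv_exp_nonneg [simp]: "0 \<le> inv_exp p"
  by (simp add: inv_exp_def)

lemma inv_exp_le:
  assumes "0 < u" "ennreal u \<le> p"
  shows "inv_exp p \<le> 1 / u"
  using assms by (cases p) (auto simp: inv_exp_top frac_le)

text \<open>
  The bound is that of the trivial estimates for \<open>p = u\<close>, where each entry is counted at most \<open>N\<^sub>2\<close> times, and
  for \<open>p = \<infinity>\<close>, where at most \<open>N\<^sub>1\<close> entries are added; Jensen's inequality gives the exponents in between.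
\<close>

lemma ell_qnorm_Schur:
  assumes "finite I" "finite J" "0 < u" "ennreal u \<le> p"
    and y: "\<And>i. i \<in> I \<Longrightarrow> enn_powr (y i) u \<le> (\<Sum>j\<in>{j\<in>J. R i j}. enn_powr (x j) u)"
    and N1: "\<And>i. i \<in> I \<Longrightarrow> real (card {j\<in>J. R i j}) \<le> N1" "0 < N1"
    and N2: "\<And>j. j \<in> J \<Longrightarrow> real (card {i\<in>I. R i j}) \<le> N2" "0 < N2"
  shows "ell_qnorm p I y \<le> ennreal (N1 powr (1/u - inv_exp p) * N2 powr inv_exp p) * ell_qnorm p J x"
proof -
  have "0 < p" using assms(3,4) by (meson ennreal_less_zero_iff less_le_trans)
  then show ?thesis
  proof (cases rule: exponent_cases)
    case 1
    have "y i \<le> ennreal (N1 powr (1/u)) * ell_qnorm p J x" if "i \<in> I" for i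
    proof -
      have "enn_powr (y i) u \<le> (\<Sum>j\<in>{j\<in>J. R i j}. enn_powr (ell_qnorm p J x) u)"
        using \<open>0 < p\<close> assms(3) that
        by (intro order_trans[OF y] sum_mono enn_powr_mono ell_qnorm_ge) auto
      also have "\<dots> = ennreal (real (card {j\<in>J. R i j})) * enn_powr (ell_qnorm p J x) u"
        by (simp add: ennreal_of_nat_eq_real_of_nat)
      also have "\<dots> \<le> ennreal N1 * enn_powr (ell_qnorm p J x) u"
        using N1 that by (intro mult_right_mono ennreal_leI) auto
      also have "\<dots> = enn_powr (ennreal (N1 powr (1/u)) * ell_qnorm p J x) u"
        using N1 assms(3) by (simp add: enn_powr_mult enn_powr_ennreal powr_powr)
      finally show ?thesis using enn_powr_le_iff[OF assms(3)] by blast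
    qed
    then show ?thesis using 1 N2 by (simp add: ell_qnorm_infty[of I] SUP_least)
  next
    case (2 r)
    define t where "t = r / u"
    have t: "1 \<le> t" using 2 assms(3,4) by (simp add: t_def)
    have pt: "enn_powr (y i) r \<le> ennreal (N1 powr (t-1)) * (\<Sum>j\<in>{j\<in>J. R i j}. enn_powr (x j) r)" if "i \<in> I" for i
    proof -
      have "enn_powr (y i) r = enn_powr (enn_powr (y i) u) t" using assms(3) by (simp add: enn_powr_powr t_def)
      also have "\<dots> \<le> enn_powr (\<Sum>j\<in>{j\<in>J. R i j}. enn_powr (x j) u) t"
        using t that by (intro enn_powr_mono y) auto
      also have "\<dots> \<le> ennreal (real (card {j\<in>J. R i j}) powr (t-1)) * (\<Sum>j\<in>{j\<in>J. R i j}. enn_powr (enn_powr (x j) u) t)"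
        using assms t by (intro enn_powr_mean_le) auto
      also have "\<dots> \<le> ennreal (N1 powr (t-1)) * (\<Sum>j\<in>{j\<in>J. R i j}. enn_powr (enn_powr (x j) u) t)"
        using N1 t that by (intro mult_right_mono ennreal_leI powr_mono2) auto
      finally show ?thesis using assms(3) by (simp add: enn_powr_powr t_def)
    qed
    have "(\<integral>\<^sup>+i. enn_powr (y i) r \<partial>count_space I) \<le> (\<Sum>i\<in>I. ennreal (N1 powr (t-1)) * (\<Sum>j\<in>{j\<in>J. R i j}. enn_powr (x j) r))"
      using assms(1) by (simp add: nn_integral_count_space_finite pt sum_mono)
    also have "\<dots> = ennreal (N1 powr (t-1)) * (\<Sum>j\<in>J. \<Sum>i\<in>{i\<in>I. R i j}. enn_powr (x j) r)"
      using assms(1,2) by (simp add: sum.swap_restrict flip: sum_distrib_left)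
    also have "\<dots> \<le> ennreal (N1 powr (t-1)) * (\<Sum>j\<in>J. ennreal N2 * enn_powr (x j) r)"
    proof (intro mult_left_mono sum_mono)
      fix j assume "j \<in> J"
      have "(\<Sum>i\<in>{i\<in>I. R i j}. enn_powr (x j) r) = ennreal (real (card {i\<in>I. R i j})) * enn_powr (x j) r"
        by (simp add: ennreal_of_nat_eq_real_of_nat)
      also have "\<dots> \<le> ennreal N2 * enn_powr (x j) r"
        using N2 \<open>j \<in> J\<close> by (intro mult_right_mono ennreal_leI) auto
      finally show "(\<Sum>i\<in>{i\<in>I. R i j}. enn_powr (x j) r) \<le> ennreal N2 * enn_powr (x j) r" .
    qed auto
    also have "\<dots> = ennreal (N1 powr (t-1)) * ennreal N2 * enn_powr (ell_qnorm p J x) r"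
      using assms(2) 2 by (simp add: ell_qnorm_powr nn_integral_count_space_finite mult.assoc flip: sum_distrib_left)
    also have "\<dots> = enn_powr (ennreal (N1 powr (1/u - inv_exp p) * N2 powr inv_exp p) * ell_qnorm p J x) r"
    proof -
      have "r * (1/u - 1/r) = t - 1" using 2 by (simp add: t_def field_simps)
      then show ?thesis
        using N1 N2 2 by (simp add: enn_powr_mult enn_powr_ennreal powr_mult powr_powr ennreal_mult mult.commute)
    qed
    finally show ?thesis using 2 by (simp add: ell_qnorm_le_iff)
  qed
qed

lemma ell_qnorm_Holder:
  assumes p: "0 < p" "0 < p0" "0 < p1" and th: "0 < \<theta>" "\<theta> < 1"
    and rel: "inv_exp p = (1 - \<theta>) * inv_exp p0 + \<theta> * inv_exp p1"
  shows "ell_qnorm p I (\<lambda>i. enn_powr (x i) (1 - \<theta>) * enn_powr (y i) \<theta>)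
    \<le> enn_powr (ell_qnorm p0 I x) (1 - \<theta>) * enn_powr (ell_qnorm p1 I y) \<theta>"
  using p(1)
proof (cases rule: exponent_cases)
  case 1
  have "(1 - \<theta>) * inv_exp p0 = 0 \<and> \<theta> * inv_exp p1 = 0"
    using rel th 1 by (auto simp: add_nonneg_eq_0_iff)
  then have "p0 = top" "p1 = top"
    using p(2,3) th by (auto elim!: exponent_cases simp: infinity_ennreal_def)
  then show ?thesis using 1 th
    by (auto simp: ell_qnorm_infty intro!: SUP_least mult_mono enn_powr_mono SUP_upper)
next
  case (2 r)
  consider (a) "p0 = top" "p1 = top" | (b) r1 where "p0 = top" "0 < r1" "p1 = ennreal r1"
    | (c) r0 where "p1 = top" "0 < r0" "p0 = ennreal r0"
    | (d) r0 r1 where "0 < r0" "p0 = ennreal r0" "0 < r1" "p1 = ennreal r1"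
    using p(2,3) by (metis exponent_cases infinity_ennreal_def)
  then show ?thesis
  proof cases
    case a
    then show ?thesis using rel 2 by simp
  next
    case b
    then have r1: "r1 = \<theta> * r" using rel 2 th by (simp add: field_simps)
    have "(\<integral>\<^sup>+i. enn_powr (enn_powr (x i) (1 - \<theta>) * enn_powr (y i) \<theta>) r \<partial>count_space I)
       \<le> (\<integral>\<^sup>+i. enn_powr (ell_qnorm p0 I x) ((1 - \<theta>) * r) * enn_powr (y i) r1 \<partial>count_space I)"
      using p th 2 unfolding enn_powr_mult enn_powr_powr r1
      by (intro nn_integral_mono mult_right_mono enn_powr_mono ell_qnorm_ge) auto
    also have "\<dots> = enn_powr (ell_qnorm p0 I x) ((1 - \<theta>) * r) * enn_powr (ell_qnorm p1 I y) r1"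
      using b by (simp add: nn_integral_cmult ell_qnorm_powr)
    also have "\<dots> = enn_powr (enn_powr (ell_qnorm p0 I x) (1 - \<theta>) * enn_powr (ell_qnorm p1 I y) \<theta>) r"
      by (simp add: enn_powr_mult enn_powr_powr r1)
    finally show ?thesis using 2 by (simp add: ell_qnorm_le_iff)
  next
    case c
    then have r0: "r0 = (1 - \<theta>) * r" using rel 2 th by (simp add: field_simps)
    have "(\<integral>\<^sup>+i. enn_powr (enn_powr (x i) (1 - \<theta>) * enn_powr (y i) \<theta>) r \<partial>count_space I)
       \<le> (\<integral>\<^sup>+i. enn_powr (x i) r0 * enn_powr (ell_qnorm p1 I y) (\<theta> * r) \<partial>count_space I)"
      using p th 2 unfolding enn_powr_mult enn_powr_powr r0
      by (intro nn_integral_mono mult_left_mono enn_powr_mono ell_qnorm_ge) auto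
    also have "\<dots> = enn_powr (ell_qnorm p0 I x) r0 * enn_powr (ell_qnorm p1 I y) (\<theta> * r)"
      using c by (simp add: nn_integral_multc ell_qnorm_powr)
    also have "\<dots> = enn_powr (enn_powr (ell_qnorm p0 I x) (1 - \<theta>) * enn_powr (ell_qnorm p1 I y) \<theta>) r"
      by (simp add: enn_powr_mult enn_powr_powr r0)
    finally show ?thesis using 2 by (simp add: ell_qnorm_le_iff)
  next
    case d
    define a where "a = (1 - \<theta>) * r / r0"
    define b where "b = \<theta> * r / r1"
    have "1 / r = (1 - \<theta>) / r0 + \<theta> / r1" using rel d 2 by simp
    then have ab: "0 < a" "0 < b" "a + b = 1" "r0 * a = (1 - \<theta>) * r" "r1 * b = \<theta> * r"
      using d 2 th by (auto simp: a_def b_def field_simps)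
    have "(\<integral>\<^sup>+i. enn_powr (enn_powr (x i) (1 - \<theta>) * enn_powr (y i) \<theta>) r \<partial>count_space I)
       = (\<integral>\<^sup>+i. enn_powr (enn_powr (x i) r0) a * enn_powr (enn_powr (y i) r1) b \<partial>count_space I)"
      by (simp add: enn_powr_mult enn_powr_powr ab)
    also have "\<dots> \<le> enn_powr (enn_powr (ell_qnorm p0 I x) r0) a * enn_powr (enn_powr (ell_qnorm p1 I y) r1) b"
      using d ab nn_integral_Holder[of "\<lambda>i. enn_powr (x i) r0" "count_space I" "\<lambda>i. enn_powr (y i) r1" a b]
      by (simp add: ell_qnorm_powr)
    also have "\<dots> = enn_powr (enn_powr (ell_qnorm p0 I x) (1 - \<theta>) * enn_powr (ell_qnorm p1 I y) \<theta>) r"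
      by (simp add: enn_powr_mult enn_powr_powr ab)
    finally show ?thesis using 2 by (simp add: ell_qnorm_le_iff)
  qed
qed

section \<open>Neighbouring cubes and almost diagonal operators\<close>

text \<open>
  The enlarged cubes \<open>cube R l m\<close> and \<open>cube R j m'\<close> meet.
\<close>

definition near :: "real \<Rightarrow> nat \<Rightarrow> int ^ 'n \<Rightarrow> nat \<Rightarrow> int ^ 'n \<Rightarrow> bool" where
  "near R l m j m' \<longleftrightarrow> (\<forall>i. \<bar>of_int (m $ i) / 2 ^ l - of_int (m' $ i) / 2 ^ j\<bar> \<le> R * (1 / 2 ^ l + 1 / 2 ^ j :: real))"

lemma near_sym: "near R l m j m' \<longleftrightarrow> near R j m' l m"
  unfolding near_def by (simp add: abs_minus_commute add.commute)

lemma near_if_cubes_meet: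
  assumes "x \<in> cube a l m" "x \<in> cube b j m'" "a \<le> R" "b \<le> R"
  shows "near R l m j m'"
  unfolding near_def
proof
  fix i
  have "\<bar>x $ i - of_int (m $ i) / 2 ^ l\<bar> \<le> R / 2 ^ l" "\<bar>x $ i - of_int (m' $ i) / 2 ^ j\<bar> \<le> R / 2 ^ j"
    using assms by (auto simp: cube_def elim!: allE[of _ i] order_trans intro!: divide_right_mono)
  then show "\<bar>of_int (m $ i) / 2 ^ l - of_int (m' $ i) / 2 ^ j\<bar> \<le> R * (1 / 2 ^ l + 1 / 2 ^ j)"
    by (simp add: distrib_left)
qed

lemma card_int_interval_le:
  fixes a b :: real
  assumes "a \<le> b"
  shows "finite {k::int. a \<le> of_int k \<and> of_int k \<le> b}" "real (card {k::int. a \<le> of_int k \<and> of_int k \<le> b}) \<le> b - a + 1"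
proof -
  have eq: "{k::int. a \<le> of_int k \<and> of_int k \<le> b} = {\<lceil>a\<rceil>..\<lfloor>b\<rfloor>}" by (auto simp: ceiling_le_iff le_floor_iff)
  show "finite {k::int. a \<le> of_int k \<and> of_int k \<le> b}" unfolding eq by simp
  have "real (card {\<lceil>a\<rceil>..\<lfloor>b\<rfloor>}) = real (nat (\<lfloor>b\<rfloor> + 1 - \<lceil>a\<rceil>))" by simp
  also have "\<dots> \<le> b - a + 1" using assms by linarith
  finally show "real (card {k::int. a \<le> of_int k \<and> of_int k \<le> b}) \<le> b - a + 1" unfolding eq .
qed

lemma card_vec_set_le:
  fixes A :: "'n::finite \<Rightarrow> int set"
  assumes "\<And>i. finite (A i)" "\<And>i. real (card (A i)) \<le> N"
  shows "finite {m :: int ^ 'n. \<forall>i. m $ i \<in> A i}" "real (card {m :: int ^ 'n. \<forall>i. m $ i \<in> A i}) \<le> N ^ CARD('n)"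
proof -
  have sub: "{m :: int ^ 'n. \<forall>i. m $ i \<in> A i} = (\<lambda>f. \<chi> i. f i) ` (PiE UNIV A)"
  proof (intro equalityI subsetI)
    fix m :: "int ^ 'n" assume "m \<in> {m. \<forall>i. m $ i \<in> A i}"
    then show "m \<in> (\<lambda>f. \<chi> i. f i) ` (PiE UNIV A)" by (intro image_eqI[of _ _ "\<lambda>i. m $ i"]) auto
  qed auto
  have fin: "finite (PiE UNIV A)" using assms by (intro finite_PiE) auto
  show "finite {m :: int ^ 'n. \<forall>i. m $ i \<in> A i}" unfolding sub using fin by simp
  have "real (card {m :: int ^ 'n. \<forall>i. m $ i \<in> A i}) \<le> real (card (PiE UNIV A))"
    unfolding sub using card_image_le[OF fin] by simp
  also have "\<dots> = (\<Prod>i\<in>UNIV. real (card (A i)))" by (simp add: card_PiE)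
  also have "\<dots> \<le> (\<Prod>i\<in>(UNIV::'n set). N)" using assms by (intro prod_mono) auto
  finally show "real (card {m :: int ^ 'n. \<forall>i. m $ i \<in> A i}) \<le> N ^ CARD('n)" by simp
qed

lemma card_near_le:
  fixes m :: "int ^ 'n"
  assumes "0 \<le> R"
  shows "finite {m'. near R l m j m'}"
    "real (card {m'. near R l m j m'}) \<le> ((4 * R + 1) * 2 ^ (j - l)) ^ CARD('n)"
proof -
  define A where "A i = {k::int. 2 ^ j * (of_int (m $ i) / 2 ^ l - R * (1 / 2 ^ l + 1 / 2 ^ j)) \<le> of_int k \<and>
      of_int k \<le> 2 ^ j * (of_int (m $ i) / 2 ^ l + R * (1 / 2 ^ l + 1 / 2 ^ j) :: real)}" for i
  have eq: "{m'. near R l m j m'} = {m'. \<forall>i. m' $ i \<in> A i}"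
  proof -
    have "\<bar>c - k / 2 ^ j\<bar> \<le> r \<longleftrightarrow> 2 ^ j * (c - r) \<le> k \<and> k \<le> 2 ^ j * (c + r)" for c k r :: real
    proof -
      have "\<bar>c - k / 2 ^ j\<bar> \<le> r \<longleftrightarrow> c - r \<le> k / 2 ^ j \<and> k / 2 ^ j \<le> c + r" by auto
      then show ?thesis by (simp add: field_simps)
    qed
    then show ?thesis unfolding near_def A_def by simp
  qed
  have le: "2 ^ j * (of_int (m $ i) / 2 ^ l - R * (1 / 2 ^ l + 1 / 2 ^ j))
     \<le> 2 ^ j * (of_int (m $ i) / 2 ^ l + R * (1 / 2 ^ l + 1 / 2 ^ j) :: real)" for i
    using assms by (intro mult_left_mono) (auto intro!: add_increasing2 simp: algebra_simps)
  have fin: "finite (A i)" for i unfolding A_def by (rule card_int_interval_le(1)[OF le])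
  have pj: "(2::real) ^ j / 2 ^ l \<le> 2 ^ (j - l)"
  proof (cases "l \<le> j")
    case True then show ?thesis by (simp add: power_diff)
  next
    case False
    then have "(2::real) ^ j \<le> 2 ^ l" by (intro power_increasing) auto
    then show ?thesis using False by simp
  qed
  have cA: "real (card (A i)) \<le> (4 * R + 1) * 2 ^ (j - l)" for i
  proof -
    have "real (card (A i)) \<le> 2 ^ j * (of_int (m $ i) / 2 ^ l + R * (1 / 2 ^ l + 1 / 2 ^ j)) -
       2 ^ j * (of_int (m $ i) / 2 ^ l - R * (1 / 2 ^ l + 1 / 2 ^ j)) + 1"
      unfolding A_def by (rule card_int_interval_le(2)[OF le])
    also have "\<dots> = 2 * R * (2 ^ j / 2 ^ l + 1) + 1" by (simp add: field_simps)
    also have "\<dots> \<le> 2 * R * (2 ^ (j - l) + 2 ^ (j - l)) + 2 ^ (j - l)"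
      using assms pj by (intro add_mono mult_left_mono) auto
    finally show ?thesis by (simp add: algebra_simps)
  qed
  show "finite {m'. near R l m j m'}" unfolding eq by (rule card_vec_set_le(1)[OF fin cA])
  show "real (card {m'. near R l m j m'}) \<le> ((4 * R + 1) * 2 ^ (j - l)) ^ CARD('n)"
    unfolding eq by (rule card_vec_set_le(2)[OF fin cA])
qed

definition level_norm ::
    "real \<Rightarrow> ennreal \<Rightarrow> (real ^ 'n) set \<Rightarrow> (nat \<Rightarrow> int ^ 'n \<Rightarrow> ennreal) \<Rightarrow> nat \<Rightarrow> ennreal" where
  "level_norm s p \<Omega> x j = ennreal (2 powr (real j * (s - real CARD('n) * inv_exp p))) *
     ell_qnorm p (meeting_cubes \<Omega> j) (x j)"

definition seq_qnorm ::
    "real \<Rightarrow> ennreal \<Rightarrow> ennreal \<Rightarrow> (real ^ 'n) set \<Rightarrow> (nat \<Rightarrow> int ^ 'n \<Rightarrow> ennreal) \<Rightarrow> ennreal" where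
  "seq_qnorm s p q \<Omega> x = ell_qnorm q UNIV (level_norm s p \<Omega> x)"

lemma b_qnorm_eq_seq_qnorm: "b_qnorm s p q \<Omega> \<mu> = seq_qnorm s p q \<Omega> (\<lambda>j m. ennreal (norm (\<mu> j m)))"
  by (simp add: b_qnorm_def seq_qnorm_def level_norm_def[abs_def] inv_exp_def)

lemma level_norm_mono:
  assumes "0 < p" "\<And>m. m \<in> meeting_cubes \<Omega> j \<Longrightarrow> x j m \<le> y j m"
  shows "level_norm s p \<Omega> x j \<le> level_norm s p \<Omega> y j"
  unfolding level_norm_def using assms by (intro mult_left_mono ell_qnorm_mono) auto

lemma seq_qnorm_mono:
  assumes "0 < p" "0 < q" "\<And>j m. m \<in> meeting_cubes \<Omega> j \<Longrightarrow> x j m \<le> y j m"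
  shows "seq_qnorm s p q \<Omega> x \<le> seq_qnorm s p q \<Omega> y"
  unfolding seq_qnorm_def using assms by (intro ell_qnorm_mono level_norm_mono) auto

lemma level_norm_cmult:
  assumes "0 < p"
  shows "level_norm s p \<Omega> (\<lambda>j m. c * x j m) j = c * level_norm s p \<Omega> x j"
  unfolding level_norm_def using assms by (simp add: ell_qnorm_cmult mult.left_commute)

lemma seq_qnorm_cmult:
  assumes "0 < p" "0 < q"
  shows "seq_qnorm s p q \<Omega> (\<lambda>j m. c * x j m) = c * seq_qnorm s p q \<Omega> x"
  unfolding seq_qnorm_def using assms
  by (subst ell_qnorm_cmult[symmetric]) (auto intro!: ell_qnorm_cong simp: level_norm_cmult)

lemma level_norm_le_seq_qnorm: "0 < q \<Longrightarrow> level_norm s p \<Omega> x j \<le> seq_qnorm s p q \<Omega> x"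
  unfolding seq_qnorm_def by (rule ell_qnorm_ge) auto

lemma seq_qnorm_coord_le:
  assumes "0 < p" "0 < q" "m \<in> meeting_cubes \<Omega> j"
  shows "ennreal (2 powr (real j * (s - real CARD('n) * inv_exp p))) * x j m \<le> seq_qnorm s p q (\<Omega> :: (real^'n) set) x"
proof -
  have "ennreal (2 powr (real j * (s - real CARD('n) * inv_exp p))) * x j m \<le> level_norm s p \<Omega> x j"
    unfolding level_norm_def using assms by (intro mult_left_mono ell_qnorm_ge) auto
  also have "\<dots> \<le> seq_qnorm s p q \<Omega> x" by (rule level_norm_le_seq_qnorm[OF assms(2)])
  finally show ?thesis .
qed

lemma bounded_meeting_cubes:
  fixes \<Omega> :: "(real ^ 'n) set"
  assumes "bounded \<Omega>"
  obtains C where "0 < C" "\<And>l. finite (meeting_cubes \<Omega> l)"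
    "\<And>l. real (card (meeting_cubes \<Omega> l)) \<le> C * 2 powr (real l * real CARD('n))"
proof -
  let ?M = "meeting_cubes \<Omega>"
  obtain B where B: "B > 0" "\<And>x. x \<in> \<Omega> \<Longrightarrow> norm x \<le> B" using assms bounded_pos by blast
  have sub: "?M l \<subseteq> {m'. near (B + 1) 0 0 l m'}" for l
  proof
    fix m' assume "m' \<in> ?M l"
    then obtain x where x: "x \<in> cube 1 l m'" "x \<in> \<Omega>" by (auto simp: meeting_cubes_def)
    have "x \<in> cube B 0 0"
      using B(2)[OF x(2)] component_le_norm_cart[of x] by (auto simp: cube_def intro: order_trans)
    then show "m' \<in> {m'. near (B + 1) 0 0 l m'}" using x B by (auto intro: near_if_cubes_meet)
  qed
  note fin = card_near_le[of "B+1" 0 "0::int^'n"]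
  show ?thesis
  proof (rule that[of "(4 * (B+1) + 1) ^ CARD('n)"])
    show "0 < (4 * (B+1) + 1) ^ CARD('n)" using B by (intro zero_less_power) auto
    show f: "finite (?M l)" for l
      using fin(1) B sub finite_subset by (metis add_nonneg_nonneg less_imp_le zero_le_one)
    show "real (card (?M l)) \<le> (4 * (B+1) + 1) ^ CARD('n) * 2 powr (real l * real CARD('n))" for l
    proof -
      have "real (card (?M l)) \<le> real (card {m' :: int^'n. near (B + 1) 0 0 l m'})"
        using card_mono[OF fin(1) sub[of l]] B by auto
      also have "\<dots> \<le> ((4 * (B+1) + 1) * 2 ^ (l - 0)) ^ CARD('n)" using fin(2) B by auto
      also have "\<dots> = (4 * (B+1) + 1) ^ CARD('n) * 2 powr (real l * real CARD('n))"
        by (simp add: power_mult_distrib powr_realpow flip: power_mult of_nat_mult)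
      finally show ?thesis .
    qed
  qed
qed

text \<open>
  Averaging over the \<open>2\<^bsup>(j-l)n\<^esup>\<close> finer cubes inside a cube of level \<open>l\<close> has the weight \<open>2\<^bsup>-(j-l)n\<^esup>\<close>; a Lipschitz
  function of the scale of a coarser level \<open>j\<close> oscillates by \<open>2\<^bsup>-(l-j)\<^esup>\<close>, in \<open>u\<close>-th powers.
\<close>

definition diag_weight :: "nat \<Rightarrow> real \<Rightarrow> nat \<Rightarrow> nat \<Rightarrow> real" where
  "diag_weight n u l j = (if l < j then 2 powr (- (real j - real l) * real n) else 2 powr (- (real l - real j) * u))"

text \<open>
  An operator whose matrix averages over the finer cubes near a given cube and gains the factor
  \<open>2\<close> per level from the coarser ones is bounded on the sequence spaces with \<open>0 < s < 1\<close>: for finer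
  cubes the gain is \<open>2\<^bsup>-s\<^esup>\<close> per level, for coarser cubes \<open>2\<^bsup>s-1\<^esup>\<close>.
\<close>

lemma seq_qnorm_almost_diagonal:
  fixes \<Omega> :: "(real ^ 'n) set"
  assumes bd: "bounded \<Omega>" and u: "0 < u" "ennreal u \<le> p" and q: "0 < q" and s: "0 < s" "s < 1"
    and R: "0 \<le> R" and Cc: "0 < Cc"
  obtains C where "0 < C"
    "\<And>x y. (\<And>l m. m \<in> meeting_cubes \<Omega> l \<Longrightarrow> enn_powr (y l m) u \<le>
        (\<Sum>j. ennreal (Cc * diag_weight CARD('n) u l j) * (\<Sum>m'\<in>{m'\<in>meeting_cubes \<Omega> j. near R l m j m'}. enn_powr (x j m') u)))
     \<Longrightarrow> seq_qnorm s p q \<Omega> y \<le> ennreal C * seq_qnorm s p q \<Omega> x"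
proof -
  let ?Q = "seq_qnorm s p q \<Omega>"
  let ?lev = "level_norm s p \<Omega>"
  let ?M = "meeting_cubes \<Omega>"
  define n where "n = real CARD('n)"
  define b where "b = inv_exp p"
  define \<delta> where "\<delta> = min s (1 - s) / 3"
  have \<delta>: "0 < \<delta>" "3 * \<delta> \<le> s" "3 * \<delta> \<le> 1 - s" using s by (auto simp: \<delta>_def)
  have p: "0 < p" using u by (meson ennreal_less_zero_iff less_le_trans)
  have b: "0 \<le> b" "b \<le> 1 / u" using inv_exp_le[OF u] by (auto simp: b_def)
  have fin: "finite (?M l)" for l using bounded_meeting_cubes[OF bd] by blast
  define K where "K = (4 * R + 1)"
  have K: "1 \<le> K" using R by (simp add: K_def)
  obtain G where G: "0 < G"
    "\<And>h x. inj h \<Longrightarrow> (\<Sum>j. x (j::nat)) \<le> ennreal G * (SUP j. ennreal (2 powr ((\<delta>*u) * \<bar>real_of_int (h j)\<bar>)) * x j)"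
    using suminf_le_SUP[OF mult_pos_pos[OF \<delta>(1) u(1)]] by blast
  obtain G2 where G2: "0 < G2"
    "\<And>(I::(int^'n) set) h z. inj h \<Longrightarrow> ell_qnorm p I (\<lambda>i. SUP j. z (j::nat) i)
       \<le> ennreal G2 * (SUP j. ennreal (2 powr (\<delta> * \<bar>real_of_int (h j)\<bar>)) * ell_qnorm p I (z j))"
    using ell_qnorm_SUP_le[OF p \<delta>(1)] by blast
  obtain G3 where G3: "0 < G3"
    "\<And>(I::nat set) h x. inj_on h I \<Longrightarrow>
       ell_qnorm q I (\<lambda>i. SUP j. ennreal (2 powr (- \<delta> * \<bar>real_of_int (h i - int j)\<bar>)) * x j)
       \<le> ennreal G3 * ell_qnorm q UNIV x"
    using ell_qnorm_decay_le[OF q \<delta>(1)] by blast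
  define C1 where "C1 = Cc powr (1/u) * K powr (n / u)"
  define N where "N a = (K * 2 ^ a) ^ CARD('n)" for a :: nat
  have N: "N a = K powr n * 2 powr (real a * n)" "0 < N a" for a
    using K by (auto simp: N_def n_def power_mult_distrib powr_realpow powr_powr simp flip: power_mult of_nat_mult)
  define F where "F l j = (Cc * diag_weight CARD('n) u l j) powr (1/u) * (N (j - l) powr (1/u - b) * N (l - j) powr b)" for l j
  have Fle: "2 powr (real l * (s - n * b)) * F l j \<le> C1 * 2 powr (- (3*\<delta>) * \<bar>real_of_int (int l - int j)\<bar>) * 2 powr (real j * (s - n * b))" for l j
  proof -
    have NN: "N (j - l) powr (1/u - b) * N (l - j) powr b
       = K powr (n/u) * 2 powr (real (j - l) * n * (1/u - b) + real (l - j) * n * b)"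
      using K by (simp add: N powr_mult powr_powr powr_add[symmetric] algebra_simps)
    show ?thesis
    proof (cases "l < j")
      case True
      have "2 powr (real l * (s - n * b)) * F l j = C1 * (2 powr (real l * (s - n * b)) * 2 powr (- (real j - real l) * n * (1/u))
          * 2 powr ((real j - real l) * n * (1/u - b)))"
        using True Cc unfolding F_def NN by (simp add: diag_weight_def powr_mult powr_powr n_def C1_def of_nat_diff)
      also have "\<dots> = C1 * (2 powr (- s * (real j - real l)) * 2 powr (real j * (s - n * b)))"
        by (simp add: powr_add[symmetric] algebra_simps)
      also have "\<dots> \<le> C1 * (2 powr (- (3*\<delta>) * \<bar>real_of_int (int l - int j)\<bar>) * 2 powr (real j * (s - n * b)))"
        using True \<delta> Cc by (intro mult_left_mono mult_right_mono powr_mono) (auto simp: C1_def intro: mult_right_mono)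
      finally show ?thesis by (simp add: mult.assoc)
    next
      case False
      have "2 powr (real l * (s - n * b)) * F l j = C1 * (2 powr (real l * (s - n * b)) * 2 powr (- (real l - real j))
          * 2 powr ((real l - real j) * n * b))"
        using False Cc u unfolding F_def NN by (simp add: diag_weight_def powr_mult powr_powr n_def C1_def of_nat_diff)
      also have "\<dots> = C1 * (2 powr (- (1 - s) * (real l - real j)) * 2 powr (real j * (s - n * b)))"
        by (simp add: powr_add[symmetric] algebra_simps)
      also have "\<dots> \<le> C1 * (2 powr (- (3*\<delta>) * \<bar>real_of_int (int l - int j)\<bar>) * 2 powr (real j * (s - n * b)))"
        using False \<delta> Cc mult_right_mono[OF \<delta>(3), of "real l - real j"]
        by (intro mult_left_mono mult_right_mono powr_mono) (auto simp: C1_def algebra_simps)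
      finally show ?thesis by (simp add: mult.assoc)
    qed
  qed
  define CC where "CC = G3 * (G powr (1/u) * G2 * C1)"
  show ?thesis
  proof (rule that[of CC])
    show "0 < CC" using G G2 G3 Cc K by (simp add: CC_def C1_def)
    fix x y
    assume y: "\<And>l m. m \<in> ?M l \<Longrightarrow> enn_powr (y l m) u \<le>
        (\<Sum>j. ennreal (Cc * diag_weight CARD('n) u l j) * (\<Sum>m'\<in>{m'\<in>?M j. near R l m j m'}. enn_powr (x j m') u))"
    define T where "T l j m = enn_powr (ennreal (Cc * diag_weight CARD('n) u l j) *
       (\<Sum>m'\<in>{m'\<in>?M j. near R l m j m'}. enn_powr (x j m') u)) (1/u)" for l j m
    have yT: "y l m \<le> ennreal (G powr (1/u)) * (SUP j. ennreal (2 powr (\<delta> * \<bar>real_of_int (int l - int j)\<bar>)) * T l j m)"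
      (is "_ \<le> _ * ?S") if m: "m \<in> ?M l" for l m
    proof -
      have "enn_powr (y l m) u \<le> (\<Sum>j. enn_powr (T l j m) u)"
        using y[OF m] u unfolding T_def by simp
      also have "\<dots> \<le> ennreal G * (SUP j. ennreal (2 powr ((\<delta>*u) * \<bar>real_of_int (int l - int j)\<bar>)) * enn_powr (T l j m) u)"
        by (rule G(2)) (simp add: inj_def)
      also have "\<dots> \<le> ennreal G * enn_powr ?S u"
      proof (intro mult_left_mono SUP_least)
        fix j
        have "ennreal (2 powr ((\<delta>*u) * \<bar>real_of_int (int l - int j)\<bar>)) * enn_powr (T l j m) u
          = enn_powr (ennreal (2 powr (\<delta> * \<bar>real_of_int (int l - int j)\<bar>)) * T l j m) u"
          by (simp add: enn_powr_mult enn_powr_ennreal powr_powr ac_simps)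
        also have "\<dots> \<le> enn_powr ?S u" using u by (intro enn_powr_mono SUP_upper) auto
        finally show "ennreal (2 powr ((\<delta>*u) * \<bar>real_of_int (int l - int j)\<bar>)) * enn_powr (T l j m) u \<le> enn_powr ?S u" .
      qed simp
      also have "\<dots> = enn_powr (ennreal (G powr (1/u)) * ?S) u"
        using G u by (simp add: enn_powr_mult enn_powr_ennreal powr_powr)
      finally show ?thesis using enn_powr_le_iff[OF u(1)] by blast
    qed
    \<comment> \<open>On the finer levels the rows, on the coarser levels the columns of the incidence matrix are long.\<close>
    have TS: "ell_qnorm p (?M l) (T l j) \<le> ennreal (F l j) * ell_qnorm p (?M j) (x j)" for l j
    proof -
      define c where "c = (Cc * diag_weight CARD('n) u l j) powr (1/u)"
      have dw: "0 < Cc * diag_weight CARD('n) u l j" using Cc by (simp add: diag_weight_def)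
      have "ell_qnorm p (?M l) (T l j) \<le> ennreal (N (j - l) powr (1/u - inv_exp p) * N (l - j) powr inv_exp p) *
         ell_qnorm p (?M j) (\<lambda>m'. ennreal c * x j m')"
      proof (rule ell_qnorm_Schur[OF fin fin u, where R = "\<lambda>m m'. near R l m j m'"])
        show "enn_powr (T l j m) u \<le> (\<Sum>m'\<in>{m'\<in>?M j. near R l m j m'}. enn_powr (ennreal c * x j m') u)" for m
          using u dw by (simp add: T_def c_def enn_powr_mult enn_powr_ennreal powr_powr flip: sum_distrib_left)
        have c1: "real (card {m' \<in> ?M j. near R l m j m'}) \<le> real (card {m'. near R l m j m'})" for m
          using card_near_le(1)[OF R, of l m j] by (auto intro!: card_mono)
        show "real (card {m' \<in> ?M j. near R l m j m'}) \<le> N (j - l)" for m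
          using order_trans[OF c1 card_near_le(2)[OF R]] by (simp add: N_def K_def)
        have c2: "real (card {m \<in> ?M l. near R l m j m'}) \<le> real (card {m. near R j m' l m})" for m'
          using card_near_le(1)[OF R, of j m' l] by (auto intro!: card_mono simp: near_sym)
        show "real (card {m \<in> ?M l. near R l m j m'}) \<le> N (l - j)" for m'
          using order_trans[OF c2 card_near_le(2)[OF R]] by (simp add: N_def K_def)
      qed (use N in auto)
      also have "\<dots> = ennreal (F l j) * ell_qnorm p (?M j) (x j)"
        unfolding ell_qnorm_cmult[OF p] F_def c_def b_def by (simp add: ennreal_mult ac_simps)
      finally show ?thesis .
    qed
    have lev: "?lev y l \<le> ennreal (G powr (1/u) * G2 * C1) *
        (SUP j. ennreal (2 powr (- \<delta> * \<bar>real_of_int (int l - int j)\<bar>)) * ?lev x j)" for l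
    proof -
      let ?w = "ennreal (2 powr (real l * (s - n * b)))"
      have "ell_qnorm p (?M l) (y l) \<le> ell_qnorm p (?M l)
          (\<lambda>m. ennreal (G powr (1/u)) * (SUP j. ennreal (2 powr (\<delta> * \<bar>real_of_int (int l - int j)\<bar>)) * T l j m))"
        by (intro ell_qnorm_mono p yT)
      also have "\<dots> \<le> ennreal (G powr (1/u)) * (ennreal G2 * (SUP j. ennreal (2 powr (\<delta> * \<bar>real_of_int (int l - int j)\<bar>)) *
           ell_qnorm p (?M l) (\<lambda>m. ennreal (2 powr (\<delta> * \<bar>real_of_int (int l - int j)\<bar>)) * T l j m)))"
        by (subst ell_qnorm_cmult[OF p]) (intro mult_left_mono G2(2)[of "\<lambda>j. int l - int j"], auto simp: inj_def)
      also have "\<dots> \<le> ennreal (G powr (1/u)) * (ennreal G2 * (SUP j. ennreal (2 powr (2 * \<delta> * \<bar>real_of_int (int l - int j)\<bar>)) *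
           (ennreal (F l j) * ell_qnorm p (?M j) (x j))))"
      proof (intro mult_left_mono SUP_mono)
        fix j
        have "ennreal (2 powr (\<delta> * \<bar>real_of_int (int l - int j)\<bar>)) *
           ell_qnorm p (?M l) (\<lambda>m. ennreal (2 powr (\<delta> * \<bar>real_of_int (int l - int j)\<bar>)) * T l j m)
          = ennreal (2 powr (2 * \<delta> * \<bar>real_of_int (int l - int j)\<bar>)) * ell_qnorm p (?M l) (T l j)"
          by (simp add: ell_qnorm_cmult[OF p] mult.assoc[symmetric] flip: ennreal_mult powr_add)
        also have "\<dots> \<le> ennreal (2 powr (2 * \<delta> * \<bar>real_of_int (int l - int j)\<bar>)) *
           (ennreal (F l j) * ell_qnorm p (?M j) (x j))" by (intro mult_left_mono TS) auto
        finally show "\<exists>j'\<in>UNIV. ennreal (2 powr (\<delta> * \<bar>real_of_int (int l - int j)\<bar>)) *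
           ell_qnorm p (?M l) (\<lambda>m. ennreal (2 powr (\<delta> * \<bar>real_of_int (int l - int j)\<bar>)) * T l j m)
          \<le> ennreal (2 powr (2 * \<delta> * \<bar>real_of_int (int l - int j')\<bar>)) *
           (ennreal (F l j') * ell_qnorm p (?M j') (x j'))" by blast
      qed auto
      finally have "?w * ell_qnorm p (?M l) (y l) \<le> ?w * \<dots>" by (rule mult_left_mono) simp
      also have "\<dots> = ennreal (G powr (1/u)) * (ennreal G2 * (SUP j. ennreal (2 powr (2 * \<delta> * \<bar>real_of_int (int l - int j)\<bar>)) *
           (?w * ennreal (F l j) * ell_qnorm p (?M j) (x j))))"
        by (simp add: SUP_mult_left_ennreal ac_simps)
      also have "\<dots> \<le> ennreal (G powr (1/u)) * (ennreal G2 * (SUP j. ennreal C1 *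
          (ennreal (2 powr (- \<delta> * \<bar>real_of_int (int l - int j)\<bar>)) * ?lev x j)))"
      proof (intro mult_left_mono SUP_mono)
        fix j
        have "ennreal (2 powr (2 * \<delta> * \<bar>real_of_int (int l - int j)\<bar>)) * (?w * ennreal (F l j) * ell_qnorm p (?M j) (x j))
          = ennreal (2 powr (2 * \<delta> * \<bar>real_of_int (int l - int j)\<bar>)) * (ennreal (2 powr (real l * (s - n * b)) * F l j) * ell_qnorm p (?M j) (x j))"
          by (simp add: ennreal_mult')
        also have "\<dots> \<le> ennreal (2 powr (2 * \<delta> * \<bar>real_of_int (int l - int j)\<bar>)) *
           (ennreal (C1 * 2 powr (- (3*\<delta>) * \<bar>real_of_int (int l - int j)\<bar>) * 2 powr (real j * (s - n * b))) * ell_qnorm p (?M j) (x j))"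
          by (intro mult_left_mono mult_right_mono ennreal_leI Fle) auto
        also have "\<dots> = ennreal (2 powr (2 * \<delta> * \<bar>real_of_int (int l - int j)\<bar>) *
           (C1 * 2 powr (- (3*\<delta>) * \<bar>real_of_int (int l - int j)\<bar>) * 2 powr (real j * (s - n * b)))) * ell_qnorm p (?M j) (x j)"
          by (subst ennreal_mult') (simp_all only: mult.assoc powr_ge_zero)
        also have "2 powr (2 * \<delta> * \<bar>real_of_int (int l - int j)\<bar>) *
           (C1 * 2 powr (- (3*\<delta>) * \<bar>real_of_int (int l - int j)\<bar>) * 2 powr (real j * (s - n * b)))
            = C1 * (2 powr (- \<delta> * \<bar>real_of_int (int l - int j)\<bar>) * 2 powr (real j * (s - n * b)))"
        proof -
          have "2 powr (2 * \<delta> * A) * (C1 * 2 powr (- (3*\<delta>) * A) * W) = C1 * (2 powr (- \<delta> * A) * W)" for A W :: real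
          proof -
            have "2 powr (- \<delta> * A) = 2 powr (2 * \<delta> * A) * 2 powr (- (3*\<delta>) * A)"
              by (simp add: algebra_simps flip: powr_add)
            then show ?thesis by simp
          qed
          then show ?thesis .
        qed
        also have "ennreal (C1 * (2 powr (- \<delta> * \<bar>real_of_int (int l - int j)\<bar>) * 2 powr (real j * (s - n * b)))) * ell_qnorm p (?M j) (x j)
           = ennreal C1 * (ennreal (2 powr (- \<delta> * \<bar>real_of_int (int l - int j)\<bar>)) * ?lev x j)"
          using Cc by (simp add: level_norm_def n_def b_def C1_def ennreal_mult mult.assoc)
        finally show "\<exists>j'\<in>UNIV. ennreal (2 powr (2 * \<delta> * \<bar>real_of_int (int l - int j)\<bar>)) * (?w * ennreal (F l j) * ell_qnorm p (?M j) (x j))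
           \<le> ennreal C1 * (ennreal (2 powr (- \<delta> * \<bar>real_of_int (int l - int j')\<bar>)) * ?lev x j')" by blast
      qed auto
      also have "\<dots> = ennreal (G powr (1/u) * G2 * C1) *
        (SUP j. ennreal (2 powr (- \<delta> * \<bar>real_of_int (int l - int j)\<bar>)) * ?lev x j)"
        using G2 Cc by (simp add: ennreal_mult C1_def mult.assoc flip: SUP_mult_left_ennreal)
      finally show ?thesis by (simp add: level_norm_def n_def b_def)
    qed
    have "?Q y \<le> ell_qnorm q UNIV (\<lambda>l. ennreal (G powr (1/u) * G2 * C1) *
        (SUP j. ennreal (2 powr (- \<delta> * \<bar>real_of_int (int l - int j)\<bar>)) * ?lev x j))"
      unfolding seq_qnorm_def by (intro ell_qnorm_mono q lev)
    also have "\<dots> \<le> ennreal (G powr (1/u) * G2 * C1) * (ennreal G3 * ?Q x)"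
      unfolding ell_qnorm_cmult[OF q] seq_qnorm_def by (intro mult_left_mono G3(2)) auto
    also have "\<dots> = ennreal CC * ?Q x"
      using G2 G3 Cc by (simp add: CC_def C1_def ennreal_mult ac_simps)
    finally show "?Q y \<le> ennreal CC * ?Q x" .
  qed
qed

section \<open>Interior balls in Lipschitz domains\<close>

text \<open>
  In the flat picture the part \<open>V\<close> of a small ball around \<open>\<psi> x\<close> in the half space contains a ball of comparable
  radius. Its preimage is connected, contains \<open>x\<close> and avoids both the boundary of \<open>\<Omega>\<close> and the sphere of radius
  \<open>r\<close> around \<open>x\<close>, so that it lies in \<open>\<Omega> \<inter> ball x r\<close>.
\<close>

lemma lipschitz_diffeo_interior_ball:
  fixes \<psi> :: "real ^ 'n \<Rightarrow> real ^ 'n"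
  assumes "lipschitz_diffeo \<psi>"
  obtains c' where "0 < c'" "c' \<le> 1"
    "\<And>\<Omega> B x r k. 0 < r \<Longrightarrow> r \<le> 1 \<Longrightarrow> x \<in> \<Omega> \<Longrightarrow> ball x r \<subseteq> B \<Longrightarrow> \<psi> ` (B \<inter> \<Omega>) \<subseteq> {x. 0 < x $ k} \<Longrightarrow>
       \<psi> ` (B \<inter> frontier \<Omega>) \<subseteq> {x. x $ k = 0} \<Longrightarrow> \<exists>y. ball y (c' * r) \<subseteq> \<Omega> \<inter> ball x r"
proof -
  from assms obtain c C where bij: "bij \<psi>" and c: "0 < c" and C: "0 < C"
    and lo: "\<And>x y. dist x y \<le> 1 \<Longrightarrow> c * dist x y \<le> dist (\<psi> x) (\<psi> y)"
    and up: "\<And>x y. dist x y \<le> 1 \<Longrightarrow> dist (\<psi> x) (\<psi> y) \<le> C * dist x y"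
    unfolding lipschitz_diffeo_def by blast
  have cont: "continuous_on UNIV \<psi>"
  proof (rule continuous_onI)
    fix x :: "real ^ 'n" and e :: real assume "e > 0"
    show "\<exists>d>0. \<forall>x'\<in>UNIV. dist x' x < d \<longrightarrow> dist (\<psi> x') (\<psi> x) \<le> e"
    proof (intro exI[of _ "min 1 (e / C)"] conjI ballI impI)
      fix x' assume "dist x' x < min 1 (e / C)"
      then have "dist (\<psi> x') (\<psi> x) \<le> C * dist x' x" "C * dist x' x \<le> e"
        using up[of x' x] C by (auto simp: field_simps)
      then show "dist (\<psi> x') (\<psi> x) \<le> e" by simp
    qed (use \<open>e > 0\<close> C in auto)
  qed
  obtain g where g: "homeomorphism UNIV (\<psi> ` UNIV) \<psi> g"
    using invariance_of_domain_homeomorphism[of UNIV \<psi>] cont bij by (auto simp: bij_def)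
  then have gc: "continuous_on UNIV g" and g\<psi>: "\<And>x. g (\<psi> x) = x"
    using bij by (auto simp: homeomorphism_def bij_def)
  have \<psi>g: "\<psi> (g y) = y" for y
    using bij g\<psi> by (metis bij_pointE)
  define c' where "c' = min 1 (c / (4 * C))"
  show ?thesis
  proof (rule that[of c'])
    show "0 < c'" "c' \<le> 1" using c C by (auto simp: c'_def)
    fix \<Omega> B :: "(real ^ 'n) set" and x r and k
    assume r: "0 < r" "r \<le> 1" and x: "x \<in> \<Omega>" and B: "ball x r \<subseteq> B"
      and H1: "\<psi> ` (B \<inter> \<Omega>) \<subseteq> {x. 0 < x $ k}" and H2: "\<psi> ` (B \<inter> frontier \<Omega>) \<subseteq> {x. x $ k = 0}"
    define V where "V = ball (\<psi> x) (c * r) \<inter> {y. 0 < y $ k}"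
    have "convex {y :: real ^ 'n. 0 < y $ k}"
      using convex_halfspace_gt[of 0 "axis k (1::real)"] by (simp add: inner_axis' )
    then have "connected V" unfolding V_def by (intro convex_connected convex_Int) auto
    then have conn: "connected (g ` V)" using gc by (meson connected_continuous_image continuous_on_subset subset_UNIV)
    have "x \<in> B" using B r by auto
    then have xV: "\<psi> x \<in> V" using H1 x r c by (auto simp: V_def)
    then have xW: "x \<in> g ` V" using g\<psi> by (metis imageI)
    have "g ` V \<inter> sphere x r = {}"
    proof (rule equals0I)
      fix w assume "w \<in> g ` V \<inter> sphere x r"
      then obtain v where v: "v \<in> V" "dist x (g v) = r" by auto
      then show False using lo[of x "g v"] r by (auto simp: \<psi>g V_def)
    qed
    moreover have "x \<in> g ` V \<inter> ball x r" using xW r by simp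
    ultimately have Wr: "g ` V \<subseteq> ball x r"
      using connected_Int_frontier[OF conn, of "ball x r"] frontier_ball[OF r(1), of x] by blast
    have "g ` V \<inter> frontier \<Omega> = {}"
    proof -
      have False if "v \<in> V" "g v \<in> frontier \<Omega>" for v
      proof -
        have "g v \<in> B" using Wr B that by auto
        then have "\<psi> (g v) $ k = 0" using H2 that by blast
        then show False using that by (simp add: \<psi>g V_def)
      qed
      then show ?thesis by auto
    qed
    then have W\<Omega>: "g ` V \<subseteq> \<Omega>" using connected_Int_frontier[OF conn, of \<Omega>] xW x by auto
    define y0 where "y0 = \<psi> x + (c * r / 2) *\<^sub>R axis k 1"
    have sub: "ball y0 (c * r / 4) \<subseteq> V"
    proof
      fix v assume "v \<in> ball y0 (c * r / 4)"
      then have d: "dist y0 v < c * r / 4" by simp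
      have "dist (\<psi> x) y0 = c * r / 2" using c r by (simp add: y0_def dist_norm norm_axis_1)
      then have "dist (\<psi> x) v < c * r" using dist_triangle[of "\<psi> x" v y0] d mult_pos_pos[OF c r(1)] by linarith
      moreover have "y0 $ k - v $ k < c * r / 4"
        using component_le_norm_cart[of "y0 - v" k] d by (simp add: dist_norm abs_le_iff)
      moreover have "y0 $ k = \<psi> x $ k + c * r / 2" by (simp add: y0_def)
      moreover have "0 < \<psi> x $ k" using xV by (simp add: V_def)
      ultimately have "dist (\<psi> x) v < c * r" "0 < v $ k" using mult_pos_pos[OF c r(1)] by linarith+
      then show "v \<in> V" by (simp add: V_def)
    qed
    have "ball (g y0) (c' * r) \<subseteq> g ` V"
    proof
      fix w assume "w \<in> ball (g y0) (c' * r)"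
      then have w: "dist w (g y0) < c' * r" by (simp add: dist_commute)
      have "c' * r \<le> 1 * 1" using r \<open>c' \<le> 1\<close> \<open>0 < c'\<close> by (intro mult_mono) auto
      then have "dist (\<psi> w) y0 \<le> C * dist w (g y0)" using up[of w "g y0"] w by (simp add: \<psi>g)
      also have "\<dots> < C * (c' * r)" using w C by simp
      also have "\<dots> \<le> C * (c / (4 * C) * r)" using C r by (intro mult_left_mono mult_right_mono) (auto simp: c'_def)
      also have "\<dots> = c * r / 4" using C by simp
      finally have "\<psi> w \<in> V" using sub by (auto simp: dist_commute)
      then show "w \<in> g ` V" using g\<psi> by (metis imageI)
    qed
    then show "\<exists>y. ball y (c' * r) \<subseteq> \<Omega> \<inter> ball x r" using W\<Omega> Wr by blast
  qed
qed

text \<open>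
  The interior corkscrew condition.
\<close>

definition corkscrew :: "real \<Rightarrow> (real ^ 'n) set \<Rightarrow> bool" where
  "corkscrew c \<Omega> \<longleftrightarrow> 0 < c \<and> (\<forall>x\<in>\<Omega>. \<forall>r. 0 < r \<and> r \<le> 1 \<longrightarrow> (\<exists>y. ball y (c * r) \<subseteq> \<Omega> \<inter> ball x r))"

text \<open>
  A Lebesgue number \<open>e\<close> of the covering of the boundary separates two cases: near the boundary the ball around \<open>x\<close>
  lies in the domain of a single chart, and far from the boundary it is itself contained in \<open>\<Omega>\<close>.
\<close>

lemma bounded_lipschitz_domain_corkscrew:
  fixes \<Omega> :: "(real ^ 'n) set"
  assumes "bounded_lipschitz_domain \<Omega>"
  shows "\<exists>c. corkscrew c \<Omega>"
proof -
  have dom: "open \<Omega>" "bounded \<Omega>" using assms by (auto simp: bounded_lipschitz_domain_def)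
  from assms obtain k and N :: nat and z :: "nat \<Rightarrow> real ^ 'n" and \<rho> \<psi> where
    cov: "frontier \<Omega> \<subseteq> (\<Union>l<N. ball (z l) (\<rho> l))" and
    all: "\<forall>l<N. lipschitz_diffeo (\<psi> l) \<and> \<psi> l ` (ball (z l) (\<rho> l) \<inter> \<Omega>) \<subseteq> {x. 0 < x $ k} \<and>
           \<psi> l ` (ball (z l) (\<rho> l) \<inter> frontier \<Omega>) \<subseteq> {x. x $ k = 0}"
    unfolding bounded_lipschitz_domain_def by (elim conjE exE) (rule that, assumption, assumption)
  have \<psi>: "lipschitz_diffeo (\<psi> l)" "\<psi> l ` (ball (z l) (\<rho> l) \<inter> \<Omega>) \<subseteq> {x. 0 < x $ k}"
    "\<psi> l ` (ball (z l) (\<rho> l) \<inter> frontier \<Omega>) \<subseteq> {x. x $ k = 0}" if "l < N" for l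
  proof -
    note * = mp[OF spec[OF all, of l] that]
    show "lipschitz_diffeo (\<psi> l)" by (rule conjunct1[OF *])
    show "\<psi> l ` (ball (z l) (\<rho> l) \<inter> \<Omega>) \<subseteq> {x. 0 < x $ k}" by (rule conjunct1[OF conjunct2[OF *]])
    show "\<psi> l ` (ball (z l) (\<rho> l) \<inter> frontier \<Omega>) \<subseteq> {x. x $ k = 0}" by (rule conjunct2[OF conjunct2[OF *]])
  qed
  have "compact (frontier \<Omega>)" using dom(2) by (rule compact_frontier_bounded)
  moreover have "frontier \<Omega> \<subseteq> \<Union>((\<lambda>l. ball (z l) (\<rho> l)) ` {..<N})" using cov by auto
  ultimately obtain e where e: "0 < e" "\<And>x. x \<in> frontier \<Omega> \<Longrightarrow> \<exists>G\<in>(\<lambda>l. ball (z l) (\<rho> l)) ` {..<N}. ball x e \<subseteq> G"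
    by (rule Heine_Borel_lemma) (auto intro: that)
  have "\<exists>c'. 0 < c' \<and> c' \<le> 1 \<and> (\<forall>\<Omega> B x r k. 0 < r \<longrightarrow> r \<le> 1 \<longrightarrow> x \<in> \<Omega> \<longrightarrow> ball x r \<subseteq> B \<longrightarrow> \<psi> l ` (B \<inter> \<Omega>) \<subseteq> {x. 0 < x $ k} \<longrightarrow>
       \<psi> l ` (B \<inter> frontier \<Omega>) \<subseteq> {x. x $ k = 0} \<longrightarrow> (\<exists>y. ball y (c' * r) \<subseteq> \<Omega> \<inter> ball x r))" if "l < N" for l
    using lipschitz_diffeo_interior_ball[OF \<psi>(1)[OF that]] by metis
  then obtain c' where c': "\<And>l. l < N \<Longrightarrow> 0 < c' l" "\<And>l. l < N \<Longrightarrow> c' l \<le> 1"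
    "\<And>l \<Omega> B x r k. l < N \<Longrightarrow> 0 < r \<Longrightarrow> r \<le> 1 \<Longrightarrow> x \<in> \<Omega> \<Longrightarrow> ball x r \<subseteq> B \<Longrightarrow> \<psi> l ` (B \<inter> \<Omega>) \<subseteq> {x. 0 < x $ k} \<Longrightarrow>
       \<psi> l ` (B \<inter> frontier \<Omega>) \<subseteq> {x. x $ k = 0} \<Longrightarrow> \<exists>y. ball y (c' l * r) \<subseteq> \<Omega> \<inter> ball x r"
    by metis
  define c1 where "c1 = Min (insert 1 (c' ` {..<N}))"
  have c1: "0 < c1" "c1 \<le> 1" "\<And>l. l < N \<Longrightarrow> c1 \<le> c' l" using c' by (auto simp: c1_def)
  define \<eta> where "\<eta> = min 1 (e / 2)"
  have \<eta>: "0 < \<eta>" "\<eta> \<le> 1" "\<eta> \<le> e / 2" using e by (auto simp: \<eta>_def)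
  have "corkscrew (c1 * \<eta>) \<Omega>"
    unfolding corkscrew_def
  proof (intro conjI ballI allI impI)
    show "0 < c1 * \<eta>" using c1 \<eta> by simp
    fix x r assume x: "x \<in> \<Omega>" and "0 < r \<and> (r::real) \<le> 1"
    then have r: "0 < r" "r \<le> 1" by auto
    define r' where "r' = r * \<eta>"
    have "r * \<eta> \<le> 1 * (e/2)" "r * \<eta> \<le> r * 1" using r \<eta> by (intro mult_mono; simp)+
    then have r': "0 < r'" "r' \<le> r" "r' \<le> e / 2" using r \<eta> by (auto simp: r'_def)
    have "\<exists>y. ball y (c1 * r') \<subseteq> \<Omega> \<inter> ball x r'"
    proof (cases "\<exists>w\<in>frontier \<Omega>. dist x w < e / 2")
      case True
      then obtain w where w: "w \<in> frontier \<Omega>" "dist x w < e / 2" by blast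
      then obtain l where l: "l < N" "ball w e \<subseteq> ball (z l) (\<rho> l)" using e(2) by auto
      have "ball x r' \<subseteq> ball w e"
      proof
        fix y assume "y \<in> ball x r'"
        then show "y \<in> ball w e" using dist_triangle[of w y x] w r' by (simp add: dist_commute)
      qed
      then obtain y where "ball y (c' l * r') \<subseteq> \<Omega> \<inter> ball x r'"
        using c'(3)[OF l(1) r'(1) _ x _ \<psi>(2)[OF l(1)] \<psi>(3)[OF l(1)]] l r' r by auto
      moreover have "ball y (c1 * r') \<subseteq> ball y (c' l * r')" using c1(3)[OF l(1)] r' by (intro subset_ball mult_right_mono) auto
      ultimately show ?thesis by blast
    next
      case False
      then have "ball x r' \<inter> frontier \<Omega> = {}" using r' by force
      then have "ball x r' \<subseteq> \<Omega>" using connected_Int_frontier[of "ball x r'" \<Omega>] x r' by (metis centre_in_ball connected_ball disjoint_iff Diff_eq_empty_iff)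
      moreover have "ball x (c1 * r') \<subseteq> ball x r'" using c1 r' by (intro subset_ball) (simp add: mult_le_cancel_right1)
      ultimately show ?thesis by blast
    qed
    then obtain y where "ball y (c1 * r') \<subseteq> \<Omega> \<inter> ball x r'" by blast
    moreover have "ball x r' \<subseteq> ball x r" using r' by (intro subset_ball)
    moreover have "c1 * r' = c1 * \<eta> * r" by (simp add: r'_def)
    ultimately show "\<exists>y. ball y (c1 * \<eta> * r) \<subseteq> \<Omega> \<inter> ball x r" by auto
  qed
  then show ?thesis by blast
qed

section \<open>Local oscillation\<close>

text \<open>Powers \<open>|z|\<^sup>u\<close> with \<open>u \<le> 1\<close> are subadditive; all local estimates are made at this exponent.\<close>

definition pw :: "real \<Rightarrow> complex \<Rightarrow> ennreal" where
  "pw u z = ennreal (norm z powr u)"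

lemma pw_0 [simp]: "pw u 0 = 0"
  by (simp add: pw_def)

lemma pw_eq_enn_powr: "pw u z = enn_powr (ennreal (norm z)) u"
  by (simp add: pw_def enn_powr_ennreal)

lemma pw_mult: "pw u (a * b) = pw u a * pw u b"
  by (simp add: pw_eq_enn_powr norm_mult ennreal_mult enn_powr_mult)

lemma pw_mono: "0 \<le> u \<Longrightarrow> norm a \<le> norm b \<Longrightarrow> pw u a \<le> pw u b"
  by (simp add: pw_def ennreal_leI powr_mono2)

lemma pw_minus_commute: "pw u (a - b) = pw u (b - a)"
  by (simp add: pw_def norm_minus_commute)

lemma pw_add_le:
  assumes "0 < u" "u \<le> 1"
  shows "pw u (a + b) \<le> pw u a + pw u b"
proof -
  have "pw u (a + b) \<le> enn_powr (ennreal (norm a) + ennreal (norm b)) u"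
    unfolding pw_eq_enn_powr using assms by (intro enn_powr_mono) (auto simp: norm_triangle_ineq ennreal_leI simp flip: ennreal_plus)
  also have "\<dots> \<le> pw u a + pw u b" unfolding pw_eq_enn_powr by (rule enn_powr_add_le[OF assms])
  finally show ?thesis .
qed

lemma pw_sum_le:
  assumes "0 < u" "u \<le> 1" "finite S"
  shows "pw u (\<Sum>i\<in>S. a i) \<le> (\<Sum>i\<in>S. pw u (a i))"
  using assms(3)
proof (induction S)
  case (insert i S)
  then show ?case
    using pw_add_le[OF assms(1,2), of "a i" "\<Sum>i\<in>S. a i"] by (auto intro: order_trans add_left_mono)
qed simp

lemma measurable_pw [measurable]:
  "f \<in> borel_measurable M \<Longrightarrow> (\<lambda>x. pw u (f x)) \<in> borel_measurable M"
  unfolding pw_def by measurable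

lemma borel_measurable_lebesgue_on_borel:
  "g \<in> borel_measurable borel \<Longrightarrow> g \<in> borel_measurable (lebesgue_on S)"
  by (intro measurable_restrict_space1 measurable_completion) simp

lemma cube_eq_cbox:
  "cube d l (m :: int ^ 'n) = cbox (\<chi> i. of_int (m $ i) / 2 ^ l - d / 2 ^ l) (\<chi> i. of_int (m $ i) / 2 ^ l + d / 2 ^ l)"
  by (auto simp: cube_def mem_box_cart abs_le_iff algebra_simps)

lemma cube_borel [measurable]: "cube d l (m :: int ^ 'n) \<in> sets borel"
  by (simp add: cube_eq_cbox)

lemma emeasure_cube:
  assumes "0 \<le> d"
  shows "emeasure lebesgue (cube d l (m :: int ^ 'n)) = ennreal ((2 * d) ^ CARD('n) / 2 ^ (l * CARD('n)))"
proof -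
  let ?a = "(\<chi> i. of_int (m $ i) / 2 ^ l - d / 2 ^ l) :: real ^ 'n" and ?b = "(\<chi> i. of_int (m $ i) / 2 ^ l + d / 2 ^ l) :: real ^ 'n"
  have *: "(?b - ?a) \<bullet> e = 2 * d / 2 ^ l" if "e \<in> Basis" for e
  proof -
    obtain i where "e = axis i 1" using \<open>e \<in> Basis\<close> by (auto simp: Basis_vec_def)
    then show ?thesis by (simp add: inner_axis)
  qed
  have "?a \<bullet> e \<le> ?b \<bullet> e" if "e \<in> Basis" for e
  proof -
    have "0 \<le> (?b - ?a) \<bullet> e" using *[OF that] assms by simp
    then show ?thesis by (simp add: inner_diff_left)
  qed
  then have "emeasure lborel (cbox ?a ?b) = ennreal (\<Prod>e\<in>Basis. (?b - ?a) \<bullet> e)"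
    by (rule emeasure_lborel_cbox)
  also have "(\<Prod>e\<in>Basis. (?b - ?a) \<bullet> e) = (2 * d / 2 ^ l) ^ CARD('n)" by (simp add: *)
  also have "\<dots> = (2 * d) ^ CARD('n) / 2 ^ (l * CARD('n))" by (simp add: power_divide power_mult)
  finally show ?thesis by (simp add: cube_eq_cbox)
qed

lemma nn_integral_lebesgue_on_cube_le:
  assumes "0 \<le> d" "\<Omega> \<in> sets lebesgue"
  shows "(\<integral>\<^sup>+x. indicator (cube d l (m :: int ^ 'n)) x \<partial>lebesgue_on \<Omega>) \<le> ennreal ((2 * d) ^ CARD('n) / 2 ^ (l * CARD('n)))"
proof -
  have "(\<integral>\<^sup>+x. indicator (cube d l m) x \<partial>lebesgue_on \<Omega>) = (\<integral>\<^sup>+x. indicator (cube d l m) x * indicator \<Omega> x \<partial>lebesgue)"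
    using assms by (subst nn_integral_restrict_space) auto
  also have "\<dots> \<le> (\<integral>\<^sup>+x. indicator (cube d l m) x \<partial>lebesgue)" by (intro nn_integral_mono) (auto simp: indicator_def)
  also have "\<dots> = ennreal ((2 * d) ^ CARD('n) / 2 ^ (l * CARD('n)))" using emeasure_cube[OF assms(1)] by simp
  finally show ?thesis .
qed

lemma norm_le_of_cube:
  assumes "x \<in> cube d l m" "y \<in> cube d l (m :: int ^ 'n)"
  shows "norm (x - y) \<le> real CARD('n) * (2 * d / 2 ^ l)"
proof -
  have "\<bar>(x - y) $ i\<bar> \<le> 2 * d / 2 ^ l" for i
  proof -
    have "\<bar>x $ i - of_int (m $ i) / 2 ^ l\<bar> \<le> d / 2 ^ l" "\<bar>y $ i - of_int (m $ i) / 2 ^ l\<bar> \<le> d / 2 ^ l"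
      using assms by (auto simp: cube_def)
    then show ?thesis by simp
  qed
  then have "(\<Sum>i\<in>UNIV. \<bar>(x - y) $ i\<bar>) \<le> (\<Sum>i\<in>(UNIV::'n set). 2 * d / 2 ^ l)" by (intro sum_mono)
  then show ?thesis using norm_le_l1_cart[of "x - y"] by simp
qed

text \<open>
  The power of \<open>2\<close> normalises the volume of the cube. The cubes are enlarged so that those of
  neighbouring cubes contain a common ball inside a corkscrew domain.
\<close>

definition osc :: "real \<Rightarrow> (real ^ 'n) set \<Rightarrow> (real ^ 'n \<Rightarrow> complex) \<Rightarrow> nat \<Rightarrow> int ^ 'n \<Rightarrow> ennreal" where
  "osc u \<Omega> f l m = (INF c. ennreal (2 ^ (l * CARD('n))) *
     (\<integral>\<^sup>+x. pw u (f x - c) * indicator (cube 3 l m) x \<partial>lebesgue_on \<Omega>))"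

definition osc_seq :: "real \<Rightarrow> (real ^ 'n) set \<Rightarrow> (real ^ 'n \<Rightarrow> complex) \<Rightarrow> nat \<Rightarrow> int ^ 'n \<Rightarrow> ennreal" where
  "osc_seq u \<Omega> f l m = enn_powr (osc u \<Omega> f l m) (1 / u)"

definition Lu_qnorm :: "real \<Rightarrow> (real ^ 'n) set \<Rightarrow> (real ^ 'n \<Rightarrow> complex) \<Rightarrow> ennreal" where
  "Lu_qnorm u \<Omega> f = enn_powr (\<integral>\<^sup>+x. pw u (f x) \<partial>lebesgue_on \<Omega>) (1 / u)"

section \<open>Atoms and their oscillation\<close>

lemma has_derivative_partial_deriv:
  assumes "(f has_derivative f') (at x)"
  shows "partial_deriv i f x = f' (axis i 1)"
proof -
  have "((\<lambda>t. x + t *\<^sub>R axis i 1) has_derivative (\<lambda>t. t *\<^sub>R axis i 1)) (at (0::real))"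
    by (auto intro!: derivative_eq_intros)
  then have "((\<lambda>t. f (x + t *\<^sub>R axis i 1)) has_derivative (\<lambda>t. f' (t *\<^sub>R axis i 1))) (at 0)"
    using assms by (intro has_derivative_compose[where g = f and f = "\<lambda>t. x + t *\<^sub>R axis i 1"]) auto
  moreover have "f' (t *\<^sub>R axis i 1) = t *\<^sub>R f' (axis i 1)" for t
    using assms has_derivative_linear linear_scale by blast
  ultimately show ?thesis
    unfolding partial_deriv_def by (intro vector_derivative_at) (simp add: has_vector_derivative_def)
qed

lemma norm_diff_le_partial_derivs:
  fixes a :: "real ^ 'n \<Rightarrow> complex"
  assumes "a differentiable_on UNIV" "\<And>i x. norm (partial_deriv i a x) \<le> B"
  shows "norm (a x - a y) \<le> real CARD('n) * B * norm (x - y)"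
proof -
  have der: "(a has_derivative frechet_derivative a (at z)) (at z within UNIV)" for z
    using assms(1) by (auto simp: differentiable_on_def frechet_derivative_works)
  show ?thesis
  proof (rule differentiable_bound[OF convex_UNIV der])
    fix z
    let ?D = "frechet_derivative a (at z)"
    have lin: "linear ?D" using der[of z] has_derivative_linear by auto
    have "norm (?D h) \<le> (real CARD('n) * B) * norm h" for h
    proof -
      have "h = (\<Sum>i\<in>UNIV. h $ i *\<^sub>R axis i 1)"
        using basis_expansion[of h] by (simp add: scalar_mult_eq_scaleR)
      then have "?D h = ?D (\<Sum>i\<in>UNIV. h $ i *\<^sub>R axis i 1)" by simp
      also have "\<dots> = (\<Sum>i\<in>UNIV. h $ i *\<^sub>R ?D (axis i 1))"
        by (simp add: linear_sum[OF lin] linear_scale[OF lin])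
      also have "norm \<dots> \<le> (\<Sum>i\<in>(UNIV::'n set). norm h * B)"
      proof (rule sum_norm_le)
        fix i :: 'n
        have "norm (?D (axis i 1)) \<le> B"
          using has_derivative_partial_deriv[of a ?D z i] der[of z] assms(2)[of i z] by simp
        then show "norm (h $ i *\<^sub>R ?D (axis i 1)) \<le> norm h * B"
          using component_le_norm_cart[of h i] by (auto intro!: mult_mono)
      qed
      finally show ?thesis by (simp add: ac_simps)
    qed
    then show "onorm ?D \<le> real CARD('n) * B" by (rule onorm_le)
  qed auto
qed

lemma atom_le_1: "atom d K j m a \<Longrightarrow> norm (a x) \<le> 1"
  unfolding atom_def by (elim conjE allE[of _ "[]"] allE[of _ x]) (simp add: D_multi_def)

lemma atom_support:
  assumes "atom d K j m a" "x \<notin> cube d j m"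
  shows "a x = 0"
proof (rule ccontr)
  assume "a x \<noteq> 0"
  then have "x \<in> closure {x. a x \<noteq> 0}" by (intro subsetD[OF closure_subset]) simp
  then show False using assms by (auto simp: atom_def)
qed

lemma C_k_imp_continuous: "C_k k f \<Longrightarrow> continuous_on UNIV f"
  by (cases k) (auto intro: differentiable_imp_continuous_on)

lemma atom_continuous: "atom d K j m a \<Longrightarrow> continuous_on UNIV a"
  by (auto simp: atom_def intro: C_k_imp_continuous)

lemma atom_Lipschitz:
  fixes a :: "real ^ 'n \<Rightarrow> complex"
  assumes "atom d K j m a" "1 \<le> K"
  shows "norm (a x - a y) \<le> real CARD('n) * 2 ^ j * norm (x - y)"
proof (rule norm_diff_le_partial_derivs)
  obtain K' where "K = Suc K'" using assms(2) by (cases K) auto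
  then show "a differentiable_on UNIV" using assms(1) by (simp add: atom_def)
  show "norm (partial_deriv i a x) \<le> 2 ^ j" for i x
  proof -
    have "\<forall>\<alpha> x. length \<alpha> \<le> K \<longrightarrow> norm (D_multi \<alpha> a x) \<le> 2 ^ (length \<alpha> * j)"
      using assms(1) by (simp add: atom_def)
    from this[rule_format, of "[i]" x] have "norm (D_multi [i] a x) \<le> 2 ^ (length [i] * j)"
      using assms(2) by simp
    then show ?thesis by (simp add: D_multi_def)
  qed
qed

definition atom_sum :: "(real ^ 'n) set \<Rightarrow> (nat \<Rightarrow> int ^ 'n \<Rightarrow> complex) \<Rightarrow> (nat \<Rightarrow> int ^ 'n \<Rightarrow> real ^ 'n \<Rightarrow> complex) \<Rightarrow>
    nat \<Rightarrow> real ^ 'n \<Rightarrow> complex" where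
  "atom_sum \<Omega> \<mu> a j x = (\<Sum>m\<in>meeting_cubes \<Omega> j. \<mu> j m * a j m x)"

lemma atomic_repr_iff:
  assumes "bounded \<Omega>"
  shows "atomic_repr d K p \<Omega> f \<mu> \<longleftrightarrow>
     (\<exists>a. (\<forall>j. \<forall>m\<in>meeting_cubes \<Omega> j. atom d K j m (a j m)) \<and>
          (\<lambda>J. Lp_qnorm p \<Omega> (\<lambda>x. f x - (\<Sum>j<J. atom_sum \<Omega> \<mu> a j x))) \<longlonglongrightarrow> 0)"
proof -
  have "finite (meeting_cubes \<Omega> j)" for j using bounded_meeting_cubes[OF assms] by blast
  then show ?thesis unfolding atomic_repr_def atom_sum_def by (simp add: infsum_finite)
qed

lemma atom_sum_measurable:
  assumes "\<And>j m. m \<in> meeting_cubes \<Omega> j \<Longrightarrow> atom d K j m (a j m)"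
  shows "atom_sum \<Omega> \<mu> a j \<in> borel_measurable (lebesgue_on S)"
proof (rule borel_measurable_lebesgue_on_borel)
  have "continuous_on UNIV (\<lambda>x. \<Sum>m\<in>meeting_cubes \<Omega> j. \<mu> j m * a j m x)"
    using atom_continuous[OF assms] by (intro continuous_intros) auto
  then show "atom_sum \<Omega> \<mu> a j \<in> borel_measurable borel"
    unfolding atom_sum_def[abs_def] by (rule borel_measurable_continuous_onI)
qed

lemma pw_atom_sum_le:
  assumes u: "0 < u" "u \<le> 1" and fin: "finite (meeting_cubes \<Omega> j)"
    and at: "\<And>m. m \<in> meeting_cubes \<Omega> j \<Longrightarrow> atom d K j m (a j m)"
  shows "pw u (atom_sum \<Omega> \<mu> a j x) \<le> (\<Sum>m\<in>meeting_cubes \<Omega> j. pw u (\<mu> j m) * indicator (cube d j m) x)"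
proof -
  have "pw u (atom_sum \<Omega> \<mu> a j x) \<le> (\<Sum>m\<in>meeting_cubes \<Omega> j. pw u (\<mu> j m * a j m x))"
    unfolding atom_sum_def by (rule pw_sum_le[OF u fin])
  also have "\<dots> \<le> (\<Sum>m\<in>meeting_cubes \<Omega> j. pw u (\<mu> j m) * indicator (cube d j m) x)"
  proof (rule sum_mono)
    fix m assume m: "m \<in> meeting_cubes \<Omega> j"
    have "pw u (a j m x) \<le> indicator (cube d j m) x"
    proof (cases "x \<in> cube d j m")
      case True
      have "pw u (a j m x) \<le> pw u 1" using u atom_le_1[OF at[OF m]] by (intro pw_mono) auto
      then show ?thesis using True by (simp add: pw_def)
    next
      case False
      then show ?thesis using atom_support[OF at[OF m]] by simp
    qed
    then show "pw u (\<mu> j m * a j m x) \<le> pw u (\<mu> j m) * indicator (cube d j m) x"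
      unfolding pw_mult by (rule mult_left_mono) simp
  qed
  finally show ?thesis .
qed

text \<open>
  Hoelder's inequality on a set of finite measure.
\<close>

lemma nn_integral_pw_le_Lp_qnorm:
  fixes \<Omega> :: "(real ^ 'n) set"
  assumes "bounded \<Omega>" "\<Omega> \<in> sets lebesgue" "0 < u" "ennreal u \<le> p"
  obtains C where "0 < C" "\<And>g. g \<in> borel_measurable (lebesgue_on \<Omega>) \<Longrightarrow>
    (\<integral>\<^sup>+x. pw u (g x) \<partial>lebesgue_on \<Omega>) \<le> ennreal C * enn_powr (Lp_qnorm p \<Omega> g) u"
proof -
  let ?L = "lebesgue_on \<Omega>"
  have p: "0 < p" using assms by (meson ennreal_less_zero_iff less_le_trans)
  have fm: "emeasure lebesgue \<Omega> < top"
    using bounded_set_imp_lmeasurable[OF assms(1,2)] by (auto simp: fmeasurable_def)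
  define V where "V = enn2real (emeasure lebesgue \<Omega>) + 1"
  have "emeasure lebesgue \<Omega> = ennreal (enn2real (emeasure lebesgue \<Omega>))" using fm by simp
  also have "\<dots> \<le> ennreal V" by (rule ennreal_leI) (simp add: V_def)
  finally have V: "emeasure lebesgue \<Omega> \<le> ennreal V" "1 \<le> V" by (simp_all add: V_def)
  have sp: "emeasure ?L (space ?L) \<le> ennreal V"
    using V assms(2) by (simp add: space_restrict_space emeasure_restrict_space)
  show ?thesis
    using p
  proof (cases rule: exponent_cases)
    case 1
    show ?thesis
    proof (rule that[of V])
      fix g :: "real ^ 'n \<Rightarrow> complex" assume [measurable]: "g \<in> borel_measurable ?L"
      have "AE x in ?L. ennreal (norm (g x)) \<le> Lp_qnorm p \<Omega> g"
        using esssup_AE[of "\<lambda>x. ennreal (norm (g x))" "?L"] 1 by (simp add: Lp_qnorm_def)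
      then have "AE x in ?L. pw u (g x) \<le> enn_powr (Lp_qnorm p \<Omega> g) u"
        unfolding pw_eq_enn_powr using assms(3) by (auto elim!: eventually_mono intro: enn_powr_mono)
      then have "(\<integral>\<^sup>+x. pw u (g x) \<partial>?L) \<le> (\<integral>\<^sup>+x. enn_powr (Lp_qnorm p \<Omega> g) u \<partial>?L)"
        by (rule nn_integral_mono_AE)
      also have "\<dots> = enn_powr (Lp_qnorm p \<Omega> g) u * emeasure ?L (space ?L)"
        by simp
      also have "\<dots> \<le> enn_powr (Lp_qnorm p \<Omega> g) u * ennreal V" by (intro mult_left_mono sp) auto
      finally show "(\<integral>\<^sup>+x. pw u (g x) \<partial>?L) \<le> ennreal V * enn_powr (Lp_qnorm p \<Omega> g) u"
        by (simp add: mult.commute)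
    qed (use V in auto)
  next
    case (2 r)
    have ur: "u \<le> r" using assms 2 by simp
    have Lp: "enn_powr (Lp_qnorm p \<Omega> g) u = enn_powr (\<integral>\<^sup>+x. pw r (g x) \<partial>?L) (u / r)" for g
      using 2 by (simp add: Lp_qnorm_def pw_def enn_powr_powr)
    show ?thesis
    proof (cases "u = r")
      case True
      show ?thesis by (rule that[of 1]) (use 2 True Lp in auto)
    next
      case False
      show ?thesis
      proof (rule that[of "V powr (1 - u / r)"])
        fix g :: "real ^ 'n \<Rightarrow> complex" assume [measurable]: "g \<in> borel_measurable ?L"
        have "(\<integral>\<^sup>+x. pw u (g x) \<partial>?L) = (\<integral>\<^sup>+x. enn_powr (pw r (g x)) (u / r) * enn_powr 1 (1 - u / r) \<partial>?L)"
          using 2 by (simp add: pw_eq_enn_powr enn_powr_powr)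
        also have "\<dots> \<le> enn_powr (\<integral>\<^sup>+x. pw r (g x) \<partial>?L) (u/r) * enn_powr (\<integral>\<^sup>+x. 1 \<partial>?L) (1 - u / r)"
          using False ur 2 assms(3) by (intro nn_integral_Holder) auto
        also have "\<dots> \<le> enn_powr (\<integral>\<^sup>+x. pw r (g x) \<partial>?L) (u/r) * enn_powr (ennreal V) (1 - u / r)"
          using sp ur 2 by (intro mult_left_mono enn_powr_mono) auto
        finally show "(\<integral>\<^sup>+x. pw u (g x) \<partial>?L) \<le> ennreal (V powr (1 - u / r)) * enn_powr (Lp_qnorm p \<Omega> g) u"
          using V by (simp add: Lp enn_powr_ennreal mult.commute)
      qed (use V in auto)
    qed
  qed
qed

lemma tendsto_enn_powr_0:
  assumes "(x \<longlongrightarrow> 0) F" "0 < u"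
  shows "((\<lambda>n. enn_powr (x n) u) \<longlongrightarrow> 0) F"
proof (rule order_tendstoI)
  fix a :: ennreal assume "0 < a"
  then have "0 < enn_powr a (1/u)" by (simp add: zero_less_iff_neq_zero)
  then have "eventually (\<lambda>n. x n < enn_powr a (1/u)) F" by (rule order_tendstoD[OF assms(1)])
  then show "eventually (\<lambda>n. enn_powr (x n) u < a) F"
  proof (rule eventually_mono)
    fix n assume *: "x n < enn_powr a (1/u)"
    show "enn_powr (x n) u < a"
    proof (rule ccontr)
      assume "\<not> enn_powr (x n) u < a"
      then have "enn_powr a (1/u) \<le> enn_powr (enn_powr (x n) u) (1/u)" using assms(2) by (intro enn_powr_mono) auto
      then show False using * assms(2) by simp
    qed
  qed
qed simp

text \<open>
  Hoelder's inequality for the at most \<open>C 2\<^bsup>jn\<^esup>\<close> cubes of level \<open>j\<close> that meet a bounded set.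
\<close>

lemma sum_powr_level_norm_le:
  fixes \<Omega> :: "(real ^ 'n) set"
  assumes "bounded \<Omega>" "0 < u" "ennreal u \<le> p"
  obtains C where "0 < C"
    "\<And>x j s. (\<Sum>m\<in>meeting_cubes \<Omega> j. enn_powr (x j m) u)
       \<le> ennreal (C * 2 powr (real j * (real CARD('n) - s * u))) * enn_powr (level_norm s p \<Omega> x j) u"
proof -
  let ?n = "real CARD('n)"
  let ?M = "meeting_cubes \<Omega>"
  obtain C where C: "0 < C" "\<And>l. finite (?M l)"
    "\<And>l. real (card (?M l)) \<le> C * 2 powr (real l * ?n)"
    using bounded_meeting_cubes[OF assms(1)] by blast
  define b where "b = inv_exp p"
  define n where "n = ?n"
  show ?thesis
  proof (rule that[of "C powr (1 - b * u)"])
    fix x and j :: nat and s :: real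
    let ?S = "\<Sum>m\<in>?M j. enn_powr (x j m) u"
    have "ell_qnorm p {()} (\<lambda>_. enn_powr ?S (1/u)) \<le> ennreal ((C * 2 powr (real j * ?n)) powr (1/u - inv_exp p) * 1 powr inv_exp p) *
       ell_qnorm p (?M j) (x j)"
      using assms(2,3) C by (intro ell_qnorm_Schur[where R = "\<lambda>_ _. True" and u = u]) auto
    moreover have "0 < p" using assms by (meson ennreal_less_zero_iff less_le_trans)
    then have "enn_powr ?S (1/u) \<le> ell_qnorm p {()} (\<lambda>_. enn_powr ?S (1/u))" by (rule ell_qnorm_ge) simp
    ultimately have "enn_powr ?S (1/u) \<le> ennreal ((C * 2 powr (real j * n)) powr (1/u - b)) *
       ell_qnorm p (?M j) (x j)" by (auto simp: b_def n_def)
    then have "?S \<le> enn_powr (ennreal ((C * 2 powr (real j * n)) powr (1/u - b)) * ell_qnorm p (?M j) (x j)) u"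
      using assms by (simp add: enn_powr_le_swap)
    also have "\<dots> = ennreal (C powr (1 - b * u) * 2 powr (real j * (?n - s * u))) * enn_powr (level_norm s p \<Omega> x j) u"
    proof -
      have "((C * 2 powr (real j * n)) powr (1/u - b)) powr u
          = (C powr (1 - b * u) * 2 powr (real j * (n - s * u))) * (2 powr (real j * (s - n * b))) powr u"
        using C assms(2) by (simp add: powr_powr powr_mult algebra_simps flip: powr_add)
      then show ?thesis
        by (simp add: enn_powr_mult enn_powr_ennreal level_norm_def ennreal_mult' b_def n_def mult.assoc)
    qed
    finally show "?S \<le> ennreal (C powr (1 - b * u) * 2 powr (real j * (?n - s * u))) * enn_powr (level_norm s p \<Omega> x j) u" .
  qed (use C in auto)
qed

text \<open>
  For a cube of side \<open>2\<^bsup>-l\<^esup>\<close>, the parts of an atomic representation at levels \<open>j > l\<close> are estimated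
  in size and the parts at levels \<open>j \<le> l\<close> by their Lipschitz constants, the comparison constant being
  the value of the coarse part at the centre of the cube.
\<close>

lemma osc_atomic_repr_le:
  fixes \<Omega> :: "(real ^ 'n) set"
  assumes bd: "bounded \<Omega>" and meas: "\<Omega> \<in> sets lebesgue" and d: "0 \<le> d" and K: "1 \<le> K"
    and u: "0 < u" "u \<le> 1" "ennreal u \<le> p"
  obtains C where "0 < C"
    "\<And>f \<mu> l m. atomic_repr d K p \<Omega> f \<mu> \<Longrightarrow> f \<in> borel_measurable (lebesgue_on \<Omega>) \<Longrightarrow> osc u \<Omega> f l m \<le>
        (\<Sum>j. ennreal (C * diag_weight CARD('n) u l j) * (\<Sum>m'\<in>{m'\<in>meeting_cubes \<Omega> j. near (max 3 d) l m j m'}. pw u (\<mu> j m')))"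
    "\<And>f \<mu>. atomic_repr d K p \<Omega> f \<mu> \<Longrightarrow> f \<in> borel_measurable (lebesgue_on \<Omega>) \<Longrightarrow> (\<integral>\<^sup>+x. pw u (f x) \<partial>lebesgue_on \<Omega>) \<le>
        (\<Sum>j. ennreal (C * 2 powr (- real j * real CARD('n))) * (\<Sum>m'\<in>meeting_cubes \<Omega> j. pw u (\<mu> j m')))"
proof -
  let ?M = "meeting_cubes \<Omega>"
  let ?L = "lebesgue_on \<Omega>"
  define n where "n = CARD('n)"
  obtain C1 where C1: "0 < C1" "\<And>g. g \<in> borel_measurable ?L \<Longrightarrow>
    (\<integral>\<^sup>+x. pw u (g x) \<partial>?L) \<le> ennreal C1 * enn_powr (Lp_qnorm p \<Omega> g) u"
    using nn_integral_pw_le_Lp_qnorm[OF bd meas u(1,3)] by blast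
  have fin: "finite (?M l)" for l using bounded_meeting_cubes[OF bd] by blast
  define Lc where "Lc = 6 * real n * real n"
  define C where "C = (2 * d) ^ n + 1 + 6 ^ n * Lc powr u"
  have C: "0 < C" using d by (simp add: C_def add_nonneg_pos add_pos_nonneg)
  have [measurable]: "cube d' j m \<in> sets lebesgue" for d' j and m :: "int ^ 'n" by simp
  have indm [measurable]: "(\<lambda>x. indicator (cube d' j m) x :: ennreal) \<in> borel_measurable ?L" for d' j and m :: "int ^ 'n"
    by (rule borel_measurable_lebesgue_on_borel) simp
  have main: "osc u \<Omega> f l m \<le> (\<Sum>j. ennreal (C * diag_weight n u l j) * (\<Sum>m'\<in>{m'\<in>?M j. near (max 3 d) l m j m'}. pw u (\<mu> j m')))"
    "(\<integral>\<^sup>+x. pw u (f x) \<partial>?L) \<le> (\<Sum>j. ennreal (C * 2 powr (- real j * real n)) * (\<Sum>m'\<in>?M j. pw u (\<mu> j m')))"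
    if repr: "atomic_repr d K p \<Omega> f \<mu>" and fm [measurable]: "f \<in> borel_measurable ?L" for f \<mu> l m
  proof -
    obtain a where a: "\<And>j m. m \<in> ?M j \<Longrightarrow> atom d K j m (a j m)"
      and lim: "(\<lambda>J. Lp_qnorm p \<Omega> (\<lambda>x. f x - (\<Sum>j<J. atom_sum \<Omega> \<mu> a j x))) \<longlonglongrightarrow> 0"
      using repr atomic_repr_iff[OF bd] by blast
    let ?P = "atom_sum \<Omega> \<mu> a"
    have Pm [measurable]: "?P j \<in> borel_measurable ?L" for j by (rule atom_sum_measurable[OF a])
    \<comment> \<open>The error of the partial sums; it tends to \<open>0\<close> because convergence in \<open>L\<^sub>p\<close> implies convergence in \<open>L\<^sub>u\<close>.\<close>
    define \<eta> where "\<eta> J = (\<integral>\<^sup>+x. pw u (f x - (\<Sum>j<J. ?P j x)) \<partial>?L)" for J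
    have \<eta>: "\<eta> \<longlonglongrightarrow> 0"
    proof (rule tendsto_sandwich[of "\<lambda>_. 0" _ _ "\<lambda>J. ennreal C1 * enn_powr (Lp_qnorm p \<Omega> (\<lambda>x. f x - (\<Sum>j<J. ?P j x))) u"])
      show "\<forall>\<^sub>F J in sequentially. \<eta> J \<le> ennreal C1 * enn_powr (Lp_qnorm p \<Omega> (\<lambda>x. f x - (\<Sum>j<J. ?P j x))) u"
        unfolding \<eta>_def by (intro always_eventually allI C1(2)) measurable
      have "(\<lambda>J. ennreal C1 * enn_powr (Lp_qnorm p \<Omega> (\<lambda>x. f x - (\<Sum>j<J. ?P j x))) u) \<longlonglongrightarrow> ennreal C1 * 0"
        by (intro ennreal_tendsto_cmult tendsto_enn_powr_0 lim u) simp
      then show "(\<lambda>J. ennreal C1 * enn_powr (Lp_qnorm p \<Omega> (\<lambda>x. f x - (\<Sum>j<J. ?P j x))) u) \<longlonglongrightarrow> 0" by simp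
    qed auto
    have limit: "A \<le> S" if "\<And>J. J > l \<Longrightarrow> A \<le> ennreal c * \<eta> J + S" for A S c
    proof -
      have "(\<lambda>J. ennreal c * \<eta> J + S) \<longlonglongrightarrow> ennreal c * 0 + S"
        by (intro tendsto_add ennreal_tendsto_cmult \<eta> tendsto_const) simp
      moreover have "\<forall>\<^sub>F J in sequentially. A \<le> ennreal c * \<eta> J + S"
        using eventually_gt_at_top[of l] by eventually_elim (rule that)
      ultimately have "A \<le> ennreal c * 0 + S" by (intro tendsto_lowerbound[of _ _ sequentially]) auto
      then show ?thesis by simp
    qed
    have intP: "(\<integral>\<^sup>+x. pw u (\<mu> j m') * indicator (cube d j m') x \<partial>?L) \<le> ennreal ((2 * d) ^ n / 2 ^ (j * n)) * pw u (\<mu> j m')" for j m'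
    proof -
      have "(\<integral>\<^sup>+x. pw u (\<mu> j m') * indicator (cube d j m') x \<partial>?L) = pw u (\<mu> j m') * (\<integral>\<^sup>+x. indicator (cube d j m') x \<partial>?L)"
        by (rule nn_integral_cmult) measurable
      also have "\<dots> \<le> pw u (\<mu> j m') * ennreal ((2 * d) ^ n / 2 ^ (j * n))"
        unfolding n_def by (intro mult_left_mono nn_integral_lebesgue_on_cube_le d meas) auto
      finally show ?thesis by (simp add: mult.commute)
    qed
    define near_set where "near_set j = {m'\<in>?M j. near (max 3 d) l m j m'}" for j
    have near_fin: "finite (near_set j)" for j using fin by (simp add: near_set_def)
    define trm where "trm j = ennreal (C * diag_weight n u l j) * (\<Sum>m'\<in>near_set j. pw u (\<mu> j m'))" for j
    \<comment> \<open>Pointwise bound for the size of level \<open>j\<close> if it is fine, and for its deviation from the value at the centre if it is coarse.\<close>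
    define maj where "maj j x = (if l < j then (\<Sum>m'\<in>near_set j. pw u (\<mu> j m') * indicator (cube d j m') x)
      else (\<Sum>m'\<in>near_set j. pw u (\<mu> j m')) * ennreal (Lc powr u * 2 powr (- (real l - real j) * u)) * indicator (cube 3 l m) x)" for j x
    have majm [measurable]: "maj j \<in> borel_measurable ?L" for j
      unfolding maj_def[abs_def] by (cases "l < j") simp_all
    have int_maj: "ennreal (2 ^ (l * n)) * (\<integral>\<^sup>+x. maj j x \<partial>?L) \<le> trm j" for j
    proof (cases "l < j")
      case True
      have "(\<integral>\<^sup>+x. maj j x \<partial>?L) = (\<Sum>m'\<in>near_set j. \<integral>\<^sup>+x. pw u (\<mu> j m') * indicator (cube d j m') x \<partial>?L)"
        unfolding maj_def using True by (simp add: nn_integral_sum)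
      also have "\<dots> \<le> (\<Sum>m'\<in>near_set j. ennreal ((2 * d) ^ n / 2 ^ (j * n)) * pw u (\<mu> j m'))" by (intro sum_mono intP)
      also have "\<dots> = ennreal ((2 * d) ^ n / 2 ^ (j * n)) * (\<Sum>m'\<in>near_set j. pw u (\<mu> j m'))" by (simp add: sum_distrib_left)
      finally have "ennreal (2 ^ (l * n)) * (\<integral>\<^sup>+x. maj j x \<partial>?L)
         \<le> ennreal (2 ^ (l * n)) * (ennreal ((2 * d) ^ n / 2 ^ (j * n)) * (\<Sum>m'\<in>near_set j. pw u (\<mu> j m')))" by (rule mult_left_mono) simp
      also have "\<dots> = ennreal (2 ^ (l * n) * ((2 * d) ^ n / 2 ^ (j * n))) * (\<Sum>m'\<in>near_set j. pw u (\<mu> j m'))"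
        by (subst ennreal_mult') (simp_all add: mult.assoc)
      also have "\<dots> \<le> trm j"
        unfolding trm_def
      proof (intro mult_right_mono ennreal_leI)
        have "(2::real) ^ (l * n) / 2 ^ (j * n) = 2 powr (- (real j - real l) * real n)"
          by (simp add: algebra_simps powr_diff flip: powr_realpow)
        moreover have "2 ^ (l * n) * ((2 * d) ^ n / 2 ^ (j * n)) = (2 * d) ^ n * (2 ^ (l * n) / 2 ^ (j * n))" by simp
        ultimately have "2 ^ (l * n) * ((2 * d) ^ n / 2 ^ (j * n)) = (2 * d) ^ n * diag_weight n u l j"
          using True by (simp only: diag_weight_def if_True)
        also have "\<dots> \<le> C * diag_weight n u l j" using True d by (intro mult_right_mono) (auto simp: C_def diag_weight_def)
        finally show "2 ^ (l * n) * ((2 * d) ^ n / 2 ^ (j * n)) \<le> C * diag_weight n u l j" .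
      qed simp
      finally show ?thesis .
    next
      case False
      let ?c = "Lc powr u * 2 powr (- (real l - real j) * u)"
      have "(\<integral>\<^sup>+x. maj j x \<partial>?L) = (\<Sum>m'\<in>near_set j. pw u (\<mu> j m')) * ennreal ?c * (\<integral>\<^sup>+x. indicator (cube 3 l m) x \<partial>?L)"
        unfolding maj_def using False by (simp only: if_False) (rule nn_integral_cmult, measurable)
      also have "\<dots> \<le> (\<Sum>m'\<in>near_set j. pw u (\<mu> j m')) * ennreal ?c * ennreal ((2 * 3) ^ n / 2 ^ (l * n))"
        unfolding n_def by (intro mult_left_mono nn_integral_lebesgue_on_cube_le meas) auto
      finally have "ennreal (2 ^ (l * n)) * (\<integral>\<^sup>+x. maj j x \<partial>?L)
         \<le> ennreal (2 ^ (l * n)) * ((\<Sum>m'\<in>near_set j. pw u (\<mu> j m')) * ennreal ?c * ennreal ((2 * 3) ^ n / 2 ^ (l * n)))" by (rule mult_left_mono) simp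
      also have "\<dots> = (ennreal (2 ^ (l * n)) * ennreal ?c * ennreal ((2 * 3) ^ n / 2 ^ (l * n))) * (\<Sum>m'\<in>near_set j. pw u (\<mu> j m'))"
        by (simp only: ac_simps)
      also have "ennreal (2 ^ (l * n)) * ennreal ?c * ennreal ((2 * 3) ^ n / 2 ^ (l * n)) = ennreal (6 ^ n * ?c)"
        by (simp add: mult.commute flip: ennreal_mult)
      also have "ennreal (6 ^ n * ?c) * (\<Sum>m'\<in>near_set j. pw u (\<mu> j m')) \<le> trm j"
        unfolding trm_def
      proof (intro mult_right_mono ennreal_leI)
        have "6 ^ n * ?c = (6 ^ n * Lc powr u) * diag_weight n u l j" using False by (simp add: diag_weight_def)
        also have "\<dots> \<le> C * diag_weight n u l j" using d by (intro mult_right_mono) (auto simp: C_def diag_weight_def)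
        finally show "6 ^ n * ?c \<le> C * diag_weight n u l j" .
      qed simp
      finally show ?thesis .
    qed
    define x0 :: "real ^ 'n" where "x0 = (\<chi> i. of_int (m $ i) / 2 ^ l)"
    have x0: "x0 \<in> cube 3 l m" by (simp add: x0_def cube_def)
    have fine: "pw u (?P j x) \<le> maj j x" if "x \<in> cube 3 l m" "l < j" for x j
    proof -
      have "pw u (?P j x) \<le> (\<Sum>m'\<in>?M j. pw u (\<mu> j m') * indicator (cube d j m') x)"
        by (rule pw_atom_sum_le[OF u(1,2) fin a])
      also have "\<dots> = (\<Sum>m'\<in>near_set j. pw u (\<mu> j m') * indicator (cube d j m') x)"
        using that near_if_cubes_meet[of x 3 l m d j _ "max 3 d"] fin
        by (intro sum.mono_neutral_right) (auto simp: near_set_def indicator_def)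
      finally show ?thesis using that by (simp add: maj_def)
    qed
    have coarse: "pw u (?P j x - ?P j x0) \<le> maj j x" if x: "x \<in> cube 3 l m" and j: "\<not> l < j" for x j
    proof -
      have "?P j x - ?P j x0 = (\<Sum>m'\<in>?M j. \<mu> j m' * (a j m' x - a j m' x0))"
        by (simp add: atom_sum_def right_diff_distrib sum_subtractf)
      also have "\<dots> = (\<Sum>m'\<in>near_set j. \<mu> j m' * (a j m' x - a j m' x0))"
      proof (intro sum.mono_neutral_right fin)
        show "\<forall>m'\<in>?M j - near_set j. \<mu> j m' * (a j m' x - a j m' x0) = 0"
        proof
          fix m' assume m': "m' \<in> ?M j - near_set j"
          then have "\<not> near (max 3 d) l m j m'" by (auto simp: near_set_def)
          then have "x \<notin> cube d j m'" "x0 \<notin> cube d j m'"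
            using near_if_cubes_meet[of _ 3 l m d j m' "max 3 d"] x x0 by auto
          then show "\<mu> j m' * (a j m' x - a j m' x0) = 0" using atom_support[OF a] m' by auto
        qed
      qed (auto simp: near_set_def)
      finally have "pw u (?P j x - ?P j x0) \<le> (\<Sum>m'\<in>near_set j. pw u (\<mu> j m' * (a j m' x - a j m' x0)))"
        using pw_sum_le[OF u(1,2) near_fin] by simp
      also have "\<dots> \<le> (\<Sum>m'\<in>near_set j. pw u (\<mu> j m') * ennreal (Lc powr u * 2 powr (- (real l - real j) * u)))"
      proof (intro sum_mono)
        fix m' assume "m' \<in> near_set j"
        then have m': "m' \<in> ?M j" by (simp add: near_set_def)
        have "norm (a j m' x - a j m' x0) \<le> real CARD('n) * 2 ^ j * norm (x - x0)"
          by (rule atom_Lipschitz[OF a[OF m'] K])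
        also have "\<dots> \<le> real CARD('n) * 2 ^ j * (real CARD('n) * (2 * 3 / 2 ^ l))"
          by (intro mult_left_mono norm_le_of_cube[OF x x0]) auto
        also have "\<dots> = Lc * 2 powr (- (real l - real j))"
          by (simp add: Lc_def n_def powr_diff powr_realpow)
        finally have "norm (a j m' x - a j m' x0) powr u \<le> (Lc * 2 powr (- (real l - real j))) powr u"
          using u by (intro powr_mono2) auto
        also have "\<dots> = Lc powr u * 2 powr (- (real l - real j) * u)"
          by (simp add: powr_mult powr_powr Lc_def)
        finally show "pw u (\<mu> j m' * (a j m' x - a j m' x0)) \<le> pw u (\<mu> j m') * ennreal (Lc powr u * 2 powr (- (real l - real j) * u))"
          unfolding pw_mult by (intro mult_left_mono) (auto simp: pw_def ennreal_leI)
      qed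
      also have "\<dots> = maj j x" using x j by (simp add: maj_def sum_distrib_right)
      finally show ?thesis .
    qed
    define c where "c = (\<Sum>j\<le>l. ?P j x0)"
    have pt: "pw u (f x - c) * indicator (cube 3 l m) x \<le> pw u (f x - (\<Sum>j<J. ?P j x)) + (\<Sum>j<J. maj j x)"
      if J: "J > l" for J x
    proof (cases "x \<in> cube 3 l m")
      case True
      have split: "{..<J} = {..l} \<union> {l<..<J}" "{..l} \<inter> {l<..<J} = {}" using J by auto
      have "(\<Sum>j<J. ?P j x) = (\<Sum>j\<le>l. ?P j x) + (\<Sum>j\<in>{l<..<J}. ?P j x)"
        unfolding split(1) by (rule sum.union_disjoint) (use split in auto)
      then have "f x - c = (f x - (\<Sum>j<J. ?P j x)) + ((\<Sum>j\<in>{l<..<J}. ?P j x) + (\<Sum>j\<le>l. ?P j x - ?P j x0))"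
        by (simp add: c_def sum_subtractf)
      then have "pw u (f x - c) \<le> pw u (f x - (\<Sum>j<J. ?P j x)) + pw u ((\<Sum>j\<in>{l<..<J}. ?P j x) + (\<Sum>j\<le>l. ?P j x - ?P j x0))"
        by (simp only: pw_add_le[OF u(1,2)])
      also have "pw u ((\<Sum>j\<in>{l<..<J}. ?P j x) + (\<Sum>j\<le>l. ?P j x - ?P j x0))
         \<le> pw u (\<Sum>j\<in>{l<..<J}. ?P j x) + pw u (\<Sum>j\<le>l. ?P j x - ?P j x0)" by (rule pw_add_le[OF u(1,2)])
      also have "\<dots> \<le> (\<Sum>j\<in>{l<..<J}. pw u (?P j x)) + (\<Sum>j\<le>l. pw u (?P j x - ?P j x0))"
        by (intro add_mono pw_sum_le u) auto
      also have "\<dots> \<le> (\<Sum>j\<in>{l<..<J}. maj j x) + (\<Sum>j\<le>l. maj j x)"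
        using fine[OF True] coarse[OF True] by (intro add_mono sum_mono) auto
      also have "\<dots> = (\<Sum>j<J. maj j x)"
        unfolding split(1) by (subst sum.union_disjoint) (use split in \<open>auto simp: add.commute\<close>)
      finally show ?thesis using True by (simp add: add_left_mono)
    qed simp
    have step: "osc u \<Omega> f l m \<le> ennreal (2 ^ (l * n)) * \<eta> J + (\<Sum>j. trm j)" if J: "J > l" for J
    proof -
      have "osc u \<Omega> f l m \<le> ennreal (2 ^ (l * n)) * (\<integral>\<^sup>+x. pw u (f x - c) * indicator (cube 3 l m) x \<partial>?L)"
        unfolding osc_def n_def by (rule INF_lower) simp
      also have "\<dots> \<le> ennreal (2 ^ (l * n)) * (\<integral>\<^sup>+x. pw u (f x - (\<Sum>j<J. ?P j x)) + (\<Sum>j<J. maj j x) \<partial>?L)"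
        by (intro mult_left_mono nn_integral_mono pt J) simp
      also have "\<dots> = ennreal (2 ^ (l * n)) * \<eta> J + (\<Sum>j<J. ennreal (2 ^ (l * n)) * (\<integral>\<^sup>+x. maj j x \<partial>?L))"
        by (simp add: \<eta>_def nn_integral_add nn_integral_sum distrib_left sum_distrib_left)
      also have "\<dots> \<le> ennreal (2 ^ (l * n)) * \<eta> J + (\<Sum>j<J. trm j)"
        by (intro add_left_mono sum_mono int_maj)
      also have "\<dots> \<le> ennreal (2 ^ (l * n)) * \<eta> J + (\<Sum>j. trm j)"
        by (intro add_left_mono sum_le_suminf) auto
      finally show ?thesis .
    qed
    show "osc u \<Omega> f l m \<le> (\<Sum>j. ennreal (C * diag_weight n u l j) * (\<Sum>m'\<in>{m'\<in>?M j. near (max 3 d) l m j m'}. pw u (\<mu> j m')))"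
      using limit[OF step] by (simp add: trm_def near_set_def)
    define t2 where "t2 j = ennreal (C * 2 powr (- real j * real n)) * (\<Sum>m'\<in>?M j. pw u (\<mu> j m'))" for j
    have "(\<integral>\<^sup>+x. pw u (f x) \<partial>?L) \<le> ennreal 1 * \<eta> J + (\<Sum>j. t2 j)" for J
    proof -
      have "pw u (f x) \<le> pw u (f x - (\<Sum>j<J. ?P j x)) + (\<Sum>j<J. pw u (?P j x))" for x
      proof -
        have "pw u (f x) \<le> pw u (f x - (\<Sum>j<J. ?P j x)) + pw u (\<Sum>j<J. ?P j x)"
          using pw_add_le[OF u(1,2), of "f x - (\<Sum>j<J. ?P j x)" "\<Sum>j<J. ?P j x"] by simp
        also have "\<dots> \<le> pw u (f x - (\<Sum>j<J. ?P j x)) + (\<Sum>j<J. pw u (?P j x))"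
          by (intro add_left_mono pw_sum_le u) auto
        finally show ?thesis .
      qed
      then have "(\<integral>\<^sup>+x. pw u (f x) \<partial>?L) \<le> (\<integral>\<^sup>+x. pw u (f x - (\<Sum>j<J. ?P j x)) + (\<Sum>j<J. pw u (?P j x)) \<partial>?L)"
        by (intro nn_integral_mono)
      also have "\<dots> = \<eta> J + (\<Sum>j<J. \<integral>\<^sup>+x. pw u (?P j x) \<partial>?L)"
        by (simp add: \<eta>_def nn_integral_add nn_integral_sum)
      also have "\<dots> \<le> \<eta> J + (\<Sum>j<J. t2 j)"
      proof (intro add_left_mono sum_mono)
        fix j
        have "(\<integral>\<^sup>+x. pw u (?P j x) \<partial>?L) \<le> (\<integral>\<^sup>+x. (\<Sum>m'\<in>?M j. pw u (\<mu> j m') * indicator (cube d j m') x) \<partial>?L)"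
          by (intro nn_integral_mono pw_atom_sum_le[OF u(1,2) fin a])
        also have "\<dots> = (\<Sum>m'\<in>?M j. \<integral>\<^sup>+x. pw u (\<mu> j m') * indicator (cube d j m') x \<partial>?L)"
          by (rule nn_integral_sum) simp
        also have "\<dots> \<le> (\<Sum>m'\<in>?M j. ennreal ((2 * d) ^ n / 2 ^ (j * n)) * pw u (\<mu> j m'))" by (intro sum_mono intP)
        also have "\<dots> = ennreal ((2 * d) ^ n / 2 ^ (j * n)) * (\<Sum>m'\<in>?M j. pw u (\<mu> j m'))"
          by (simp add: sum_distrib_left)
        also have "\<dots> \<le> t2 j"
          unfolding t2_def
        proof (intro mult_right_mono ennreal_leI)
          have "(2 * d) ^ n / 2 ^ (j * n) = (2 * d) ^ n * 2 powr (- real j * real n)"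
            by (simp add: powr_minus_divide flip: powr_realpow of_nat_mult)
          also have "\<dots> \<le> C * 2 powr (- real j * real n)" by (intro mult_right_mono) (auto simp: C_def)
          finally show "(2 * d) ^ n / 2 ^ (j * n) \<le> C * 2 powr (- real j * real n)" .
        qed simp
        finally show "(\<integral>\<^sup>+x. pw u (?P j x) \<partial>?L) \<le> t2 j" .
      qed
      also have "\<dots> \<le> \<eta> J + (\<Sum>j. t2 j)" by (intro add_left_mono sum_le_suminf) auto
      finally show ?thesis by simp
    qed
    then have "(\<integral>\<^sup>+x. pw u (f x) \<partial>?L) \<le> (\<Sum>j. t2 j)" by (rule limit)
    then show "(\<integral>\<^sup>+x. pw u (f x) \<partial>?L) \<le> (\<Sum>j. ennreal (C * 2 powr (- real j * real n)) * (\<Sum>m'\<in>?M j. pw u (\<mu> j m')))"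
      by (simp add: t2_def)
  qed
  show ?thesis by (rule that[OF C]) (use main in \<open>simp_all add: n_def\<close>)
qed

text \<open>
  The oscillations arise from the coefficients of any atomic representation by an almost diagonal operator,
  which is bounded because \<open>0 < s < 1\<close>; then pass to the infimum over the representations.
\<close>

lemma besov_osc_seq_le:
  fixes \<Omega> :: "(real ^ 'n) set"
  assumes bd: "bounded \<Omega>" and meas: "\<Omega> \<in> sets lebesgue" and d: "0 \<le> d" and K: "1 \<le> K"
    and u: "0 < u" "u \<le> 1" "ennreal u \<le> p" and q: "0 < q" and s: "0 < s" "s < 1"
  obtains C where "0 < C"
    "\<And>f. f \<in> vecs (besov d K s p q \<Omega>) \<Longrightarrow> seq_qnorm s p q \<Omega> (osc_seq u \<Omega> f) \<le> ennreal C * qn (besov d K s p q \<Omega>) f"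
    "\<And>f. f \<in> vecs (besov d K s p q \<Omega>) \<Longrightarrow> Lu_qnorm u \<Omega> f \<le> ennreal C * qn (besov d K s p q \<Omega>) f"
proof -
  let ?Q = "seq_qnorm s p q \<Omega>"
  let ?M = "meeting_cubes \<Omega>"
  let ?L = "lebesgue_on \<Omega>"
  obtain C1 where C1: "0 < C1"
    "\<And>f \<mu> l m. atomic_repr d K p \<Omega> f \<mu> \<Longrightarrow> f \<in> borel_measurable ?L \<Longrightarrow> osc u \<Omega> f l m \<le>
        (\<Sum>j. ennreal (C1 * diag_weight CARD('n) u l j) * (\<Sum>m'\<in>{m'\<in>?M j. near (max 3 d) l m j m'}. pw u (\<mu> j m')))"
    "\<And>f \<mu>. atomic_repr d K p \<Omega> f \<mu> \<Longrightarrow> f \<in> borel_measurable ?L \<Longrightarrow> (\<integral>\<^sup>+x. pw u (f x) \<partial>?L) \<le>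
        (\<Sum>j. ennreal (C1 * 2 powr (- real j * real CARD('n))) * (\<Sum>m'\<in>?M j. pw u (\<mu> j m')))"
    using osc_atomic_repr_le[OF bd meas d K u] by blast
  obtain C2 where C2: "0 < C2"
    "\<And>x y. (\<And>l m. m \<in> ?M l \<Longrightarrow> enn_powr (y l m) u \<le>
        (\<Sum>j. ennreal (C1 * diag_weight CARD('n) u l j) * (\<Sum>m'\<in>{m'\<in>?M j. near (max 3 d) l m j m'}. enn_powr (x j m') u)))
     \<Longrightarrow> ?Q y \<le> ennreal C2 * ?Q x"
    by (rule seq_qnorm_almost_diagonal[OF bd u(1,3) q s, of "max 3 d" C1]) (use C1 in auto)
  obtain C3 where C3: "0 < C3"
    "\<And>x j s. (\<Sum>m\<in>?M j. enn_powr (x j m) u)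
       \<le> ennreal (C3 * 2 powr (real j * (real CARD('n) - s * u))) * enn_powr (level_norm s p \<Omega> x j) u"
    using sum_powr_level_norm_le[OF bd u(1,3)] by blast
  define G where "G = enn2real (geo_sum (s * u))"
  have "geo_sum (s * u) < top" using s u by (intro geo_sum_finite) simp
  then have G: "geo_sum (s * u) = ennreal G" "0 \<le> G" by (auto simp: G_def)
  define C where "C = C2 + (C1 * C3 * G) powr (1/u)"
  have Cp: "0 < C" using C2 by (simp add: C_def add_pos_nonneg)
  have fmeas: "f \<in> borel_measurable ?L" if "f \<in> vecs (besov d K s p q \<Omega>)" for f
    using that by (simp add: besov_def Lp_fun_def)
  have A: "?Q (osc_seq u \<Omega> f) \<le> ennreal C * b_qnorm s p q \<Omega> \<mu>"
    if "f \<in> borel_measurable ?L" "atomic_repr d K p \<Omega> f \<mu>" for f \<mu>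
  proof -
    have "?Q (osc_seq u \<Omega> f) \<le> ennreal C2 * ?Q (\<lambda>j m. ennreal (norm (\<mu> j m)))"
    proof (rule C2(2))
      fix l m assume "m \<in> ?M l"
      show "enn_powr (osc_seq u \<Omega> f l m) u \<le>
        (\<Sum>j. ennreal (C1 * diag_weight CARD('n) u l j) * (\<Sum>m'\<in>{m'\<in>?M j. near (max 3 d) l m j m'}. enn_powr (ennreal (norm (\<mu> j m'))) u))"
        using C1(2)[OF that(2,1), of l m] u by (simp add: osc_seq_def pw_eq_enn_powr)
    qed
    also have "\<dots> \<le> ennreal C * ?Q (\<lambda>j m. ennreal (norm (\<mu> j m)))"
      by (intro mult_right_mono ennreal_leI) (auto simp: C_def)
    finally show ?thesis by (simp add: b_qnorm_eq_seq_qnorm)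
  qed
  have B: "Lu_qnorm u \<Omega> f \<le> ennreal C * b_qnorm s p q \<Omega> \<mu>"
    if "f \<in> borel_measurable ?L" "atomic_repr d K p \<Omega> f \<mu>" for f \<mu>
  proof -
    let ?x = "\<lambda>j m. ennreal (norm (\<mu> j m))" and ?n = "real CARD('n)"
    define A where "A = ?Q ?x"
    have "(\<integral>\<^sup>+x. pw u (f x) \<partial>?L) \<le> (\<Sum>j. ennreal (C1 * 2 powr (- real j * ?n)) * (\<Sum>m'\<in>?M j. pw u (\<mu> j m')))"
      by (rule C1(3)[OF that(2,1)])
    also have "\<dots> \<le> (\<Sum>j. ennreal (2 powr (- (s * u) * \<bar>real_of_int (int j)\<bar>)) * (ennreal (C1 * C3) * enn_powr A u))"
    proof (intro suminf_le)
      fix j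
      have "(\<Sum>m'\<in>?M j. pw u (\<mu> j m')) \<le> ennreal (C3 * 2 powr (real j * (?n - s * u))) * enn_powr (level_norm s p \<Omega> ?x j) u"
        unfolding pw_eq_enn_powr by (rule C3(2))
      also have "\<dots> \<le> ennreal (C3 * 2 powr (real j * (?n - s * u))) * enn_powr A u"
        unfolding A_def using u by (intro mult_left_mono enn_powr_mono level_norm_le_seq_qnorm q) auto
      finally have "ennreal (C1 * 2 powr (- real j * ?n)) * (\<Sum>m'\<in>?M j. pw u (\<mu> j m')) \<le>
         ennreal (C1 * 2 powr (- real j * ?n)) * (ennreal (C3 * 2 powr (real j * (?n - s * u))) * enn_powr A u)"
        by (rule mult_left_mono) simp
      also have "\<dots> = ennreal ((C1 * 2 powr (- real j * ?n)) * (C3 * 2 powr (real j * (?n - s * u)))) * enn_powr A u"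
        using C1 C3 by (subst ennreal_mult) (simp_all add: mult.assoc)
      also have "(C1 * 2 powr (- real j * ?n)) * (C3 * 2 powr (real j * (?n - s * u))) = 2 powr (- (s * u) * \<bar>real_of_int (int j)\<bar>) * (C1 * C3)"
        by (simp add: algebra_simps flip: powr_add)
      also have "ennreal (2 powr (- (s * u) * \<bar>real_of_int (int j)\<bar>) * (C1 * C3)) * enn_powr A u
          = ennreal (2 powr (- (s * u) * \<bar>real_of_int (int j)\<bar>)) * (ennreal (C1 * C3) * enn_powr A u)"
        by (subst ennreal_mult') (simp_all add: mult.assoc)
      finally show "ennreal (C1 * 2 powr (- real j * ?n)) * (\<Sum>m'\<in>?M j. pw u (\<mu> j m'))
        \<le> ennreal (2 powr (- (s * u) * \<bar>real_of_int (int j)\<bar>)) * (ennreal (C1 * C3) * enn_powr A u)" .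
    qed auto
    also have "\<dots> = (\<Sum>j. ennreal (2 powr (- (s * u) * \<bar>real_of_int (int j)\<bar>))) * (ennreal (C1 * C3) * enn_powr A u)" by (rule ennreal_suminf_multc)
    also have "\<dots> \<le> ennreal G * (ennreal (C1 * C3) * enn_powr A u)"
    proof (rule mult_right_mono)
      have "(\<Sum>j. ennreal (2 powr (- (s * u) * \<bar>real_of_int (int j)\<bar>))) \<le> geo_sum (s * u)"
        by (rule geo_sum_inj_le_nat) (simp add: inj_def)
      then show "(\<Sum>j. ennreal (2 powr (- (s * u) * \<bar>real_of_int (int j)\<bar>))) \<le> ennreal G" unfolding G .
    qed simp
    also have "\<dots> = enn_powr (ennreal ((C1 * C3 * G) powr (1/u)) * A) u"
      using C1 C3 G u by (simp add: enn_powr_mult enn_powr_ennreal powr_powr ennreal_mult ac_simps)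
    finally have "Lu_qnorm u \<Omega> f \<le> ennreal ((C1 * C3 * G) powr (1/u)) * A"
      unfolding Lu_qnorm_def using u by (simp add: enn_powr_le_swap)
    also have "\<dots> \<le> ennreal C * A" using C2 by (intro mult_right_mono ennreal_leI) (auto simp: C_def)
    finally show ?thesis by (simp add: A_def b_qnorm_eq_seq_qnorm)
  qed
  have INFle: "Y \<le> ennreal C * qn (besov d K s p q \<Omega>) f"
    if "\<And>\<mu>. atomic_repr d K p \<Omega> f \<mu> \<Longrightarrow> Y \<le> ennreal C * b_qnorm s p q \<Omega> \<mu>" for Y f
  proof -
    have "Y / ennreal C \<le> qn (besov d K s p q \<Omega>) f"
      unfolding besov_def qn_space.simps
    proof (rule INF_greatest)
      fix \<mu> assume "\<mu> \<in> {\<mu>. atomic_repr d K p \<Omega> f \<mu> \<and> b_qnorm s p q \<Omega> \<mu> < \<infinity>}"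
      then have "Y \<le> ennreal C * b_qnorm s p q \<Omega> \<mu>" using that by blast
      then show "Y / ennreal C \<le> b_qnorm s p q \<Omega> \<mu>"
        using Cp by (intro divide_le_posI_ennreal) (auto simp: mult.commute)
    qed
    then have "ennreal C * (Y / ennreal C) \<le> ennreal C * qn (besov d K s p q \<Omega>) f" by (rule mult_left_mono) simp
    then show ?thesis using Cp by (simp add: ennreal_times_divide ennreal_mult_divide_eq mult.commute)
  qed
  show ?thesis
    by (rule that[OF Cp]) (intro INFle A B fmeas; assumption)+
qed

section \<open>A smooth partition of unity\<close>

text \<open>
  \<open>bndC k M A f\<close> says that \<open>f\<close> is of class \<open>C\<^sup>k\<close> and that its derivatives of order \<open>r \<le> k\<close> are
  bounded by \<open>M A\<^sup>r\<close>. In this form the product rule is multiplicative in \<open>M\<close> and additive in \<open>A\<close>.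
\<close>

fun bndC :: "nat \<Rightarrow> real \<Rightarrow> real \<Rightarrow> (real ^ 'n \<Rightarrow> complex) \<Rightarrow> bool" where
  "bndC 0 M A f \<longleftrightarrow> continuous_on UNIV f \<and> (\<forall>x. norm (f x) \<le> M)"
| "bndC (Suc k) M A f \<longleftrightarrow> f differentiable_on UNIV \<and> (\<forall>x. norm (f x) \<le> M) \<and> (\<forall>i. bndC k (M * A) A (partial_deriv i f))"

lemma bndC_le: "bndC k M A f \<Longrightarrow> norm (f x) \<le> M"
  by (cases k) auto

lemma bndC_nonneg: "bndC k M A f \<Longrightarrow> 0 \<le> M"
  using bndC_le[of k M A f 0] norm_ge_zero order_trans by blast

lemma bndC_imp_C_k: "bndC k M A f \<Longrightarrow> C_k k f"
  by (induction k arbitrary: M f) auto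

lemma bndC_Suc_imp: "bndC (Suc k) M A f \<Longrightarrow> bndC k M A f"
  by (induction k arbitrary: M f) (auto intro: differentiable_imp_continuous_on)

lemma D_multi_snoc: "D_multi (\<alpha> @ [i]) f = D_multi \<alpha> (partial_deriv i f)"
  by (simp add: D_multi_def)

lemma bndC_D_multi_le:
  "bndC k M A f \<Longrightarrow> length \<alpha> \<le> k \<Longrightarrow> norm (D_multi \<alpha> f x) \<le> M * A ^ length \<alpha>"
proof (induction \<alpha> arbitrary: k M f rule: rev_induct)
  case Nil
  then show ?case using bndC_le by (auto simp: D_multi_def)
next
  case (snoc i \<alpha>)
  then obtain k' where k': "k = Suc k'" by (cases k) auto
  then have "norm (D_multi \<alpha> (partial_deriv i f) x) \<le> (M * A) * A ^ length \<alpha>"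
    using snoc by (intro snoc.IH[of k']) auto
  then show ?case by (simp add: D_multi_snoc ac_simps)
qed

lemma partial_deriv_eq:
  assumes "\<And>x. (f has_derivative f' x) (at x)"
  shows "partial_deriv i f = (\<lambda>x. f' x (axis i 1))"
  using has_derivative_partial_deriv[OF assms] by auto

lemma partial_deriv_add:
  assumes "f differentiable_on UNIV" "g differentiable_on UNIV"
  shows "partial_deriv i (\<lambda>x. f x + g x) = (\<lambda>x. partial_deriv i f x + partial_deriv i g x)"
proof
  fix x
  have "(f has_derivative frechet_derivative f (at x)) (at x)" "(g has_derivative frechet_derivative g (at x)) (at x)"
    using assms by (auto simp: differentiable_on_def frechet_derivative_works)
  note d = this has_derivative_add[OF this]
  show "partial_deriv i (\<lambda>x. f x + g x) x = partial_deriv i f x + partial_deriv i g x"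
    by (simp add: d[THEN has_derivative_partial_deriv])
qed

lemma partial_deriv_mult:
  assumes "f differentiable_on UNIV" "g differentiable_on UNIV"
  shows "partial_deriv i (\<lambda>x. f x * g x) = (\<lambda>x. partial_deriv i f x * g x + f x * partial_deriv i g x)"
proof
  fix x
  have "(f has_derivative frechet_derivative f (at x)) (at x)" "(g has_derivative frechet_derivative g (at x)) (at x)"
    using assms by (auto simp: differentiable_on_def frechet_derivative_works)
  note d = this has_derivative_mult[OF this]
  show "partial_deriv i (\<lambda>x. f x * g x) x = partial_deriv i f x * g x + f x * partial_deriv i g x"
    by (simp add: d[THEN has_derivative_partial_deriv])
qed

lemma bndC_add:
  "bndC k M1 A f \<Longrightarrow> bndC k M2 A g \<Longrightarrow> bndC k (M1 + M2) A (\<lambda>x. f x + g x)"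
proof (induction k arbitrary: M1 M2 f g)
  case 0
  then show ?case by (auto intro!: continuous_intros norm_triangle_mono)
next
  case (Suc k)
  have "bndC k (M1 * A + M2 * A) A (\<lambda>x. partial_deriv i f x + partial_deriv i g x)" for i
    using Suc by (intro Suc.IH) auto
  then show ?case using Suc.prems
    by (auto simp: partial_deriv_add distrib_right intro!: differentiable_on_add norm_triangle_mono)
qed

lemma bndC_const: "bndC k (norm c) 0 (\<lambda>_. c)"
proof (induction k arbitrary: c)
  case (Suc k)
  have "partial_deriv i (\<lambda>_. c) = (\<lambda>_. 0)" for i :: 'a
    using partial_deriv_eq[of "\<lambda>_. c" "\<lambda>_ _. 0"] by simp
  then show ?case using Suc[of 0] by simp
qed simp

lemma bndC_mult:
  "bndC k M1 A1 f \<Longrightarrow> bndC k M2 A2 g \<Longrightarrow> 0 \<le> A1 \<Longrightarrow> 0 \<le> A2 \<Longrightarrow> bndC k (M1 * M2) (A1 + A2) (\<lambda>x. f x * g x)"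
proof (induction k arbitrary: M1 M2 f g)
  case 0
  have "0 \<le> M1" "0 \<le> M2" using bndC_nonneg 0 by blast+
  then show ?case using 0 by (auto intro!: continuous_intros mult_mono simp: norm_mult)
next
  case (Suc k)
  have nn: "0 \<le> M1" "0 \<le> M2" using bndC_nonneg Suc.prems by blast+
  have "bndC k ((M1 * A1) * M2 + M1 * (M2 * A2)) (A1 + A2) (\<lambda>x. partial_deriv i f x * g x + f x * partial_deriv i g x)" for i
  proof -
    have f: "bndC k M1 A1 f" "bndC k (M1 * A1) A1 (partial_deriv i f)" using Suc.prems(1) bndC_Suc_imp by auto
    have g: "bndC k M2 A2 g" "bndC k (M2 * A2) A2 (partial_deriv i g)" using Suc.prems(2) bndC_Suc_imp by auto
    show ?thesis
      by (rule bndC_add[OF Suc.IH[OF f(2) g(1) Suc.prems(3,4)] Suc.IH[OF f(1) g(2) Suc.prems(3,4)]])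
  qed
  then show ?case using Suc.prems nn
    by (auto simp: partial_deriv_mult norm_mult algebra_simps intro!: differentiable_on_mult mult_mono)
qed

lemma bndC_zero: "0 \<le> M \<Longrightarrow> 0 \<le> A \<Longrightarrow> bndC k M A (\<lambda>_. 0)"
proof (induction k arbitrary: M)
  case (Suc k)
  have "partial_deriv i (\<lambda>_. 0) = (\<lambda>_. 0)" for i :: 'a
    using partial_deriv_eq[of "\<lambda>_. 0" "\<lambda>_ _. 0"] by simp
  then show ?case using Suc by simp
qed simp

lemma bndC_sum:
  assumes "finite S" "\<And>j. j \<in> S \<Longrightarrow> bndC k (M j) A (f j)" "0 \<le> A"
  shows "bndC k (\<Sum>j\<in>S. M j) A (\<lambda>x. \<Sum>j\<in>S. f j x)"
  using assms(1,2) by (induction S) (auto intro!: bndC_add bndC_zero assms(3))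

lemma bndC_prod:
  assumes "finite S" "\<And>j. j \<in> S \<Longrightarrow> bndC k 1 A (f j)" "0 \<le> A"
  shows "bndC k 1 (real (card S) * A) (\<lambda>x. \<Prod>j\<in>S. f j x)"
  using assms(1,2)
proof (induction S)
  case empty
  then show ?case using bndC_const[of k 1] by simp
next
  case (insert j S)
  have "bndC k (1 * 1) (A + real (card S) * A) (\<lambda>x. f j x * (\<Prod>j\<in>S. f j x))"
    using insert assms(3) by (intro bndC_mult) auto
  then show ?case using insert by (simp add: algebra_simps)
qed

lemma bndC_coordinate:
  assumes "0 \<le> A" "\<And>r t. r < k \<Longrightarrow> (g r has_real_derivative g (Suc r) t) (at t)"
    "\<And>r. r \<le> k \<Longrightarrow> continuous_on UNIV (g r)" "\<And>r t. r \<le> k \<Longrightarrow> \<bar>g r t\<bar> \<le> M * A ^ r"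
  shows "bndC k M A (\<lambda>x :: real ^ 'n. complex_of_real (g 0 (x $ i)))"
  using assms(2-)
proof (induction k arbitrary: g M)
  case 0
  then show ?case
    by (auto intro!: continuous_intros continuous_on_compose2[of UNIV "g 0"])
next
  case (Suc k)
  have der: "((\<lambda>x :: real ^ 'n. complex_of_real (g 0 (x $ i))) has_derivative (\<lambda>h. complex_of_real (h $ i * g 1 (x $ i)))) (at x)" for x
  proof -
    have "((\<lambda>x :: real ^ 'n. g 0 (x $ i)) has_derivative (\<lambda>h. g 1 (x $ i) * (h $ i))) (at x)"
      using Suc.prems(1)[of 0 "x $ i"]
      by (intro has_derivative_compose[where g = "g 0" and f = "\<lambda>x. x $ i"] bounded_linear_imp_has_derivative bounded_linear_vec_nth)
         (auto simp: has_field_derivative_def)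
    from has_derivative_of_real[OF this] show ?thesis by (simp add: mult.commute)
  qed
  have "bndC k (M * A) A (partial_deriv j (\<lambda>x :: real ^ 'n. complex_of_real (g 0 (x $ i))))" for j
  proof (cases "j = i")
    case True
    have "bndC k (M * A) A (\<lambda>x :: real ^ 'n. complex_of_real (g (Suc 0) (x $ i)))"
    proof (rule Suc.IH[of "\<lambda>r. g (Suc r)"])
      show "\<bar>g (Suc r) t\<bar> \<le> M * A * A ^ r" if "r \<le> k" for r t
        using Suc.prems(3)[of "Suc r" t] that by (simp add: ac_simps)
    qed (use Suc.prems in auto)
    then show ?thesis unfolding partial_deriv_eq[OF der] by (simp add: True)
  next
    case False
    have "0 \<le> M" using order_trans[OF abs_ge_zero Suc.prems(3)[of 0 0]] by simp
    then show ?thesis unfolding partial_deriv_eq[OF der] using False assms(1)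
      by (simp add: axis_def bndC_zero)
  qed
  moreover have "(\<lambda>x :: real ^ 'n. complex_of_real (g 0 (x $ i))) differentiable_on UNIV"
    using der by (auto simp: differentiable_on_def differentiable_def)
  ultimately show ?case using Suc.prems(3)[of 0] by simp
qed

text \<open>
  \<open>g 0\<close> is a step of width \<open>2w\<close> and class \<open>C\<^sup>N\<close>, and \<open>g r\<close> is its derivative of order \<open>r\<close>.
\<close>

definition smooth_step :: "nat \<Rightarrow> real \<Rightarrow> (nat \<Rightarrow> real \<Rightarrow> real) \<Rightarrow> real \<Rightarrow> bool" where
  "smooth_step N w g B \<longleftrightarrow> (\<forall>r<N. \<forall>t. (g r has_real_derivative g (Suc r) t) (at t)) \<and> (\<forall>r\<le>N. continuous_on UNIV (g r)) \<and>
     (\<forall>t\<le>-w. g 0 t = 0) \<and> (\<forall>t\<ge>w. g 0 t = 1) \<and> (\<forall>t. 0 \<le> g 0 t \<and> g 0 t \<le> 1) \<and> (\<forall>r\<le>N. \<forall>t. \<bar>g r t\<bar> \<le> B)"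

text \<open>
  The average of a step over intervals of length \<open>w\<close> has one more derivative. Halving the width beforehand
  makes room for the average.
\<close>

lemma smooth_step_exists:
  assumes "0 < w"
  shows "\<exists>g B. smooth_step N w g B"
  using assms
proof (induction N arbitrary: w)
  case 0
  define g where "g t = max 0 (min 1 ((t / w + 1) / 2))" for t :: real
  have "continuous_on UNIV g" using 0 unfolding g_def by (intro continuous_intros) auto
  moreover have "g t = 0" if "t \<le> - w" for t
  proof -
    have "t / w \<le> -1" using that 0 by (simp add: field_simps)
    then show ?thesis by (simp add: g_def)
  qed
  moreover have "g t = 1" if "w \<le> t" for t
  proof -
    have "1 \<le> t / w" using that 0 by (simp add: field_simps)
    then show ?thesis by (simp add: g_def)
  qed
  moreover have "0 \<le> g t" "g t \<le> 1" "\<bar>g t\<bar> \<le> 1" for t by (auto simp: g_def)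
  ultimately show ?case unfolding smooth_step_def by (intro exI[of _ "\<lambda>_. g"] exI[of _ 1]) auto
next
  case (Suc N)
  obtain g B where gB: "smooth_step N (w/2) g B" using Suc.IH[of "w/2"] Suc.prems by auto
  have g: "\<And>r t. r < N \<Longrightarrow> (g r has_real_derivative g (Suc r) t) (at t)" "\<And>r. r \<le> N \<Longrightarrow> continuous_on UNIV (g r)"
     "\<And>t. t \<le> - (w/2) \<Longrightarrow> g 0 t = 0" "\<And>t. w/2 \<le> t \<Longrightarrow> g 0 t = 1" "\<And>t. 0 \<le> g 0 t \<and> g 0 t \<le> 1" "\<And>r t. r \<le> N \<Longrightarrow> \<bar>g r t\<bar> \<le> B"
    using gB unfolding smooth_step_def by blast+
  obtain G where G: "\<And>t. (G has_real_derivative g 0 t) (at t)"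
  proof -
    have "\<exists>F. \<forall>x::real. - \<infinity> < ereal x \<longrightarrow> ereal x < \<infinity> \<longrightarrow> (F has_vector_derivative g 0 x) (at x)"
      using g(2)[of 0] by (intro einterval_antiderivative) (auto simp: continuous_on_eq_continuous_at)
    then show ?thesis using that by (auto simp: has_real_derivative_iff_has_vector_derivative)
  qed
  define g' where "g' r t = (case r of 0 \<Rightarrow> (G (t + w/2) - G (t - w/2)) / w | Suc r \<Rightarrow> (g r (t + w/2) - g r (t - w/2)) / w)" for r t
  have mvt: "\<exists>\<xi>. t - w/2 < \<xi> \<and> \<xi> < t + w/2 \<and> g' 0 t = g 0 \<xi>" for t
    using MVT2[of "t - w/2" "t + w/2" G "g 0"] G Suc.prems by (auto simp: g'_def)
  have shift: "((\<lambda>t. (F (t + w/2) - F (t - w/2)) / w) has_real_derivative (F' (t + w/2) - F' (t - w/2)) / w) (at t)"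
    if "\<And>t. (F has_real_derivative F' t) (at t)" for F F' t
  proof -
    have "((\<lambda>t. F (t + w/2)) has_real_derivative F' (t + w/2)) (at t)"
      using DERIV_shift[of F "F' (t + w/2)" t "w/2"] that by (simp add: add.commute)
    moreover have "((\<lambda>t. F (t - w/2)) has_real_derivative F' (t - w/2)) (at t)"
      using DERIV_shift[of F "F' (t - w/2)" t "-w/2"] that by (simp add: add.commute)
    ultimately show ?thesis by (intro DERIV_cdivide DERIV_diff)
  qed
  have der: "(g' r has_real_derivative g' (Suc r) t) (at t)" if "r < Suc N" for r t
  proof (cases r)
    case 0
    then show ?thesis using shift[of G "g 0" t] G by (simp add: g'_def[abs_def])
  next
    case (Suc r')
    then show ?thesis using shift[of "g r'" "g (Suc r')" t] g(1)[of r'] that by (simp add: g'_def[abs_def])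
  qed
  have cont: "continuous_on UNIV (g' r)" if "r \<le> Suc N" for r
  proof (cases r)
    case 0
    then show ?thesis using der[of 0] by (auto intro!: continuous_at_imp_continuous_on DERIV_isCont)
  next
    case (Suc r')
    then show ?thesis using g(2)[of r'] that Suc.prems unfolding g'_def
      by (auto intro!: continuous_intros continuous_on_compose2[of UNIV "g r'"])
  qed
  have bd: "\<bar>g' r t\<bar> \<le> 1 + 2 * B / w" if "r \<le> Suc N" for r t
  proof (cases r)
    case 0
    obtain \<xi> where "g' 0 t = g 0 \<xi>" using mvt by blast
    moreover have "0 \<le> B" using order_trans[OF abs_ge_zero g(6)[of 0 0]] by simp
    ultimately show ?thesis using 0 g(5)[of \<xi>] Suc.prems by (simp add: add_increasing2)
  next
    case (Suc r')
    have "\<bar>g r' (t + w/2) - g r' (t - w/2)\<bar> \<le> 2 * B"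
      using g(6)[of r' "t + w/2"] g(6)[of r' "t - w/2"] that Suc by auto
    then have "\<bar>g r' (t + w/2) - g r' (t - w/2)\<bar> / w \<le> 2 * B / w" using Suc.prems by (intro divide_right_mono) auto
    then show ?thesis using Suc Suc.prems by (simp add: g'_def)
  qed
  have "g' 0 t = 0" if "t \<le> - w" for t
  proof -
    obtain \<xi> where "g' 0 t = g 0 \<xi>" "\<xi> < t + w/2" using mvt by blast
    then show ?thesis using g(3)[of \<xi>] that by simp
  qed
  moreover have "g' 0 t = 1" if "w \<le> t" for t
  proof -
    obtain \<xi> where "g' 0 t = g 0 \<xi>" "t - w/2 < \<xi>" using mvt by blast
    then show ?thesis using g(4)[of \<xi>] that by simp
  qed
  moreover have "0 \<le> g' 0 t \<and> g' 0 t \<le> 1" for t using mvt[of t] g(5) by auto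
  ultimately show ?case using der cont bd unfolding smooth_step_def by (intro exI[of _ g'] exI[of _ "1 + 2 * B / w"]) auto
qed

definition adapted_partition :: "nat \<Rightarrow> real \<Rightarrow> (nat \<Rightarrow> int ^ 'n \<Rightarrow> real ^ 'n \<Rightarrow> complex) \<Rightarrow> bool" where
  "adapted_partition K A \<phi> \<longleftrightarrow> 1 \<le> A \<and> (\<forall>l m. bndC K 1 (A * 2 ^ l) (\<phi> l m)) \<and>
    (\<forall>l m x. \<phi> l m x \<noteq> 0 \<longrightarrow> x \<in> cube 1 l m) \<and>
    (\<forall>l x F. finite F \<longrightarrow> {m. x \<in> cube 1 l m} \<subseteq> F \<longrightarrow> (\<Sum>m\<in>F. \<phi> l m x) = 1)"

text \<open>
  Differences of a smooth step function give a partition of unity on the line by integer translates of a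
  function supported in \<open>[-1, 1]\<close>; tensor products of its dilates give one adapted to the cubes of each level.
\<close>

lemma adapted_partition_exists: "\<exists>A (\<phi> :: nat \<Rightarrow> int ^ 'n \<Rightarrow> real ^ 'n \<Rightarrow> complex). adapted_partition K A \<phi>"
proof -
  obtain g B where gB: "smooth_step K (1/2) g B" using smooth_step_exists[of "1/2" K] by auto
  have g: "\<And>r t. r < K \<Longrightarrow> (g r has_real_derivative g (Suc r) t) (at t)" "\<And>r. r \<le> K \<Longrightarrow> continuous_on UNIV (g r)"
     "\<And>t. t \<le> - (1/2) \<Longrightarrow> g 0 t = 0" "\<And>t. 1/2 \<le> t \<Longrightarrow> g 0 t = 1" "\<And>t. 0 \<le> g 0 t \<and> g 0 t \<le> 1" "\<And>r t. r \<le> K \<Longrightarrow> \<bar>g r t\<bar> \<le> B"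
    using gB unfolding smooth_step_def by blast+
  define h where "h r t = g r (t + 1/2) - g r (t - 1/2)" for r t
  define C where "C = 2 * B + 1"
  have B0: "0 \<le> B" using order_trans[OF abs_ge_zero g(6)[of 0 0]] by simp
  have h1: "\<bar>h 0 t\<bar> \<le> 1" for t using g(5)[of "t + 1/2"] g(5)[of "t - 1/2"] by (auto simp: h_def abs_le_iff)
  have hC: "\<bar>h r t\<bar> \<le> C" if "r \<le> K" for r t
    using g(6)[OF that, of "t + 1/2"] g(6)[OF that, of "t - 1/2"] by (auto simp: h_def C_def abs_le_iff)
  have h0: "\<bar>t\<bar> < 1" if "h 0 t \<noteq> 0" for t
  proof (rule ccontr)
    assume "\<not> \<bar>t\<bar> < 1"
    then consider "1 \<le> t" | "t \<le> -1" by linarith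
    then show False using that g(3,4) by cases (auto simp: h_def)
  qed
  have h_sum: "(\<Sum>k\<in>{\<lfloor>t\<rfloor>, \<lfloor>t\<rfloor> + 1}. h 0 (t - of_int k)) = 1" for t
  proof -
    have "g 0 (t - of_int \<lfloor>t\<rfloor> + 1/2) = 1" "g 0 (t - of_int \<lfloor>t\<rfloor> - 3/2) = 0"
      by (rule g(4), linarith, rule g(3), linarith)
    then show ?thesis by (simp add: h_def algebra_simps)
  qed
  define \<phi> :: "nat \<Rightarrow> int ^ 'n \<Rightarrow> real ^ 'n \<Rightarrow> complex" where
    "\<phi> l m x = (\<Prod>i\<in>UNIV. complex_of_real (h 0 (2 ^ l * x $ i - of_int (m $ i))))" for l m x
  have C1: "1 \<le> C" using B0 by (simp add: C_def)
  have hnz: "\<bar>x $ i - of_int k / 2 ^ l\<bar> \<le> 1 / 2 ^ l" if "h 0 (2 ^ l * x $ i - of_int k) \<noteq> 0" for x :: "real ^ 'n" and i k l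
  proof -
    have "x $ i - of_int k / 2 ^ l = (2 ^ l * x $ i - of_int k) / 2 ^ l" by (simp add: field_simps)
    also have "\<bar>\<dots>\<bar> \<le> 1 / 2 ^ l" using h0[OF that] by (simp add: divide_right_mono)
    finally show ?thesis .
  qed
  have sup: "x \<in> cube 1 l m" if "\<phi> l m x \<noteq> 0" for l m x
    using that hnz by (auto simp: \<phi>_def cube_def)
  have "adapted_partition K (real CARD('n) * C) \<phi>"
    unfolding adapted_partition_def
  proof (intro conjI allI impI)
    show "1 \<le> real CARD('n) * C" using C1 mult_mono[of 1 "real CARD('n)" 1 C] by simp
    show "bndC K 1 (real CARD('n) * C * 2 ^ l) (\<phi> l m)" for l m
    proof -
      have "bndC K 1 (C * 2 ^ l) (\<lambda>x. complex_of_real (h 0 (2 ^ l * x $ i - of_int (m $ i))))" for i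
      proof -
        define f where "f r t = (2 ^ l) ^ r * h r (2 ^ l * t - of_int (m $ i))" for r t
        have "bndC K 1 (C * 2 ^ l) (\<lambda>x :: real ^ 'n. complex_of_real (f 0 (x $ i)))"
        proof (rule bndC_coordinate)
          show "(f r has_real_derivative f (Suc r) t) (at t)" if "r < K" for r t
          proof -
            have "(h r has_real_derivative h (Suc r) t) (at t)" for t
            proof -
              have "((\<lambda>t. g r (t + 1/2)) has_real_derivative g (Suc r) (t + 1/2)) (at t)"
                using DERIV_shift[of "g r" "g (Suc r) (t + 1/2)" t "1/2"] g(1)[OF that] by (simp add: add.commute)
              moreover have "((\<lambda>t. g r (t - 1/2)) has_real_derivative g (Suc r) (t - 1/2)) (at t)"
                using DERIV_shift[of "g r" "g (Suc r) (t - 1/2)" t "-1/2"] g(1)[OF that] by (simp add: add.commute)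
              ultimately show ?thesis unfolding h_def[abs_def] by (rule DERIV_diff)
            qed
            moreover have "((\<lambda>t. 2 ^ l * t - of_int (m $ i)) has_real_derivative 2 ^ l) (at t)"
              by (auto intro!: derivative_eq_intros)
            ultimately have "((\<lambda>t. h r (2 ^ l * t - of_int (m $ i))) has_real_derivative h (Suc r) (2 ^ l * t - of_int (m $ i)) * 2 ^ l) (at t)"
              by (rule DERIV_chain2)
            from DERIV_cmult[OF this, of "(2 ^ l) ^ r"] show ?thesis unfolding f_def by (simp add: ac_simps)
          qed
          show "continuous_on UNIV (f r)" if "r \<le> K" for r
            unfolding f_def h_def by (intro continuous_intros continuous_on_compose2[OF g(2)[OF that]]) auto
          show "\<bar>f r t\<bar> \<le> 1 * (C * 2 ^ l) ^ r" if "r \<le> K" for r t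
          proof (cases r)
            case 0
            then show ?thesis using h1 by (simp add: f_def)
          next
            case (Suc r')
            have "\<bar>h r (2 ^ l * t - of_int (m $ i))\<bar> \<le> C" by (rule hC[OF that])
            also have "\<dots> \<le> C ^ r" using C1 Suc by (simp add: self_le_power)
            finally have "(2 ^ l) ^ r * \<bar>h r (2 ^ l * t - of_int (m $ i))\<bar> \<le> (2 ^ l) ^ r * C ^ r" by (rule mult_left_mono) simp
            then show ?thesis by (simp add: f_def abs_mult power_mult_distrib mult.commute)
          qed
        qed (use C1 in auto)
        then show ?thesis by (simp add: f_def)
      qed
      then have "bndC K 1 (real (card (UNIV :: 'n set)) * (C * 2 ^ l)) (\<lambda>x. \<Prod>i\<in>UNIV. complex_of_real (h 0 (2 ^ l * x $ i - of_int (m $ i))))"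
        using C1 by (intro bndC_prod) auto
      then show ?thesis by (simp add: \<phi>_def[abs_def] mult.assoc)
    qed
    show "x \<in> cube 1 l m" if "\<phi> l m x \<noteq> 0" for l m x by (rule sup[OF that])
    show "(\<Sum>m\<in>F. \<phi> l m x) = 1" if F: "finite F" "{m. x \<in> cube 1 l m} \<subseteq> F" for l x F
    proof -
      define k where "k i = \<lfloor>2 ^ l * x $ i\<rfloor>" for i
      \<comment> \<open>The product of one-dimensional sums over the two nearest integers expands to a sum over a box of indices.\<close>
      define P where "P = PiE UNIV (\<lambda>i. {k i, k i + 1})"
      define Bx where "Bx = (\<lambda>f. \<chi> i. f i) ` P"
      have finP: "finite P" unfolding P_def by (intro finite_PiE) auto
      have nz: "m \<in> Bx" if "\<phi> l m x \<noteq> 0" for m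
      proof -
        have "m $ i \<in> {k i, k i + 1}" for i
        proof -
          have "h 0 (2 ^ l * x $ i - of_int (m $ i)) \<noteq> 0" using that by (auto simp: \<phi>_def)
          then have "\<bar>2 ^ l * x $ i - of_int (m $ i)\<bar> < 1" by (rule h0)
          then show ?thesis unfolding k_def by (simp add: abs_less_iff) linarith
        qed
        then show ?thesis unfolding Bx_def P_def by (intro image_eqI[of _ _ "\<lambda>i. m $ i"]) auto
      qed
      have "(\<Sum>m\<in>F. \<phi> l m x) = (\<Sum>m\<in>F \<inter> Bx. \<phi> l m x)"
        using F nz by (intro sum.mono_neutral_right) auto
      also have "\<dots> = (\<Sum>m\<in>Bx. \<phi> l m x)"
      proof (rule sum.mono_neutral_left)
        show "\<forall>m\<in>Bx - F \<inter> Bx. \<phi> l m x = 0"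
        proof
          fix m assume "m \<in> Bx - F \<inter> Bx"
          then have "x \<notin> cube 1 l m" using F(2) by auto
          then show "\<phi> l m x = 0" using sup by blast
        qed
      qed (use finP in \<open>auto simp: Bx_def\<close>)
      also have "\<dots> = (\<Sum>f\<in>P. \<Prod>i\<in>UNIV. complex_of_real (h 0 (2 ^ l * x $ i - of_int (f i))))"
        unfolding Bx_def \<phi>_def by (subst sum.reindex) (auto simp: inj_on_def vec_eq_iff)
      also have "\<dots> = (\<Prod>i\<in>UNIV. \<Sum>j\<in>{k i, k i + 1}. complex_of_real (h 0 (2 ^ l * x $ i - of_int j)))"
        unfolding P_def by (rule prod_sum_PiE[symmetric]) auto
      also have "\<dots> = (\<Prod>i\<in>(UNIV :: 'n set). 1)"
      proof (rule prod.cong[OF refl])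
        fix i :: 'n
        show "(\<Sum>j\<in>{k i, k i + 1}. complex_of_real (h 0 (2 ^ l * x $ i - of_int j))) = 1"
          using arg_cong[OF h_sum[of "2 ^ l * x $ i"], of complex_of_real] unfolding k_def by (simp only: of_real_sum of_real_1)
      qed
      finally show ?thesis by simp
    qed
  qed
  then show ?thesis by blast
qed

lemma atom_if_bndC:
  assumes "bndC K M (A * 2 ^ l) f" "1 \<le> A" "\<And>x. f x \<noteq> 0 \<Longrightarrow> x \<in> cube 1 l m" "1 \<le> d" "0 < c" "M * A ^ K \<le> c"
  shows "atom d K l (m :: int ^ 'n) (\<lambda>x. complex_of_real (1 / c) * f x)"
proof -
  have b: "bndC K (norm (complex_of_real (1/c)) * M) (0 + A * 2 ^ l) (\<lambda>x. complex_of_real (1 / c) * f x)"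
    using assms(2) by (intro bndC_mult bndC_const assms(1)) auto
  have M: "0 \<le> M" by (rule bndC_nonneg[OF assms(1)])
  have "1 / 2 ^ l \<le> d / 2 ^ l" using assms(4) by (intro divide_right_mono) auto
  then have sub: "cube 1 l m \<subseteq> cube d l m" by (auto simp: cube_def intro: order_trans)
  have "closure {x. complex_of_real (1 / c) * f x \<noteq> 0} \<subseteq> cube 1 l m"
    using assms(3) by (intro closure_minimal) (auto simp: cube_eq_cbox)
  moreover have "norm (D_multi \<alpha> (\<lambda>x. complex_of_real (1 / c) * f x) x) \<le> 2 ^ (length \<alpha> * l)" if "length \<alpha> \<le> K" for \<alpha> x
  proof -
    have "norm (D_multi \<alpha> (\<lambda>x. complex_of_real (1 / c) * f x) x) \<le> (norm (complex_of_real (1/c)) * M) * (0 + A * 2 ^ l) ^ length \<alpha>"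
      by (rule bndC_D_multi_le[OF b that])
    also have "\<dots> = (M * A ^ length \<alpha> / c) * 2 ^ (length \<alpha> * l)"
      using assms(5) by (simp add: norm_divide power_mult_distrib mult.commute flip: power_mult)
    also have "\<dots> \<le> 1 * 2 ^ (length \<alpha> * l)"
    proof (rule mult_right_mono)
      have "M * A ^ length \<alpha> \<le> M * A ^ K" using assms(2) that M by (intro mult_left_mono power_increasing)
      then show "M * A ^ length \<alpha> / c \<le> 1" using assms(5,6) by simp
    qed simp
    finally show ?thesis by simp
  qed
  ultimately show ?thesis unfolding atom_def using bndC_imp_C_k[OF b] sub by blast
qed

section \<open>Synthesis\<close>

lemma card_cubes_containing_le:
  fixes x :: "real ^ 'n"
  assumes "0 \<le> d" "finite M"
  shows "real (card {m\<in>M. x \<in> cube d j m}) \<le> (4 * d + 1) ^ CARD('n)"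
proof (cases "{m\<in>M. x \<in> cube d j m} = {}")
  case False
  then obtain m0 where m0: "x \<in> cube d j m0" by auto
  have "card {m\<in>M. x \<in> cube d j m} \<le> card {m'. near d j m0 j m'}"
    using near_if_cubes_meet[OF m0, of d j _ d] card_near_le(1)[OF assms(1), of j m0 j] by (intro card_mono) auto
  also have "real \<dots> \<le> (4 * d + 1) ^ CARD('n)" using card_near_le(2)[OF assms(1), of j m0 j] by simp
  finally show ?thesis by simp
next
  case True
  show ?thesis unfolding True using assms(1) by simp
qed

text \<open>
  The \<open>L\<^sub>p\<close> quasi-norm for functions with values in \<open>[0, \<infinity>]\<close>, such as series of absolute values.
\<close>

definition Lp_enn :: "ennreal \<Rightarrow> (real ^ 'n) set \<Rightarrow> (real ^ 'n \<Rightarrow> ennreal) \<Rightarrow> ennreal" where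
  "Lp_enn p \<Omega> T = (if p = \<infinity> then esssup (lebesgue_on \<Omega>) T
      else enn_powr (\<integral>\<^sup>+x. enn_powr (T x) (enn2real p) \<partial>lebesgue_on \<Omega>) (1 / enn2real p))"

lemma Lp_qnorm_eq_Lp_enn: "Lp_qnorm p \<Omega> g = Lp_enn p \<Omega> (\<lambda>x. ennreal (norm (g x)))"
  by (simp add: Lp_qnorm_def Lp_enn_def enn_powr_ennreal)

lemma Lp_enn_mono_AE:
  assumes "f \<in> borel_measurable (lebesgue_on \<Omega>)" "AE x in lebesgue_on \<Omega>. f x \<le> g x"
  shows "Lp_enn p \<Omega> f \<le> Lp_enn p \<Omega> g"
proof (cases "p = \<infinity>")
  case True
  then show ?thesis using assms by (simp add: Lp_enn_def esssup_AE_mono)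
next
  case False
  have "(\<integral>\<^sup>+x. enn_powr (f x) (enn2real p) \<partial>lebesgue_on \<Omega>) \<le> (\<integral>\<^sup>+x. enn_powr (g x) (enn2real p) \<partial>lebesgue_on \<Omega>)"
    by (intro nn_integral_mono_AE eventually_mono[OF assms(2)] enn_powr_mono) auto
  then show ?thesis using False by (simp add: Lp_enn_def enn_powr_mono)
qed

lemma Lp_enn_finite_AE:
  assumes [measurable]: "T \<in> borel_measurable (lebesgue_on \<Omega>)" and "0 < p" "Lp_enn p \<Omega> T < top"
  shows "AE x in lebesgue_on \<Omega>. T x < top"
  using assms(2)
proof (cases rule: exponent_cases)
  case 1
  have "AE x in lebesgue_on \<Omega>. T x \<le> Lp_enn p \<Omega> T"
    using esssup_AE[of T "lebesgue_on \<Omega>"] 1 by (simp add: Lp_enn_def)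
  then show ?thesis using assms(3) by (auto elim!: eventually_mono intro: le_less_trans)
next
  case (2 r)
  have "(\<integral>\<^sup>+x. enn_powr (T x) r \<partial>lebesgue_on \<Omega>) \<noteq> \<infinity>"
    using assms(3) 2 by (auto simp: Lp_enn_def)
  then have "AE x in lebesgue_on \<Omega>. enn_powr (T x) r \<noteq> \<infinity>"
    by (intro nn_integral_PInf_AE) auto
  then show ?thesis by (auto elim!: eventually_mono simp: less_top)
qed

text \<open>
  A point lies in a bounded number of supports of atoms of one level, so that the \<open>L\<^sub>p\<close> quasi-norm of level \<open>j\<close> is
  at most \<open>C 2\<^bsup>-sj\<^esup>\<close> times the quasi-norm of the coefficients. The geometric decay is used up by half to sum the
  levels, which replaces the triangle inequality if \<open>p < 1\<close>.
\<close>

lemma Lp_enn_tail_le: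
  fixes \<Omega> :: "(real ^ 'n) set"
  assumes bd: "bounded \<Omega>" and meas: "\<Omega> \<in> sets lebesgue" and d: "0 \<le> d" and p: "0 < p" and q: "0 < q" and s: "0 < s"
    and a: "\<And>j m. m \<in> meeting_cubes \<Omega> j \<Longrightarrow> atom d K j m (a j m)"
  obtains C where "0 < C" "\<And>J. Lp_enn p \<Omega> (\<lambda>x. \<Sum>i. ennreal (norm (atom_sum \<Omega> \<mu> a (J + i) x)))
     \<le> ennreal (C * 2 powr (- s * real J)) * b_qnorm s p q \<Omega> \<mu>"
proof -
  let ?M = "meeting_cubes \<Omega>"
  let ?L = "lebesgue_on \<Omega>"
  let ?P = "atom_sum \<Omega> \<mu> a"
  have fin: "finite (?M l)" for l using bounded_meeting_cubes[OF bd] by blast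
  define n where "n = CARD('n)"
  define N where "N = (4 * d + 1) ^ n"
  have N: "0 < N" using d by (simp add: N_def)
  have Pm [measurable]: "?P j \<in> borel_measurable ?L" for j by (rule atom_sum_measurable[OF a])
  define x where "x j m = ennreal (norm (\<mu> j m))" for j m
  define A where "A = seq_qnorm s p q \<Omega> x"
  have A: "b_qnorm s p q \<Omega> \<mu> = A" by (simp add: A_def x_def[abs_def] b_qnorm_eq_seq_qnorm)
  have lev: "ell_qnorm p (?M j) (x j) \<le> ennreal (2 powr (- real j * (s - real n * inv_exp p))) * A" for j
  proof -
    have "ell_qnorm p (?M j) (x j) = ennreal (2 powr (- real j * (s - real n * inv_exp p))) * level_norm s p \<Omega> x j"
      by (simp add: level_norm_def n_def mult.assoc[symmetric] flip: ennreal_mult powr_add)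
    also have "\<dots> \<le> ennreal (2 powr (- real j * (s - real n * inv_exp p))) * A"
      unfolding A_def by (intro mult_left_mono level_norm_le_seq_qnorm q) simp
    finally show ?thesis .
  qed
  have pt: "ennreal (norm (?P j y)) \<le> (\<Sum>m\<in>{m\<in>?M j. y \<in> cube d j m}. x j m)" for j y
  proof -
    have "ennreal (norm (?P j y)) = pw 1 (?P j y)" by (simp add: pw_def)
    also have "\<dots> \<le> (\<Sum>m\<in>?M j. pw 1 (\<mu> j m) * indicator (cube d j m) y)"
      by (rule pw_atom_sum_le[OF _ _ fin a]) auto
    also have "\<dots> = (\<Sum>m\<in>{m\<in>?M j. y \<in> cube d j m}. x j m)"
      unfolding sum.inter_filter[OF fin] by (intro sum.cong) (auto simp: pw_def x_def)
    finally show ?thesis .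
  qed
  have le: "ennreal (norm (?P j y)) \<le> ennreal N * B" if "\<And>m. m \<in> ?M j \<Longrightarrow> y \<in> cube d j m \<Longrightarrow> x j m \<le> B" for j y B
  proof -
    have "ennreal (norm (?P j y)) \<le> (\<Sum>m\<in>{m\<in>?M j. y \<in> cube d j m}. B)"
      using that by (intro order_trans[OF pt] sum_mono) auto
    also have "\<dots> = ennreal (real (card {m\<in>?M j. y \<in> cube d j m})) * B" by (simp add: ennreal_of_nat_eq_real_of_nat)
    also have "\<dots> \<le> ennreal N * B"
      unfolding N_def n_def by (intro mult_right_mono ennreal_leI card_cubes_containing_le d fin) simp
    finally show ?thesis .
  qed
  show ?thesis
    using p
  proof (cases rule: exponent_cases)
    case 1
    have lin: "inj int" by (simp add: inj_def)
    define G where "G = enn2real (geo_sum s)"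
    have G: "geo_sum s = ennreal G" "0 \<le> G" using geo_sum_finite[OF s] by (auto simp: G_def)
    show ?thesis
    proof (rule that[of "N * (G + 1)"])
      show "0 < N * (G + 1)" using N G by simp
      fix J
      have "(\<Sum>i. ennreal (norm (?P (J + i) y))) \<le> ennreal (N * (G + 1) * 2 powr (- s * real J)) * A" for y
      proof -
        have "(\<Sum>i. ennreal (norm (?P (J + i) y))) \<le> (\<Sum>i. ennreal (2 powr (- s * \<bar>real_of_int (int i)\<bar>)) * (ennreal (N * 2 powr (- s * real J)) * A))"
        proof (intro suminf_le)
          fix i
          have "ennreal (norm (?P (J + i) y)) \<le> ennreal N * (ennreal (2 powr (- real (J + i) * s)) * A)"
          proof (rule le)
            fix m assume "m \<in> ?M (J + i)"
            then have "x (J + i) m \<le> ell_qnorm p (?M (J + i)) (x (J + i))" using p by (intro ell_qnorm_ge)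
            also have "\<dots> \<le> ennreal (2 powr (- real (J + i) * s)) * A" using lev[of "J + i"] 1 by simp
            finally show "x (J + i) m \<le> ennreal (2 powr (- real (J + i) * s)) * A" .
          qed
          also have "2 powr (- real (J + i) * s) = 2 powr (- s * \<bar>real_of_int (int i)\<bar>) * 2 powr (- s * real J)"
            by (simp add: algebra_simps flip: powr_add)
          also have "ennreal N * (ennreal (2 powr (- s * \<bar>real_of_int (int i)\<bar>) * 2 powr (- s * real J)) * A)
             = ennreal (2 powr (- s * \<bar>real_of_int (int i)\<bar>)) * (ennreal (N * 2 powr (- s * real J)) * A)"
            using N by (simp add: ennreal_mult ac_simps)
          finally show "ennreal (norm (?P (J + i) y)) \<le> ennreal (2 powr (- s * \<bar>real_of_int (int i)\<bar>)) * (ennreal (N * 2 powr (- s * real J)) * A)" .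
        qed auto
        also have "\<dots> = (\<Sum>i. ennreal (2 powr (- s * \<bar>real_of_int (int i)\<bar>))) * (ennreal (N * 2 powr (- s * real J)) * A)"
          by (rule ennreal_suminf_multc)
        also have "\<dots> \<le> ennreal (G + 1) * (ennreal (N * 2 powr (- s * real J)) * A)"
        proof (rule mult_right_mono)
          have "(\<Sum>i. ennreal (2 powr (- s * \<bar>real_of_int (int i)\<bar>))) \<le> geo_sum s" by (rule geo_sum_inj_le_nat[OF lin])
          also have "\<dots> \<le> ennreal (G + 1)" using G by (simp add: ennreal_leI)
          finally show "(\<Sum>i. ennreal (2 powr (- s * \<bar>real_of_int (int i)\<bar>))) \<le> ennreal (G + 1)" .
        qed simp
        also have "\<dots> = ennreal (N * (G + 1) * 2 powr (- s * real J)) * A"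
          using N G by (simp add: ennreal_mult ac_simps)
        finally show ?thesis .
      qed
      then show "Lp_enn p \<Omega> (\<lambda>x. \<Sum>i. ennreal (norm (?P (J + i) x))) \<le> ennreal (N * (G + 1) * 2 powr (- s * real J)) * b_qnorm s p q \<Omega> \<mu>"
        unfolding A Lp_enn_def using 1 by (auto intro!: esssup_I)
    qed
  next
    case (2 r)
    define sr where "sr = s * r / 2"
    obtain G where G: "0 < G"
      "\<And>h x. inj h \<Longrightarrow> (\<Sum>j. x (j::nat)) \<le> ennreal G * (SUP j. ennreal (2 powr ((s/2) * \<bar>real_of_int (h j)\<bar>)) * x j)"
      using suminf_le_SUP[OF half_gt_zero[OF s]] by blast
    have "0 < sr" using s 2 by (simp add: sr_def)
    define H where "H = enn2real (geo_sum sr)"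
    have H: "geo_sum sr = ennreal H" "0 \<le> H" using geo_sum_finite[OF \<open>0 < sr\<close>] by (auto simp: H_def)
    define V where "V = (2 * d) ^ n"
    have V: "0 \<le> V" using d by (simp add: V_def)
    have intP: "(\<integral>\<^sup>+y. enn_powr (ennreal (norm (?P j y))) r \<partial>?L) \<le> ennreal (N powr r * V * 2 powr (- real j * (s * r))) * enn_powr A r" for j
    proof -
      have "enn_powr (ennreal (norm (?P j y))) r \<le> ennreal (N powr r) * (\<Sum>m\<in>?M j. enn_powr (x j m) r * indicator (cube d j m) y)" for y
      proof -
        let ?S = "\<Sum>m\<in>?M j. enn_powr (x j m) r * indicator (cube d j m) y"
        have "ennreal (norm (?P j y)) \<le> ennreal N * enn_powr ?S (1 / r)"
        proof (rule le)
          fix m assume m: "m \<in> ?M j" "y \<in> cube d j m"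
          then have "enn_powr (x j m) r * indicator (cube d j m) y \<le> ?S" by (intro member_le_sum fin) auto
          then have "enn_powr (enn_powr (x j m) r) (1/r) \<le> enn_powr ?S (1/r)" using m 2 by (intro enn_powr_mono) auto
          then show "x j m \<le> enn_powr ?S (1 / r)" using 2 by simp
        qed
        then have "enn_powr (ennreal (norm (?P j y))) r \<le> enn_powr (ennreal N * enn_powr ?S (1 / r)) r" using 2 by (intro enn_powr_mono) auto
        then show ?thesis using 2 N by (simp add: enn_powr_mult enn_powr_ennreal)
      qed
      then have "(\<integral>\<^sup>+y. enn_powr (ennreal (norm (?P j y))) r \<partial>?L) \<le>
         (\<integral>\<^sup>+y. ennreal (N powr r) * (\<Sum>m\<in>?M j. enn_powr (x j m) r * indicator (cube d j m) y) \<partial>?L)"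
        by (intro nn_integral_mono)
      also have "\<dots> = ennreal (N powr r) * (\<Sum>m\<in>?M j. enn_powr (x j m) r * (\<integral>\<^sup>+y. indicator (cube d j m) y \<partial>?L))"
      proof -
        have [measurable]: "(\<lambda>y. indicator (cube d j m) y :: ennreal) \<in> borel_measurable ?L" for m :: "int ^ 'n"
          by (rule borel_measurable_lebesgue_on_borel) simp
        show ?thesis by (simp add: nn_integral_cmult nn_integral_sum)
      qed
      also have "\<dots> \<le> ennreal (N powr r) * (\<Sum>m\<in>?M j. enn_powr (x j m) r * ennreal (V / 2 ^ (j * n)))"
        unfolding V_def n_def by (intro mult_left_mono sum_mono nn_integral_lebesgue_on_cube_le d meas) auto
      also have "\<dots> = ennreal (N powr r) * (ennreal (V / 2 ^ (j * n)) * enn_powr (ell_qnorm p (?M j) (x j)) r)"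
        using 2 fin by (simp add: ell_qnorm_powr nn_integral_count_space_finite sum_distrib_left mult.commute)
      also have "\<dots> \<le> ennreal (N powr r) * (ennreal (V / 2 ^ (j * n)) * enn_powr (ennreal (2 powr (- real j * (s - real n * inv_exp p))) * A) r)"
        using 2 by (intro mult_left_mono enn_powr_mono lev) auto
      also have "\<dots> = ennreal (N powr r * (V / 2 ^ (j * n) * (2 powr (- real j * (s - real n / r))) powr r)) * enn_powr A r"
      proof -
        have e: "ennreal a * (ennreal b * (ennreal c * X)) = ennreal (a * (b * c)) * X" if "0 \<le> a" "0 \<le> b" "0 \<le> c" for a b c X
          using that by (simp add: ennreal_mult mult.assoc)
        show ?thesis using V unfolding enn_powr_mult by (subst enn_powr_ennreal[OF powr_ge_zero], subst e) (use 2 in auto)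
      qed
      also have "V / 2 ^ (j * n) * (2 powr (- real j * (s - real n / r))) powr r = V * 2 powr (- real j * (s * r))"
      proof -
        have "(2::real) ^ (j * n) = 2 powr (real j * real n)" by (simp flip: powr_realpow)
        moreover have "(2 powr (- real j * (s - real n / r))) powr r = 2 powr (real j * real n) * 2 powr (- real j * (s * r))"
        proof -
          have "- real j * (s - real n / r) * r = real j * real n + - real j * (s * r)" using 2 by (simp add: field_simps)
          then show ?thesis by (simp only: powr_powr powr_add)
        qed
        ultimately show ?thesis by simp
      qed
      finally show ?thesis by (simp add: mult.assoc)
    qed
    show ?thesis
    proof (rule that[of "G * (N powr r * V * H + 1) powr (1/r)"])
      show "0 < G * (N powr r * V * H + 1) powr (1 / r)"
      proof -
        have "0 < N powr r * V * H + 1" using H V by (simp add: add_nonneg_pos)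
        then show ?thesis using G by simp
      qed
      fix J
      have "(\<integral>\<^sup>+y. enn_powr (\<Sum>i. ennreal (norm (?P (J + i) y))) r \<partial>?L)
        \<le> (\<integral>\<^sup>+y. ennreal (G powr r) * (\<Sum>i. ennreal (2 powr (sr * real i)) * enn_powr (ennreal (norm (?P (J + i) y))) r) \<partial>?L)"
      proof (rule nn_integral_mono)
        fix y
        have "(\<Sum>i. ennreal (norm (?P (J + i) y))) \<le> ennreal G * (SUP i. ennreal (2 powr ((s/2) * \<bar>real_of_int (int i)\<bar>)) * ennreal (norm (?P (J + i) y)))"
          by (rule G(2)) (simp add: inj_def)
        then have "enn_powr (\<Sum>i. ennreal (norm (?P (J + i) y))) r \<le> enn_powr (ennreal G * (SUP i. ennreal (2 powr ((s/2) * \<bar>real_of_int (int i)\<bar>)) * ennreal (norm (?P (J + i) y)))) r"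
          using 2 by (intro enn_powr_mono) auto
        also have "\<dots> \<le> ennreal (G powr r) * (\<Sum>i. enn_powr (ennreal (2 powr ((s/2) * \<bar>real_of_int (int i)\<bar>)) * ennreal (norm (?P (J + i) y))) r)"
          using G 2 by (simp only: enn_powr_mult[of "ennreal G"] enn_powr_ennreal less_imp_le) (intro mult_left_mono SUP_le_powr_sum, auto)
        also have "\<dots> = ennreal (G powr r) * (\<Sum>i. ennreal (2 powr (sr * real i)) * enn_powr (ennreal (norm (?P (J + i) y))) r)"
          by (simp add: enn_powr_mult enn_powr_ennreal[of "2 powr _"] powr_powr sr_def ac_simps)
        finally show "enn_powr (\<Sum>i. ennreal (norm (?P (J + i) y))) r
           \<le> ennreal (G powr r) * (\<Sum>i. ennreal (2 powr (sr * real i)) * enn_powr (ennreal (norm (?P (J + i) y))) r)" .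
      qed
      also have "\<dots> = ennreal (G powr r) * (\<Sum>i. ennreal (2 powr (sr * real i)) * (\<integral>\<^sup>+y. enn_powr (ennreal (norm (?P (J + i) y))) r \<partial>?L))"
        by (simp add: nn_integral_cmult nn_integral_suminf)
      also have "\<dots> \<le> ennreal (G powr r) * (\<Sum>i. ennreal (2 powr (- sr * \<bar>real_of_int (int i)\<bar>)) * (ennreal (N powr r * V * 2 powr (- real J * (s * r))) * enn_powr A r))"
      proof (intro mult_left_mono suminf_le)
        fix i
        have "ennreal (2 powr (sr * real i)) * (\<integral>\<^sup>+y. enn_powr (ennreal (norm (?P (J + i) y))) r \<partial>?L)
          \<le> ennreal (2 powr (sr * real i)) * (ennreal (N powr r * V * 2 powr (- real (J + i) * (s * r))) * enn_powr A r)"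
          by (intro mult_left_mono intP) simp
        also have "\<dots> = ennreal (2 powr (sr * real i) * (N powr r * V * 2 powr (- real (J + i) * (s * r)))) * enn_powr A r"
          by (subst ennreal_mult') (simp_all add: mult.assoc)
        also have "2 powr (sr * real i) * (N powr r * V * 2 powr (- real (J + i) * (s * r)))
           = 2 powr (- sr * \<bar>real_of_int (int i)\<bar>) * (N powr r * V * 2 powr (- real J * (s * r)))"
        proof -
          have "2 powr (sr * real i) * 2 powr (- real (J + i) * (s * r)) = 2 powr (- sr * real i) * 2 powr (- real J * (s * r))"
          proof -
            have "sr * real i + - real (J + i) * (s * r) = - sr * real i + - real J * (s * r)"
              by (simp add: sr_def field_simps)
            then show ?thesis by (simp only: powr_add[symmetric])
          qed
          then show ?thesis by simp
        qed
        also have "ennreal (2 powr (- sr * \<bar>real_of_int (int i)\<bar>) * (N powr r * V * 2 powr (- real J * (s * r)))) * enn_powr A r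
          = ennreal (2 powr (- sr * \<bar>real_of_int (int i)\<bar>)) * (ennreal (N powr r * V * 2 powr (- real J * (s * r))) * enn_powr A r)"
          by (subst ennreal_mult') (simp_all add: mult.assoc)
        finally show "ennreal (2 powr (sr * real i)) * (\<integral>\<^sup>+y. enn_powr (ennreal (norm (?P (J + i) y))) r \<partial>?L)
           \<le> ennreal (2 powr (- sr * \<bar>real_of_int (int i)\<bar>)) * (ennreal (N powr r * V * 2 powr (- real J * (s * r))) * enn_powr A r)" .
      qed auto
      also have "\<dots> = ennreal (G powr r) * ((\<Sum>i. ennreal (2 powr (- sr * \<bar>real_of_int (int i)\<bar>))) * (ennreal (N powr r * V * 2 powr (- real J * (s * r))) * enn_powr A r))"
        by (simp only: ennreal_suminf_multc)
      also have "\<dots> \<le> ennreal (G powr r) * (ennreal H * (ennreal (N powr r * V * 2 powr (- real J * (s * r))) * enn_powr A r))"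
      proof (intro mult_left_mono mult_right_mono)
        show "(\<Sum>i. ennreal (2 powr (- sr * \<bar>real_of_int (int i)\<bar>))) \<le> ennreal H"
          unfolding H(1)[symmetric] by (rule geo_sum_inj_le_nat) (simp add: inj_def)
      qed auto
      also have "\<dots> = ennreal (G powr r * (N powr r * V * H) * 2 powr (- real J * (s * r))) * enn_powr A r"
        using H V by (simp add: ennreal_mult mult.assoc ac_simps)
      also have "\<dots> \<le> ennreal (G powr r * (N powr r * V * H + 1) * 2 powr (- real J * (s * r))) * enn_powr A r"
        by (intro mult_right_mono ennreal_leI mult_left_mono) auto
      also have "\<dots> = enn_powr (ennreal (G * (N powr r * V * H + 1) powr (1/r) * 2 powr (- s * real J)) * A) r"
      proof -
        have "0 \<le> N powr r * V * H + 1" using H V by simp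
        then have "(G * (N powr r * V * H + 1) powr (1/r) * 2 powr (- s * real J)) powr r = G powr r * (N powr r * V * H + 1) * 2 powr (- real J * (s * r))"
          using G 2 by (simp add: powr_mult powr_powr ac_simps)
        then show ?thesis using G by (simp add: enn_powr_mult enn_powr_ennreal)
      qed
      finally show "Lp_enn p \<Omega> (\<lambda>x. \<Sum>i. ennreal (norm (?P (J + i) x))) \<le> ennreal (G * (N powr r * V * H + 1) powr (1/r) * 2 powr (- s * real J)) * b_qnorm s p q \<Omega> \<mu>"
        unfolding A Lp_enn_def using 2 by (simp add: enn_powr_le_swap)
    qed
  qed
qed

text \<open>
  The tails of the series tend to \<open>0\<close> in \<open>L\<^sub>p\<close>; so every series of atoms with coefficients in the sequence space
  converges absolutely almost everywhere and is an atomic representation of its sum.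
\<close>

lemma atomic_synthesis:
  fixes \<Omega> :: "(real ^ 'n) set"
  assumes bd: "bounded \<Omega>" and meas: "\<Omega> \<in> sets lebesgue" and d: "0 \<le> d" and p: "0 < p" and q: "0 < q" and s: "0 < s"
    and a: "\<And>j m. m \<in> meeting_cubes \<Omega> j \<Longrightarrow> atom d K j m (a j m)" and fin: "b_qnorm s p q \<Omega> \<mu> < \<infinity>"
  shows "AE x in lebesgue_on \<Omega>. summable (\<lambda>j. norm (atom_sum \<Omega> \<mu> a j x))"
    and "\<And>f. f \<in> borel_measurable (lebesgue_on \<Omega>) \<Longrightarrow> AE x in lebesgue_on \<Omega>. f x = (\<Sum>j. atom_sum \<Omega> \<mu> a j x) \<Longrightarrow>
      f \<in> vecs (besov d K s p q \<Omega>) \<and> qn (besov d K s p q \<Omega>) f \<le> b_qnorm s p q \<Omega> \<mu>"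
proof -
  let ?L = "lebesgue_on \<Omega>"
  let ?P = "atom_sum \<Omega> \<mu> a"
  have Pm [measurable]: "?P j \<in> borel_measurable ?L" for j by (rule atom_sum_measurable[OF a])
  obtain C where C: "0 < C" "\<And>J. Lp_enn p \<Omega> (\<lambda>x. \<Sum>i. ennreal (norm (?P (J + i) x)))
     \<le> ennreal (C * 2 powr (- s * real J)) * b_qnorm s p q \<Omega> \<mu>"
    using Lp_enn_tail_le[OF bd meas d p q s a] by blast
  define A where "A = enn2real (b_qnorm s p q \<Omega> \<mu>)"
  have A: "b_qnorm s p q \<Omega> \<mu> = ennreal A" "0 \<le> A" using fin by (auto simp: A_def)
  define T where "T J x = (\<Sum>i. ennreal (norm (?P (J + i) x)))" for J x
  have Tm [measurable]: "T J \<in> borel_measurable ?L" for J unfolding T_def[abs_def] by measurable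
  have TJ: "Lp_enn p \<Omega> (T J) \<le> ennreal (C * A * 2 powr (- s * real J))" for J
    using C(2)[of J] C(1) A by (simp add: T_def[abs_def] ennreal_mult[symmetric] ac_simps)
  have "AE x in ?L. T 0 x < top"
    using TJ[of 0] p by (intro Lp_enn_finite_AE) (auto intro: le_less_trans)
  then show summ: "AE x in ?L. summable (\<lambda>j. norm (?P j x))"
    by (auto elim!: eventually_mono intro!: summable_suminf_not_top simp: T_def)
  fix f assume [measurable]: "f \<in> borel_measurable ?L" and f: "AE x in ?L. f x = (\<Sum>j. ?P j x)"
  have tail: "AE x in ?L. ennreal (norm (f x - (\<Sum>j<J. ?P j x))) \<le> T J x" for J
    using summ f
  proof eventually_elim
    case (elim x)
    have sm: "summable (\<lambda>j. ?P j x)" using elim(1) by (rule summable_norm_cancel)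
    have smJ: "summable (\<lambda>j. norm (?P (J + j) x))"
      using elim(1) summable_ignore_initial_segment[of "\<lambda>j. norm (?P j x)" J] by (simp add: add.commute)
    have "f x - (\<Sum>j<J. ?P j x) = (\<Sum>j. ?P (J + j) x)"
      using suminf_split_initial_segment[OF sm, of J] elim(2) by (simp add: add.commute)
    then have "norm (f x - (\<Sum>j<J. ?P j x)) \<le> (\<Sum>j. norm (?P (J + j) x))"
      using summable_norm[OF smJ] by simp
    then have "ennreal (norm (f x - (\<Sum>j<J. ?P j x))) \<le> ennreal (\<Sum>j. norm (?P (J + j) x))" by (rule ennreal_leI)
    also have "\<dots> = T J x" unfolding T_def using smJ by (intro suminf_ennreal2[symmetric]) auto
    finally show ?case .
  qed
  have Lp: "Lp_qnorm p \<Omega> (\<lambda>x. f x - (\<Sum>j<J. ?P j x)) \<le> ennreal (C * A * 2 powr (- s * real J))" for J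
    unfolding Lp_qnorm_eq_Lp_enn by (rule order_trans[OF Lp_enn_mono_AE[OF _ tail] TJ]) measurable
  have "Lp_qnorm p \<Omega> f < \<infinity>" using le_less_trans[OF Lp[of 0]] by simp
  then have fLp: "f \<in> Lp_fun p \<Omega>" by (simp add: Lp_fun_def)
  have "(\<lambda>J. C * A * 2 powr (- s * real J)) \<longlonglongrightarrow> C * A * 0"
  proof (intro tendsto_mult_left)
    have "(\<lambda>J. (2 powr (- s)) ^ J) \<longlonglongrightarrow> 0" using s by (intro LIMSEQ_realpow_zero) (auto simp: powr_less_one)
    then show "(\<lambda>J. 2 powr (- s * real J)) \<longlonglongrightarrow> 0" by (simp add: powr_powr flip: powr_realpow)
  qed
  then have "(\<lambda>J. ennreal (C * A * 2 powr (- s * real J))) \<longlonglongrightarrow> ennreal 0" by (intro tendsto_ennrealI) simp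
  then have lim0: "(\<lambda>J. ennreal (C * A * 2 powr (- s * real J))) \<longlonglongrightarrow> 0" by simp
  have "(\<lambda>J. Lp_qnorm p \<Omega> (\<lambda>x. f x - (\<Sum>j<J. ?P j x))) \<longlonglongrightarrow> 0"
  proof (rule tendsto_sandwich[OF _ _ tendsto_const lim0])
    show "\<forall>\<^sub>F J in sequentially. Lp_qnorm p \<Omega> (\<lambda>x. f x - (\<Sum>j<J. ?P j x)) \<le> ennreal (C * A * 2 powr (- s * real J))"
      by (intro always_eventually allI Lp)
  qed simp
  then have repr: "atomic_repr d K p \<Omega> f \<mu>" using atomic_repr_iff[OF bd] a by blast
  then show "f \<in> vecs (besov d K s p q \<Omega>) \<and> qn (besov d K s p q \<Omega>) f \<le> b_qnorm s p q \<Omega> \<mu>"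
    using fin fLp by (auto simp: besov_def intro!: INF_lower)
qed

section \<open>Analysis: atomic decompositions from local oscillations\<close>

lemma nn_integral_const_on_ge:
  assumes meas: "\<Omega> \<in> sets lebesgue" and B: "B \<in> sets borel" "B \<subseteq> \<Omega>" "B \<subseteq> Q" and h: "\<And>x. x \<in> B \<Longrightarrow> k \<le> h x"
  shows "k * emeasure lebesgue B \<le> (\<integral>\<^sup>+x. h x * indicator Q x \<partial>lebesgue_on \<Omega>)"
proof -
  have "k * emeasure lebesgue B = (\<integral>\<^sup>+x. k * indicator B x \<partial>lebesgue)" using B(1) by (simp add: nn_integral_cmult_indicator)
  also have "\<dots> = (\<integral>\<^sup>+x. (k * indicator B x) * indicator \<Omega> x \<partial>lebesgue)"
    using B(2) by (intro nn_integral_cong) (auto simp: indicator_def)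
  also have "\<dots> = (\<integral>\<^sup>+x. k * indicator B x \<partial>lebesgue_on \<Omega>)" using meas by (simp add: nn_integral_restrict_space)
  also have "\<dots> \<le> (\<integral>\<^sup>+x. h x * indicator Q x \<partial>lebesgue_on \<Omega>)"
    using B(3) h by (intro nn_integral_mono) (auto simp: indicator_def)
  finally show ?thesis .
qed

lemma corkscrew_ball:
  fixes \<Omega> :: "(real ^ 'n) set"
  assumes "corkscrew c0 \<Omega>" "x \<in> \<Omega>"
  obtains B where "B \<in> sets borel" "B \<subseteq> \<Omega>" "B \<subseteq> ball x (1 / 2 ^ l)"
    "emeasure lebesgue B = ennreal (unit_ball_vol (real CARD('n)) * c0 ^ CARD('n) / 2 ^ (l * CARD('n)))"
proof -
  have c0: "0 < c0" using assms by (simp add: corkscrew_def)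
  have "0 < 1 / (2::real) ^ l" "1 / (2::real) ^ l \<le> 1" by auto
  then obtain y where y: "ball y (c0 * (1 / 2 ^ l)) \<subseteq> \<Omega> \<inter> ball x (1 / 2 ^ l)"
    using assms unfolding corkscrew_def by meson
  show ?thesis
  proof (rule that[of "ball y (c0 * (1 / 2 ^ l))"])
    have "emeasure lborel (ball y (c0 * (1 / 2 ^ l))) = ennreal (unit_ball_vol (real DIM(real^'n)) * (c0 * (1 / 2 ^ l)) ^ DIM(real^'n))"
      using c0 by (intro emeasure_ball) auto
    then show "emeasure lebesgue (ball y (c0 * (1 / 2 ^ l))) = ennreal (unit_ball_vol (real CARD('n)) * c0 ^ CARD('n) / 2 ^ (l * CARD('n)))"
      by (simp add: power_divide power_mult)
  qed (use y in auto)
qed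

lemma ball_subset_cube:
  assumes "x \<in> cube a l (m :: int ^ 'n)" "a + 2 ^ l * r \<le> b"
  shows "ball x r \<subseteq> cube b l m"
proof
  fix y assume "y \<in> ball x r"
  then have d: "norm (y - x) < r" by (simp add: dist_norm norm_minus_commute)
  have "\<bar>y $ i - of_int (m $ i) / 2 ^ l\<bar> \<le> b / 2 ^ l" for i
  proof -
    have "\<bar>(y - x) $ i\<bar> \<le> r" using component_le_norm_cart[of "y - x" i] d by simp
    moreover have "\<bar>x $ i - of_int (m $ i) / 2 ^ l\<bar> \<le> a / 2 ^ l" using assms(1) by (simp add: cube_def)
    ultimately have "\<bar>y $ i - of_int (m $ i) / 2 ^ l\<bar> \<le> a / 2 ^ l + r" by simp
    also have "\<dots> = (a + 2 ^ l * r) / 2 ^ l" by (simp add: field_simps)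
    also have "\<dots> \<le> b / 2 ^ l" using assms(2) by (intro divide_right_mono) auto
    finally show ?thesis .
  qed
  then show "y \<in> cube b l m" by (simp add: cube_def)
qed

text \<open>
  Only the case of oscillation \<open>0\<close> is not immediate. There a minimising sequence of constants is a Cauchy sequence,
  because two constants can be compared on a ball inside \<open>\<Omega>\<close>, and its limit attains the infimum.
\<close>

lemma exists_near_best_constant:
  fixes f :: "real ^ 'n \<Rightarrow> complex"
  assumes meas: "\<Omega> \<in> sets lebesgue" and cork: "corkscrew c0 \<Omega>" and u: "0 < u" "u \<le> 1"
    and m: "m \<in> meeting_cubes \<Omega> l" and f [measurable]: "f \<in> borel_measurable (lebesgue_on \<Omega>)"
  shows "\<exists>c. ennreal (2 ^ (l * CARD('n))) * (\<integral>\<^sup>+x. pw u (f x - c) * indicator (cube 3 l m) x \<partial>lebesgue_on \<Omega>) \<le> 2 * osc u \<Omega> f l m"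
proof -
  let ?L = "lebesgue_on \<Omega>"
  define W where "W = ennreal (2 ^ (l * CARD('n)))"
  have W: "0 < W" "W < top" by (auto simp: W_def)
  define I where "I c = (\<integral>\<^sup>+x. pw u (f x - c) * indicator (cube 3 l m) x \<partial>?L)" for c
  have osc: "osc u \<Omega> f l m = (INF c. W * I c)" by (simp add: osc_def W_def I_def)
  have [measurable]: "(\<lambda>x. indicator (cube 3 l m) x :: ennreal) \<in> borel_measurable ?L"
    by (rule borel_measurable_lebesgue_on_borel) simp
  consider "osc u \<Omega> f l m = top" | "osc u \<Omega> f l m \<noteq> top" "osc u \<Omega> f l m \<noteq> 0" | "osc u \<Omega> f l m = 0" by blast
  then have "\<exists>c. W * I c \<le> 2 * osc u \<Omega> f l m"
  proof cases
    case 1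
    then show ?thesis by (simp add: ennreal_mult_top)
  next
    case 2
    then have "osc u \<Omega> f l m < 2 * osc u \<Omega> f l m"
      by (cases "osc u \<Omega> f l m") (auto simp: ennreal_mult'[symmetric] ennreal_less_iff simp flip: ennreal_numeral)
    then have "(INF c. W * I c) < 2 * osc u \<Omega> f l m" by (simp add: osc)
    then obtain c where "W * I c < 2 * osc u \<Omega> f l m" by (auto simp: INF_less_iff)
    then show ?thesis by (intro exI[of _ c]) simp
  next
    case 3
    obtain x where x: "x \<in> cube 1 l m" "x \<in> \<Omega>" using m by (auto simp: meeting_cubes_def)
    define v where "v = unit_ball_vol (real CARD('n)) * c0 ^ CARD('n) / 2 ^ (l * CARD('n))"
    have v: "0 < v" using cork by (simp add: v_def corkscrew_def)
    obtain B where B: "B \<in> sets borel" "B \<subseteq> \<Omega>" "B \<subseteq> ball x (1 / 2 ^ l)" "emeasure lebesgue B = ennreal v"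
      using corkscrew_ball[OF cork x(2), of l] unfolding v_def by blast
    have BQ: "B \<subseteq> cube 3 l m" using B(3) ball_subset_cube[OF x(1), of "1 / 2 ^ l" 3] by auto
    have cmp: "pw u (c - c') * ennreal v \<le> I c + I c'" for c c'
    proof -
      have "pw u (c - c') * emeasure lebesgue B \<le> (\<integral>\<^sup>+x. (pw u (f x - c) + pw u (f x - c')) * indicator (cube 3 l m) x \<partial>?L)"
      proof (rule nn_integral_const_on_ge[OF meas B(1,2) BQ])
        fix x
        show "pw u (c - c') \<le> pw u (f x - c) + pw u (f x - c')"
          using pw_add_le[OF u, of "c - f x" "f x - c'"] by (simp add: pw_minus_commute[of u c "f x"])
      qed
      also have "\<dots> = I c + I c'" by (simp add: I_def distrib_right nn_integral_add)
      finally show ?thesis using B(4) by simp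
    qed
    have "\<exists>c. I c < ennreal (v * (1/2) ^ k)" for k
    proof -
      have "(INF c. W * I c) < W * ennreal (v * (1/2) ^ k)"
        using 3 osc W v by (simp add: ennreal_zero_less_mult_iff)
      then obtain c where "W * I c < W * ennreal (v * (1/2) ^ k)" by (auto simp: INF_less_iff)
      then have "I c < ennreal (v * (1/2) ^ k)" by (metis mult_left_mono not_le zero_le)
      then show ?thesis ..
    qed
    then obtain ck where ck: "\<And>k. I (ck k) < ennreal (v * (1/2) ^ k)" by metis
    have dist: "norm (ck k - ck j) powr u \<le> (1/2) ^ k + (1/2) ^ j" for k j
    proof -
      have "ennreal (norm (ck k - ck j) powr u * v) \<le> ennreal (v * (1/2) ^ k) + ennreal (v * (1/2) ^ j)"
        using order_trans[OF cmp[of "ck k" "ck j"] add_mono[OF less_imp_le[OF ck] less_imp_le[OF ck]]] v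
        by (simp add: pw_def ennreal_mult)
      also have "\<dots> = ennreal (((1/2) ^ k + (1/2) ^ j) * v)" using v by (simp add: algebra_simps flip: ennreal_plus)
      finally have "norm (ck k - ck j) powr u * v \<le> ((1/2) ^ k + (1/2) ^ j) * v" using v by (subst (asm) ennreal_le_iff) auto
      then show ?thesis using v by simp
    qed
    have "Cauchy ck"
    proof (rule CauchyI)
      fix e :: real assume e: "0 < e"
      then have "0 < e powr u / 2" by simp
      then obtain N where N: "(1/2::real) ^ N < e powr u / 2" using real_arch_pow_inv[of "e powr u / 2" "1/2"] by auto
      show "\<exists>M. \<forall>k\<ge>M. \<forall>j\<ge>M. norm (ck k - ck j) < e"
      proof (intro exI[of _ N] allI impI)
        fix k j assume kj: "N \<le> k" "N \<le> j"
        have "norm (ck k - ck j) powr u \<le> (1/2) ^ k + (1/2) ^ j" by (rule dist)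
        also have "\<dots> \<le> (1/2) ^ N + (1/2) ^ N" using kj by (intro add_mono power_decreasing) auto
        also have "\<dots> < e powr u" using N by simp
        finally show "norm (ck k - ck j) < e"
          using u e powr_mono2[of u e "norm (ck k - ck j)"] by (meson less_imp_le not_less)
      qed
    qed
    then obtain c where c: "ck \<longlonglongrightarrow> c" using Cauchy_convergent convergent_def by blast
    define V where "V = (\<integral>\<^sup>+x. indicator (cube 3 l m) x \<partial>?L)"
    have V: "V < top" unfolding V_def using nn_integral_lebesgue_on_cube_le[of 3 \<Omega> l m] meas by (auto intro: le_less_trans)
    have le: "I c \<le> ennreal (v * (1/2) ^ k) + ennreal (norm (ck k - c) powr u) * V" for k
    proof -
      have "I c \<le> (\<integral>\<^sup>+x. pw u (f x - ck k) * indicator (cube 3 l m) x + pw u (ck k - c) * indicator (cube 3 l m) x \<partial>?L)"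
        unfolding I_def
      proof (rule nn_integral_mono)
        fix x
        have "pw u (f x - c) \<le> pw u (f x - ck k) + pw u (ck k - c)" using pw_add_le[OF u, of "f x - ck k" "ck k - c"] by simp
        then show "pw u (f x - c) * indicator (cube 3 l m) x \<le> pw u (f x - ck k) * indicator (cube 3 l m) x + pw u (ck k - c) * indicator (cube 3 l m) x"
          unfolding distrib_right[symmetric] by (rule mult_right_mono) simp
      qed
      also have "\<dots> = I (ck k) + pw u (ck k - c) * V" by (simp add: I_def V_def nn_integral_add nn_integral_cmult)
      also have "\<dots> \<le> ennreal (v * (1/2) ^ k) + pw u (ck k - c) * V" using ck[of k] by (intro add_right_mono) simp
      finally show ?thesis by (simp add: pw_def)
    qed
    have "(\<lambda>k. ennreal (v * (1/2) ^ k) + V * ennreal (norm (ck k - c) powr u)) \<longlonglongrightarrow> ennreal (v * 0) + V * ennreal 0"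
    proof (intro tendsto_add ennreal_tendsto_cmult tendsto_ennrealI V tendsto_mult_left)
      have "(\<lambda>k. norm (ck k - c) powr u) \<longlonglongrightarrow> 0 powr u"
        using u by (intro tendsto_powr' tendsto_norm_zero LIM_zero c tendsto_const) auto
      then show "(\<lambda>k. norm (ck k - c) powr u) \<longlonglongrightarrow> 0" by simp
    qed (auto intro: LIMSEQ_realpow_zero)
    then have "(\<lambda>k. ennreal (v * (1/2) ^ k) + V * ennreal (norm (ck k - c) powr u)) \<longlonglongrightarrow> 0" by simp
    then have "I c \<le> 0" using le by (intro tendsto_lowerbound[of _ 0 sequentially]) (auto simp: mult.commute)
    then show ?thesis by (intro exI[of _ c]) simp
  qed
  then show ?thesis by (simp add: W_def I_def)
qed

lemma ell_qnorm_singleton: "0 < p \<Longrightarrow> ell_qnorm p {i} x = x i"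
  by (erule exponent_cases) (auto simp: ell_qnorm_infty ell_qnorm_real nn_integral_count_space_finite)

text \<open>
  Level \<open>0\<close> consists of finitely many cubes. The number \<open>v\<close> will be the \<open>L\<^sub>u\<close> quasi-norm of a function, which
  controls the coefficients of level \<open>0\<close> in its atomic decomposition.
\<close>

lemma seq_qnorm_add_base_le:
  fixes \<Omega> :: "(real ^ 'n) set"
  assumes bd: "bounded \<Omega>" and p: "0 < p" and q: "0 < q"
  obtains C where "0 < C" "\<And>x v. seq_qnorm s p q \<Omega> (\<lambda>l m. x l m + (if l = 0 then v else 0)) \<le> ennreal C * (seq_qnorm s p q \<Omega> x + v)"
proof -
  let ?Q = "seq_qnorm s p q \<Omega>"
  let ?lev = "level_norm s p \<Omega>"
  let ?M = "meeting_cubes \<Omega>"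
  obtain C0 where C0: "0 < C0" "\<And>l. finite (?M l)"
    "\<And>l. real (card (?M l)) \<le> C0 * 2 powr (real l * real CARD('n))"
    using bounded_meeting_cubes[OF bd] by blast
  define N where "N = real (card (?M 0)) + 1"
  obtain u where u: "0 < u" "ennreal u \<le> p" using p by (cases p) (auto intro: that[of 1] that)
  define C1 where "C1 = 1 powr (1 / u - inv_exp p) * N powr inv_exp p"
  have "0 < N" by (simp add: N_def)
  then have C1: "0 < C1" by (simp add: C1_def)
  have base: "ell_qnorm p (?M 0) (\<lambda>_. v) \<le> ennreal C1 * v" for v
  proof -
    have "ell_qnorm p (?M 0) (\<lambda>_. v) \<le> ennreal C1 * ell_qnorm p {()} (\<lambda>_. v)"
      unfolding C1_def
      by (rule ell_qnorm_Schur[OF C0(2) _ u, where R = "\<lambda>_ _. True"]) (auto simp: N_def)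
    then show ?thesis using p by (simp add: ell_qnorm_singleton)
  qed
  obtain C2 where C2: "0 < C2" "\<And>(I::(int^'n) set) x y. ell_qnorm p I (\<lambda>i. x i + y i) \<le> ennreal C2 * (ell_qnorm p I x + ell_qnorm p I y)"
    using ell_qnorm_add_le[OF p] by blast
  obtain C3 where C3: "0 < C3" "\<And>(I::nat set) x y. ell_qnorm q I (\<lambda>i. x i + y i) \<le> ennreal C3 * (ell_qnorm q I x + ell_qnorm q I y)"
    using ell_qnorm_add_le[OF q] by blast
  obtain C4 where C4: "0 < C4" "\<And>(I::nat set) h. inj_on h I \<Longrightarrow> ell_qnorm q I (\<lambda>i. ennreal (2 powr (- 1 * \<bar>real_of_int (h i)\<bar>))) \<le> ennreal C4"
    using ell_qnorm_geometric[OF q, of 1] by (metis zero_less_one)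
  have geo: "ell_qnorm q UNIV (\<lambda>l::nat. if l = 0 then v else 0) \<le> ennreal C4 * v" for v
  proof -
    have "ell_qnorm q UNIV (\<lambda>l::nat. if l = 0 then v else 0) \<le> ell_qnorm q UNIV (\<lambda>l. v * ennreal (2 powr (- 1 * \<bar>real_of_int (int l)\<bar>)))"
      using q by (intro ell_qnorm_mono) auto
    also have "\<dots> \<le> v * ennreal C4"
      unfolding ell_qnorm_cmult[OF q] by (intro mult_left_mono C4(2)) (auto simp: inj_on_def)
    finally show ?thesis by (simp add: mult.commute)
  qed
  define C where "C = C2 * C3 * (1 + C4 * C1)"
  show ?thesis
  proof (rule that[of C])
    show "0 < C" using C1 C2 C3 C4 by (simp add: C_def add_pos_pos)
    fix x v
    have "?lev (\<lambda>l m. x l m + (if l = 0 then v else 0)) l \<le> ennreal C2 * (?lev x l + (if l = 0 then ennreal C1 * v else 0))" for l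
    proof -
      let ?w = "ennreal (2 powr (real l * (s - real CARD('n) * inv_exp p)))"
      have "?lev (\<lambda>l m. x l m + (if l = 0 then v else 0)) l
         \<le> ?w * (ennreal C2 * (ell_qnorm p (?M l) (x l) + ell_qnorm p (?M l) (\<lambda>m. if l = 0 then v else 0)))"
        unfolding level_norm_def by (intro mult_left_mono C2(2)) simp
      also have "\<dots> = ennreal C2 * (?lev x l + ?w * ell_qnorm p (?M l) (\<lambda>m. if l = 0 then v else 0))"
        by (simp add: level_norm_def distrib_left mult.left_commute)
      also have "\<dots> \<le> ennreal C2 * (?lev x l + (if l = 0 then ennreal C1 * v else 0))"
        using base[of v] p by (intro mult_left_mono add_left_mono) auto
      finally show ?thesis .
    qed
    then have "?Q (\<lambda>l m. x l m + (if l = 0 then v else 0)) \<le>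
       ell_qnorm q UNIV (\<lambda>l. ennreal C2 * (?lev x l + (if l = 0 then ennreal C1 * v else 0)))"
      unfolding seq_qnorm_def by (intro ell_qnorm_mono q)
    also have "\<dots> \<le> ennreal C2 * (ennreal C3 * (?Q x + ell_qnorm q UNIV (\<lambda>l::nat. if l = 0 then ennreal C1 * v else 0)))"
      unfolding ell_qnorm_cmult[OF q] seq_qnorm_def by (intro mult_left_mono C3(2)) simp
    also have "\<dots> \<le> ennreal C2 * (ennreal C3 * (?Q x + ennreal C4 * (ennreal C1 * v)))"
      by (intro mult_left_mono add_left_mono geo) auto
    also have "\<dots> \<le> ennreal C2 * (ennreal C3 * (ennreal (1 + C4 * C1) * (?Q x + v)))"
    proof (intro mult_left_mono)
      have "ennreal 1 * ?Q x + ennreal (C4 * C1) * v \<le> ennreal (1 + C4 * C1) * ?Q x + ennreal (1 + C4 * C1) * v"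
        using C1 C4 by (intro add_mono mult_right_mono ennreal_leI) auto
      then show "?Q x + ennreal C4 * (ennreal C1 * v) \<le> ennreal (1 + C4 * C1) * (?Q x + v)"
        using C1 C4 by (simp add: distrib_left ennreal_mult mult.assoc del: ennreal_plus)
    qed auto
    also have "\<dots> = ennreal C * (?Q x + v)"
      using C1 C2 C3 C4 by (simp add: C_def ennreal_mult mult.assoc del: ennreal_plus)
    finally show "?Q (\<lambda>l m. x l m + (if l = 0 then v else 0)) \<le> ennreal C * (?Q x + v)" .
  qed
qed

lemma cube_mono: "a \<le> b \<Longrightarrow> cube a l m \<subseteq> cube b l m"
proof -
  assume "a \<le> b"
  then have "a / 2 ^ l \<le> b / 2 ^ l" by (intro divide_right_mono) auto
  then show ?thesis by (auto simp: cube_def intro: order_trans)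
qed

text \<open>
  With near-best constants \<open>c\<^sub>l\<^sub>,\<^sub>m\<close> on the cubes and the partition of unity \<open>\<phi>\<close>, the function is the
  limit of \<open>\<Sum>\<^sub>m c\<^sub>l\<^sub>,\<^sub>m \<phi>\<^sub>l\<^sub>,\<^sub>m\<close>. The difference of two consecutive levels is a sum of products
  \<open>(c\<^sub>l\<^sub>+\<^sub>1\<^sub>,\<^sub>m - c\<^sub>l\<^sub>,\<^sub>m\<^sub>') \<phi>\<^sub>l\<^sub>+\<^sub>1\<^sub>,\<^sub>m \<phi>\<^sub>l\<^sub>,\<^sub>m\<^sub>'\<close>, and differences of constants of neighbouring cubes are controlled
  by the oscillations, because both enlarged cubes contain the same ball inside the domain.
\<close>

lemma atomic_analysis:
  fixes \<Omega> :: "(real ^ 'n) set"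
  assumes bd: "bounded \<Omega>" and meas: "\<Omega> \<in> sets lebesgue" and cork: "corkscrew c0 \<Omega>"
    and u: "0 < u" "u \<le> 1" "ennreal u \<le> p" and q: "0 < q" and s: "0 < s" "s < 1" and d: "1 \<le> d"
  obtains C where "0 < C" "\<And>f. f \<in> borel_measurable (lebesgue_on \<Omega>) \<Longrightarrow> seq_qnorm s p q \<Omega> (osc_seq u \<Omega> f) < top \<Longrightarrow>
     Lu_qnorm u \<Omega> f < top \<Longrightarrow> \<exists>\<mu> a. (\<forall>j. \<forall>m\<in>meeting_cubes \<Omega> j. atom d K j m (a j m)) \<and>
       (AE x in lebesgue_on \<Omega>. f x = (\<Sum>j. atom_sum \<Omega> \<mu> a j x)) \<and>
       b_qnorm s p q \<Omega> \<mu> \<le> ennreal C * (seq_qnorm s p q \<Omega> (osc_seq u \<Omega> f) + Lu_qnorm u \<Omega> f)"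
proof -
  let ?Q = "seq_qnorm s p q \<Omega>"
  let ?M = "meeting_cubes \<Omega>"
  let ?L = "lebesgue_on \<Omega>"
  have p: "0 < p" using u by (meson ennreal_less_zero_iff less_le_trans)
  define n where "n = CARD('n)"
  have fin: "finite (?M l)" for l using bounded_meeting_cubes[OF bd] by blast
  obtain A and \<phi> :: "nat \<Rightarrow> int ^ 'n \<Rightarrow> real ^ 'n \<Rightarrow> complex" where part: "adapted_partition K A \<phi>"
    using adapted_partition_exists by blast
  have A: "1 \<le> A" and \<phi>: "\<And>l m. bndC K 1 (A * 2 ^ l) (\<phi> l m)"
    "\<And>l m x. \<phi> l m x \<noteq> 0 \<Longrightarrow> x \<in> cube 1 l m"
    "\<And>l x F. finite F \<Longrightarrow> {m. x \<in> cube 1 l m} \<subseteq> F \<Longrightarrow> (\<Sum>m\<in>F. \<phi> l m x) = 1"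
    using part unfolding adapted_partition_def by auto
  have \<phi>1: "norm (\<phi> l m x) \<le> 1" for l m x by (rule bndC_le[OF \<phi>(1)])
  define L where "L = (3 / 2 * A) ^ K"
  have L: "0 < L" using A by (simp add: L_def)
  define v0 where "v0 = unit_ball_vol (real n) * c0 ^ n"
  have v0: "0 < v0" using cork by (simp add: v0_def corkscrew_def)
  define Nn where "Nn = (4 * 3 + 1 :: real) ^ n * 2 ^ n"
  have Nn: "1 \<le> Nn" using mult_mono[of 1 "(4 * 3 + 1 :: real) ^ n" 1 "2 ^ n"] by (simp add: Nn_def)
  define Cd where "Cd = 2 / v0 * 2 ^ n"
  have Cd: "0 < Cd" using v0 by (simp add: Cd_def)
  define Cc where "Cc = L powr u * (Cd * Nn * 2 powr u + 3 / v0)"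
  have Cc: "0 < Cc" using L Cd Nn v0 by (auto simp: Cc_def intro!: mult_pos_pos add_pos_pos)
  obtain C1 where C1: "0 < C1"
    "\<And>x y. (\<And>l m. m \<in> ?M l \<Longrightarrow> enn_powr (y l m) u \<le>
        (\<Sum>j. ennreal (Cc * diag_weight CARD('n) u l j) * (\<Sum>m'\<in>{m'\<in>?M j. near 3 l m j m'}. enn_powr (x j m') u)))
     \<Longrightarrow> ?Q y \<le> ennreal C1 * ?Q x"
    by (rule seq_qnorm_almost_diagonal[OF bd u(1,3) q s, of 3 Cc]) (use Cc in auto)
  obtain C2 where C2: "0 < C2" "\<And>x v. ?Q (\<lambda>l m. x l m + (if l = 0 then v else 0)) \<le> ennreal C2 * (?Q x + v)"
    using seq_qnorm_add_base_le[OF bd p q] by blast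
  obtain C3 where C3: "0 < C3"
    "\<And>x j s. (\<Sum>m\<in>?M j. enn_powr (x j m) u)
       \<le> ennreal (C3 * 2 powr (real j * (real CARD('n) - s * u))) * enn_powr (level_norm s p \<Omega> x j) u"
    using sum_powr_level_norm_le[OF bd u(1,3)] by blast
  have indm [measurable]: "(\<lambda>x. indicator (cube d' j m) x :: ennreal) \<in> borel_measurable ?L" for d' j and m :: "int ^ 'n"
    by (rule borel_measurable_lebesgue_on_borel) simp
  show ?thesis
  proof (rule that[of "C1 * C2"])
    show "0 < C1 * C2" using C1 C2 by simp
    fix f :: "real ^ 'n \<Rightarrow> complex"
    assume f [measurable]: "f \<in> borel_measurable ?L"
      and finO: "?Q (osc_seq u \<Omega> f) < top" and finL: "Lu_qnorm u \<Omega> f < top"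
    define I where "I l m c = (\<integral>\<^sup>+x. pw u (f x - c) * indicator (cube 3 l m) x \<partial>?L)" for l m c
    have "\<forall>l m. \<exists>c. m \<in> ?M l \<longrightarrow> ennreal (2 ^ (l * n)) * I l m c \<le> 2 * osc u \<Omega> f l m"
      using exists_near_best_constant[OF meas cork u(1,2) _ f] unfolding I_def n_def by blast
    then obtain c where c0: "\<And>l m. m \<in> ?M l \<Longrightarrow> ennreal (2 ^ (l * n)) * I l m (c l m) \<le> 2 * osc u \<Omega> f l m"
      by metis
    have c: "I l m (c l m) \<le> ennreal (2 / 2 ^ (l * n)) * osc u \<Omega> f l m" if "m \<in> ?M l" for l m
    proof -
      have "I l m (c l m) = ennreal (1 / 2 ^ (l * n)) * (ennreal (2 ^ (l * n)) * I l m (c l m))"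
        by (simp add: mult.assoc[symmetric] flip: ennreal_mult)
      also have "\<dots> \<le> ennreal (1 / 2 ^ (l * n)) * (ennreal 2 * osc u \<Omega> f l m)" using c0[OF that] by (intro mult_left_mono) auto
      also have "\<dots> = ennreal (2 / 2 ^ (l * n)) * osc u \<Omega> f l m" by (simp add: mult.assoc[symmetric] del: ennreal_numeral flip: ennreal_mult)
      finally show ?thesis .
    qed
    \<comment> \<open>The partition functions of level \<open>l\<close> that interact with the cube \<open>m\<close> of level \<open>l + 1\<close>.\<close>
    define nb where "nb l m = {m'\<in>?M l. cube 1 l m' \<inter> cube 1 (Suc l) m \<noteq> {}}" for l m
    have nbfin: "finite (nb l m)" for l m using fin by (simp add: nb_def)
    \<comment> \<open>The terms of the telescoping sum, sorted by the finer cube; \<open>\<Lambda>\<close> bounds their size.\<close>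
    define b where "b l m x = (case l of 0 \<Rightarrow> c 0 m * \<phi> 0 m x
       | Suc l' \<Rightarrow> \<phi> (Suc l') m x * (\<Sum>m'\<in>nb l' m. (c (Suc l') m - c l' m') * \<phi> l' m' x))" for l m x
    define \<Lambda> where "\<Lambda> l m = (case l of 0 \<Rightarrow> norm (c 0 m) | Suc l' \<Rightarrow> (\<Sum>m'\<in>nb l' m. norm (c (Suc l') m - c l' m')))" for l m
    have \<Lambda>0: "0 \<le> \<Lambda> l m" for l m by (cases l) (auto simp: \<Lambda>_def sum_nonneg)
    define \<mu> where "\<mu> l m = complex_of_real (\<Lambda> l m * L)" for l m
    \<comment> \<open>The normalising factor; any positive value serves where the term vanishes.\<close>
    define k where "k l m = (if \<Lambda> l m = 0 then 1 else \<Lambda> l m * L)" for l m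
    define a where "a l m x = complex_of_real (1 / k l m) * b l m x" for l m x
    have bb: "\<exists>A'. bndC K (\<Lambda> l m) (A' * 2 ^ l) (b l m) \<and> 1 \<le> A' \<and> A' \<le> 3 / 2 * A" for l m
    proof (cases l)
      case 0
      have "bndC K (norm (c 0 m) * 1) (0 + A * 2 ^ 0) (\<lambda>x. c 0 m * \<phi> 0 m x)"
        using A by (intro bndC_mult bndC_const \<phi>(1)) auto
      then show ?thesis using 0 A by (intro exI[of _ A]) (auto simp: b_def[abs_def] \<Lambda>_def)
    next
      case (Suc l')
      have "bndC K (norm (c (Suc l') m - c l' m') * 1) (0 + A * 2 ^ l') (\<lambda>x. (c (Suc l') m - c l' m') * \<phi> l' m' x)" for m'
        using A by (intro bndC_mult bndC_const \<phi>(1)) auto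
      then have "bndC K (\<Sum>m'\<in>nb l' m. norm (c (Suc l') m - c l' m')) (A * 2 ^ l') (\<lambda>x. \<Sum>m'\<in>nb l' m. (c (Suc l') m - c l' m') * \<phi> l' m' x)"
        using A by (intro bndC_sum nbfin) auto
      from bndC_mult[OF \<phi>(1)[of "Suc l'" m] this] have "bndC K (1 * (\<Sum>m'\<in>nb l' m. norm (c (Suc l') m - c l' m'))) (A * 2 ^ Suc l' + A * 2 ^ l')
         (\<lambda>x. \<phi> (Suc l') m x * (\<Sum>m'\<in>nb l' m. (c (Suc l') m - c l' m') * \<phi> l' m' x))"
        using A by simp
      moreover have "A * 2 ^ Suc l' + A * 2 ^ l' = (3 / 2 * A) * 2 ^ Suc l'" by simp
      ultimately show ?thesis using Suc A by (intro exI[of _ "3 / 2 * A"]) (auto simp: b_def[abs_def] \<Lambda>_def)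
    qed
    have atoms: "atom d K l m (a l m)" for l m
    proof -
      obtain A' where A': "bndC K (\<Lambda> l m) (A' * 2 ^ l) (b l m)" "1 \<le> A'" "A' \<le> 3 / 2 * A" using bb by blast
      have "\<Lambda> l m * A' ^ K \<le> \<Lambda> l m * L"
        unfolding L_def using A' by (intro mult_left_mono power_mono \<Lambda>0) auto
      then have kk: "\<Lambda> l m * A' ^ K \<le> k l m" "0 < k l m" using L \<Lambda>0[of l m] by (auto simp: k_def)
      show ?thesis
        unfolding a_def
        by (rule atom_if_bndC[OF A'(1,2) _ d kk(2,1)]) (use \<phi>(2) in \<open>auto simp: b_def split: nat.splits\<close>)
    qed
    have \<mu>a: "\<mu> l m * a l m x = b l m x" for l m x
    proof (cases "\<Lambda> l m = 0")
      case True
      then have "norm (b l m x) \<le> 0" using bb[of l m] bndC_le by metis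
      then show ?thesis using True by (simp add: a_def \<mu>_def)
    next
      case False
      then show ?thesis using L by (simp add: a_def \<mu>_def k_def)
    qed
    define S where "S l x = (\<Sum>m\<in>?M l. c l m * \<phi> l m x)" for l x
    have sum1: "(\<Sum>m\<in>?M l. \<phi> l m x) = 1" if "x \<in> \<Omega>" for l x
      using that by (intro \<phi>(3) fin) (auto simp: meeting_cubes_def)
    have step: "atom_sum \<Omega> \<mu> a (Suc l) x = S (Suc l) x - S l x" if x: "x \<in> \<Omega>" for l x
    proof -
      have "b (Suc l) m x = c (Suc l) m * \<phi> (Suc l) m x - \<phi> (Suc l) m x * S l x" for m
      proof (cases "\<phi> (Suc l) m x = 0")
        case True
        then show ?thesis by (simp add: b_def)
      next
        case False
        then have xm: "x \<in> cube 1 (Suc l) m" by (rule \<phi>(2))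
        have "\<phi> l m' x = 0" if "m' \<in> ?M l - nb l m" for m'
          using \<phi>(2)[of l m' x] that xm by (auto simp: nb_def)
        then have "(\<Sum>m'\<in>nb l m. (c (Suc l) m - c l m') * \<phi> l m' x) = (\<Sum>m'\<in>?M l. (c (Suc l) m - c l m') * \<phi> l m' x)"
          by (intro sum.mono_neutral_left fin) (auto simp: nb_def)
        also have "\<dots> = c (Suc l) m * (\<Sum>m'\<in>?M l. \<phi> l m' x) - S l x"
          by (simp add: S_def left_diff_distrib sum_subtractf sum_distrib_left)
        also have "\<dots> = c (Suc l) m - S l x" by (simp add: sum1[OF x])
        finally have "b (Suc l) m x = \<phi> (Suc l) m x * (c (Suc l) m - S l x)" by (simp only: b_def nat.case)
        then show ?thesis by (simp add: right_diff_distrib mult.commute)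
      qed
      then have "atom_sum \<Omega> \<mu> a (Suc l) x = (\<Sum>m\<in>?M (Suc l). c (Suc l) m * \<phi> (Suc l) m x - \<phi> (Suc l) m x * S l x)"
        by (simp add: atom_sum_def \<mu>a)
      also have "\<dots> = S (Suc l) x - S l x"
        by (simp add: sum_subtractf S_def[of "Suc l"] sum1[OF x] flip: sum_distrib_right)
      finally show ?thesis .
    qed
    have tele: "(\<Sum>j<Suc l. atom_sum \<Omega> \<mu> a j x) = S l x" if x: "x \<in> \<Omega>" for l x
    proof (induction l)
      case 0
      show ?case by (simp add: atom_sum_def \<mu>a b_def S_def)
    next
      case (Suc l)
      then show ?case using step[OF x, of l] by simp
    qed
    define X where "X l m = osc_seq u \<Omega> f l m + (if l = 0 then Lu_qnorm u \<Omega> f else 0)" for l m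
    have oscX: "osc u \<Omega> f l m \<le> enn_powr (X l m) u" for l m
    proof -
      have "enn_powr (osc_seq u \<Omega> f l m) u \<le> enn_powr (X l m) u" using u by (intro enn_powr_mono) (auto simp: X_def)
      then show ?thesis using u by (simp add: osc_seq_def)
    qed
    have LuX: "(\<integral>\<^sup>+x. pw u (f x) \<partial>?L) \<le> enn_powr (X 0 m) u" for m
    proof -
      have "enn_powr (Lu_qnorm u \<Omega> f) u \<le> enn_powr (X 0 m) u" using u by (intro enn_powr_mono) (auto simp: X_def)
      then show ?thesis using u by (simp add: Lu_qnorm_def)
    qed
    \<comment> \<open>Integrate \<open>|c - c'|\<^sup>u \<le> |f - c|\<^sup>u + |f - c'|\<^sup>u\<close> over the common ball.\<close>
    have cmp: "pw u (c (Suc l) m - c l m') \<le> ennreal Cd * (osc u \<Omega> f (Suc l) m + osc u \<Omega> f l m')"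
      if m: "m \<in> ?M (Suc l)" and m': "m' \<in> nb l m" for l m m'
    proof -
      obtain x where x: "x \<in> cube 1 (Suc l) m" "x \<in> \<Omega>" using m by (auto simp: meeting_cubes_def)
      obtain y where y: "y \<in> cube 1 l m'" "y \<in> cube 1 (Suc l) m" using m' by (auto simp: nb_def)
      have m'': "m' \<in> ?M l" using m' by (simp add: nb_def)
      define v where "v = v0 / 2 ^ (Suc l * n)"
      have v: "0 < v" using v0 by (simp add: v_def)
      obtain B where B: "B \<in> sets borel" "B \<subseteq> \<Omega>" "B \<subseteq> ball x (1 / 2 ^ Suc l)" "emeasure lebesgue B = ennreal v"
        using corkscrew_ball[OF cork x(2), of "Suc l"] unfolding v_def v0_def n_def by blast
      have B1: "B \<subseteq> cube 3 (Suc l) m" using B(3) ball_subset_cube[OF x(1), of "1 / 2 ^ Suc l" 3] by auto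
      have "x \<in> cube 2 l m'"
        unfolding cube_def
      proof (clarify)
        fix i
        have "\<bar>x $ i - of_int (m $ i) / 2 ^ Suc l\<bar> \<le> 1 / 2 ^ Suc l" "\<bar>y $ i - of_int (m $ i) / 2 ^ Suc l\<bar> \<le> 1 / 2 ^ Suc l"
          "\<bar>y $ i - of_int (m' $ i) / 2 ^ l\<bar> \<le> 1 / 2 ^ l" using x(1) y by (auto simp: cube_def)
        then have "\<bar>x $ i - of_int (m' $ i) / 2 ^ l\<bar> \<le> 1 / 2 ^ Suc l + 1 / 2 ^ Suc l + 1 / 2 ^ l" by linarith
        also have "\<dots> = 2 / 2 ^ l" by simp
        finally show "\<bar>x $ i - of_int (m' $ i) / 2 ^ l\<bar> \<le> 2 / 2 ^ l" .
      qed
      then have B2: "B \<subseteq> cube 3 l m'" using B(3) ball_subset_cube[of x 2 l m' "1 / 2 ^ Suc l" 3] by auto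
      have "pw u (c (Suc l) m - c l m') * emeasure lebesgue B \<le>
         (\<integral>\<^sup>+x. (pw u (f x - c (Suc l) m) * indicator (cube 3 (Suc l) m) x + pw u (f x - c l m') * indicator (cube 3 l m') x) * indicator UNIV x \<partial>?L)"
      proof (rule nn_integral_const_on_ge[OF meas B(1,2)])
        fix x assume "x \<in> B"
        moreover have "pw u (c (Suc l) m - c l m') \<le> pw u (f x - c (Suc l) m) + pw u (f x - c l m')"
          using pw_add_le[OF u(1,2), of "c (Suc l) m - f x" "f x - c l m'"] by (simp add: pw_minus_commute[of u "c (Suc l) m" "f x"])
        ultimately show "pw u (c (Suc l) m - c l m') \<le> pw u (f x - c (Suc l) m) * indicator (cube 3 (Suc l) m) x + pw u (f x - c l m') * indicator (cube 3 l m') x"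
          using B1 B2 by (auto simp: indicator_def)
      qed auto
      also have "\<dots> = I (Suc l) m (c (Suc l) m) + I l m' (c l m')" by (simp add: I_def nn_integral_add)
      also have "\<dots> \<le> ennreal (2 / 2 ^ (Suc l * n)) * osc u \<Omega> f (Suc l) m + ennreal (2 / 2 ^ (l * n)) * osc u \<Omega> f l m'"
        by (intro add_mono c m m'')
      also have "\<dots> \<le> ennreal (2 / 2 ^ (l * n)) * osc u \<Omega> f (Suc l) m + ennreal (2 / 2 ^ (l * n)) * osc u \<Omega> f l m'"
        by (intro add_mono mult_right_mono ennreal_leI divide_left_mono power_increasing) auto
      finally have "pw u (c (Suc l) m - c l m') * ennreal v \<le> ennreal (2 / 2 ^ (l * n)) * (osc u \<Omega> f (Suc l) m + osc u \<Omega> f l m')"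
        using B(4) by (simp add: distrib_left)
      then have "ennreal (1 / v) * (pw u (c (Suc l) m - c l m') * ennreal v) \<le> ennreal (1 / v) * (ennreal (2 / 2 ^ (l * n)) * (osc u \<Omega> f (Suc l) m + osc u \<Omega> f l m'))"
        by (rule mult_left_mono) simp
      moreover have "ennreal (1 / v) * (pw u (c (Suc l) m - c l m') * ennreal v) = pw u (c (Suc l) m - c l m')"
        using v by (simp add: pw_def flip: ennreal_mult)
      moreover have "ennreal (1 / v) * (ennreal (2 / 2 ^ (l * n)) * (osc u \<Omega> f (Suc l) m + osc u \<Omega> f l m')) = ennreal Cd * (osc u \<Omega> f (Suc l) m + osc u \<Omega> f l m')"
      proof -
        have "1 / v * (2 / 2 ^ (l * n)) = Cd" using v0 by (simp add: v_def Cd_def power_add field_simps)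
        then show ?thesis using v by (simp add: mult.assoc[symmetric] flip: ennreal_mult)
      qed
      ultimately show ?thesis by simp
    qed
    \<comment> \<open>The same with the constant \<open>0\<close> in place of the coarser level.\<close>
    have base: "pw u (c 0 m) \<le> ennreal (3 / v0) * enn_powr (X 0 m) u" if m: "m \<in> ?M 0" for m
    proof -
      obtain x where x: "x \<in> cube 1 0 m" "x \<in> \<Omega>" using m by (auto simp: meeting_cubes_def)
      obtain B where B: "B \<in> sets borel" "B \<subseteq> \<Omega>" "B \<subseteq> ball x (1 / 2 ^ 0)" "emeasure lebesgue B = ennreal v0"
        using corkscrew_ball[OF cork x(2), of 0] unfolding v0_def n_def by auto
      have B1: "B \<subseteq> cube 3 0 m" using B(3) ball_subset_cube[OF x(1), of "1 / 2 ^ 0" 3] by auto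
      have "pw u (c 0 m) * emeasure lebesgue B \<le>
         (\<integral>\<^sup>+x. (pw u (f x - c 0 m) * indicator (cube 3 0 m) x + pw u (f x)) * indicator UNIV x \<partial>?L)"
      proof (rule nn_integral_const_on_ge[OF meas B(1,2)])
        fix x assume "x \<in> B"
        moreover have "pw u (c 0 m) \<le> pw u (f x - c 0 m) + pw u (f x)"
          using pw_add_le[OF u(1,2), of "c 0 m - f x" "f x"] by (simp add: pw_minus_commute[of u "c 0 m" "f x"])
        ultimately show "pw u (c 0 m) \<le> pw u (f x - c 0 m) * indicator (cube 3 0 m) x + pw u (f x)"
          using B1 by (auto simp: indicator_def)
      qed auto
      also have "\<dots> = I 0 m (c 0 m) + (\<integral>\<^sup>+x. pw u (f x) \<partial>?L)" by (simp add: I_def nn_integral_add)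
      also have "\<dots> \<le> ennreal (2 / 2 ^ (0 * n)) * enn_powr (X 0 m) u + enn_powr (X 0 m) u"
        by (intro add_mono LuX order_trans[OF c[OF m]] mult_left_mono oscX) simp
      also have "\<dots> = ennreal 3 * enn_powr (X 0 m) u"
      proof -
        have "ennreal 2 * y + y = ennreal 3 * y" for y
          using distrib_right[of 2 1 y] by simp
        then show ?thesis by simp
      qed
      finally have "ennreal (1 / v0) * (pw u (c 0 m) * ennreal v0) \<le> ennreal (1 / v0) * (ennreal 3 * enn_powr (X 0 m) u)"
        using B(4) by (intro mult_left_mono) auto
      moreover have "ennreal (1 / v0) * (pw u (c 0 m) * ennreal v0) = pw u (c 0 m)"
        using v0 by (simp add: pw_def flip: ennreal_mult)
      moreover have "ennreal (1 / v0) * (ennreal 3 * enn_powr (X 0 m) u) = ennreal (3 / v0) * enn_powr (X 0 m) u"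
        using v0 by (simp add: mult.assoc[symmetric] del: ennreal_numeral flip: ennreal_mult)
      ultimately show ?thesis by simp
    qed
    have coef: "enn_powr (ennreal (norm (\<mu> l m))) u \<le>
        (\<Sum>j. ennreal (Cc * diag_weight CARD('n) u l j) * (\<Sum>m'\<in>{m'\<in>?M j. near 3 l m j m'}. enn_powr (X j m') u))"
      (is "_ \<le> (\<Sum>j. ?t j)") if m: "m \<in> ?M l" for l m
    proof -
      have self: "near 3 l m l m" by (simp add: near_def)
      have tl: "ennreal Cc * enn_powr (X l m) u \<le> ?t l"
      proof -
        have "enn_powr (X l m) u \<le> (\<Sum>m'\<in>{m'\<in>?M l. near 3 l m l m'}. enn_powr (X l m') u)"
          using m self fin by (intro member_le_sum) auto
        then show ?thesis by (simp add: diag_weight_def mult_left_mono)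
      qed
      have \<mu>u: "enn_powr (ennreal (norm (\<mu> l m))) u = ennreal (L powr u) * enn_powr (ennreal (\<Lambda> l m)) u"
      proof -
        have "norm (\<mu> l m) = \<Lambda> l m * L" using \<Lambda>0[of l m] L unfolding \<mu>_def norm_of_real by simp
        then show ?thesis using \<Lambda>0[of l m] L by (simp only: ennreal_mult less_imp_le enn_powr_mult enn_powr_ennreal[of L] mult.commute)
      qed
      show ?thesis
      proof (cases l)
        case 0
        have "enn_powr (ennreal (norm (\<mu> l m))) u = ennreal (L powr u) * pw u (c 0 m)"
          unfolding \<mu>u using 0 by (simp add: \<Lambda>_def pw_eq_enn_powr)
        also have "\<dots> \<le> ennreal (L powr u) * (ennreal (3 / v0) * enn_powr (X 0 m) u)"
          using base m 0 by (intro mult_left_mono) auto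
        also have "\<dots> = ennreal (L powr u * (3 / v0)) * enn_powr (X 0 m) u"
          by (subst ennreal_mult') (simp_all add: mult.assoc)
        also have "\<dots> \<le> ennreal Cc * enn_powr (X 0 m) u"
          unfolding Cc_def using Cd Nn by (intro mult_right_mono ennreal_leI mult_left_mono) auto
        also have "\<dots> \<le> ?t l" using tl 0 by simp
        also have "\<dots> \<le> (\<Sum>j. ?t j)" using sum_le_suminf[of ?t "{l}"] by simp
        finally show ?thesis .
      next
        case (Suc l')
        have nbn: "m' \<in> {m'\<in>?M l'. near 3 l m l' m'}" if "m' \<in> nb l' m" for m'
          using that Suc near_if_cubes_meet[of _ 1 l m 1 l' m' 3] by (auto simp: nb_def)
        have cardnb: "real (card (nb l' m)) \<le> Nn"
        proof -
          have "real (card (nb l' m)) \<le> real (card {m'. near 3 l m l' m'})"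
            using nbn card_near_le(1)[of 3 l m l'] by (auto intro!: card_mono)
          also have "\<dots> \<le> ((4 * 3 + 1) * 2 ^ (l' - l)) ^ n" using card_near_le(2)[of 3 l m l'] by (simp add: n_def)
          also have "\<dots> \<le> Nn * 1" unfolding Nn_def using Suc by simp
          finally show ?thesis by simp
        qed
        have "enn_powr (ennreal (\<Lambda> l m)) u = enn_powr (\<Sum>m'\<in>nb l' m. ennreal (norm (c (Suc l') m - c l' m'))) u"
          using Suc by (simp add: \<Lambda>_def)
        also have "\<dots> \<le> (\<Sum>m'\<in>nb l' m. pw u (c (Suc l') m - c l' m'))"
          unfolding pw_eq_enn_powr by (rule enn_powr_sum_le[OF u(1,2) nbfin])
        also have "\<dots> \<le> (\<Sum>m'\<in>nb l' m. ennreal Cd * (enn_powr (X l m) u + enn_powr (X l' m') u))"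
          using m Suc by (intro sum_mono order_trans[OF cmp] mult_left_mono add_mono oscX) (auto simp: oscX)
        also have "\<dots> = ennreal Cd * (ennreal (real (card (nb l' m))) * enn_powr (X l m) u + (\<Sum>m'\<in>nb l' m. enn_powr (X l' m') u))"
          by (simp add: sum.distrib ennreal_of_nat_eq_real_of_nat flip: sum_distrib_left)
        also have "\<dots> \<le> ennreal Cd * (ennreal Nn * enn_powr (X l m) u + ennreal Nn * (\<Sum>m'\<in>{m'\<in>?M l'. near 3 l m l' m'}. enn_powr (X l' m') u))"
        proof (intro mult_left_mono add_mono mult_right_mono ennreal_leI cardnb)
          have "(\<Sum>m'\<in>nb l' m. enn_powr (X l' m') u) \<le> ennreal 1 * (\<Sum>m'\<in>{m'\<in>?M l'. near 3 l m l' m'}. enn_powr (X l' m') u)"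
            using nbn fin by (simp, intro sum_mono2) auto
          also have "\<dots> \<le> ennreal Nn * (\<Sum>m'\<in>{m'\<in>?M l'. near 3 l m l' m'}. enn_powr (X l' m') u)"
            by (intro mult_right_mono ennreal_leI Nn) auto
          finally show "(\<Sum>m'\<in>nb l' m. enn_powr (X l' m') u) \<le> ennreal Nn * (\<Sum>m'\<in>{m'\<in>?M l'. near 3 l m l' m'}. enn_powr (X l' m') u)" .
        qed auto
        finally have "enn_powr (ennreal (norm (\<mu> l m))) u \<le> ennreal (L powr u) * (ennreal Cd * (ennreal Nn * enn_powr (X l m) u + ennreal Nn * (\<Sum>m'\<in>{m'\<in>?M l'. near 3 l m l' m'}. enn_powr (X l' m') u)))"
          unfolding \<mu>u by (rule mult_left_mono) simp
        also have "\<dots> = ennreal (L powr u * Cd * Nn) * enn_powr (X l m) u + ennreal (L powr u * Cd * Nn) * (\<Sum>m'\<in>{m'\<in>?M l'. near 3 l m l' m'}. enn_powr (X l' m') u)"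
          using Cd Nn by (simp add: ennreal_mult distrib_left mult.assoc)
        also have "\<dots> \<le> ?t l + ?t l'"
        proof (rule add_mono)
          have "1 \<le> 2 powr u" using u by (simp add: ge_one_powr_ge_zero)
          then have "L powr u * Cd * Nn * 1 \<le> L powr u * Cd * Nn * 2 powr u" using Cd Nn by (intro mult_left_mono) auto
          also have "\<dots> \<le> Cc" unfolding Cc_def using v0 by (simp add: distrib_left mult.assoc)
          finally have "ennreal (L powr u * Cd * Nn) * enn_powr (X l m) u \<le> ennreal Cc * enn_powr (X l m) u"
            by (intro mult_right_mono ennreal_leI) auto
          then show "ennreal (L powr u * Cd * Nn) * enn_powr (X l m) u \<le> ?t l" using tl by (rule order_trans)
          have "L powr u * Cd * Nn = (L powr u * Cd * Nn * 2 powr u) * 2 powr (- u)" by (simp flip: powr_add)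
          also have "\<dots> \<le> Cc * 2 powr (- u)"
            unfolding Cc_def using v0 by (intro mult_right_mono) (auto simp: distrib_left mult.assoc)
          also have "\<dots> = Cc * diag_weight CARD('n) u l l'" using Suc by (simp add: diag_weight_def)
          finally show "ennreal (L powr u * Cd * Nn) * (\<Sum>m'\<in>{m'\<in>?M l'. near 3 l m l' m'}. enn_powr (X l' m') u) \<le> ?t l'"
            by (intro mult_right_mono ennreal_leI) auto
        qed
        also have "\<dots> = sum ?t {l, l'}" using Suc by simp
        also have "\<dots> \<le> (\<Sum>j. ?t j)" by (rule sum_le_suminf) auto
        finally show ?thesis .
      qed
    qed
    have bound: "b_qnorm s p q \<Omega> \<mu> \<le> ennreal (C1 * C2) * (?Q (osc_seq u \<Omega> f) + Lu_qnorm u \<Omega> f)"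
    proof -
      have "b_qnorm s p q \<Omega> \<mu> \<le> ennreal C1 * ?Q X"
        unfolding b_qnorm_eq_seq_qnorm by (rule C1(2)) (rule coef)
      also have "\<dots> \<le> ennreal C1 * (ennreal C2 * (?Q (osc_seq u \<Omega> f) + Lu_qnorm u \<Omega> f))"
        unfolding X_def[abs_def] by (intro mult_left_mono C2(2)) simp
      finally show ?thesis using C1 C2 by (simp add: ennreal_mult mult.assoc)
    qed
    then have bfin: "b_qnorm s p q \<Omega> \<mu> < \<infinity>"
      using finO finL by (auto intro!: le_less_trans[OF bound] simp: ennreal_mult_less_top)
    have summ: "AE x in ?L. summable (\<lambda>j. norm (atom_sum \<Omega> \<mu> a j x))"
      by (rule atomic_synthesis(1)[OF bd meas _ p q s(1) atoms bfin]) (use d in auto)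
    have Pm [measurable]: "atom_sum \<Omega> \<mu> a j \<in> borel_measurable ?L" for j by (rule atom_sum_measurable[OF atoms])
    define g where "g l x = (\<Sum>j<Suc l. atom_sum \<Omega> \<mu> a j x)" for l x
    have gm [measurable]: "g l \<in> borel_measurable ?L" for l unfolding g_def[abs_def] by measurable
    define A0 where "A0 = enn2real (enn_powr (?Q (osc_seq u \<Omega> f)) u)"
    have A0: "enn_powr (?Q (osc_seq u \<Omega> f)) u = ennreal A0" "0 \<le> A0" using finO by (auto simp: A0_def)
    \<comment> \<open>The partial sum is \<open>S l\<close>, and \<open>f - S l\<close> is a sum of the \<open>f - c l m\<close> with coefficients bounded by \<open>1\<close>.\<close>
    have err: "(\<integral>\<^sup>+x. pw u (f x - g l x) \<partial>?L) \<le> ennreal (2 * C3 * A0 * 2 powr (- (s * u) * real l))" for l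
    proof -
      have "(\<integral>\<^sup>+x. pw u (f x - g l x) \<partial>?L) \<le> (\<integral>\<^sup>+x. (\<Sum>m\<in>?M l. pw u (f x - c l m) * indicator (cube 3 l m) x) \<partial>?L)"
      proof (rule nn_integral_mono)
        fix x assume "x \<in> space ?L"
        then have x: "x \<in> \<Omega>" by (simp add: space_restrict_space)
        have "f x - g l x = f x * (\<Sum>m\<in>?M l. \<phi> l m x) - S l x" by (simp add: sum1[OF x] g_def tele[OF x] del: sum.lessThan_Suc)
        also have "\<dots> = (\<Sum>m\<in>?M l. (f x - c l m) * \<phi> l m x)"
          by (simp add: S_def sum_distrib_left left_diff_distrib sum_subtractf)
        finally have "pw u (f x - g l x) \<le> (\<Sum>m\<in>?M l. pw u ((f x - c l m) * \<phi> l m x))"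
          using pw_sum_le[OF u(1,2) fin] by simp
        also have "\<dots> \<le> (\<Sum>m\<in>?M l. pw u (f x - c l m) * indicator (cube 3 l m) x)"
        proof (rule sum_mono)
          fix m
          show "pw u ((f x - c l m) * \<phi> l m x) \<le> pw u (f x - c l m) * indicator (cube 3 l m) x"
          proof (cases "\<phi> l m x = 0")
            case False
            then have "x \<in> cube 1 l m" by (rule \<phi>(2))
            then have "x \<in> cube 3 l m" using cube_mono[of 1 3 l m] by auto
            moreover have "pw u (\<phi> l m x) \<le> pw u 1" using u \<phi>1 by (intro pw_mono) auto
            ultimately show ?thesis using mult_left_mono[of "pw u (\<phi> l m x)" 1 "pw u (f x - c l m)"] by (simp add: pw_mult pw_def[of u 1])
          qed simp
        qed
        finally show "pw u (f x - g l x) \<le> (\<Sum>m\<in>?M l. pw u (f x - c l m) * indicator (cube 3 l m) x)" .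
      qed
      also have "\<dots> = (\<Sum>m\<in>?M l. I l m (c l m))" by (simp add: I_def nn_integral_sum)
      also have "\<dots> \<le> (\<Sum>m\<in>?M l. ennreal (2 / 2 ^ (l * n)) * enn_powr (osc_seq u \<Omega> f l m) u)"
        using c u by (intro sum_mono) (simp add: osc_seq_def)
      also have "\<dots> = ennreal (2 / 2 ^ (l * n)) * (\<Sum>m\<in>?M l. enn_powr (osc_seq u \<Omega> f l m) u)"
        by (simp add: sum_distrib_left)
      also have "\<dots> \<le> ennreal (2 / 2 ^ (l * n)) * (ennreal (C3 * 2 powr (real l * (real CARD('n) - s * u))) * ennreal A0)"
      proof (intro mult_left_mono order_trans[OF C3(2)])
        have "enn_powr (level_norm s p \<Omega> (osc_seq u \<Omega> f) l) u \<le> ennreal A0"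
          unfolding A0(1)[symmetric] using u by (intro enn_powr_mono level_norm_le_seq_qnorm q) auto
        then show "ennreal (C3 * 2 powr (real l * (real CARD('n) - s * u))) * enn_powr (level_norm s p \<Omega> (osc_seq u \<Omega> f) l) u
          \<le> ennreal (C3 * 2 powr (real l * (real CARD('n) - s * u))) * ennreal A0" by (rule mult_left_mono) simp
      qed simp
      also have "\<dots> = ennreal (2 / 2 ^ (l * n) * (C3 * 2 powr (real l * (real n - s * u)) * A0))"
        using C3 A0 by (simp add: n_def flip: ennreal_mult)
      also have "2 / 2 ^ (l * n) * (C3 * 2 powr (real l * (real n - s * u)) * A0) = 2 * C3 * A0 * 2 powr (- (s * u) * real l)"
      proof -
        have "(2::real) ^ (l * n) = 2 powr (real l * real n)" by (simp flip: powr_realpow)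
        moreover have "real l * (real n - s * u) = real l * real n + - (s * u) * real l" by (simp add: algebra_simps)
        ultimately show ?thesis by (simp only: powr_add) simp
      qed
      finally show ?thesis .
    qed
    have "(\<lambda>l. 2 * C3 * A0 * 2 powr (- (s * u) * real l)) \<longlonglongrightarrow> 2 * C3 * A0 * 0"
    proof (intro tendsto_mult_left)
      have "(\<lambda>J. (2 powr (- (s * u))) ^ J) \<longlonglongrightarrow> 0" using s u by (intro LIMSEQ_realpow_zero) (auto simp: powr_less_one)
      then show "(\<lambda>l. 2 powr (- (s * u) * real l)) \<longlonglongrightarrow> 0" by (simp add: powr_powr flip: powr_realpow)
    qed
    then have lim0: "(\<lambda>l. ennreal (2 * C3 * A0 * 2 powr (- (s * u) * real l))) \<longlonglongrightarrow> 0"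
      using tendsto_ennrealI by fastforce
    have "AE x in ?L. pw u (f x - (\<Sum>j. atom_sum \<Omega> \<mu> a j x)) = liminf (\<lambda>l. pw u (f x - g l x))"
      using summ
    proof eventually_elim
      case (elim x)
      have "(\<lambda>l. g l x) \<longlonglongrightarrow> (\<Sum>j. atom_sum \<Omega> \<mu> a j x)"
        unfolding g_def using summable_LIMSEQ[OF summable_norm_cancel[OF elim]] by (rule LIMSEQ_Suc)
      then have "(\<lambda>l. pw u (f x - g l x)) \<longlonglongrightarrow> pw u (f x - (\<Sum>j. atom_sum \<Omega> \<mu> a j x))"
        unfolding pw_def using u by (intro tendsto_ennrealI tendsto_powr' tendsto_norm tendsto_diff tendsto_const) auto
      then show ?case by (intro lim_imp_Liminf[symmetric]) auto
    qed
    then have "(\<integral>\<^sup>+x. pw u (f x - (\<Sum>j. atom_sum \<Omega> \<mu> a j x)) \<partial>?L) = (\<integral>\<^sup>+x. liminf (\<lambda>l. pw u (f x - g l x)) \<partial>?L)"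
      by (rule nn_integral_cong_AE)
    also have "\<dots> \<le> liminf (\<lambda>l. \<integral>\<^sup>+x. pw u (f x - g l x) \<partial>?L)"
      by (rule nn_integral_liminf) measurable
    also have "\<dots> \<le> liminf (\<lambda>l. ennreal (2 * C3 * A0 * 2 powr (- (s * u) * real l)))"
      by (intro Liminf_mono always_eventually allI err)
    also have "\<dots> = 0" using lim0 by (intro lim_imp_Liminf) auto
    finally have zero: "(\<integral>\<^sup>+x. pw u (f x - (\<Sum>j. atom_sum \<Omega> \<mu> a j x)) \<partial>?L) = 0" by simp
    have "(\<lambda>x. \<Sum>j. atom_sum \<Omega> \<mu> a j x) \<in> borel_measurable ?L" by measurable
    then have "AE x in ?L. pw u (f x - (\<Sum>j. atom_sum \<Omega> \<mu> a j x)) = 0"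
      using zero by (subst (asm) nn_integral_0_iff_AE) auto
    then have "AE x in ?L. f x = (\<Sum>j. atom_sum \<Omega> \<mu> a j x)"
      by (auto elim!: eventually_mono simp: pw_def ennreal_eq_0_iff)
    then show "\<exists>\<mu> a. (\<forall>j. \<forall>m\<in>?M j. atom d K j m (a j m)) \<and>
       (AE x in ?L. f x = (\<Sum>j. atom_sum \<Omega> \<mu> a j x)) \<and>
       b_qnorm s p q \<Omega> \<mu> \<le> ennreal (C1 * C2) * (?Q (osc_seq u \<Omega> f) + Lu_qnorm u \<Omega> f)"
      using atoms bound by blast
  qed
qed

section \<open>Discretisation of the interpolation quasi-norm\<close>

lemma K_functional_le:
  assumes "f0 \<in> vecs A0" "f1 \<in> vecs A1" "f = (\<lambda>x. f0 x + f1 x)"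
  shows "K_functional A0 A1 t f \<le> qn A0 f0 + ennreal t * qn A1 f1"
proof -
  have "K_functional A0 A1 t f \<le> (\<lambda>(f0, f1). qn A0 f0 + ennreal t * qn A1 f1) (f0, f1)"
    unfolding K_functional_def using assms by (intro INF_lower) auto
  then show ?thesis by simp
qed

lemma K_functional_greatest:
  assumes "\<And>f0 f1. f0 \<in> vecs A0 \<Longrightarrow> f1 \<in> vecs A1 \<Longrightarrow> f = (\<lambda>x. f0 x + f1 x) \<Longrightarrow> Y \<le> qn A0 f0 + ennreal t * qn A1 f1"
  shows "Y \<le> K_functional A0 A1 t f"
  unfolding K_functional_def using assms by (intro INF_greatest) auto

lemma K_functional_mono:
  assumes "t \<le> t'"
  shows "K_functional A0 A1 t f \<le> K_functional A0 A1 t' f"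
proof (rule K_functional_greatest)
  fix f0 f1 assume "f0 \<in> vecs A0" "f1 \<in> vecs A1" "f = (\<lambda>x. f0 x + f1 x)"
  then have "K_functional A0 A1 t f \<le> qn A0 f0 + ennreal t * qn A1 f1" by (rule K_functional_le)
  also have "\<dots> \<le> qn A0 f0 + ennreal t' * qn A1 f1" using assms by (intro add_left_mono mult_right_mono ennreal_leI) auto
  finally show "K_functional A0 A1 t f \<le> qn A0 f0 + ennreal t' * qn A1 f1" .
qed

lemma K_functional_scale_le:
  assumes "1 \<le> c" "0 \<le> t"
  shows "K_functional A0 A1 (c * t) f \<le> ennreal c * K_functional A0 A1 t f"
proof -
  have "K_functional A0 A1 (c * t) f / ennreal c \<le> K_functional A0 A1 t f"
  proof (rule K_functional_greatest)
    fix f0 f1 assume *: "f0 \<in> vecs A0" "f1 \<in> vecs A1" "f = (\<lambda>x. f0 x + f1 x)"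
    have "K_functional A0 A1 (c * t) f \<le> qn A0 f0 + ennreal (c * t) * qn A1 f1" by (rule K_functional_le[OF *])
    also have "\<dots> \<le> ennreal c * qn A0 f0 + ennreal c * (ennreal t * qn A1 f1)"
    proof (rule add_mono)
      have "ennreal 1 * qn A0 f0 \<le> ennreal c * qn A0 f0" using assms by (intro mult_right_mono ennreal_leI) auto
      then show "qn A0 f0 \<le> ennreal c * qn A0 f0" by simp
      show "ennreal (c * t) * qn A1 f1 \<le> ennreal c * (ennreal t * qn A1 f1)"
        using assms by (simp add: ennreal_mult mult.assoc)
    qed
    also have "\<dots> = ennreal c * (qn A0 f0 + ennreal t * qn A1 f1)" by (simp add: distrib_left)
    finally show "K_functional A0 A1 (c * t) f / ennreal c \<le> qn A0 f0 + ennreal t * qn A1 f1"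
      using assms by (intro divide_le_posI_ennreal) auto
  qed
  then have "ennreal c * (K_functional A0 A1 (c * t) f / ennreal c) \<le> ennreal c * K_functional A0 A1 t f"
    by (rule mult_left_mono) simp
  moreover have "ennreal c * (K_functional A0 A1 (c * t) f / ennreal c) = K_functional A0 A1 (c * t) f"
    using assms by (simp add: ennreal_times_divide mult.commute[of "ennreal c"] mult_divide_eq_ennreal)
  ultimately show ?thesis by simp
qed

text \<open>
  On \<open>[b\<^sup>k, b\<^bsup>k+1\<^esup>)\<close> the integrand of the interpolation quasi-norm is at least a constant multiple of its value at
  \<open>b\<^sup>k\<close>, because the \<open>K\<close>-functional is increasing.
\<close>

lemma ell_qnorm_K_functional_le:
  assumes b: "1 < (b::real)" and th: "0 < \<theta>" and q: "0 < q"
  obtains C where "0 < C" "\<And>(A0 :: ('a \<Rightarrow> complex) qn_space) A1 f.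
    ell_qnorm q (UNIV :: int set) (\<lambda>k. ennreal (b powr (- real_of_int k * \<theta>)) * K_functional A0 A1 (b powr real_of_int k) f)
      \<le> ennreal C * interp_qnorm \<theta> q A0 A1 f"
  using q
proof (cases rule: exponent_cases)
  case 1
  show ?thesis
  proof (rule that[of 1])
    fix A0 A1 :: "('a \<Rightarrow> complex) qn_space" and f
    have "ennreal (b powr (- real_of_int k * \<theta>)) * K_functional A0 A1 (b powr real_of_int k) f \<le> interp_qnorm \<theta> q A0 A1 f" for k
    proof -
      have "ennreal (b powr (- real_of_int k * \<theta>)) * K_functional A0 A1 (b powr real_of_int k) f
         = (\<lambda>t. ennreal (t powr - \<theta>) * K_functional A0 A1 t f) (b powr real_of_int k)"
        by (simp add: powr_powr)
      also have "\<dots> \<le> interp_qnorm \<theta> q A0 A1 f"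
        unfolding interp_qnorm_def using 1 b by (simp only: if_True simp_thms) (rule SUP_upper, simp)
      finally show ?thesis .
    qed
    then show "ell_qnorm q (UNIV :: int set) (\<lambda>k. ennreal (b powr (- real_of_int k * \<theta>)) * K_functional A0 A1 (b powr real_of_int k) f)
      \<le> ennreal 1 * interp_qnorm \<theta> q A0 A1 f" using 1 by (auto simp: ell_qnorm_infty intro!: SUP_least)
  qed simp
next
  case (2 r)
  define c where "c = b powr (- \<theta> * r) * (1 - 1 / b)"
  have c: "0 < c" using b by (simp add: c_def)
  show ?thesis
  proof (rule that[of "(1 / c) powr (1 / r)"])
    show "0 < (1 / c) powr (1 / r)" using c by simp
    fix A0 A1 :: "('a \<Rightarrow> complex) qn_space" and f
    define g where "g t = enn_powr (ennreal (t powr - \<theta>) * K_functional A0 A1 t f) r * ennreal (1 / t) * indicator {0<..} t" for t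
    define z where "z k = enn_powr (ennreal (b powr (- real_of_int k * \<theta>)) * K_functional A0 A1 (b powr real_of_int k) f) r" for k
    define Ik where "Ik k = {b powr real_of_int k ..< b powr (real_of_int k + 1)}" for k
    have pos: "0 < b powr y" for y using b by simp
    have zg: "ennreal (b powr (- \<theta> * r) / b powr (real_of_int k + 1)) * z k \<le> g t" if t: "t \<in> Ik k" for t k
    proof -
      have "b powr real_of_int k \<le> t" using t by (simp add: Ik_def)
      with pos have t0: "0 < t" by (rule less_le_trans)
      have "b powr (- \<theta> * r) = (b powr - \<theta>) powr r" by (simp add: powr_powr)
      then have "ennreal (b powr (- \<theta> * r)) * z k = enn_powr (ennreal (b powr - \<theta> * b powr (- real_of_int k * \<theta>)) * K_functional A0 A1 (b powr real_of_int k) f) r"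
        by (simp add: z_def enn_powr_mult enn_powr_ennreal ennreal_mult mult.assoc)
      also have "\<dots> \<le> enn_powr (ennreal (t powr - \<theta>) * K_functional A0 A1 t f) r"
      proof (intro enn_powr_mono mult_mono ennreal_leI K_functional_mono)
        have "b powr - \<theta> * b powr (- real_of_int k * \<theta>) = (b powr (real_of_int k + 1)) powr - \<theta>"
          by (simp add: powr_powr algebra_simps flip: powr_add)
        also have "\<dots> \<le> t powr - \<theta>" using t t0 th by (intro powr_mono2') (auto simp: Ik_def)
        finally show "b powr - \<theta> * b powr (- real_of_int k * \<theta>) \<le> t powr - \<theta>" .
      qed (use t 2 in \<open>auto simp: Ik_def\<close>)
      finally have A: "ennreal (b powr (- \<theta> * r)) * z k \<le> enn_powr (ennreal (t powr - \<theta>) * K_functional A0 A1 t f) r" .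
      have "1 / b powr (real_of_int k + 1) \<le> 1 / t" using t by (intro divide_left_mono mult_pos_pos pos t0) (auto simp: Ik_def)
      then have "(ennreal (b powr (- \<theta> * r)) * z k) * ennreal (1 / b powr (real_of_int k + 1)) \<le> enn_powr (ennreal (t powr - \<theta>) * K_functional A0 A1 t f) r * ennreal (1 / t)"
        using A by (intro mult_mono ennreal_leI) auto
      moreover have "ennreal (b powr (- \<theta> * r) / b powr (real_of_int k + 1)) = ennreal (b powr (- \<theta> * r)) * ennreal (1 / b powr (real_of_int k + 1))"
        by (simp flip: ennreal_mult)
      ultimately show ?thesis using t0 by (simp add: g_def ac_simps)
    qed
    have "(\<integral>\<^sup>+k. ennreal c * z k \<partial>count_space UNIV) = (\<integral>\<^sup>+k. (\<integral>\<^sup>+t. ennreal (b powr (- \<theta> * r) / b powr (real_of_int k + 1)) * z k * indicator (Ik k) t \<partial>lborel) \<partial>count_space UNIV)"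
    proof (rule nn_integral_cong)
      fix k
      have le: "b powr real_of_int k \<le> b powr (real_of_int k + 1)" using b by simp
      have "(\<integral>\<^sup>+t. ennreal (b powr (- \<theta> * r) / b powr (real_of_int k + 1)) * z k * indicator (Ik k) t \<partial>lborel)
        = ennreal (b powr (- \<theta> * r) / b powr (real_of_int k + 1)) * z k * ennreal (b powr (real_of_int k + 1) - b powr real_of_int k)"
        using le by (subst nn_integral_cmult_indicator) (auto simp: Ik_def)
      also have "\<dots> = ennreal (b powr (- \<theta> * r) / b powr (real_of_int k + 1) * (b powr (real_of_int k + 1) - b powr real_of_int k)) * z k"
      proof -
        have "ennreal a * Z * ennreal d = ennreal (a * d) * Z" if "0 \<le> a" "0 \<le> d" for a d Z
          using that by (simp add: ennreal_mult ac_simps)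
        then show ?thesis using le by simp
      qed
      also have "b powr (- \<theta> * r) / b powr (real_of_int k + 1) * (b powr (real_of_int k + 1) - b powr real_of_int k) = c"
        using b by (simp add: c_def powr_add field_simps)
      finally show "ennreal c * z k = (\<integral>\<^sup>+t. ennreal (b powr (- \<theta> * r) / b powr (real_of_int k + 1)) * z k * indicator (Ik k) t \<partial>lborel)" by simp
    qed
    also have "\<dots> = (\<integral>\<^sup>+t. (\<integral>\<^sup>+k. ennreal (b powr (- \<theta> * r) / b powr (real_of_int k + 1)) * z k * indicator (Ik k) t \<partial>count_space UNIV) \<partial>lborel)"
      by (rule nn_integral_count_space_nn_integral[symmetric]) (auto simp: Ik_def)
    also have "\<dots> \<le> (\<integral>\<^sup>+t. g t \<partial>lborel)"
    proof (rule nn_integral_mono)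
      fix t :: real
      show "(\<integral>\<^sup>+k. ennreal (b powr (- \<theta> * r) / b powr (real_of_int k + 1)) * z k * indicator (Ik k) t \<partial>count_space UNIV) \<le> g t"
      proof (cases "0 < t")
        case True
        define k0 where "k0 = \<lfloor>log b t\<rfloor>"
        have iff: "t \<in> Ik k \<longleftrightarrow> k = k0" for k
        proof -
          have "t \<in> Ik k \<longleftrightarrow> real_of_int k \<le> log b t \<and> log b t < real_of_int k + 1"
            using True b by (simp add: Ik_def le_log_iff log_less_iff)
          also have "\<dots> \<longleftrightarrow> k = k0" unfolding k0_def by linarith
          finally show ?thesis .
        qed
        have "(\<integral>\<^sup>+k. ennreal (b powr (- \<theta> * r) / b powr (real_of_int k + 1)) * z k * indicator (Ik k) t \<partial>count_space UNIV)
          = (\<integral>\<^sup>+k. (ennreal (b powr (- \<theta> * r) / b powr (real_of_int k + 1)) * z k) * indicator {k0} k \<partial>count_space UNIV)"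
          by (intro nn_integral_cong) (auto simp: indicator_def iff)
        also have "\<dots> = ennreal (b powr (- \<theta> * r) / b powr (real_of_int k0 + 1)) * z k0"
          by (subst nn_integral_indicator_singleton) auto
        also have "\<dots> \<le> g t" by (rule zg) (simp add: iff)
        finally show ?thesis .
      next
        case False
        have "indicator (Ik k) t = (0 :: ennreal)" for k
        proof -
          have "t < b powr real_of_int k" using False by (intro le_less_trans[OF _ pos]) simp
          then show ?thesis by (simp add: Ik_def)
        qed
        then show ?thesis by simp
      qed
    qed
    finally have "ennreal c * (\<integral>\<^sup>+k. z k \<partial>count_space UNIV) \<le> (\<integral>\<^sup>+t. g t \<partial>lborel)" by (simp add: nn_integral_cmult)
    also have "\<dots> = enn_powr (interp_qnorm \<theta> q A0 A1 f) r"
      using 2 by (simp add: interp_qnorm_def g_def)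
    finally have "ennreal (1 / c) * (ennreal c * (\<integral>\<^sup>+k. z k \<partial>count_space UNIV)) \<le> ennreal (1 / c) * enn_powr (interp_qnorm \<theta> q A0 A1 f) r"
      by (rule mult_left_mono) simp
    then have "(\<integral>\<^sup>+k. z k \<partial>count_space UNIV) \<le> ennreal (1 / c) * enn_powr (interp_qnorm \<theta> q A0 A1 f) r"
      using c by (simp add: mult.assoc[symmetric] flip: ennreal_mult)
    also have "\<dots> = enn_powr (ennreal ((1 / c) powr (1 / r)) * interp_qnorm \<theta> q A0 A1 f) r"
      using c 2 by (simp add: enn_powr_mult enn_powr_ennreal powr_powr)
    finally show "ell_qnorm q (UNIV :: int set) (\<lambda>k. ennreal (b powr (- real_of_int k * \<theta>)) * K_functional A0 A1 (b powr real_of_int k) f)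
      \<le> ennreal ((1 / c) powr (1 / r)) * interp_qnorm \<theta> q A0 A1 f"
      using 2 by (simp add: ell_qnorm_le_iff z_def)
  qed
qed

text \<open>
  Each \<open>\<tau>\<close> is compared with a grid point at bounded ratio; the interval of these \<open>\<tau>\<close> has bounded measure
  with respect to \<open>d\<tau> / \<tau>\<close>, whatever the number of grid points near it.
\<close>

lemma interp_qnorm_le_discrete:
  assumes th: "0 < \<theta>" and q: "0 < q" and C: "1 \<le> C"
  obtains C' where "0 < C'" "\<And>(A0 :: ('a \<Rightarrow> complex) qn_space) A1 f t \<beta>.
    (\<And>k::int. 0 < t k) \<Longrightarrow> (\<And>\<tau>. 0 < \<tau> \<Longrightarrow> \<exists>k. t k / C \<le> \<tau> \<and> \<tau> \<le> C * t k) \<Longrightarrow>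
    (\<And>k. K_functional A0 A1 (t k) f \<le> ennreal (t k powr \<theta>) * \<beta> k) \<Longrightarrow>
    interp_qnorm \<theta> q A0 A1 f \<le> ennreal C' * ell_qnorm q UNIV \<beta>"
proof -
  define D where "D = C * C powr \<theta>"
  have D: "0 < D" using C by (simp add: D_def)
  have pt: "ennreal (\<tau> powr - \<theta>) * K_functional A0 A1 \<tau> f \<le> ennreal D * \<beta> k"
    if "0 < t k" "0 < \<tau>" "t k / C \<le> \<tau>" "\<tau> \<le> C * t k" "K_functional A0 A1 (t k) f \<le> ennreal (t k powr \<theta>) * \<beta> k"
    for A0 A1 :: "('a \<Rightarrow> complex) qn_space" and f and t :: "int \<Rightarrow> real" and \<beta> \<tau> k
  proof -
    have "K_functional A0 A1 \<tau> f \<le> ennreal C * K_functional A0 A1 (t k) f"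
      using K_functional_mono[OF that(4)] K_functional_scale_le[OF C, of "t k"] that(1) by (meson less_imp_le order_trans)
    also have "\<dots> \<le> ennreal C * (ennreal (t k powr \<theta>) * \<beta> k)" using that(5) by (rule mult_left_mono) simp
    finally have "ennreal (\<tau> powr - \<theta>) * K_functional A0 A1 \<tau> f \<le> ennreal ((t k / C) powr - \<theta>) * (ennreal C * (ennreal (t k powr \<theta>) * \<beta> k))"
      using that C th by (intro mult_mono ennreal_leI powr_mono2') auto
    also have "\<dots> = ennreal ((t k / C) powr - \<theta> * (C * t k powr \<theta>)) * \<beta> k" using C by (simp add: ennreal_mult mult.assoc)
    also have "(t k / C) powr - \<theta> * (C * t k powr \<theta>) = D"
      using that(1) C by (simp add: D_def powr_divide powr_minus_divide)
    finally show ?thesis .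
  qed
  show ?thesis
    using q
  proof (cases rule: exponent_cases)
    case 1
    show ?thesis
    proof (rule that[OF D])
      fix A0 A1 :: "('a \<Rightarrow> complex) qn_space" and f and t :: "int \<Rightarrow> real" and \<beta>
      assume *: "\<And>k. 0 < t k" "\<And>\<tau>. 0 < \<tau> \<Longrightarrow> \<exists>k. t k / C \<le> \<tau> \<and> \<tau> \<le> C * t k"
        "\<And>k. K_functional A0 A1 (t k) f \<le> ennreal (t k powr \<theta>) * \<beta> k"
      have "ennreal (\<tau> powr - \<theta>) * K_functional A0 A1 \<tau> f \<le> ennreal D * (SUP k. \<beta> k)" if \<tau>: "0 < \<tau>" for \<tau>
      proof -
        obtain k where k: "t k / C \<le> \<tau>" "\<tau> \<le> C * t k" using *(2)[OF \<tau>] by blast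
        have "ennreal (\<tau> powr - \<theta>) * K_functional A0 A1 \<tau> f \<le> ennreal D * \<beta> k" by (rule pt[where t = t and k = k and \<beta> = \<beta>, OF *(1) \<tau> k *(3)])
        also have "\<dots> \<le> ennreal D * (SUP k. \<beta> k)" by (intro mult_left_mono SUP_upper) auto
        finally show ?thesis .
      qed
      then show "interp_qnorm \<theta> q A0 A1 f \<le> ennreal D * ell_qnorm q UNIV \<beta>"
        using 1 by (auto simp: interp_qnorm_def ell_qnorm_infty intro!: SUP_least)
    qed
  next
    case (2 r)
    show ?thesis
    proof (rule that[of "(C * C) powr (1/r) * D"])
      show "0 < (C * C) powr (1/r) * D" using C D by simp
      fix A0 A1 :: "('a \<Rightarrow> complex) qn_space" and f and t :: "int \<Rightarrow> real" and \<beta>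
      assume *: "\<And>k. 0 < t k" "\<And>\<tau>. 0 < \<tau> \<Longrightarrow> \<exists>k. t k / C \<le> \<tau> \<and> \<tau> \<le> C * t k"
        "\<And>k. K_functional A0 A1 (t k) f \<le> ennreal (t k powr \<theta>) * \<beta> k"
      define z where "z k = enn_powr (ennreal D * \<beta> k) r" for k
      have "(\<integral>\<^sup>+\<tau>\<in>{0<..}. enn_powr (ennreal (\<tau> powr - \<theta>) * K_functional A0 A1 \<tau> f) r * ennreal (1 / \<tau>) \<partial>lborel)
        \<le> (\<integral>\<^sup>+\<tau>. (\<integral>\<^sup>+k. z k * ennreal (C / t k) * indicator {t k / C..C * t k} \<tau> \<partial>count_space UNIV) \<partial>lborel)"
      proof (rule nn_integral_mono)
        fix \<tau> :: real
        show "enn_powr (ennreal (\<tau> powr - \<theta>) * K_functional A0 A1 \<tau> f) r * ennreal (1 / \<tau>) * indicator {0<..} \<tau>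
           \<le> (\<integral>\<^sup>+k. z k * ennreal (C / t k) * indicator {t k / C..C * t k} \<tau> \<partial>count_space UNIV)"
        proof (cases "0 < \<tau>")
          case True
          obtain k where k: "t k / C \<le> \<tau>" "\<tau> \<le> C * t k" using *(2)[OF True] by blast
          have "enn_powr (ennreal (\<tau> powr - \<theta>) * K_functional A0 A1 \<tau> f) r \<le> z k"
            unfolding z_def using 2 by (intro enn_powr_mono pt[where t = t and k = k and \<beta> = \<beta>, OF *(1) True k *(3)]) auto
          moreover have "1 / \<tau> \<le> C / t k"
            using k(1) True *(1)[of k] C by (simp add: field_simps)
          ultimately have "enn_powr (ennreal (\<tau> powr - \<theta>) * K_functional A0 A1 \<tau> f) r * ennreal (1 / \<tau>) \<le> z k * ennreal (C / t k)"
            by (intro mult_mono ennreal_leI) auto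
          also have "\<dots> = (\<integral>\<^sup>+k'. (z k' * ennreal (C / t k') * indicator {t k' / C..C * t k'} \<tau>) * indicator {k} k' \<partial>count_space UNIV)"
            using k by (subst nn_integral_indicator_singleton) auto
          also have "\<dots> \<le> (\<integral>\<^sup>+k. z k * ennreal (C / t k) * indicator {t k / C..C * t k} \<tau> \<partial>count_space UNIV)"
            by (intro nn_integral_mono) (auto simp: indicator_def)
          finally show ?thesis using True by simp
        qed simp
      qed
      also have "\<dots> = (\<integral>\<^sup>+k. (\<integral>\<^sup>+\<tau>. z k * ennreal (C / t k) * indicator {t k / C..C * t k} \<tau> \<partial>lborel) \<partial>count_space UNIV)"
        by (rule nn_integral_count_space_nn_integral) auto
      also have "\<dots> \<le> (\<integral>\<^sup>+k. ennreal (C * C) * z k \<partial>count_space UNIV)"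
      proof (rule nn_integral_mono)
        fix k
        have tk: "0 < t k" by (rule *(1))
        have "1 / C \<le> C" using C mult_mono[of 1 C 1 C] by (simp add: field_simps)
        then have "t k * (1 / C) \<le> t k * C" using tk by (intro mult_left_mono) auto
        then have le: "t k / C \<le> C * t k" by (simp add: mult.commute)
        have "(\<integral>\<^sup>+\<tau>. z k * ennreal (C / t k) * indicator {t k / C..C * t k} \<tau> \<partial>lborel) = z k * ennreal (C / t k) * ennreal (C * t k - t k / C)"
          using le by (subst nn_integral_cmult_indicator) auto
        also have "\<dots> \<le> z k * ennreal (C / t k) * ennreal (C * t k)"
          using tk C by (intro mult_left_mono ennreal_leI) auto
        also have "\<dots> = ennreal (C / t k * (C * t k)) * z k"
        proof -
          have "Z * ennreal a * ennreal b = ennreal (a * b) * Z" if "0 \<le> a" "0 \<le> b" for a b Z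
            using that by (simp add: ennreal_mult ac_simps)
          then show ?thesis using tk C by simp
        qed
        also have "C / t k * (C * t k) = C * C" using tk by simp
        finally show "(\<integral>\<^sup>+\<tau>. z k * ennreal (C / t k) * indicator {t k / C..C * t k} \<tau> \<partial>lborel) \<le> ennreal (C * C) * z k" .
      qed
      also have "\<dots> = ennreal (C * C) * enn_powr (ennreal D * ell_qnorm q UNIV \<beta>) r"
        using 2 by (simp add: nn_integral_cmult z_def ell_qnorm_powr[symmetric] ell_qnorm_cmult)
      also have "\<dots> = enn_powr (ennreal ((C * C) powr (1/r) * D) * ell_qnorm q UNIV \<beta>) r"
        using 2 C D by (simp add: enn_powr_mult enn_powr_ennreal powr_powr powr_mult ennreal_mult mult.assoc)
      finally show "interp_qnorm \<theta> q A0 A1 f \<le> ennreal ((C * C) powr (1/r) * D) * ell_qnorm q UNIV \<beta>"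
        unfolding interp_qnorm_def using 2 by (simp add: enn_powr_le_swap)
    qed
  qed
qed

section \<open>Splitting sequences\<close>

definition part :: "(nat \<Rightarrow> (int ^ 'n) set) \<Rightarrow> (nat \<Rightarrow> int ^ 'n \<Rightarrow> 'b) \<Rightarrow> nat \<Rightarrow> int ^ 'n \<Rightarrow> 'b :: zero" where
  "part S x j m = (if m \<in> S j then x j m else 0)"

text \<open>
  \<open>splits C \<theta> q Q\<^sub>0 Q\<^sub>1 x N\<close>: cutting the index set of \<open>x\<close> in two at parameters \<open>t\<^sub>k\<close> that come within
  the factor \<open>C\<close> of every positive number bounds the interpolation quasi-norm of \<open>x\<close> for the quasi-norms \<open>Q\<^sub>0\<close>, \<open>Q\<^sub>1\<close> by \<open>C N\<close>.
\<close>

definition splits :: "real \<Rightarrow> real \<Rightarrow> ennreal \<Rightarrow> ((nat \<Rightarrow> int ^ 'n \<Rightarrow> ennreal) \<Rightarrow> ennreal) \<Rightarrow>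
    ((nat \<Rightarrow> int ^ 'n \<Rightarrow> ennreal) \<Rightarrow> ennreal) \<Rightarrow> (nat \<Rightarrow> int ^ 'n \<Rightarrow> ennreal) \<Rightarrow> ennreal \<Rightarrow> bool" where
  "splits C \<theta> q Q0 Q1 x N \<longleftrightarrow> (\<exists>t \<beta> S. (\<forall>k::int. 0 < t k) \<and> (\<forall>\<tau>>0. \<exists>k. t k / C \<le> \<tau> \<and> \<tau> \<le> C * t k) \<and>
     (\<forall>k. Q0 (part (S k) x) \<le> ennreal (t k powr \<theta>) * \<beta> k \<and> ennreal (t k) * Q1 (part (\<lambda>j. - S k j) x) \<le> ennreal (t k powr \<theta>) * \<beta> k) \<and>
     ell_qnorm q UNIV \<beta> \<le> ennreal C * N)"

text \<open>
  The entries are finite because they stand for absolute values of coefficients.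
\<close>

definition splits_all :: "real \<Rightarrow> real \<Rightarrow> ennreal \<Rightarrow> ((nat \<Rightarrow> int ^ 'n \<Rightarrow> ennreal) \<Rightarrow> ennreal) \<Rightarrow>
    ((nat \<Rightarrow> int ^ 'n \<Rightarrow> ennreal) \<Rightarrow> ennreal) \<Rightarrow> ((nat \<Rightarrow> int ^ 'n \<Rightarrow> ennreal) \<Rightarrow> ennreal) \<Rightarrow> bool" where
  "splits_all C \<theta> q Q0 Q1 Q \<longleftrightarrow>
     (\<forall>x. (\<forall>j m. x j m < top) \<longrightarrow> Q x < top \<longrightarrow> splits C \<theta> q Q0 Q1 x (Q x))"

lemma level_norm_exponent:
  fixes \<Omega> :: "(real ^ 'a) set"
  shows "level_norm s' p \<Omega> x j = ennreal (2 powr (real j * (s' - s))) * level_norm s p \<Omega> x j"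
proof -
  have "real j * (s' - real CARD('a) * inv_exp p) = real j * (s' - s) + real j * (s - real CARD('a) * inv_exp p)"
    by (simp add: algebra_simps)
  then show ?thesis by (simp add: level_norm_def powr_add ennreal_mult mult.assoc)
qed

lemma level_norm_part_0:
  assumes "0 < p" "S j = {}"
  shows "level_norm s p \<Omega> (part S x) j = 0"
  using assms by (simp add: level_norm_def part_def[abs_def])

text \<open>
  For equal integrability exponents the sequence is cut at a level. A majorant of the level norms that varies slowly
  compared with the smoothness gap replaces the usual Hardy inequalities.
\<close>

lemma splits_same_p:
  fixes \<Omega> :: "(real ^ 'n) set"
  assumes p: "0 < p" and q: "0 < q" "0 < q0" "0 < q1" and s: "s0 \<noteq> s1" and th: "0 < \<theta>" "\<theta> < 1"
    and ss: "s = (1 - \<theta>) * s0 + \<theta> * s1"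
  obtains C where "1 \<le> C" "splits_all C \<theta> q (seq_qnorm s0 p q0 \<Omega>) (seq_qnorm s1 p q1 \<Omega>) (seq_qnorm s p q \<Omega>)"
proof -
  let ?F = "seq_qnorm s1 p q1 \<Omega>"
  let ?Q = "seq_qnorm s p q \<Omega>"
  define \<delta> where "\<delta> = min \<bar>s0 - s\<bar> \<bar>s1 - s\<bar> / 2"
  have e0: "s0 - s = \<theta> * (s0 - s1)" and e1: "s1 - s = - (1 - \<theta>) * (s0 - s1)" by (simp_all add: ss algebra_simps)
  have \<delta>: "0 < \<delta>" "2 * \<delta> \<le> \<bar>s0 - s\<bar>" "2 * \<delta> \<le> \<bar>s1 - s\<bar>" using e0 e1 th s by (auto simp: \<delta>_def)
  obtain G0 where G0: "0 < G0" "\<And>(I::nat set) h. inj_on h I \<Longrightarrow> ell_qnorm q0 I (\<lambda>i. ennreal (2 powr (- \<delta> * \<bar>real_of_int (h i)\<bar>))) \<le> ennreal G0"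
    using ell_qnorm_geometric[OF q(2) \<delta>(1)] by blast
  obtain G1 where G1: "0 < G1" "\<And>(I::nat set) h. inj_on h I \<Longrightarrow> ell_qnorm q1 I (\<lambda>i. ennreal (2 powr (- \<delta> * \<bar>real_of_int (h i)\<bar>))) \<le> ennreal G1"
    using ell_qnorm_geometric[OF q(3) \<delta>(1)] by blast
  obtain G where G: "0 < G"
    "\<And>(I::int set) h x. inj_on h I \<Longrightarrow>
       ell_qnorm q I (\<lambda>i. SUP j. ennreal (2 powr (- \<delta> * \<bar>real_of_int (h i - int j)\<bar>)) * x j) \<le> ennreal G * ell_qnorm q UNIV x"
    using ell_qnorm_decay_le[OF q(1) \<delta>(1)] by blast
  define M where "M = G0 + G1"
  define C where "C = 2 powr \<bar>s0 - s1\<bar> + M * G"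
  have C1: "1 \<le> 2 powr \<bar>s0 - s1\<bar>" by (simp add: ge_one_powr_ge_zero)
  show ?thesis
  proof (rule that[of C])
    show "1 \<le> C" using C1 G G0 G1 by (simp add: C_def M_def add_increasing2)
    show "splits_all C \<theta> q (seq_qnorm s0 p q0 \<Omega>) ?F ?Q"
      unfolding splits_all_def
    proof (intro allI impI)
      fix x :: "nat \<Rightarrow> int ^ 'n \<Rightarrow> ennreal"
      define lev where "lev = level_norm s p \<Omega> x"
      \<comment> \<open>The least majorant of the level norms that varies by at most \<open>2\<^bsup>\<delta>\<^esup>\<close> per level; it has an equivalent quasi-norm.\<close>
      define b where "b k = (SUP j. ennreal (2 powr (- \<delta> * \<bar>real_of_int (k - int j)\<bar>)) * lev j)" for k
      define t where "t k = 2 powr (real_of_int k * (s0 - s1))" for k :: int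
      \<comment> \<open>The levels on which the weight \<open>2\<^bsup>(j-k)(s0-s)\<^esup>\<close> decays with the distance from \<open>k\<close>.\<close>
      define S :: "int \<Rightarrow> nat \<Rightarrow> (int ^ 'n) set" where "S k j = (if (s0 - s) * real_of_int (int j - k) \<le> 0 then UNIV else {})" for k j
      have lev_le: "lev j \<le> ennreal (2 powr (\<delta> * \<bar>real_of_int (k - int j)\<bar>)) * b k" for j k
      proof -
        have "lev j = ennreal (2 powr (\<delta> * \<bar>real_of_int (k - int j)\<bar>)) * (ennreal (2 powr (- \<delta> * \<bar>real_of_int (k - int j)\<bar>)) * lev j)"
          by (simp add: mult.assoc[symmetric] flip: ennreal_mult powr_add)
        also have "\<dots> \<le> ennreal (2 powr (\<delta> * \<bar>real_of_int (k - int j)\<bar>)) * b k"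
          unfolding b_def by (intro mult_left_mono SUP_upper) auto
        finally show ?thesis .
      qed
      have main: "seq_qnorm s' p q' \<Omega> (part T x) \<le> ennreal (2 powr (real_of_int k * (s' - s)) * M) * b k"
        if q': "0 < q'" and G': "ell_qnorm q' UNIV (\<lambda>j::nat. ennreal (2 powr (- \<delta> * \<bar>real_of_int (k - int j)\<bar>))) \<le> ennreal M"
          and T: "\<And>j. T j \<noteq> {} \<Longrightarrow> (s' - s) * real_of_int (int j - k) \<le> - (2 * \<delta>) * \<bar>real_of_int (k - int j)\<bar>" for s' q' T k
      proof -
        have "level_norm s' p \<Omega> (part T x) j \<le> (ennreal (2 powr (real_of_int k * (s' - s))) * b k) * ennreal (2 powr (- \<delta> * \<bar>real_of_int (k - int j)\<bar>))" for j
        proof (cases "T j = {}")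
          case True
          then show ?thesis using level_norm_part_0[where S = T and j = j, OF p True] by simp
        next
          case False
          have "level_norm s' p \<Omega> (part T x) j \<le> level_norm s' p \<Omega> x j" by (intro level_norm_mono p) (auto simp: part_def)
          also have "\<dots> = ennreal (2 powr (real j * (s' - s))) * lev j" unfolding lev_def by (rule level_norm_exponent)
          also have "\<dots> \<le> ennreal (2 powr (real j * (s' - s))) * (ennreal (2 powr (\<delta> * \<bar>real_of_int (k - int j)\<bar>)) * b k)"
            by (intro mult_left_mono lev_le) simp
          also have "\<dots> = ennreal (2 powr (real j * (s' - s) + \<delta> * \<bar>real_of_int (k - int j)\<bar>)) * b k"
            by (simp add: mult.assoc[symmetric] powr_add ennreal_mult)
          also have "\<dots> \<le> ennreal (2 powr (real_of_int k * (s' - s) + - \<delta> * \<bar>real_of_int (k - int j)\<bar>)) * b k"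
          proof (intro mult_right_mono ennreal_leI powr_mono)
            show "real j * (s' - s) + \<delta> * \<bar>real_of_int (k - int j)\<bar> \<le> real_of_int k * (s' - s) + - \<delta> * \<bar>real_of_int (k - int j)\<bar>"
              using T[OF False] by (simp add: algebra_simps)
          qed auto
          also have "\<dots> = (ennreal (2 powr (real_of_int k * (s' - s))) * b k) * ennreal (2 powr (- \<delta> * \<bar>real_of_int (k - int j)\<bar>))"
            unfolding powr_add by (simp add: ennreal_mult ac_simps)
          finally show ?thesis .
        qed
        then have "seq_qnorm s' p q' \<Omega> (part T x) \<le> ell_qnorm q' UNIV (\<lambda>j. (ennreal (2 powr (real_of_int k * (s' - s))) * b k) * ennreal (2 powr (- \<delta> * \<bar>real_of_int (k - int j)\<bar>)))"
          unfolding seq_qnorm_def by (intro ell_qnorm_mono q')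
        also have "\<dots> \<le> (ennreal (2 powr (real_of_int k * (s' - s))) * b k) * ennreal M"
          unfolding ell_qnorm_cmult[OF q'] by (intro mult_left_mono G') simp
        also have "\<dots> = ennreal (2 powr (real_of_int k * (s' - s)) * M) * b k"
          by (subst ennreal_mult') (simp_all add: ac_simps)
        finally show ?thesis .
      qed
      have M0: "0 \<le> M" using G0 G1 by (simp add: M_def)
      have ell0: "ell_qnorm q0 UNIV (\<lambda>j::nat. ennreal (2 powr (- \<delta> * \<bar>real_of_int (k - int j)\<bar>))) \<le> ennreal M" for k
        by (rule order_trans[OF G0(2)]) (use G1 in \<open>auto simp: inj_on_def M_def intro!: ennreal_leI\<close>)
      have ell1: "ell_qnorm q1 UNIV (\<lambda>j::nat. ennreal (2 powr (- \<delta> * \<bar>real_of_int (k - int j)\<bar>))) \<le> ennreal M" for k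
        by (rule order_trans[OF G1(2)]) (use G0 in \<open>auto simp: inj_on_def M_def intro!: ennreal_leI\<close>)
      have P0: "seq_qnorm s0 p q0 \<Omega> (part (S k) x) \<le> ennreal (t k powr \<theta>) * (ennreal M * b k)" for k
      proof -
        have "seq_qnorm s0 p q0 \<Omega> (part (S k) x) \<le> ennreal (2 powr (real_of_int k * (s0 - s)) * M) * b k"
        proof (rule main[OF q(2) ell0])
          fix j assume "S k j \<noteq> {}"
          then have "(s0 - s) * real_of_int (int j - k) \<le> 0" by (auto simp: S_def split: if_splits)
          then have "(s0 - s) * real_of_int (int j - k) = - (\<bar>s0 - s\<bar> * \<bar>real_of_int (k - int j)\<bar>)"
            by (simp add: abs_mult[symmetric] abs_minus_commute) (simp add: abs_if algebra_simps)
          also have "\<dots> \<le> - (2 * \<delta>) * \<bar>real_of_int (k - int j)\<bar>" using mult_right_mono[OF \<delta>(2), of "\<bar>real_of_int (k - int j)\<bar>"] by simp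
          finally show "(s0 - s) * real_of_int (int j - k) \<le> - (2 * \<delta>) * \<bar>real_of_int (k - int j)\<bar>" .
        qed
        also have "\<dots> = ennreal (t k powr \<theta>) * (ennreal M * b k)"
          using M0 by (simp add: t_def powr_powr e0 ennreal_mult mult.assoc mult.commute[of \<theta>])
        finally show ?thesis .
      qed
      have P1: "ennreal (t k) * ?F (part (\<lambda>j. - S k j) x) \<le> ennreal (t k powr \<theta>) * (ennreal M * b k)" for k
      proof -
        have "?F (part (\<lambda>j. - S k j) x) \<le> ennreal (2 powr (real_of_int k * (s1 - s)) * M) * b k"
        proof (rule main[OF q(3) ell1])
          fix j assume "- S k j \<noteq> {}"
          then have "(s0 - s) * real_of_int (int j - k) > 0" by (auto simp: S_def split: if_splits)
          then have "0 < \<theta> * ((s0 - s1) * real_of_int (int j - k))" by (simp only: e0 mult.assoc)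
          then have "0 < (s0 - s1) * real_of_int (int j - k)" by (rule zero_less_mult_pos[OF _ th(1)])
          then have "0 < (1 - \<theta>) * ((s0 - s1) * real_of_int (int j - k))" by (rule mult_pos_pos[rotated]) (use th in simp)
          then have "(s1 - s) * real_of_int (int j - k) \<le> 0" unfolding e1 by (simp add: algebra_simps)
          then have "(s1 - s) * real_of_int (int j - k) = - (\<bar>s1 - s\<bar> * \<bar>real_of_int (k - int j)\<bar>)"
            by (simp add: abs_mult[symmetric] abs_minus_commute) (simp add: abs_if algebra_simps)
          also have "\<dots> \<le> - (2 * \<delta>) * \<bar>real_of_int (k - int j)\<bar>" using mult_right_mono[OF \<delta>(3), of "\<bar>real_of_int (k - int j)\<bar>"] by simp
          finally show "(s1 - s) * real_of_int (int j - k) \<le> - (2 * \<delta>) * \<bar>real_of_int (k - int j)\<bar>" .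
        qed
        then have "ennreal (t k) * ?F (part (\<lambda>j. - S k j) x) \<le> ennreal (t k) * (ennreal (2 powr (real_of_int k * (s1 - s)) * M) * b k)"
          by (rule mult_left_mono) simp
        also have "\<dots> = ennreal (t k * 2 powr (real_of_int k * (s1 - s))) * (ennreal M * b k)"
          using M0 by (simp add: t_def ennreal_mult mult.assoc)
        also have "t k * 2 powr (real_of_int k * (s1 - s)) = t k powr \<theta>"
        proof -
          have "real_of_int k * (s0 - s1) + real_of_int k * (s1 - s) = real_of_int k * (s0 - s1) * \<theta>" by (simp add: e1 algebra_simps)
          then show ?thesis by (simp add: t_def powr_powr flip: powr_add)
        qed
        finally show ?thesis .
      qed
      have cover: "\<exists>k. t k / C \<le> \<tau> \<and> \<tau> \<le> C * t k" if \<tau>: "0 < \<tau>" for \<tau>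
      proof -
        define y where "y = log 2 \<tau> / (s0 - s1)"
        define k where "k = \<lfloor>y\<rfloor>"
        have "\<tau> = 2 powr (y * (s0 - s1))" using \<tau> s by (simp add: y_def)
        then have \<tau>t: "\<tau> = t k * 2 powr ((y - real_of_int k) * (s0 - s1))" by (simp add: t_def algebra_simps flip: powr_add)
        have "\<bar>y - real_of_int k\<bar> \<le> 1" unfolding k_def by linarith
        then have "\<bar>y - real_of_int k\<bar> * \<bar>s0 - s1\<bar> \<le> 1 * \<bar>s0 - s1\<bar>" by (intro mult_right_mono) auto
        then have "\<bar>(y - real_of_int k) * (s0 - s1)\<bar> \<le> \<bar>s0 - s1\<bar>" by (simp add: abs_mult)
        then have e: "2 powr ((y - real_of_int k) * (s0 - s1)) \<le> 2 powr \<bar>s0 - s1\<bar>" "2 powr (- \<bar>s0 - s1\<bar>) \<le> 2 powr ((y - real_of_int k) * (s0 - s1))"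
          by (auto intro!: powr_mono)
        have CC: "2 powr \<bar>s0 - s1\<bar> \<le> C" using M0 G by (simp add: C_def)
        have tk: "0 < t k" by (simp add: t_def)
        have "t k / C \<le> t k / 2 powr \<bar>s0 - s1\<bar>" using CC tk C1 by (intro divide_left_mono) auto
        also have "\<dots> = t k * 2 powr (- \<bar>s0 - s1\<bar>)" by (simp add: powr_minus_divide)
        also have "\<dots> \<le> \<tau>" unfolding \<tau>t using tk e by (intro mult_left_mono) auto
        finally have "t k / C \<le> \<tau>" .
        moreover have "\<tau> \<le> C * t k" unfolding \<tau>t using tk order_trans[OF e(1) CC] by (simp add: mult.commute)
        ultimately show ?thesis by blast
      qed
      have "ell_qnorm q UNIV (\<lambda>k. ennreal M * b k) \<le> ennreal M * (ennreal G * ?Q x)"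
        unfolding ell_qnorm_cmult[OF q(1)] b_def seq_qnorm_def lev_def[symmetric] by (intro mult_left_mono G(2)) auto
      also have "\<dots> = ennreal (M * G) * ?Q x" using M0 G by (simp add: ennreal_mult mult.assoc)
      also have "\<dots> \<le> ennreal C * ?Q x" using C1 by (intro mult_right_mono ennreal_leI) (auto simp: C_def)
      finally have N: "ell_qnorm q UNIV (\<lambda>k. ennreal M * b k) \<le> ennreal C * ?Q x" .
      show "splits C \<theta> q (seq_qnorm s0 p q0 \<Omega>) ?F x (?Q x)"
        unfolding splits_def using cover P0 P1 N
        by (intro exI[of _ t] exI[of _ "\<lambda>k. ennreal M * b k"] exI[of _ S]) (auto simp: t_def)
    qed
  qed
qed

text \<open>
  After rescaling, \<open>g\<close> is within \<open>|v| / 2\<close> of the identity up to a constant, so that it takes all values by the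
  intermediate value theorem.
\<close>

lemma almost_linear_surj:
  fixes g :: "real \<Rightarrow> real"
  assumes c: "c \<noteq> 0" and g: "\<And>v v'. \<bar>g v - g v' - c * (v - v')\<bar> \<le> \<bar>c\<bar> / 2 * \<bar>v - v'\<bar>"
  shows "\<exists>v. g v = y"
proof -
  define h where "h v = g (v / c)" for v
  have h: "\<bar>h v - h v' - (v - v')\<bar> \<le> \<bar>v - v'\<bar> / 2" for v v'
  proof -
    have "c * (v / c - v' / c) = v - v'" "\<bar>c\<bar> / 2 * \<bar>v / c - v' / c\<bar> = \<bar>v - v'\<bar> / 2"
      using c by (simp_all add: field_simps abs_mult flip: diff_divide_distrib)
    then show ?thesis using g[of "v / c" "v' / c"] by (simp add: h_def)
  qed
  have hlo: "- (\<bar>v - v'\<bar> / 2) \<le> h v - h v' - (v - v')" and hup: "h v - h v' - (v - v') \<le> \<bar>v - v'\<bar> / 2" for v v'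
    using h[of v v'] unfolding abs_le_iff by linarith+
  have cont: "isCont h v" for v
    unfolding isCont_def LIM_def
  proof (intro allI impI)
    fix e :: real assume "0 < e"
    show "\<exists>d>0. \<forall>x. x \<noteq> v \<and> dist x v < d \<longrightarrow> dist (h x) (h v) < e"
    proof (intro exI[of _ "e / 2"] conjI allI impI)
      fix x assume "x \<noteq> v \<and> dist x v < e / 2"
      then have "\<bar>x - v\<bar> < e / 2" by (simp add: dist_real_def)
      moreover define w where "w = \<bar>x - v\<bar>"
      ultimately have "w < e / 2" "- (w / 2) \<le> h x - h v - (x - v)" "h x - h v - (x - v) \<le> w / 2" "x - v \<le> w" "- (x - v) \<le> w" "0 \<le> w"
        using hlo[of x v] hup[of x v] by (simp_all only: w_def abs_ge_self abs_ge_minus_self abs_ge_zero)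
      then have "h x - h v < e \<and> h v - h x < e" by linarith
      then show "dist (h x) (h v) < e" by (simp add: dist_real_def abs_less_iff)
    qed (use \<open>0 < e\<close> in simp)
  qed
  define V where "V = 2 * \<bar>y - h 0\<bar>"
  have "h (- V) \<le> y" "y \<le> h V" "- V \<le> V"
  proof -
    have V: "0 \<le> V" "y - h 0 \<le> V / 2" "- (V / 2) \<le> y - h 0" by (auto simp: V_def)
    show "h (- V) \<le> y" using hup[of "- V" 0] V by simp
    show "y \<le> h V" using hlo[of V 0] V by simp
    show "- V \<le> V" using V by simp
  qed
  then obtain v where "h v = y" using IVT[of h "- V" y V] cont by auto
  then show ?thesis by (auto simp: h_def)
qed

lemma geometric_covering:
  fixes t :: "int \<Rightarrow> real"
  assumes pos: "\<And>k. 0 < t k" and lo: "\<And>k. sqrt 2 * t k \<le> t (k + 1)" and up: "\<And>k. t (k + 1) \<le> C * t k" and \<tau>: "0 < \<tau>" and C: "1 \<le> C"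
  shows "\<exists>k. t k / C \<le> \<tau> \<and> \<tau> \<le> C * t k"
proof -
  have grow: "sqrt 2 ^ n * t k \<le> t (k + int n)" for k n
  proof (induction n)
    case (Suc n)
    have "sqrt 2 ^ Suc n * t k \<le> sqrt 2 * t (k + int n)" using Suc by simp
    also have "\<dots> \<le> t (k + int n + 1)" by (rule lo)
    finally show ?case by (simp add: add.commute add.left_commute)
  qed simp
  obtain n where n: "\<tau> / t 0 < sqrt 2 ^ n" using real_arch_pow[of "sqrt 2" "\<tau> / t 0"] by auto
  have n1: "\<tau> < t (int n)"
  proof -
    have "\<tau> < sqrt 2 ^ n * t 0" using n pos[of 0] by (simp add: field_simps)
    also have "\<dots> \<le> t (0 + int n)" by (rule grow)
    finally show ?thesis by simp
  qed
  obtain m where m: "t 0 / \<tau> < sqrt 2 ^ m" using real_arch_pow[of "sqrt 2" "t 0 / \<tau>"] by auto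
  have m1: "t (- int m) \<le> \<tau>"
  proof -
    have "sqrt 2 ^ m * t (- int m) \<le> t 0" using grow[of m "- int m"] by simp
    also have "\<dots> < sqrt 2 ^ m * \<tau>" using m \<tau> by (simp add: field_simps)
    finally show ?thesis by simp
  qed
  have "\<exists>k. t k \<le> \<tau> \<and> \<tau> < t (k + 1)"
  proof (rule ccontr)
    assume neg: "\<not> (\<exists>k. t k \<le> \<tau> \<and> \<tau> < t (k + 1))"
    have "t (- int m + int i) \<le> \<tau>" for i
    proof (induction i)
      case (Suc i)
      then show ?case using neg by (auto simp: not_less algebra_simps)
    qed (use m1 in simp)
    from this[of "m + n"] show False using n1 by simp
  qed
  then obtain k where k: "t k \<le> \<tau>" "\<tau> < t (k + 1)" by blast
  have "t k / C \<le> t k / 1" using pos[of k] C by (intro divide_left_mono) auto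
  then show ?thesis using k up[of k] by (intro exI[of _ k]) auto
qed

text \<open>
  Here level \<open>j\<close> is cut at a height. Let \<open>y\<close> be the entries with the weights of the \<open>\<ell>\<^sub>r\<close> space and \<open>B j v\<close> the sum
  of their \<open>r\<close>-th powers, smoothed so that it is concentrated at the height \<open>2\<^sup>v\<close> but changes slowly with \<open>v\<close>. Up to
  constants, the entries on the appropriate side of the height have at most the quasi-norm
  \<open>2\<^bsup>v (1 - r / p')\<^esup> (B j v)\<^bsup>1 / p'\<^esup>\<close> for the exponent \<open>p'\<close>, since the decay of the smoothing kernel is weaker than
  that of the powers. The logarithm \<open>\<rho> j v\<close> of the ratio of the two end point quasi-norms, corrected
  by the power of \<open>B j v\<close> that the outer exponents demand, is a small perturbation of an affine function of
  \<open>v\<close>. Hence there is a height \<open>v k j\<close> at which it equals \<open>k\<close>. Summing over the levels produces the powers of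
  \<open>bh k = (\<Sum>j. B j (v k j))\<close> required at the parameter \<open>t k\<close>. Finally the sum over \<open>k\<close> of \<open>bh k\<close> is at most a
  multiple of the sum of all \<open>y\<^sup>r\<close>, because the heights \<open>v k j\<close>, for fixed \<open>j\<close>, are separated.
\<close>

lemma splits_diagonal:
  fixes \<Omega> :: "(real ^ 'n) set"
  assumes bd: "bounded \<Omega>" and r: "0 < r" and p: "0 < p0" "0 < p1" and q: "0 < q0" "0 < q1" and th: "0 < \<theta>" "\<theta> < 1"
    and ss: "s = (1 - \<theta>) * s0 + \<theta> * s1"
    and rp: "1 / r = (1 - \<theta>) * inv_exp p0 + \<theta> * inv_exp p1" and rq: "1 / r = (1 - \<theta>) * inv_exp q0 + \<theta> * inv_exp q1"
    and neq: "inv_exp p0 \<noteq> inv_exp p1"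
  obtains C where "1 \<le> C" "splits_all C \<theta> (ennreal r) (seq_qnorm s0 p0 q0 \<Omega>) (seq_qnorm s1 p1 q1 \<Omega>) (seq_qnorm s (ennreal r) (ennreal r) \<Omega>)"
proof -
  let ?E = "seq_qnorm s0 p0 q0 \<Omega>"
  let ?F = "seq_qnorm s1 p1 q1 \<Omega>"
  let ?Q = "seq_qnorm s (ennreal r) (ennreal r) \<Omega>"
  let ?M = "meeting_cubes \<Omega>"
  define n where "n = real CARD('n)"
  have fin: "finite (?M l)" for l using bounded_meeting_cubes[OF bd] by blast
  define a0 a1 e0 e1 where "a0 = inv_exp p0" and "a1 = inv_exp p1" and "e0 = inv_exp q0" and "e1 = inv_exp q1"
  define a where "a = a0 - a1"
  have a: "a \<noteq> 0" using neq by (simp add: a_def a0_def a1_def)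
  have r0: "a0 - 1 / r = \<theta> * a" and r1: "a1 - 1 / r = - (1 - \<theta>) * a"
    using rp by (simp_all add: a_def a0_def a1_def algebra_simps)
  have re: "e0 + \<theta> * (e1 - e0) = 1 / r" using rq by (simp add: e0_def e1_def algebra_simps)
  define D where "D = a + (e1 - e0)"
  define gap where "gap p' = (if p' = top then 1 else \<bar>enn2real p' - r\<bar>)" for p' :: ennreal
  have gap: "0 < gap p'" if "0 < p'" "inv_exp p' \<noteq> 1 / r" for p'
    using that(1) by (rule exponent_cases) (use that(2) in \<open>auto simp: gap_def\<close>)
  have ne: "a0 \<noteq> 1 / r" "a1 \<noteq> 1 / r" using r0 r1 a th by auto
  \<comment> \<open>The rate of the smoothing kernel. The terms keep it below the gaps of the exponents, \<open>\<rho>\<close> close to affine, and \<open>t\<close> close to geometric.\<close>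
  define \<delta> where "\<delta> = min (min (gap p0) (gap p1)) (min (r * \<bar>a\<bar> / (2 * \<bar>D\<bar> + 1)) (r * \<bar>a\<bar> / (4 * \<bar>e0 - e1\<bar> + 1)))"
  have "0 < \<delta>" using gap[OF p(1)] gap[OF p(2)] ne r a by (auto simp: \<delta>_def a0_def a1_def intro!: divide_pos_pos add_nonneg_pos)
  have \<delta>1: "\<delta> \<le> gap p0" "\<delta> \<le> gap p1" by (auto simp: \<delta>_def min_le_iff_disj)
  have \<delta>2: "\<delta> * \<bar>D\<bar> \<le> r * \<bar>a\<bar> / 2"
  proof -
    have "\<delta> \<le> r * \<bar>a\<bar> / (2 * \<bar>D\<bar> + 1)" by (simp add: \<delta>_def min_le_iff_disj)
    then have "\<delta> * (2 * \<bar>D\<bar> + 1) \<le> r * \<bar>a\<bar>" by (simp add: pos_le_divide_eq add_nonneg_pos)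
    then show ?thesis using \<open>0 < \<delta>\<close> by (simp add: distrib_left)
  qed
  have \<delta>3: "\<delta> * \<bar>e0 - e1\<bar> * (2 / (r * \<bar>a\<bar>)) \<le> 1 / 2"
  proof -
    have "\<delta> \<le> r * \<bar>a\<bar> / (4 * \<bar>e0 - e1\<bar> + 1)" by (simp add: \<delta>_def min_le_iff_disj)
    then have "\<delta> * (4 * \<bar>e0 - e1\<bar> + 1) \<le> r * \<bar>a\<bar>" by (simp add: pos_le_divide_eq add_nonneg_pos)
    then have "4 * (\<delta> * \<bar>e0 - e1\<bar>) \<le> r * \<bar>a\<bar>" using \<open>0 < \<delta>\<close> by (simp add: distrib_left)
    then show ?thesis using r a by (simp add: field_simps)
  qed
  define \<sigma> where "\<sigma> = 2 / (3 * r * \<bar>a\<bar>)"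
  have \<sigma>: "0 < \<sigma>" using r a by (simp add: \<sigma>_def)
  define G where "G = enn2real (geo_sum (\<delta> * \<sigma>))"
  have "geo_sum (\<delta> * \<sigma>) < top" using \<open>0 < \<delta>\<close> \<sigma> by (intro geo_sum_finite) simp
  then have G: "geo_sum (\<delta> * \<sigma>) = ennreal G" "0 \<le> G" by (auto simp: G_def)
  define Cg where "Cg = 2 powr (\<delta> * \<sigma>) * G"
  have Cg: "0 \<le> Cg" using G by (simp add: Cg_def)
  define C where "C = 4 + Cg powr (1 / r)"
  have C: "4 \<le> C" by (simp add: C_def)
  show ?thesis
  proof (rule that[of C])
    show "1 \<le> C" using C by simp
    have "splits C \<theta> (ennreal r) ?E ?F x (?Q x)"
      if xfin: "\<And>j m. x j m < top" and finx: "?Q x < top" for x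
    proof -
      define X where "X j m = enn2real (x j m)" for j m
      have X0: "\<And>j m. 0 \<le> X j m" by (simp add: X_def)
      let ?x = "\<lambda>j m. ennreal (X j m)"
      have x: "x = ?x" using xfin by (simp add: X_def fun_eq_iff)
      have finN: "?Q ?x < top" using finx by (simp only: x)
      define N where "N = ?Q ?x"
      define J where "J = {j. \<exists>m\<in>?M j. 0 < X j m}"
      have outJ: "level_norm s' p' \<Omega> (part S ?x) j = 0" if "j \<notin> J" "0 < p'" for s' p' S j
      proof -
        have "ell_qnorm p' (?M j) (part S ?x j) = ell_qnorm p' (?M j) (\<lambda>m. 0)"
          using that X0 by (intro ell_qnorm_cong) (auto simp: J_def part_def less_le)
        then show ?thesis using that by (simp add: level_norm_def)
      qed
      have "splits C \<theta> (ennreal r) ?E ?F ?x (?Q ?x)"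
      proof (cases "J = {}")
        case True
        have zero: "seq_qnorm s' p' q' \<Omega> (part S ?x) = 0" if "0 < p'" "0 < q'" for s' p' q' S
        proof -
          have "level_norm s' p' \<Omega> (part S ?x) = (\<lambda>_. 0)" using outJ True that by (intro ext) auto
          then show ?thesis using that by (simp add: seq_qnorm_def)
        qed
        have "\<exists>k. 2 powr real_of_int k / C \<le> \<tau> \<and> \<tau> \<le> C * 2 powr real_of_int k" if "0 < \<tau>" for \<tau>
        proof (rule geometric_covering)
          fix k
          show "sqrt 2 * 2 powr real_of_int k \<le> 2 powr real_of_int (k + 1)"
            using mult_right_mono[of "sqrt 2" 2 "2 powr real_of_int k"] by (simp add: powr_add sqrt2_less_2 less_imp_le mult.commute)
          show "2 powr real_of_int (k + 1) \<le> C * 2 powr real_of_int k" using C by (simp add: powr_add)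
        qed (use that C in auto)
        then show ?thesis unfolding splits_def
          by (intro exI[of _ "\<lambda>k. 2 powr real_of_int k"] exI[of _ "\<lambda>_. 0"] exI[of _ "\<lambda>_ _. {}"]) (use zero p q r in auto)
      next
        case False
        define y where "y j m = 2 powr (real j * (s - n / r)) * X j m" for j m
        have y0: "0 \<le> y j m" for j m using X0 by (simp add: y_def)
        have ypos: "0 < y j m \<longleftrightarrow> 0 < X j m" for j m by (simp add: y_def zero_less_mult_iff)
        define ly where "ly j m = log 2 (y j m)" for j m
        have yly: "y j m = 2 powr ly j m" if "0 < X j m" for j m using that ypos by (simp add: ly_def)
        have Nr: "enn_powr N r = (\<integral>\<^sup>+j. ennreal (\<Sum>m\<in>?M j. y j m powr r) \<partial>count_space UNIV)"
        proof -
          have "enn_powr (level_norm s (ennreal r) \<Omega> ?x j) r = ennreal (\<Sum>m\<in>?M j. y j m powr r)" for j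
          proof -
            have "enn_powr (level_norm s (ennreal r) \<Omega> ?x j) r = ennreal ((2 powr (real j * (s - n / r))) powr r) * (\<Sum>m\<in>?M j. ennreal (X j m powr r))"
              using r fin by (simp add: level_norm_def enn_powr_mult enn_powr_ennreal X0 ell_qnorm_powr nn_integral_count_space_finite n_def)
            also have "\<dots> = ennreal (\<Sum>m\<in>?M j. y j m powr r)"
              by (simp add: y_def powr_mult X0 sum_nonneg ennreal_mult flip: sum_distrib_left)
            finally show ?thesis .
          qed
          then show ?thesis unfolding N_def seq_qnorm_def using r by (simp add: ell_qnorm_powr)
        qed
        define B where "B j v = (\<Sum>m\<in>?M j. y j m powr r * 2 powr (- \<delta> * \<bar>ly j m - v\<bar>))" for j v
        have Bpos: "0 < B j v" if j: "j \<in> J" for j v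
        proof -
          obtain m where m: "m \<in> ?M j" "0 < X j m" using j by (auto simp: J_def)
          show ?thesis unfolding B_def
            by (rule sum_pos2[OF fin m(1)]) (use m ypos[of j m] y0 in \<open>auto\<close>)
        qed
        have B0: "0 \<le> B j v" for j v by (auto simp: B_def intro!: sum_nonneg)
        have Blip: "B j v \<le> 2 powr (\<delta> * \<bar>v - v'\<bar>) * B j v'" for j v v'
        proof -
          have "B j v \<le> (\<Sum>m\<in>?M j. 2 powr (\<delta> * \<bar>v - v'\<bar>) * (y j m powr r * 2 powr (- \<delta> * \<bar>ly j m - v'\<bar>)))"
            unfolding B_def
          proof (rule sum_mono)
            fix m
            have "\<bar>ly j m - v'\<bar> - \<bar>v - v'\<bar> \<le> \<bar>ly j m - v\<bar>" by linarith
            then have "\<delta> * (\<bar>ly j m - v'\<bar> - \<bar>v - v'\<bar>) \<le> \<delta> * \<bar>ly j m - v\<bar>" using \<open>0 < \<delta>\<close> by (intro mult_left_mono) auto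
            then have "2 powr (- \<delta> * \<bar>ly j m - v\<bar>) \<le> 2 powr (\<delta> * \<bar>v - v'\<bar> + - \<delta> * \<bar>ly j m - v'\<bar>)" by (intro powr_mono) (auto simp: algebra_simps)
            also have "\<dots> = 2 powr (\<delta> * \<bar>v - v'\<bar>) * 2 powr (- \<delta> * \<bar>ly j m - v'\<bar>)" by (rule powr_add)
            finally have "y j m powr r * 2 powr (- \<delta> * \<bar>ly j m - v\<bar>) \<le> y j m powr r * (2 powr (\<delta> * \<bar>v - v'\<bar>) * 2 powr (- \<delta> * \<bar>ly j m - v'\<bar>))"
              by (intro mult_left_mono) auto
            then show "y j m powr r * 2 powr (- \<delta> * \<bar>ly j m - v\<bar>) \<le> 2 powr (\<delta> * \<bar>v - v'\<bar>) * (y j m powr r * 2 powr (- \<delta> * \<bar>ly j m - v'\<bar>))"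
              by (simp only: ac_simps)
          qed
          then show ?thesis by (simp add: B_def sum_distrib_left)
        qed
        define lB where "lB j v = log 2 (B j v)" for j v
        have BlB: "B j v = 2 powr lB j v" if "j \<in> J" for j v using Bpos[OF that] by (simp add: lB_def)
        have lBlip: "\<bar>lB j v - lB j v'\<bar> \<le> \<delta> * \<bar>v - v'\<bar>" if j: "j \<in> J" for j v v'
        proof -
          have "lB j v - lB j v' \<le> \<delta> * \<bar>v - v'\<bar>" for v v'
          proof -
            have "2 powr lB j v \<le> 2 powr (\<delta> * \<bar>v - v'\<bar> + lB j v')"
              using Blip[of j v v'] by (simp add: BlB[OF j] powr_add)
            then show ?thesis by simp
          qed
          from this[of v v'] this[of v' v] show ?thesis by (simp add: abs_minus_commute abs_le_iff)
        qed
        define lW where "lW j = real j * (s0 - n * a0 - s1 + n * a1)" for j :: nat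
        define \<rho> where "\<rho> j v = lW j + D * lB j v - r * a * v" for j v
        have \<rho>: "\<bar>\<rho> j v - \<rho> j v' - (- r * a) * (v - v')\<bar> \<le> \<bar>- r * a\<bar> / 2 * \<bar>v - v'\<bar>" if j: "j \<in> J" for j v v'
        proof -
          have "\<rho> j v - \<rho> j v' - (- r * a) * (v - v') = D * (lB j v - lB j v')" by (simp add: \<rho>_def algebra_simps)
          then have "\<bar>\<rho> j v - \<rho> j v' - (- r * a) * (v - v')\<bar> = \<bar>D\<bar> * \<bar>lB j v - lB j v'\<bar>" by (simp add: abs_mult)
          also have "\<dots> \<le> \<bar>D\<bar> * (\<delta> * \<bar>v - v'\<bar>)" by (intro mult_left_mono lBlip[OF j]) auto
          also have "\<dots> \<le> (r * \<bar>a\<bar> / 2) * \<bar>v - v'\<bar>" using mult_right_mono[OF \<delta>2, of "\<bar>v - v'\<bar>"] by (simp add: ac_simps)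
          finally show ?thesis using r by (simp add: abs_mult)
        qed
        have "\<exists>v. \<forall>j\<in>J. \<rho> j (v j) = real_of_int k" for k
        proof -
          have "\<exists>v. \<rho> j v = real_of_int k" if "j \<in> J" for j
            by (rule almost_linear_surj[OF _ \<rho>[OF that]]) (use r a in auto)
          then show ?thesis by metis
        qed
        then obtain v where v: "\<And>k j. j \<in> J \<Longrightarrow> \<rho> j (v k j) = real_of_int k" by metis
        have \<rho>lo: "r * \<bar>a\<bar> / 2 * \<bar>w - w'\<bar> \<le> \<bar>\<rho> j w - \<rho> j w'\<bar>" and \<rho>up: "\<bar>\<rho> j w - \<rho> j w'\<bar> \<le> 3 * r * \<bar>a\<bar> / 2 * \<bar>w - w'\<bar>" if j: "j \<in> J" for j w w'
        proof -
          have eq: "\<bar>(- r * a) * (w - w')\<bar> = r * \<bar>a\<bar> * \<bar>w - w'\<bar>" using r by (simp add: abs_mult)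
          have "\<bar>\<rho> j w - \<rho> j w' - (- r * a) * (w - w')\<bar> \<le> r * \<bar>a\<bar> * \<bar>w - w'\<bar> / 2" using \<rho>[OF j, of w w'] r by (simp add: abs_mult)
          then have "r * \<bar>a\<bar> * \<bar>w - w'\<bar> / 2 \<le> \<bar>\<rho> j w - \<rho> j w'\<bar> \<and> \<bar>\<rho> j w - \<rho> j w'\<bar> \<le> 3 * (r * \<bar>a\<bar> * \<bar>w - w'\<bar>) / 2"
            using eq by linarith
          then show "r * \<bar>a\<bar> / 2 * \<bar>w - w'\<bar> \<le> \<bar>\<rho> j w - \<rho> j w'\<bar>" "\<bar>\<rho> j w - \<rho> j w'\<bar> \<le> 3 * r * \<bar>a\<bar> / 2 * \<bar>w - w'\<bar>"
            by (simp_all add: ac_simps)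
        qed
        have vstep: "\<bar>v k j - v k' j\<bar> \<le> 2 / (r * \<bar>a\<bar>) * \<bar>real_of_int k - real_of_int k'\<bar>" if j: "j \<in> J" for j k k'
        proof -
          have "r * \<bar>a\<bar> / 2 * \<bar>v k j - v k' j\<bar> \<le> \<bar>real_of_int k - real_of_int k'\<bar>" using \<rho>lo[OF j, of "v k j" "v k' j"] v[OF j] by simp
          then show ?thesis using r a by (simp add: field_simps)
        qed
        define bh where "bh k = enn2real (\<integral>\<^sup>+j. ennreal (B j (v k j)) \<partial>count_space J)" for k
        have Bsum: "(\<integral>\<^sup>+j. ennreal (B j (v k j)) \<partial>count_space J) \<le> enn_powr N r" for k
        proof -
          have "(\<integral>\<^sup>+j. ennreal (B j (v k j)) \<partial>count_space J) \<le> (\<integral>\<^sup>+j. ennreal (\<Sum>m\<in>?M j. y j m powr r) \<partial>count_space J)"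
          proof (intro nn_integral_mono ennreal_leI)
            fix j
            show "B j (v k j) \<le> (\<Sum>m\<in>?M j. y j m powr r)"
              unfolding B_def
            proof (rule sum_mono)
              fix m
              have "2 powr (- \<delta> * \<bar>ly j m - v k j\<bar>) \<le> 2 powr 0" using \<open>0 < \<delta>\<close> by (intro powr_mono) (auto simp: mult_nonneg_nonneg)
              then show "y j m powr r * 2 powr (- \<delta> * \<bar>ly j m - v k j\<bar>) \<le> y j m powr r"
                using mult_left_mono[of "2 powr (- \<delta> * \<bar>ly j m - v k j\<bar>)" 1 "y j m powr r"] by simp
            qed
          qed
          also have "\<dots> \<le> enn_powr N r" unfolding Nr by (rule nn_integral_count_space_mono_set) simp
          finally show ?thesis .
        qed
        have bh: "(\<integral>\<^sup>+j. ennreal (B j (v k j)) \<partial>count_space J) = ennreal (bh k)" for k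
        proof -
          have "(\<integral>\<^sup>+j. ennreal (B j (v k j)) \<partial>count_space J) < top"
            using finN by (intro le_less_trans[OF Bsum]) (simp add: N_def)
          then show ?thesis by (simp add: bh_def)
        qed
        have Bbh: "B j (v k j) \<le> bh k" if j: "j \<in> J" for j k
        proof -
          have "ennreal (B j (v k j)) = (\<integral>\<^sup>+i. ennreal (B i (v k i)) * indicator {j} i \<partial>count_space J)"
            using j by (subst nn_integral_indicator_singleton) auto
          also have "\<dots> \<le> (\<integral>\<^sup>+i. ennreal (B i (v k i)) \<partial>count_space J)" by (intro nn_integral_mono) (auto simp: indicator_def)
          finally have "ennreal (B j (v k j)) \<le> ennreal (bh k)" by (simp add: bh)
          then show ?thesis using B0 by (subst (asm) ennreal_le_iff) (auto simp: bh_def)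
        qed
        have bhpos: "0 < bh k" for k
        proof -
          obtain j where "j \<in> J" using False by auto
          then show ?thesis using Bbh[of j k] Bpos[of j "v k j"] by linarith
        qed
        have bhlip: "bh k \<le> 2 powr (\<delta> * (2 / (r * \<bar>a\<bar>)) * \<bar>real_of_int k - real_of_int k'\<bar>) * bh k'" for k k'
        proof -
          let ?c = "2 powr (\<delta> * (2 / (r * \<bar>a\<bar>)) * \<bar>real_of_int k - real_of_int k'\<bar>)"
          have "ennreal (bh k) \<le> (\<integral>\<^sup>+j. ennreal ?c * ennreal (B j (v k' j)) \<partial>count_space J)"
            unfolding bh[symmetric]
          proof (rule nn_integral_mono)
            fix j assume "j \<in> space (count_space J)"
            then have j: "j \<in> J" by simp
            have "B j (v k j) \<le> 2 powr (\<delta> * \<bar>v k j - v k' j\<bar>) * B j (v k' j)" by (rule Blip)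
            also have "\<dots> \<le> ?c * B j (v k' j)"
              using vstep[OF j, of k k'] \<open>0 < \<delta>\<close> mult_left_mono[OF vstep[OF j, of k k'], of \<delta>]
              by (intro mult_right_mono powr_mono B0) (auto simp: mult.assoc)
            finally show "ennreal (B j (v k j)) \<le> ennreal ?c * ennreal (B j (v k' j))"
              by (simp add: ennreal_leI B0 flip: ennreal_mult)
          qed
          also have "\<dots> = ennreal (?c * bh k')" using bhpos[of k'] by (simp add: nn_integral_cmult bh ennreal_mult)
          finally show ?thesis using bhpos[of k'] by (subst (asm) ennreal_le_iff) auto
        qed
        define t where "t k = 2 powr real_of_int k * bh k powr (e0 - e1)" for k
        have tpos: "0 < t k" for k using bhpos[of k] by (simp add: t_def)
        have tstep: "sqrt 2 * t k \<le> t (k + 1) \<and> t (k + 1) \<le> C * t k" for k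
        proof -
          define \<eta> where "\<eta> = \<delta> * (2 / (r * \<bar>a\<bar>))"
          define z where "z = log 2 (bh (k + 1) / bh k)"
          have bz: "bh (k + 1) = bh k * 2 powr z" using bhpos[of k] bhpos[of "k + 1"] by (simp add: z_def)
          have "bh k * 2 powr z \<le> 2 powr \<eta> * bh k" using bhlip[of "k+1" k] by (simp add: bz \<eta>_def)
          then have z1: "z \<le> \<eta>" using bhpos[of k] by (simp add: mult.commute)
          have "bh k \<le> 2 powr \<eta> * (bh k * 2 powr z)" using bhlip[of k "k+1"] by (simp add: bz \<eta>_def)
          then have "bh k * 1 \<le> bh k * (2 powr (\<eta> + z))" by (simp add: powr_add ac_simps)
          then have "1 \<le> 2 powr (\<eta> + z)" using bhpos[of k] mult_le_cancel_left_pos by blast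
          then have "2 powr 0 \<le> (2 :: real) powr (\<eta> + z)" by simp
          then have z2: "- \<eta> \<le> z" by (subst (asm) powr_le_cancel_iff) auto
          have "\<bar>z\<bar> * \<bar>e0 - e1\<bar> \<le> \<eta> * \<bar>e0 - e1\<bar>" using z1 z2 by (intro mult_right_mono) auto
          also have "\<dots> \<le> 1 / 2" using \<delta>3 by (simp add: \<eta>_def ac_simps)
          finally have "\<bar>z * (e0 - e1)\<bar> \<le> 1 / 2" by (simp add: abs_mult)
          then have zz: "1 / 2 \<le> 1 + z * (e0 - e1)" "1 + z * (e0 - e1) \<le> 2" by linarith+
          have tt: "t (k + 1) = 2 powr (1 + z * (e0 - e1)) * t k"
          proof -
            have "bh (k + 1) powr (e0 - e1) = bh k powr (e0 - e1) * 2 powr (z * (e0 - e1))"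
              unfolding bz using bhpos[of k] by (simp add: powr_mult powr_powr)
            then show ?thesis unfolding t_def by (simp add: powr_add)
          qed
          have "sqrt 2 = 2 powr (1/2)" by (simp add: powr_half_sqrt)
          also have "\<dots> \<le> 2 powr (1 + z * (e0 - e1))" using zz by (intro powr_mono) auto
          finally have "sqrt 2 * t k \<le> t (k + 1)" unfolding tt using tpos[of k] by (intro mult_right_mono) auto
          moreover have "2 powr (1 + z * (e0 - e1)) \<le> 2 powr 2" using zz by (intro powr_mono) auto
          then have "2 powr (1 + z * (e0 - e1)) \<le> C" using C by simp
          then have "t (k + 1) \<le> C * t k" unfolding tt using tpos[of k] by (intro mult_right_mono) auto
          ultimately show ?thesis by simp
        qed
        \<comment> \<open>The large entries belong to the smaller of the two integrability exponents.\<close>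
        define S where "S k j = {m. 0 \<le> a * (ly j m - v k j)}" for k j
        have slice: "ell_qnorm p' (?M j) (part T ?x j) \<le> ennreal (2 powr (- real j * (s - n / r) + w - w * r * inv_exp p') * B j w powr inv_exp p')"
          if j: "j \<in> J" and p': "0 < p'" "\<delta> \<le> gap p'" and T: "\<And>m. m \<in> T j \<Longrightarrow> 0 \<le> (inv_exp p' - 1 / r) * (ly j m - w)" for p' j T w
          using p'(1)
        proof (cases rule: exponent_cases)
          case 1
          have "part T ?x j m \<le> ennreal (2 powr (- real j * (s - n / r) + w))" for m
          proof (cases "m \<in> T j \<and> 0 < X j m")
            case True
            then have "0 \<le> - (1 / r) * (ly j m - w)" using T[of m] 1 by simp
            then have "ly j m \<le> w" using r by (auto simp: divide_le_0_iff)
            then have "2 powr (real j * (s - n / r)) * X j m \<le> 2 powr w" using yly[of j m] True by (simp add: y_def[symmetric])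
            then have "2 powr (- real j * (s - n / r)) * (2 powr (real j * (s - n / r)) * X j m) \<le> 2 powr (- real j * (s - n / r)) * 2 powr w"
              by (rule mult_left_mono) simp
            then have "X j m \<le> 2 powr (- real j * (s - n / r) + w)" by (simp add: mult.assoc[symmetric] flip: powr_add)
            then show ?thesis using True by (simp add: part_def ennreal_leI)
          next
            case False
            then show ?thesis using X0[of j m] by (auto simp: part_def less_le)
          qed
          then show ?thesis using 1 Bpos[OF j, of w] by (auto simp: ell_qnorm_infty intro!: SUP_least)
        next
          case (2 \<pi>)
          have gp: "\<delta> \<le> \<bar>\<pi> - r\<bar>" using p'(2) 2 by (simp add: gap_def)
          define c where "c = 2 powr (- real j * (s - n / r) * \<pi> + w * (\<pi> - r))"
          have "enn_powr (part T ?x j m) \<pi> \<le> ennreal (c * (y j m powr r * 2 powr (- \<delta> * \<bar>ly j m - w\<bar>)))" for m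
          proof (cases "m \<in> T j \<and> 0 < X j m")
            case True
            have "0 \<le> (1 / \<pi> - 1 / r) * (ly j m - w)" using T[of m] True 2 by simp
            then have "0 \<le> (\<pi> * r) * ((1 / \<pi> - 1 / r) * (ly j m - w))" by (rule mult_nonneg_nonneg[rotated]) (use 2 r in simp)
            also have "\<dots> = (r - \<pi>) * (ly j m - w)" using 2 r by (simp add: field_simps)
            finally have nn: "0 \<le> (r - \<pi>) * (ly j m - w)" .
            have "(\<pi> - r) * (ly j m - w) = - (\<bar>\<pi> - r\<bar> * \<bar>ly j m - w\<bar>)"
              using nn by (simp add: abs_mult[symmetric]) (simp add: abs_if algebra_simps)
            also have "\<dots> \<le> - \<delta> * \<bar>ly j m - w\<bar>" using mult_right_mono[OF gp, of "\<bar>ly j m - w\<bar>"] by simp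
            finally have ex: "\<pi> * ly j m \<le> w * (\<pi> - r) + (r * ly j m + - \<delta> * \<bar>ly j m - w\<bar>)" by (simp add: algebra_simps)
            have "y j m powr \<pi> = 2 powr (\<pi> * ly j m)" using yly[of j m] True by (simp add: powr_powr mult.commute)
            also have "\<dots> \<le> 2 powr (w * (\<pi> - r) + (r * ly j m + - \<delta> * \<bar>ly j m - w\<bar>))" using ex by (intro powr_mono) auto
            also have "\<dots> = 2 powr (w * (\<pi> - r)) * (y j m powr r * 2 powr (- \<delta> * \<bar>ly j m - w\<bar>))"
              using yly[of j m] True by (simp add: powr_powr mult.commute[of r] powr_add[symmetric])
            finally have yp: "y j m powr \<pi> \<le> 2 powr (w * (\<pi> - r)) * (y j m powr r * 2 powr (- \<delta> * \<bar>ly j m - w\<bar>))" .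
            have "X j m = 2 powr (- real j * (s - n / r)) * y j m" by (simp add: y_def mult.assoc[symmetric] flip: powr_add)
            then have "X j m powr \<pi> = 2 powr (- real j * (s - n / r) * \<pi>) * y j m powr \<pi>" by (simp add: powr_mult powr_powr)
            also have "\<dots> \<le> 2 powr (- real j * (s - n / r) * \<pi>) * (2 powr (w * (\<pi> - r)) * (y j m powr r * 2 powr (- \<delta> * \<bar>ly j m - w\<bar>)))"
              by (intro mult_left_mono yp) simp
            also have "\<dots> = c * (y j m powr r * 2 powr (- \<delta> * \<bar>ly j m - w\<bar>))" by (simp only: c_def powr_add mult.assoc)
            finally show ?thesis using True X0 by (simp add: part_def enn_powr_ennreal ennreal_leI)
          next
            case False
            then show ?thesis using X0[of j m] by (auto simp: part_def less_le)
          qed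
          then have "(\<integral>\<^sup>+m. enn_powr (part T ?x j m) \<pi> \<partial>count_space (?M j)) \<le> (\<Sum>m\<in>?M j. ennreal (c * (y j m powr r * 2 powr (- \<delta> * \<bar>ly j m - w\<bar>))))"
            using fin by (simp add: nn_integral_count_space_finite sum_mono)
          also have "\<dots> = ennreal (c * B j w)" by (simp add: c_def B_def sum_distrib_left)
          also have "\<dots> = enn_powr (ennreal (2 powr (- real j * (s - n / r) + w - w * r * inv_exp p') * B j w powr inv_exp p')) \<pi>"
          proof -
            have "c = (2 powr (- real j * (s - n / r) + w - w * r * (1 / \<pi>))) powr \<pi>"
            proof -
              have "(A + w - w * r * (1 / \<pi>)) * \<pi> = A * \<pi> + w * (\<pi> - r)" for A using 2 by (simp add: field_simps)
              then show ?thesis by (simp only: c_def powr_powr)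
            qed
            moreover have "B j w = (B j w powr (1 / \<pi>)) powr \<pi>" using 2 Bpos[OF j, of w] by (simp add: powr_powr abs_of_pos)
            ultimately show ?thesis using 2 by (simp add: enn_powr_ennreal powr_mult)
          qed
          finally show ?thesis using 2 by (simp add: ell_qnorm_le_iff)
        qed
        have sn: "s - n / r = (1 - \<theta>) * (s0 - n * a0) + \<theta> * (s1 - n * a1)"
        proof -
          have "n / r = n * (1 / r)" by simp
          also have "\<dots> = n * ((1 - \<theta>) * a0 + \<theta> * a1)" unfolding rp a0_def a1_def ..
          finally have "n / r = n * ((1 - \<theta>) * a0 + \<theta> * a1)" .
          then show ?thesis by (simp add: ss algebra_simps)
        qed
        have sumup: "seq_qnorm s' p' q' \<Omega> (part T ?x) \<le> ennreal (c * bh k powr inv_exp q')"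
          if q': "0 < q'" and p': "0 < p'" and c: "0 \<le> c" and le: "\<And>j. j \<in> J \<Longrightarrow> level_norm s' p' \<Omega> (part T ?x) j \<le> ennreal (c * B j (v k j) powr inv_exp q')" for s' p' q' T c k
          using q'
        proof (cases rule: exponent_cases)
          case 1
          have "level_norm s' p' \<Omega> (part T ?x) j \<le> ennreal c" for j
            using le[of j] outJ[OF _ p', of j s' T] Bpos[of j "v k j"] 1 by (cases "j \<in> J") auto
          then show ?thesis using 1 bhpos[of k] by (auto simp: seq_qnorm_def ell_qnorm_infty intro!: SUP_least)
        next
          case (2 \<kappa>)
          have "(\<integral>\<^sup>+j. enn_powr (level_norm s' p' \<Omega> (part T ?x) j) \<kappa> \<partial>count_space UNIV) \<le> (\<integral>\<^sup>+j. ennreal (c powr \<kappa>) * ennreal (B j (v k j)) * indicator J j \<partial>count_space UNIV)"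
          proof (rule nn_integral_mono)
            fix j
            show "enn_powr (level_norm s' p' \<Omega> (part T ?x) j) \<kappa> \<le> ennreal (c powr \<kappa>) * ennreal (B j (v k j)) * indicator J j"
            proof (cases "j \<in> J")
              case True
              have "enn_powr (level_norm s' p' \<Omega> (part T ?x) j) \<kappa> \<le> enn_powr (ennreal (c * B j (v k j) powr (1 / \<kappa>))) \<kappa>"
                using le[OF True] 2 by (intro enn_powr_mono) auto
              also have "\<dots> = ennreal (c powr \<kappa> * B j (v k j))"
                using 2 c Bpos[OF True, of "v k j"] by (simp add: enn_powr_ennreal powr_mult powr_powr)
              finally show ?thesis using True B0 by (simp add: ennreal_mult)
            next
              case False
              then show ?thesis using outJ[OF False p'] by simp
            qed
          qed
          also have "\<dots> = ennreal (c powr \<kappa>) * (\<integral>\<^sup>+j. ennreal (B j (v k j)) \<partial>count_space J)"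
          proof -
            have "(\<integral>\<^sup>+j. ennreal (B j (v k j)) \<partial>count_space J) = (\<integral>\<^sup>+j. ennreal (B j (v k j)) * indicator J j \<partial>count_space UNIV)"
              by (rule nn_integral_count_space_indicator) simp
            then show ?thesis by (simp add: mult.assoc nn_integral_cmult)
          qed
          also have "\<dots> = enn_powr (ennreal (c * bh k powr inv_exp q')) \<kappa>"
          proof -
            have "enn_powr (ennreal (c * bh k powr inv_exp q')) \<kappa> = ennreal ((c * bh k powr inv_exp q') powr \<kappa>)"
              using c by (intro enn_powr_ennreal) simp
            also have "(c * bh k powr inv_exp q') powr \<kappa> = c powr \<kappa> * bh k"
              using 2 c bhpos[of k] by (simp add: powr_mult powr_powr abs_of_pos)
            finally show ?thesis using bhpos[of k] by (simp add: bh ennreal_mult')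
          qed
          finally show ?thesis using 2 by (simp add: seq_qnorm_def ell_qnorm_le_iff)
        qed
        \<comment> \<open>The first end point has \<open>\<tau> = \<theta>\<close>, the second \<open>\<tau> = - (1 - \<theta>)\<close>.\<close>
        have endpoint: "seq_qnorm s' p' q' \<Omega> (part T ?x) \<le> ennreal (2 powr (\<tau> * real_of_int k) * bh k powr inv_exp q')"
          if p': "0 < p'" "\<delta> \<le> gap p'" and q': "0 < q'"
            and \<tau>: "inv_exp p' - 1 / r = \<tau> * a" "\<tau> * D + inv_exp q' = inv_exp p'"
            and s': "\<And>j. real j * (s' - n * inv_exp p') - real j * (s - n / r) = \<tau> * lW j"
            and T: "\<And>j m. m \<in> T j \<Longrightarrow> 0 \<le> \<tau> * a * (ly j m - v k j)" for s' p' q' \<tau> T k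
        proof (rule sumup[OF q' p'(1)])
          fix j assume j: "j \<in> J"
          define w where "w = v k j"
          have "ell_qnorm p' (?M j) (part T ?x j) \<le> ennreal (2 powr (- real j * (s - n / r) + w - w * r * inv_exp p') * B j w powr inv_exp p')"
            using T \<tau> by (intro slice[OF j p']) (auto simp: w_def)
          then have "level_norm s' p' \<Omega> (part T ?x) j \<le> ennreal (2 powr (real j * (s' - n * inv_exp p'))) * ennreal (2 powr (- real j * (s - n / r) + w - w * r * inv_exp p') * B j w powr inv_exp p')"
            unfolding level_norm_def n_def by (rule mult_left_mono) simp
          also have "\<dots> = ennreal (2 powr (real j * (s' - n * inv_exp p') + (- real j * (s - n / r) + w - w * r * inv_exp p') + lB j w * inv_exp p'))"
            by (simp only: BlB[OF j] powr_powr powr_add ennreal_mult' powr_ge_zero mult.assoc)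
          also have "real j * (s' - n * inv_exp p') + (- real j * (s - n / r) + w - w * r * inv_exp p') + lB j w * inv_exp p' = \<tau> * real_of_int k + lB j w * inv_exp q'"
          proof -
            have k: "real_of_int k = lW j + D * lB j w - r * a * w" using v[OF j, of k] by (simp add: \<rho>_def w_def)
            have i2: "r * inv_exp p' - 1 = \<tau> * (r * a)" using arg_cong[OF \<tau>(1), of "\<lambda>z. r * z"] r by (simp add: algebra_simps)
            have "w - w * r * inv_exp p' = - w * (r * inv_exp p' - 1)" by (simp add: algebra_simps)
            also have "\<dots> = - w * (\<tau> * (r * a))" by (simp only: i2)
            finally have i4: "w - w * r * inv_exp p' = - w * (\<tau> * (r * a))" .
            have "lB j w * inv_exp p' = lB j w * (\<tau> * D + inv_exp q')" by (simp only: \<tau>(2))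
            then show ?thesis using s'[of j] i4 unfolding k by (simp add: algebra_simps)
          qed
          also have "ennreal (2 powr (\<tau> * real_of_int k + lB j w * inv_exp q')) = ennreal (2 powr (\<tau> * real_of_int k) * B j (v k j) powr inv_exp q')"
            by (simp only: BlB[OF j] powr_powr powr_add w_def)
          finally show "level_norm s' p' \<Omega> (part T ?x) j \<le> ennreal (2 powr (\<tau> * real_of_int k) * B j (v k j) powr inv_exp q')" .
        qed simp
        have P0: "?E (part (S k) ?x) \<le> ennreal (t k powr \<theta>) * ennreal (bh k powr (1 / r))" for k
        proof -
          have "?E (part (S k) ?x) \<le> ennreal (2 powr (\<theta> * real_of_int k) * bh k powr inv_exp q0)"
          proof (rule endpoint[OF p(1) \<delta>1(1) q(1)])
            show "inv_exp p0 - 1 / r = \<theta> * a" using r0 by (simp add: a0_def)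
            show "\<theta> * D + inv_exp q0 = inv_exp p0" using r0 re by (simp add: D_def a0_def e0_def algebra_simps)
            show "real j * (s0 - n * inv_exp p0) - real j * (s - n / r) = \<theta> * lW j" for j
              unfolding sn lW_def a0_def by (simp add: algebra_simps)
            show "0 \<le> \<theta> * a * (ly j m - v k j)" if "m \<in> S k j" for j m using that th by (simp add: S_def mult.assoc)
          qed
          also have "2 powr (\<theta> * real_of_int k) * bh k powr inv_exp q0 = t k powr \<theta> * bh k powr (1 / r)"
          proof -
            have "(e0 - e1) * \<theta> + 1 / r = e0" using re by (simp add: algebra_simps)
            then have "bh k powr ((e0 - e1) * \<theta>) * bh k powr (1 / r) = bh k powr e0" by (simp flip: powr_add)
            then show ?thesis using bhpos[of k] by (simp add: t_def powr_mult powr_powr e0_def[symmetric] mult.commute[of \<theta>] mult.assoc)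
          qed
          finally show ?thesis by (simp add: ennreal_mult)
        qed
        have P1: "ennreal (t k) * ?F (part (\<lambda>j. - S k j) ?x) \<le> ennreal (t k powr \<theta>) * ennreal (bh k powr (1 / r))" for k
        proof -
          have "?F (part (\<lambda>j. - S k j) ?x) \<le> ennreal (2 powr (- (1 - \<theta>) * real_of_int k) * bh k powr inv_exp q1)"
          proof (rule endpoint[OF p(2) \<delta>1(2) q(2)])
            show "inv_exp p1 - 1 / r = - (1 - \<theta>) * a" using r1 by (simp only: a1_def)
            show "- (1 - \<theta>) * D + inv_exp q1 = inv_exp p1" using r1 re by (simp add: D_def a1_def e1_def algebra_simps)
            show "real j * (s1 - n * inv_exp p1) - real j * (s - n / r) = - (1 - \<theta>) * lW j" for j
              unfolding sn lW_def a1_def by (simp add: algebra_simps)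
            show "0 \<le> - (1 - \<theta>) * a * (ly j m - v k j)" if "m \<in> - S k j" for j m
            proof -
              have "0 \<le> (1 - \<theta>) * (- (a * (ly j m - v k j)))" using that th by (intro mult_nonneg_nonneg) (auto simp: S_def)
              then show ?thesis by (simp add: algebra_simps)
            qed
          qed
          then have "ennreal (t k) * ?F (part (\<lambda>j. - S k j) ?x) \<le> ennreal (t k) * ennreal (2 powr (- (1 - \<theta>) * real_of_int k) * bh k powr inv_exp q1)"
            by (rule mult_left_mono) simp
          also have "\<dots> = ennreal (t k * (2 powr (- (1 - \<theta>) * real_of_int k) * bh k powr inv_exp q1))"
            using tpos[of k] by (simp flip: ennreal_mult)
          also have "t k * (2 powr (- (1 - \<theta>) * real_of_int k) * bh k powr inv_exp q1) = t k powr \<theta> * bh k powr (1 / r)"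
          proof -
            have e: "(e0 - e1) * \<theta> + 1 / r = (e0 - e1) + e1" using re by (simp add: algebra_simps)
            have b: "bh k powr (e0 - e1) * bh k powr e1 = bh k powr ((e0 - e1) * \<theta>) * bh k powr (1 / r)" using e by (simp flip: powr_add)
            have c: "2 powr real_of_int k * 2 powr (- (1 - \<theta>) * real_of_int k) = 2 powr (real_of_int k * \<theta>)" by (simp add: algebra_simps flip: powr_add)
            have "t k * (2 powr (- (1 - \<theta>) * real_of_int k) * bh k powr inv_exp q1) = (2 powr real_of_int k * 2 powr (- (1 - \<theta>) * real_of_int k)) * (bh k powr (e0 - e1) * bh k powr e1)"
              by (simp only: t_def e1_def ac_simps)
            also have "\<dots> = t k powr \<theta> * bh k powr (1 / r)" unfolding b c using bhpos[of k] by (simp add: t_def powr_mult powr_powr mult.assoc)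
            finally show ?thesis .
          qed
          finally show ?thesis by (simp add: ennreal_mult)
        qed
        \<comment> \<open>By the upper bound on the slope of \<open>\<rho>\<close>, the heights of a level are separated by multiples of \<open>\<sigma>\<close>.\<close>
        have tail: "(\<integral>\<^sup>+k. ennreal (2 powr (- \<delta> * \<bar>ly j m - v k j\<bar>)) \<partial>count_space UNIV) \<le> ennreal Cg" if j: "j \<in> J" for j m
        proof -
          define k0 where "k0 = \<lfloor>\<rho> j (ly j m)\<rfloor>"
          have "(\<integral>\<^sup>+k. ennreal (2 powr (- \<delta> * \<bar>ly j m - v k j\<bar>)) \<partial>count_space UNIV) \<le> (\<integral>\<^sup>+k. ennreal (2 powr (\<delta> * \<sigma>)) * ennreal (2 powr (- (\<delta> * \<sigma>) * \<bar>real_of_int (k - k0)\<bar>)) \<partial>count_space UNIV)"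
          proof (rule nn_integral_mono)
            fix k
            have "\<bar>\<rho> j (ly j m) - real_of_int k\<bar> \<le> 3 * r * \<bar>a\<bar> / 2 * \<bar>ly j m - v k j\<bar>"
              using \<rho>up[OF j, of "ly j m" "v k j"] v[OF j] by simp
            then have "\<sigma> * \<bar>\<rho> j (ly j m) - real_of_int k\<bar> \<le> \<sigma> * (3 * r * \<bar>a\<bar> / 2 * \<bar>ly j m - v k j\<bar>)" using \<sigma> by (intro mult_left_mono) auto
            also have "\<dots> = \<bar>ly j m - v k j\<bar>" using r a by (simp add: \<sigma>_def)
            finally have "\<sigma> * \<bar>\<rho> j (ly j m) - real_of_int k\<bar> \<le> \<bar>ly j m - v k j\<bar>" .
            moreover have "\<bar>real_of_int (k - k0)\<bar> - 1 \<le> \<bar>\<rho> j (ly j m) - real_of_int k\<bar>" unfolding k0_def by linarith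
            then have "\<sigma> * (\<bar>real_of_int (k - k0)\<bar> - 1) \<le> \<sigma> * \<bar>\<rho> j (ly j m) - real_of_int k\<bar>" using \<sigma> by (intro mult_left_mono) auto
            ultimately have "\<delta> * (\<sigma> * (\<bar>real_of_int (k - k0)\<bar> - 1)) \<le> \<delta> * \<bar>ly j m - v k j\<bar>" using \<open>0 < \<delta>\<close> by (intro mult_left_mono) auto
            then have "2 powr (- \<delta> * \<bar>ly j m - v k j\<bar>) \<le> 2 powr (\<delta> * \<sigma> + - (\<delta> * \<sigma>) * \<bar>real_of_int (k - k0)\<bar>)"
              by (intro powr_mono) (auto simp: algebra_simps)
            then show "ennreal (2 powr (- \<delta> * \<bar>ly j m - v k j\<bar>)) \<le> ennreal (2 powr (\<delta> * \<sigma>)) * ennreal (2 powr (- (\<delta> * \<sigma>) * \<bar>real_of_int (k - k0)\<bar>))"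
              by (simp only: powr_add ennreal_mult'[symmetric] powr_ge_zero ennreal_leI)
          qed
          also have "\<dots> = ennreal (2 powr (\<delta> * \<sigma>)) * (\<integral>\<^sup>+k. ennreal (2 powr (- (\<delta> * \<sigma>) * \<bar>real_of_int (k - k0)\<bar>)) \<partial>count_space UNIV)"
            by (rule nn_integral_cmult) simp
          also have "\<dots> \<le> ennreal (2 powr (\<delta> * \<sigma>)) * geo_sum (\<delta> * \<sigma>)"
            by (intro mult_left_mono geo_sum_inj_le) (auto simp: inj_on_def)
          also have "\<dots> = ennreal Cg" using G by (simp add: Cg_def ennreal_mult)
          finally show ?thesis .
        qed
        have "ell_qnorm (ennreal r) UNIV (\<lambda>k. ennreal (bh k powr (1 / r))) \<le> ennreal (Cg powr (1 / r)) * N"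
        proof -
          have "(\<integral>\<^sup>+k. enn_powr (ennreal (bh k powr (1 / r))) r \<partial>count_space UNIV) = (\<integral>\<^sup>+k. (\<integral>\<^sup>+j. ennreal (B j (v k j)) \<partial>count_space J) \<partial>count_space UNIV)"
            using r bhpos by (intro nn_integral_cong) (simp add: bh enn_powr_ennreal powr_powr less_imp_le)
          also have "\<dots> = (\<integral>\<^sup>+j. (\<integral>\<^sup>+k. ennreal (B j (v k j)) \<partial>count_space UNIV) \<partial>count_space J)"
            by (rule nn_integral_count_space_nn_integral) auto
          also have "\<dots> \<le> (\<integral>\<^sup>+j. ennreal Cg * ennreal (\<Sum>m\<in>?M j. y j m powr r) \<partial>count_space J)"
          proof (rule nn_integral_mono)
            fix j assume "j \<in> space (count_space J)"
            then have j: "j \<in> J" by simp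
            have "(\<integral>\<^sup>+k. ennreal (B j (v k j)) \<partial>count_space UNIV) = (\<integral>\<^sup>+k. (\<Sum>m\<in>?M j. ennreal (y j m powr r) * ennreal (2 powr (- \<delta> * \<bar>ly j m - v k j\<bar>))) \<partial>count_space UNIV)"
              unfolding B_def by (intro nn_integral_cong) (simp flip: ennreal_mult)
            also have "\<dots> = (\<Sum>m\<in>?M j. ennreal (y j m powr r) * (\<integral>\<^sup>+k. ennreal (2 powr (- \<delta> * \<bar>ly j m - v k j\<bar>)) \<partial>count_space UNIV))"
              by (simp add: nn_integral_sum nn_integral_cmult)
            also have "\<dots> \<le> (\<Sum>m\<in>?M j. ennreal (y j m powr r) * ennreal Cg)" by (intro sum_mono mult_left_mono tail j) auto
            also have "\<dots> = ennreal Cg * ennreal (\<Sum>m\<in>?M j. y j m powr r)"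
              using Cg by (simp add: mult.commute sum_distrib_left flip: sum_ennreal)
            finally show "(\<integral>\<^sup>+k. ennreal (B j (v k j)) \<partial>count_space UNIV) \<le> ennreal Cg * ennreal (\<Sum>m\<in>?M j. y j m powr r)" .
          qed
          also have "\<dots> = ennreal Cg * (\<integral>\<^sup>+j. ennreal (\<Sum>m\<in>?M j. y j m powr r) \<partial>count_space J)" by (rule nn_integral_cmult) simp
          also have "\<dots> \<le> ennreal Cg * enn_powr N r"
            unfolding Nr by (intro mult_left_mono nn_integral_count_space_mono_set) auto
          also have "\<dots> = enn_powr (ennreal (Cg powr (1 / r)) * N) r" using Cg r by (simp add: enn_powr_mult enn_powr_ennreal powr_powr)
          finally show ?thesis using r by (simp add: ell_qnorm_le_iff)
        qed
        also have "\<dots> \<le> ennreal C * N" by (intro mult_right_mono ennreal_leI) (auto simp: C_def)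
        finally have fN: "ell_qnorm (ennreal r) UNIV (\<lambda>k. ennreal (bh k powr (1 / r))) \<le> ennreal C * N" .
        have cover: "\<exists>k. t k / C \<le> \<tau> \<and> \<tau> \<le> C * t k" if "0 < \<tau>" for \<tau>
          by (rule geometric_covering[OF tpos _ _ that]) (use tstep C in auto)
        show ?thesis
          unfolding splits_def N_def[symmetric] using tpos cover P0 P1 fN
          by (intro exI[of _ t] exI[of _ "\<lambda>k. ennreal (bh k powr (1 / r))"] exI[of _ S]) auto
      qed
      then show ?thesis by (simp only: x)
    qed
    then show "splits_all C \<theta> (ennreal r) ?E ?F ?Q"
      by (simp add: splits_all_def)
  qed
qed

section \<open>Sequences that split along with a function\<close>

text \<open>
  If every decomposition of \<open>f\<close> in the couple \<open>(A\<^sub>0, A\<^sub>1)\<close> induces a decomposition of the sequence \<open>y\<close> bounded in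
  \<open>Q\<^sub>0\<close> and \<open>Q\<^sub>1\<close>, then the interpolation quasi-norm of \<open>f\<close> controls \<open>y\<close> in \<open>Q\<close>.
\<close>

definition sub_interp :: "real \<Rightarrow> real \<Rightarrow> ennreal \<Rightarrow> ((nat \<Rightarrow> int ^ 'n \<Rightarrow> ennreal) \<Rightarrow> ennreal) \<Rightarrow>
    ((nat \<Rightarrow> int ^ 'n \<Rightarrow> ennreal) \<Rightarrow> ennreal) \<Rightarrow> ((nat \<Rightarrow> int ^ 'n \<Rightarrow> ennreal) \<Rightarrow> ennreal) \<Rightarrow> bool" where
  "sub_interp C \<theta> q Q0 Q1 Q \<longleftrightarrow> (\<forall>(A0 :: (real ^ 'n \<Rightarrow> complex) qn_space) A1 f y.
     (\<forall>f0\<in>vecs A0. \<forall>f1\<in>vecs A1. f = (\<lambda>x. f0 x + f1 x) \<longrightarrow>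
        (\<exists>z0 z1. (\<forall>j m. y j m \<le> z0 j m + z1 j m) \<and> Q0 z0 \<le> qn A0 f0 \<and> Q1 z1 \<le> qn A1 f1)) \<longrightarrow>
     Q y \<le> ennreal C * interp_qnorm \<theta> q A0 A1 f)"

text \<open>
  The norm of the single level \<open>l\<close> has smoothness weights whose ratio is \<open>2\<^bsup>l(s\<^sub>0-s\<^sub>1)\<^esup>\<close>; it is therefore at most the
  \<open>K\<close>-functional at this parameter.
\<close>

lemma sub_interp_same_p:
  fixes \<Omega> :: "(real ^ 'n) set"
  assumes p: "0 < p" and q: "0 < q" "0 < q0" "0 < q1" and s: "s0 \<noteq> s1" and th: "0 < \<theta>" "\<theta> < 1"
    and ss: "s = (1 - \<theta>) * s0 + \<theta> * s1"
  obtains C where "0 < C" "sub_interp C \<theta> q (seq_qnorm s0 p q0 \<Omega>) (seq_qnorm s1 p q1 \<Omega>) (seq_qnorm s p q \<Omega>)"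
proof -
  define b where "b = 2 powr \<bar>s0 - s1\<bar>"
  have b: "1 < b" using s by (simp add: b_def)
  define h where "h l = (if s1 < s0 then int l else - int l)" for l :: nat
  have injh: "inj h" by (auto simp: h_def inj_on_def)
  have bh: "b powr real_of_int (h l) = 2 powr (real l * (s0 - s1))" for l
    using s by (auto simp: b_def h_def powr_powr abs_if algebra_simps)
  have bth: "b powr (- real_of_int (h l) * \<theta>) = 2 powr (real l * (s - s0))" for l
  proof -
    have "b powr (- real_of_int (h l) * \<theta>) = (b powr real_of_int (h l)) powr (- \<theta>)" by (simp add: powr_powr)
    also have "\<dots> = 2 powr (real l * (s - s0))" unfolding bh powr_powr by (simp add: ss algebra_simps)
    finally show ?thesis .
  qed
  obtain G where G: "0 < G" "\<And>(I::(int^'n) set) x y. ell_qnorm p I (\<lambda>i. x i + y i) \<le> ennreal G * (ell_qnorm p I x + ell_qnorm p I y)"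
    using ell_qnorm_add_le[OF p] by blast
  obtain C where C: "0 < C" "\<And>(A0 :: (real ^ 'n \<Rightarrow> complex) qn_space) A1 f.
    ell_qnorm q (UNIV :: int set) (\<lambda>k. ennreal (b powr (- real_of_int k * \<theta>)) * K_functional A0 A1 (b powr real_of_int k) f)
      \<le> ennreal C * interp_qnorm \<theta> q A0 A1 f"
    using ell_qnorm_K_functional_le[OF b th(1) q(1)] by blast
  show ?thesis
  proof (rule that[of "G * C"])
    show "0 < G * C" using G C by simp
    show "sub_interp (G * C) \<theta> q (seq_qnorm s0 p q0 \<Omega>) (seq_qnorm s1 p q1 \<Omega>) (seq_qnorm s p q \<Omega>)"
      unfolding sub_interp_def
    proof (intro allI impI)
      fix A0 A1 :: "(real ^ 'n \<Rightarrow> complex) qn_space" and f and y :: "nat \<Rightarrow> int ^ 'n \<Rightarrow> ennreal"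
      assume *: "\<forall>f0\<in>vecs A0. \<forall>f1\<in>vecs A1. f = (\<lambda>x. f0 x + f1 x) \<longrightarrow>
        (\<exists>z0 z1. (\<forall>j m. y j m \<le> z0 j m + z1 j m) \<and> seq_qnorm s0 p q0 \<Omega> z0 \<le> qn A0 f0 \<and> seq_qnorm s1 p q1 \<Omega> z1 \<le> qn A1 f1)"
      have lev: "level_norm s0 p \<Omega> y l \<le> ennreal G * K_functional A0 A1 (b powr real_of_int (h l)) f" for l
      proof -
        have "level_norm s0 p \<Omega> y l / ennreal G \<le> K_functional A0 A1 (b powr real_of_int (h l)) f"
        proof (rule K_functional_greatest)
          fix f0 f1 assume f: "f0 \<in> vecs A0" "f1 \<in> vecs A1" "f = (\<lambda>x. f0 x + f1 x)"
          then obtain z0 z1 where z: "\<And>j m. y j m \<le> z0 j m + z1 j m" "seq_qnorm s0 p q0 \<Omega> z0 \<le> qn A0 f0" "seq_qnorm s1 p q1 \<Omega> z1 \<le> qn A1 f1"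
            using * by blast
          have "level_norm s0 p \<Omega> y l \<le> level_norm s0 p \<Omega> (\<lambda>j m. z0 j m + z1 j m) l"
            using z(1) p by (intro level_norm_mono) auto
          also have "\<dots> \<le> ennreal G * (level_norm s0 p \<Omega> z0 l + level_norm s0 p \<Omega> z1 l)"
          proof -
            have "ennreal w * ell_qnorm p I (\<lambda>i. x i + x' i) \<le> ennreal G * (ennreal w * ell_qnorm p I x + ennreal w * ell_qnorm p I x')"
              for w and I :: "(int^'n) set" and x x'
              using mult_left_mono[OF G(2)[of I x x'], of "ennreal w"] by (simp add: algebra_simps)
            then show ?thesis unfolding level_norm_def .
          qed
          also have "\<dots> \<le> ennreal G * (qn A0 f0 + ennreal (b powr real_of_int (h l)) * qn A1 f1)"
          proof (intro mult_left_mono add_mono)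
            show "level_norm s0 p \<Omega> z0 l \<le> qn A0 f0" using level_norm_le_seq_qnorm[OF q(2)] z(2) order_trans by blast
            have "level_norm s0 p \<Omega> z1 l = ennreal (b powr real_of_int (h l)) * level_norm s1 p \<Omega> z1 l"
              unfolding bh by (rule level_norm_exponent)
            also have "\<dots> \<le> ennreal (b powr real_of_int (h l)) * qn A1 f1"
              using level_norm_le_seq_qnorm[OF q(3)] z(3) order_trans by (intro mult_left_mono) (blast, simp)
            finally show "level_norm s0 p \<Omega> z1 l \<le> ennreal (b powr real_of_int (h l)) * qn A1 f1" .
          qed auto
          finally show "level_norm s0 p \<Omega> y l / ennreal G \<le> qn A0 f0 + ennreal (b powr real_of_int (h l)) * qn A1 f1"
            using G(1) by (intro divide_le_posI_ennreal) (auto simp: mult.commute)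
        qed
        then show ?thesis using G(1) ennreal_mult_divide_eq
          by (metis divide_le_posI_ennreal ennreal_divide_times ennreal_less_top ennreal_less_zero_iff ennreal_times_divide less_irrefl mult.commute mult_left_mono mult_right_mono top_neq_ennreal zero_le)
      qed
      let ?k = "\<lambda>k. ennreal (b powr (- real_of_int k * \<theta>)) * K_functional A0 A1 (b powr real_of_int k) f"
      have "seq_qnorm s p q \<Omega> y \<le> ell_qnorm q UNIV (\<lambda>l. ennreal G * ?k (h l))"
        unfolding seq_qnorm_def
      proof (rule ell_qnorm_mono[OF q(1)])
        fix l
        have "level_norm s p \<Omega> y l = ennreal (2 powr (real l * (s - s0))) * level_norm s0 p \<Omega> y l" by (rule level_norm_exponent)
        also have "\<dots> \<le> ennreal (2 powr (real l * (s - s0))) * (ennreal G * K_functional A0 A1 (b powr real_of_int (h l)) f)"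
          by (intro mult_left_mono lev) simp
        finally show "level_norm s p \<Omega> y l \<le> ennreal G * ?k (h l)" unfolding bth by (simp add: algebra_simps)
      qed
      also have "\<dots> = ennreal G * ell_qnorm q UNIV (\<lambda>l. ?k (h l))" by (rule ell_qnorm_cmult[OF q(1)])
      also have "\<dots> \<le> ennreal G * ell_qnorm q UNIV ?k" using injh q(1) by (intro mult_left_mono ell_qnorm_reindex_le) auto
      also have "\<dots> \<le> ennreal G * (ennreal C * interp_qnorm \<theta> q A0 A1 f)" by (intro mult_left_mono C(2)) simp
      finally show "seq_qnorm s p q \<Omega> y \<le> ennreal (G * C) * interp_qnorm \<theta> q A0 A1 f"
        using G(1) C(1) by (simp add: ennreal_mult mult.assoc)
    qed
  qed
qed

lemma seq_qnorm_powr: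
  fixes \<Omega> :: "(real ^ 'n) set"
  assumes "0 < r"
  shows "enn_powr (seq_qnorm s (ennreal r) (ennreal r) \<Omega> x) r =
    (\<integral>\<^sup>+j. ennreal (2 powr (real j * (s - real CARD('n) / r) * r)) * (\<integral>\<^sup>+m. enn_powr (x j m) r \<partial>count_space (meeting_cubes \<Omega> j)) \<partial>count_space UNIV)"
  using assms by (simp add: seq_qnorm_def ell_qnorm_powr level_norm_def enn_powr_mult enn_powr_ennreal powr_powr)

text \<open>
  If the inner and outer exponents agree, the \<open>r\<close>-th powers of sequences with disjoint supports add.
\<close>

lemma seq_qnorm_split_le:
  fixes \<Omega> :: "(real ^ 'n) set" and \<kappa> :: "nat \<Rightarrow> int ^ 'n \<Rightarrow> int"
  assumes r: "0 < r"
  shows "seq_qnorm s (ennreal r) (ennreal r) \<Omega> x \<le>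
    ell_qnorm (ennreal r) UNIV (\<lambda>k. seq_qnorm s (ennreal r) (ennreal r) \<Omega> (part (\<lambda>j. {m. \<kappa> j m = k}) x))"
proof -
  let ?w = "\<lambda>j. ennreal (2 powr (real j * (s - real CARD('n) / r) * r))"
  let ?M = "\<lambda>j. count_space (meeting_cubes \<Omega> j)"
  have pt: "enn_powr (x j m) r = (\<integral>\<^sup>+k. enn_powr (part (\<lambda>j. {m. \<kappa> j m = k}) x j m) r \<partial>count_space UNIV)" for j m
  proof -
    have "(\<integral>\<^sup>+k. enn_powr (part (\<lambda>j. {m. \<kappa> j m = k}) x j m) r \<partial>count_space UNIV) =
        (\<integral>\<^sup>+k. enn_powr (x j m) r * indicator {\<kappa> j m} k \<partial>count_space UNIV)"
      by (intro nn_integral_cong) (auto simp: part_def indicator_def)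
    then show ?thesis by (simp add: nn_integral_cmult_indicator)
  qed
  have "enn_powr (seq_qnorm s (ennreal r) (ennreal r) \<Omega> x) r
     = (\<integral>\<^sup>+j. ?w j * (\<integral>\<^sup>+m. \<integral>\<^sup>+k. enn_powr (part (\<lambda>j. {m. \<kappa> j m = k}) x j m) r \<partial>count_space UNIV \<partial>?M j) \<partial>count_space UNIV)"
    unfolding seq_qnorm_powr[OF r] using pt by simp
  also have "\<dots> = (\<integral>\<^sup>+j. \<integral>\<^sup>+k. ?w j * (\<integral>\<^sup>+m. enn_powr (part (\<lambda>j. {m. \<kappa> j m = k}) x j m) r \<partial>?M j) \<partial>count_space UNIV \<partial>count_space UNIV)"
    by (subst nn_integral_count_space_nn_integral) (auto simp: nn_integral_cmult)
  also have "\<dots> = (\<integral>\<^sup>+k. \<integral>\<^sup>+j. ?w j * (\<integral>\<^sup>+m. enn_powr (part (\<lambda>j. {m. \<kappa> j m = k}) x j m) r \<partial>?M j) \<partial>count_space UNIV \<partial>count_space UNIV)"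
    by (rule nn_integral_count_space_nn_integral) auto
  also have "\<dots> = enn_powr (ell_qnorm (ennreal r) UNIV (\<lambda>k. seq_qnorm s (ennreal r) (ennreal r) \<Omega> (part (\<lambda>j. {m. \<kappa> j m = k}) x))) r"
    unfolding ell_qnorm_powr[OF r] seq_qnorm_powr[OF r] ..
  finally show ?thesis using r by (metis enn_powr_le_iff order_refl)
qed

lemma seq_qnorm_Holder:
  fixes \<Omega> :: "(real ^ 'n) set"
  assumes p: "0 < p" "0 < p0" "0 < p1" and q: "0 < q" "0 < q0" "0 < q1" and th: "0 < \<theta>" "\<theta> < 1"
    and ss: "s = (1 - \<theta>) * s0 + \<theta> * s1"
    and rp: "inv_exp p = (1 - \<theta>) * inv_exp p0 + \<theta> * inv_exp p1" and rq: "inv_exp q = (1 - \<theta>) * inv_exp q0 + \<theta> * inv_exp q1"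
  shows "seq_qnorm s p q \<Omega> (\<lambda>j m. enn_powr (x j m) (1 - \<theta>) * enn_powr (y j m) \<theta>)
    \<le> enn_powr (seq_qnorm s0 p0 q0 \<Omega> x) (1 - \<theta>) * enn_powr (seq_qnorm s1 p1 q1 \<Omega> y) \<theta>"
proof -
  have lev: "level_norm s p \<Omega> (\<lambda>j m. enn_powr (x j m) (1 - \<theta>) * enn_powr (y j m) \<theta>) j
     \<le> enn_powr (level_norm s0 p0 \<Omega> x j) (1 - \<theta>) * enn_powr (level_norm s1 p1 \<Omega> y j) \<theta>" for j
  proof -
    let ?e = "\<lambda>s p. real j * (s - real CARD('n) * inv_exp p)"
    have e: "?e s p = ?e s0 p0 * (1 - \<theta>) + ?e s1 p1 * \<theta>" unfolding ss rp by (simp add: algebra_simps)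
    have "level_norm s p \<Omega> (\<lambda>j m. enn_powr (x j m) (1 - \<theta>) * enn_powr (y j m) \<theta>) j
      \<le> ennreal (2 powr ?e s p) * (enn_powr (ell_qnorm p0 (meeting_cubes \<Omega> j) (x j)) (1 - \<theta>) * enn_powr (ell_qnorm p1 (meeting_cubes \<Omega> j) (y j)) \<theta>)"
      unfolding level_norm_def by (intro mult_left_mono ell_qnorm_Holder p th rp) simp
    also have "\<dots> = enn_powr (level_norm s0 p0 \<Omega> x j) (1 - \<theta>) * enn_powr (level_norm s1 p1 \<Omega> y j) \<theta>"
      unfolding level_norm_def enn_powr_mult e powr_add
      by (simp add: enn_powr_ennreal powr_powr ennreal_mult algebra_simps)
    finally show ?thesis .
  qed
  have "seq_qnorm s p q \<Omega> (\<lambda>j m. enn_powr (x j m) (1 - \<theta>) * enn_powr (y j m) \<theta>)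
     \<le> ell_qnorm q UNIV (\<lambda>j. enn_powr (level_norm s0 p0 \<Omega> x j) (1 - \<theta>) * enn_powr (level_norm s1 p1 \<Omega> y j) \<theta>)"
    unfolding seq_qnorm_def by (intro ell_qnorm_mono q(1) lev)
  also have "\<dots> \<le> enn_powr (seq_qnorm s0 p0 q0 \<Omega> x) (1 - \<theta>) * enn_powr (seq_qnorm s1 p1 q1 \<Omega> y) \<theta>"
    unfolding seq_qnorm_def by (intro ell_qnorm_Holder q th rq)
  finally show ?thesis .
qed

lemma seq_qnorm_coord_tendsto_0:
  fixes \<Omega> :: "(real ^ 'n) set" and z :: "int \<Rightarrow> nat \<Rightarrow> int ^ 'n \<Rightarrow> ennreal"
  assumes p: "0 < p" "0 < q" and m: "m \<in> meeting_cubes \<Omega> j" and D: "D < top" and a: "a < 0"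
    and z: "\<And>k. k \<in> S \<Longrightarrow> seq_qnorm s p q \<Omega> (z k) \<le> ennreal (2 powr (a * \<bar>real_of_int k\<bar>)) * D" and y: "0 < y"
  shows "\<exists>N. \<forall>k\<in>S. N \<le> \<bar>k\<bar> \<longrightarrow> z k j m < y"
proof -
  define w where "w = 2 powr (real j * (s - real CARD('n) * inv_exp p))"
  have w: "0 < w" by (simp add: w_def)
  obtain \<delta> where \<delta>: "0 < \<delta>" "D = ennreal \<delta> \<or> D < ennreal \<delta>" using D
    by (metis ennreal_0 ennreal_cases ennreal_less_zero_iff infinity_ennreal_def less_le not_gr_zero zero_less_one top.not_eq_extremum)
  have D': "D \<le> ennreal \<delta>" using \<delta> by auto
  obtain y' where y': "0 < y'" "ennreal y' < y"
  proof -
    obtain y'' where "0 < y''" "y'' < y" using dense[OF y] by blast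
    then show ?thesis using that[of "enn2real y''"] by (metis ennreal_enn2real ennreal_less_top enn2real_positive_iff infinity_ennreal_def less_trans less_top)
  qed
  obtain N :: nat where N: "\<delta> / (w * y') < (2 powr (- a)) ^ N"
    using real_arch_pow[of "2 powr (- a)" "\<delta> / (w * y')"] a by auto
  show ?thesis
  proof (intro exI[of _ "int N"] ballI impI)
    fix k assume k: "k \<in> S" "int N \<le> \<bar>k\<bar>"
    have Nk: "real N \<le> \<bar>real_of_int k\<bar>" using k(2) by linarith
    have "\<delta> / (w * y') < 2 powr (- a * real N)" using N by (simp add: powr_powr flip: powr_realpow)
    also have "\<dots> \<le> 2 powr (- a * \<bar>real_of_int k\<bar>)" using Nk a by (intro powr_mono mult_left_mono) auto
    finally have small: "2 powr (a * \<bar>real_of_int k\<bar>) * \<delta> \<le> w * y'"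
      using w y'(1) by (simp add: powr_minus field_simps)
    have "ennreal w * z k j m \<le> seq_qnorm s p q \<Omega> (z k)" unfolding w_def by (rule seq_qnorm_coord_le[OF p m])
    also have "\<dots> \<le> ennreal (2 powr (a * \<bar>real_of_int k\<bar>)) * ennreal \<delta>" using z[OF k(1)] D' by (meson mult_left_mono order_trans zero_le)
    also have "\<dots> \<le> ennreal (w * y')" using small \<delta> by (simp add: ennreal_leI flip: ennreal_mult)
    also have "\<dots> = ennreal w * ennreal y'" using w y' by (simp add: ennreal_mult)
    finally have "z k j m \<le> ennreal y'" using w by (simp add: ennreal_mult_le_mult_iff)
    then show "z k j m < y" using y'(2) by (rule le_less_trans)
  qed
qed

text \<open>
  Each entry of \<open>y\<close> is dominated by the first part \<open>z0 k\<close> for large \<open>k\<close> and by the second part \<open>z1 k\<close> for small \<open>k\<close>. Where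
  the dominance changes, the entry is at most a constant times \<open>(z0 (k+1))\<^bsup>1-\<theta>\<^esup> (z1 k)\<^bsup>\<theta>\<^esup>\<close>. Hoelder's inequality bounds the entries that
  change at the same \<open>k\<close>, and these groups have disjoint supports.
\<close>

lemma seq_qnorm_le_interpolated_pairs:
  fixes \<Omega> :: "(real ^ 'n) set"
  assumes r: "0 < r" and p: "0 < p0" "0 < p1" and q: "0 < q0" "0 < q1" and th: "0 < \<theta>" "\<theta> < 1"
    and ss: "s = (1 - \<theta>) * s0 + \<theta> * s1"
    and rp: "1 / r = (1 - \<theta>) * inv_exp p0 + \<theta> * inv_exp p1" and rq: "1 / r = (1 - \<theta>) * inv_exp q0 + \<theta> * inv_exp q1"
    and y: "\<And>k j m. y j m \<le> z0 k j m + z1 k j m"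
    and z0: "\<And>k. seq_qnorm s0 p0 q0 \<Omega> (z0 k) \<le> ennreal (2 powr (real_of_int k * \<theta>)) * \<beta> k"
    and z1: "\<And>k. ennreal (2 powr real_of_int k) * seq_qnorm s1 p1 q1 \<Omega> (z1 k) \<le> ennreal (2 powr (real_of_int k * \<theta>)) * \<beta> k"
    and fin: "ell_qnorm (ennreal r) (UNIV :: int set) \<beta> < top"
  shows "seq_qnorm s (ennreal r) (ennreal r) \<Omega> y \<le> 4 * ell_qnorm (ennreal r) (UNIV :: int set) \<beta>"
proof -
  let ?F = "seq_qnorm s1 p1 q1 \<Omega>"
  let ?R = "ennreal r"
  define D where "D = ell_qnorm ?R (UNIV :: int set) \<beta>"
  have R: "0 < ?R" using r by simp
  have \<beta>D: "\<beta> k \<le> D" for k unfolding D_def by (rule ell_qnorm_ge[OF R]) simp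
  have z1': "?F (z1 k) \<le> ennreal (2 powr (real_of_int k * (\<theta> - 1))) * \<beta> k" for k
  proof -
    have "?F (z1 k) = ennreal (2 powr (- real_of_int k)) * (ennreal (2 powr real_of_int k) * ?F (z1 k))"
      by (simp add: mult.assoc[symmetric] flip: ennreal_mult powr_add)
    also have "\<dots> \<le> ennreal (2 powr (- real_of_int k)) * (ennreal (2 powr (real_of_int k * \<theta>)) * \<beta> k)" by (intro mult_left_mono z1) simp
    also have "\<dots> = ennreal (2 powr (- real_of_int k) * 2 powr (real_of_int k * \<theta>)) * \<beta> k"
      by (simp only: mult.assoc ennreal_mult powr_ge_zero)
    also have "2 powr (- real_of_int k) * 2 powr (real_of_int k * \<theta>) = 2 powr (real_of_int k * (\<theta> - 1))"
      unfolding powr_add[symmetric] by (simp add: algebra_simps)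
    finally show ?thesis .
  qed
  have cross: "\<exists>k. y j m \<le> 2 * z1 k j m \<and> y j m \<le> 2 * z0 (k + 1) j m" if m: "m \<in> meeting_cubes \<Omega> j" for j m
  proof (cases "y j m = 0")
    case False
    \<comment> \<open>Any number with the property that a part below \<open>c\<close> is less than half of the entry.\<close>
    define c where "c = (if y j m = top then 1 else y j m / 2)"
    have c: "0 < c" using False by (auto simp: c_def zero_less_iff_neq_zero ennreal_divide_eq_0_iff)
    have "\<exists>N. \<forall>k\<in>{..0}. N \<le> \<bar>k\<bar> \<longrightarrow> z0 k j m < c"
    proof (rule seq_qnorm_coord_tendsto_0[OF p(1) q(1) m _ _ _ c])
      show "D < top" using fin by (simp add: D_def)
      show "- \<theta> < 0" using th by simp
      fix k :: int assume k: "k \<in> {..0}"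
      then have "- \<theta> * \<bar>real_of_int k\<bar> = real_of_int k * \<theta>" by simp
      then show "seq_qnorm s0 p0 q0 \<Omega> (z0 k) \<le> ennreal (2 powr (- \<theta> * \<bar>real_of_int k\<bar>)) * D"
        using order_trans[OF z0 mult_left_mono[OF \<beta>D zero_le], of k] by simp
    qed
    then obtain N0 where N0: "\<And>k. k \<le> 0 \<Longrightarrow> N0 \<le> \<bar>k\<bar> \<Longrightarrow> z0 k j m < c" by auto
    have "\<exists>N. \<forall>k\<in>{0..}. N \<le> \<bar>k\<bar> \<longrightarrow> z1 k j m < c"
    proof (rule seq_qnorm_coord_tendsto_0[OF p(2) q(2) m _ _ _ c])
      show "D < top" using fin by (simp add: D_def)
      show "\<theta> - 1 < 0" using th by simp
      fix k :: int assume k: "k \<in> {0..}"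
      then have "\<bar>real_of_int k\<bar> = real_of_int k" by simp
      then have "(\<theta> - 1) * \<bar>real_of_int k\<bar> = real_of_int k * (\<theta> - 1)" by (simp only: mult.commute)
      then show "?F (z1 k) \<le> ennreal (2 powr ((\<theta> - 1) * \<bar>real_of_int k\<bar>)) * D"
        using order_trans[OF z1' mult_left_mono[OF \<beta>D zero_le], of k] by (simp only:)
    qed
    then obtain N1 where N1: "\<And>k. 0 \<le> k \<Longrightarrow> N1 \<le> \<bar>k\<bar> \<Longrightarrow> z1 k j m < c" by auto
    have half: "y j m \<le> 2 * b" if "y j m \<le> a + b" "a \<le> b" for a b
      using that by (metis add_mono order_refl order_trans mult_2)
    have c2: "\<not> y j m \<le> 2 * b" if "b < c" for b
    proof
      assume *: "y j m \<le> 2 * b"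
      show False
      proof (cases "y j m = top")
        case True
        then have "2 * b = top" using * by (simp add: top_unique)
        then show False using that True by (auto simp: c_def ennreal_mult_eq_top_iff)
      next
        case False
        have "y j m / 2 \<le> b" using * by (intro divide_le_posI_ennreal) (auto simp: mult.commute)
        then show False using that False by (auto simp: c_def)
      qed
    qed
    define P where "P k \<longleftrightarrow> y j m \<le> 2 * z1 k j m" for k
    have lowP: "P (- int n)" if "nat N0 \<le> n" for n
    proof -
      have "z0 (- int n) j m < c" using that by (intro N0) auto
      then have "\<not> y j m \<le> 2 * z0 (- int n) j m" by (rule c2)
      then have "z0 (- int n) j m \<le> z1 (- int n) j m" using half[of "z1 (- int n) j m" "z0 (- int n) j m"] y[of j m "- int n"] by (simp add: add.commute linear) (metis linear)
      then show ?thesis using half y[of j m "- int n"] by (simp add: P_def)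
    qed
    have highP: "\<not> P (int (nat N1))"
      unfolding P_def by (rule c2, rule N1) auto
    have "\<exists>n. \<not> P (- int (nat N0) + int n)"
      using highP by (intro exI[of _ "nat N0 + nat N1"]) simp
    then obtain n where n: "\<not> P (- int (nat N0) + int n)" "\<And>i. i < n \<Longrightarrow> P (- int (nat N0) + int i)"
      using exists_least_iff[of "\<lambda>n. \<not> P (- int (nat N0) + int n)"] by blast
    have "n \<noteq> 0" using n(1) lowP[of "nat N0"] by (intro notI) simp
    then obtain n' where n': "n = Suc n'" using not0_implies_Suc by blast
    define k where "k = - int (nat N0) + int n'"
    have k: "P k" "\<not> P (k + 1)" using n(2)[of n'] n(1) by (simp_all add: k_def n' algebra_simps)
    have "z1 (k + 1) j m \<le> z0 (k + 1) j m"
      using k(2) half[OF y[of j m "k + 1"]] linear unfolding P_def by blast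
    then have "y j m \<le> 2 * z0 (k + 1) j m" using half[of "z1 (k + 1) j m" "z0 (k + 1) j m"] y[of j m "k + 1"] by (simp add: add.commute)
    then show ?thesis using k(1) by (auto simp: P_def)
  qed simp
  define \<kappa> where "\<kappa> j m = (SOME k. y j m \<le> 2 * z1 k j m \<and> y j m \<le> 2 * z0 (k + 1) j m)" for j m
  have \<kappa>: "y j m \<le> 2 * z1 (\<kappa> j m) j m" "y j m \<le> 2 * z0 (\<kappa> j m + 1) j m" if "m \<in> meeting_cubes \<Omega> j" for j m
    using someI_ex[OF cross[OF that]] by (simp_all add: \<kappa>_def)
  have piece: "seq_qnorm s ?R ?R \<Omega> (part (\<lambda>j. {m. \<kappa> j m = k}) y) \<le> 4 * (enn_powr (\<beta> (k + 1)) (1 - \<theta>) * enn_powr (\<beta> k) \<theta>)" for k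
  proof -
    have "seq_qnorm s ?R ?R \<Omega> (part (\<lambda>j. {m. \<kappa> j m = k}) y)
       \<le> seq_qnorm s ?R ?R \<Omega> (\<lambda>j m. 2 * (enn_powr (z0 (k + 1) j m) (1 - \<theta>) * enn_powr (z1 k j m) \<theta>))"
    proof (rule seq_qnorm_mono[OF R R])
      fix j m assume m: "m \<in> meeting_cubes \<Omega> j"
      show "part (\<lambda>j. {m. \<kappa> j m = k}) y j m \<le> 2 * (enn_powr (z0 (k + 1) j m) (1 - \<theta>) * enn_powr (z1 k j m) \<theta>)"
      proof (cases "\<kappa> j m = k")
        case True
        have "y j m = enn_powr (y j m) (1 - \<theta>) * enn_powr (y j m) \<theta>" by (simp flip: enn_powr_add_exp)
        also have "\<dots> \<le> enn_powr (2 * z0 (k + 1) j m) (1 - \<theta>) * enn_powr (2 * z1 k j m) \<theta>"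
          using \<kappa>[OF m] True th by (intro mult_mono enn_powr_mono) auto
        also have "\<dots> = (enn_powr 2 (1 - \<theta>) * enn_powr 2 \<theta>) * (enn_powr (z0 (k + 1) j m) (1 - \<theta>) * enn_powr (z1 k j m) \<theta>)"
          by (simp add: enn_powr_mult mult_ac)
        also have "enn_powr 2 (1 - \<theta>) * enn_powr 2 \<theta> = 2" by (simp flip: enn_powr_add_exp)
        finally show ?thesis using True by (simp add: part_def)
      qed (simp add: part_def)
    qed
    also have "\<dots> = 2 * seq_qnorm s ?R ?R \<Omega> (\<lambda>j m. enn_powr (z0 (k + 1) j m) (1 - \<theta>) * enn_powr (z1 k j m) \<theta>)"
      by (rule seq_qnorm_cmult[OF R R])
    also have "\<dots> \<le> 2 * (enn_powr (seq_qnorm s0 p0 q0 \<Omega> (z0 (k + 1))) (1 - \<theta>) * enn_powr (?F (z1 k)) \<theta>)"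
      using r rp rq by (intro mult_left_mono seq_qnorm_Holder R p q th ss) auto
    also have "\<dots> \<le> 2 * (enn_powr (ennreal (2 powr (real_of_int (k + 1) * \<theta>)) * \<beta> (k + 1)) (1 - \<theta>) * enn_powr (ennreal (2 powr (real_of_int k * (\<theta> - 1))) * \<beta> k) \<theta>)"
      using th by (intro mult_left_mono mult_mono enn_powr_mono z0 z1') auto
    also have "\<dots> = 2 * (ennreal (2 powr (\<theta> * (1 - \<theta>))) * (enn_powr (\<beta> (k + 1)) (1 - \<theta>) * enn_powr (\<beta> k) \<theta>))"
    proof -
      have "real_of_int (k + 1) * \<theta> * (1 - \<theta>) + real_of_int k * (\<theta> - 1) * \<theta> = \<theta> * (1 - \<theta>)" by (simp add: algebra_simps)
      then have "2 powr (real_of_int (k + 1) * \<theta> * (1 - \<theta>)) * 2 powr (real_of_int k * (\<theta> - 1) * \<theta>) = 2 powr (\<theta> * (1 - \<theta>))"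
        by (metis powr_add)
      then have c: "enn_powr (ennreal (2 powr (real_of_int (k + 1) * \<theta>))) (1 - \<theta>) * enn_powr (ennreal (2 powr (real_of_int k * (\<theta> - 1)))) \<theta> = ennreal (2 powr (\<theta> * (1 - \<theta>)))"
        by (simp add: enn_powr_ennreal powr_powr flip: ennreal_mult)
      then show ?thesis unfolding enn_powr_mult c[symmetric] by (simp only: mult_ac)
    qed
    also have "\<dots> \<le> 2 * (2 * (enn_powr (\<beta> (k + 1)) (1 - \<theta>) * enn_powr (\<beta> k) \<theta>))"
    proof (intro mult_left_mono mult_right_mono)
      have "\<theta> * (1 - \<theta>) \<le> 1 * 1" using th by (intro mult_mono) auto
      then have "2 powr (\<theta> * (1 - \<theta>)) \<le> 2 powr 1" by (intro powr_mono) auto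
      then show "ennreal (2 powr (\<theta> * (1 - \<theta>))) \<le> 2" using ennreal_leI by fastforce
    qed auto
    finally show ?thesis by (simp add: mult.assoc[symmetric])
  qed
  have "seq_qnorm s ?R ?R \<Omega> y \<le> ell_qnorm ?R UNIV (\<lambda>k. seq_qnorm s ?R ?R \<Omega> (part (\<lambda>j. {m. \<kappa> j m = k}) y))"
    by (rule seq_qnorm_split_le[OF r])
  also have "\<dots> \<le> ell_qnorm ?R UNIV (\<lambda>k. 4 * (enn_powr (\<beta> (k + 1)) (1 - \<theta>) * enn_powr (\<beta> k) \<theta>))"
    by (intro ell_qnorm_mono R piece)
  also have "\<dots> = 4 * ell_qnorm ?R UNIV (\<lambda>k. enn_powr (\<beta> (k + 1)) (1 - \<theta>) * enn_powr (\<beta> k) \<theta>)" by (rule ell_qnorm_cmult[OF R])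
  also have "\<dots> \<le> 4 * (enn_powr (ell_qnorm ?R UNIV (\<lambda>k. \<beta> (k + 1))) (1 - \<theta>) * enn_powr D \<theta>)"
    unfolding D_def by (intro mult_left_mono ell_qnorm_Holder R th) (auto simp: algebra_simps)
  also have "\<dots> \<le> 4 * (enn_powr D (1 - \<theta>) * enn_powr D \<theta>)"
    unfolding D_def using th by (intro mult_left_mono mult_right_mono enn_powr_mono ell_qnorm_reindex_le R) (auto simp: inj_on_def)
  also have "\<dots> = 4 * D" by (simp flip: enn_powr_add_exp)
  finally show ?thesis by (simp add: D_def)
qed

text \<open>
  Decompositions that attain the \<open>K\<close>-functional at \<open>2\<^sup>k\<close> up to an additive error, geometrically small in \<open>|k|\<close>, provide
  the parts. The additive form of the error covers the case that the \<open>K\<close>-functional vanishes.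
\<close>

lemma sub_interp_diagonal:
  fixes \<Omega> :: "(real ^ 'n) set"
  assumes r: "0 < r" and p: "0 < p0" "0 < p1" and q: "0 < q0" "0 < q1" and th: "0 < \<theta>" "\<theta> < 1"
    and ss: "s = (1 - \<theta>) * s0 + \<theta> * s1"
    and rp: "1 / r = (1 - \<theta>) * inv_exp p0 + \<theta> * inv_exp p1" and rq: "1 / r = (1 - \<theta>) * inv_exp q0 + \<theta> * inv_exp q1"
  obtains C where "0 < C" "sub_interp C \<theta> (ennreal r) (seq_qnorm s0 p0 q0 \<Omega>) (seq_qnorm s1 p1 q1 \<Omega>) (seq_qnorm s (ennreal r) (ennreal r) \<Omega>)"
proof -
  let ?E = "seq_qnorm s0 p0 q0 \<Omega>"
  let ?F = "seq_qnorm s1 p1 q1 \<Omega>"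
  let ?R = "ennreal r"
  have R: "0 < ?R" using r by simp
  obtain C where C: "0 < C" "\<And>(A0 :: (real ^ 'n \<Rightarrow> complex) qn_space) A1 f.
    ell_qnorm ?R (UNIV :: int set) (\<lambda>k. ennreal (2 powr (- real_of_int k * \<theta>)) * K_functional A0 A1 (2 powr real_of_int k) f)
      \<le> ennreal C * interp_qnorm \<theta> ?R A0 A1 f"
    using ell_qnorm_K_functional_le[of 2, OF _ th(1) R] by auto
  obtain G where G: "0 < G" "\<And>(I::int set) h. inj_on h I \<Longrightarrow> ell_qnorm ?R I (\<lambda>i. ennreal (2 powr (- 1 * \<bar>real_of_int (h i)\<bar>))) \<le> ennreal G"
    using ell_qnorm_geometric[OF R, of 1] by auto
  obtain B where B: "0 < B" "\<And>(I::int set) x y. ell_qnorm ?R I (\<lambda>i. x i + y i) \<le> ennreal B * (ell_qnorm ?R I x + ell_qnorm ?R I y)"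
    using ell_qnorm_add_le[OF R] by blast
  show ?thesis
  proof (rule that[of "4 * B * C"])
    show "0 < 4 * B * C" using B C by simp
    show "sub_interp (4 * B * C) \<theta> ?R ?E ?F (seq_qnorm s ?R ?R \<Omega>)"
      unfolding sub_interp_def
    proof (intro allI impI)
      fix A0 A1 :: "(real ^ 'n \<Rightarrow> complex) qn_space" and f and y :: "nat \<Rightarrow> int ^ 'n \<Rightarrow> ennreal"
      assume *: "\<forall>f0\<in>vecs A0. \<forall>f1\<in>vecs A1. f = (\<lambda>x. f0 x + f1 x) \<longrightarrow>
        (\<exists>z0 z1. (\<forall>j m. y j m \<le> z0 j m + z1 j m) \<and> ?E z0 \<le> qn A0 f0 \<and> ?F z1 \<le> qn A1 f1)"
      let ?N = "interp_qnorm \<theta> ?R A0 A1 f"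
      let ?K = "\<lambda>k::int. K_functional A0 A1 (2 powr real_of_int k) f"
      let ?b = "\<lambda>k::int. ennreal (2 powr (- real_of_int k * \<theta>)) * ?K k"
      show "seq_qnorm s ?R ?R \<Omega> y \<le> ennreal (4 * B * C) * ?N"
      proof (cases "?N = top")
        case True
        then show ?thesis using B C by (simp add: ennreal_mult_top)
      next
        case False
        then have "ennreal C * ?N < top" by (simp add: ennreal_mult_less_top less_top)
        then have finb: "ell_qnorm ?R UNIV ?b < top" by (rule le_less_trans[OF C(2)])
        have est: "seq_qnorm s ?R ?R \<Omega> y \<le> 4 * (ennreal B * (ennreal C * ?N + ennreal (\<epsilon> * G)))" if \<epsilon>: "0 < \<epsilon>" for \<epsilon>
        proof -
          define \<beta> where "\<beta> k = ?b k + ennreal \<epsilon> * ennreal (2 powr (- 1 * \<bar>real_of_int k\<bar>))" for k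
          have \<beta>: "ell_qnorm ?R UNIV \<beta> \<le> ennreal B * (ell_qnorm ?R UNIV ?b + ennreal (\<epsilon> * G))"
          proof -
            have "ell_qnorm ?R UNIV \<beta> \<le> ennreal B * (ell_qnorm ?R UNIV ?b + ell_qnorm ?R UNIV (\<lambda>k. ennreal \<epsilon> * ennreal (2 powr (- 1 * \<bar>real_of_int k\<bar>))))"
              unfolding \<beta>_def by (rule B(2))
            also have "\<dots> \<le> ennreal B * (ell_qnorm ?R UNIV ?b + ennreal \<epsilon> * ennreal G)"
              unfolding ell_qnorm_cmult[OF R] using G(2)[of "\<lambda>k. k" UNIV] by (intro mult_left_mono add_left_mono) auto
            finally show ?thesis using \<epsilon> G by (simp add: ennreal_mult)
          qed
          have "\<exists>z0 z1. (\<forall>j m. y j m \<le> z0 j m + z1 j m) \<and> ?E z0 \<le> ennreal (2 powr (real_of_int k * \<theta>)) * \<beta> k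
              \<and> ennreal (2 powr real_of_int k) * ?F z1 \<le> ennreal (2 powr (real_of_int k * \<theta>)) * \<beta> k" for k
          proof -
            have gen: "a < a + b" if "a < top" "0 < b" for a b :: ennreal
              using that ennreal_add_left_cancel_less[of a 0 b] by simp
            have gen2: "a \<le> c \<and> b \<le> c" if "a + b \<le> c" for a b c :: ennreal
              using order_trans[OF _ that] by (simp add: add_increasing add_increasing2)
            have cancel: "ennreal (2 powr (real_of_int k * \<theta>)) * ?b k = ?K k"
              by (simp add: mult.assoc[symmetric] flip: ennreal_mult powr_add)
            have "?b k < top" using le_less_trans[OF ell_qnorm_ge[OF R, of k UNIV ?b] finb] by simp
            then have "?K k < top" by (auto simp: ennreal_mult_less_top)
            moreover have "0 < ennreal (2 powr (real_of_int k * \<theta>)) * (ennreal \<epsilon> * ennreal (2 powr (- 1 * \<bar>real_of_int k\<bar>)))"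
              using \<epsilon> by (simp flip: ennreal_mult)
            ultimately have "?K k < ennreal (2 powr (real_of_int k * \<theta>)) * \<beta> k"
              unfolding \<beta>_def distrib_left cancel using gen by blast
            then obtain f0 f1 where f: "f0 \<in> vecs A0" "f1 \<in> vecs A1" "f = (\<lambda>x. f0 x + f1 x)"
              and le: "qn A0 f0 + ennreal (2 powr real_of_int k) * qn A1 f1 < ennreal (2 powr (real_of_int k * \<theta>)) * \<beta> k"
              unfolding K_functional_def INF_less_iff by auto
            obtain z0 z1 where z: "\<forall>j m. y j m \<le> z0 j m + z1 j m" "?E z0 \<le> qn A0 f0" "?F z1 \<le> qn A1 f1"
              using * f by blast
            have "?E z0 + ennreal (2 powr real_of_int k) * ?F z1 \<le> ennreal (2 powr (real_of_int k * \<theta>)) * \<beta> k"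
              using z(2,3) by (intro order_trans[OF add_mono less_imp_le[OF le]] mult_left_mono) auto
            then have "?E z0 \<le> ennreal (2 powr (real_of_int k * \<theta>)) * \<beta> k"
              "ennreal (2 powr real_of_int k) * ?F z1 \<le> ennreal (2 powr (real_of_int k * \<theta>)) * \<beta> k"
              using gen2 by blast+
            then show ?thesis using z(1) by blast
          qed
          then obtain z0 z1 where z: "\<And>k j m. y j m \<le> z0 k j m + z1 k j m"
            "\<And>k. ?E (z0 k) \<le> ennreal (2 powr (real_of_int k * \<theta>)) * \<beta> k"
            "\<And>k. ennreal (2 powr real_of_int k) * ?F (z1 k) \<le> ennreal (2 powr (real_of_int k * \<theta>)) * \<beta> k" by metis
          have "ell_qnorm ?R UNIV \<beta> < top" using \<beta> finb by (simp add: le_less_trans ennreal_mult_less_top)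
          then have "seq_qnorm s ?R ?R \<Omega> y \<le> 4 * ell_qnorm ?R UNIV \<beta>"
            by (rule seq_qnorm_le_interpolated_pairs[OF r p q th ss rp rq z])
          also have "\<dots> \<le> 4 * (ennreal B * (ell_qnorm ?R UNIV ?b + ennreal (\<epsilon> * G)))" by (intro mult_left_mono \<beta>) simp
          also have "\<dots> \<le> 4 * (ennreal B * (ennreal C * ?N + ennreal (\<epsilon> * G)))" by (intro mult_left_mono add_right_mono C(2)) auto
          finally show ?thesis .
        qed
        show ?thesis
        proof (rule ennreal_le_epsilon)
          fix e :: real assume e: "0 < e"
          define \<epsilon> where "\<epsilon> = e / (4 * B * G)"
          have \<epsilon>: "0 < \<epsilon>" "4 * B * (\<epsilon> * G) = e" using e B G by (simp_all add: \<epsilon>_def)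
          have "4 * (ennreal B * (ennreal C * ?N + ennreal (\<epsilon> * G))) = ennreal (4 * B * C) * ?N + ennreal (4 * B * (\<epsilon> * G))"
            using B(1) C(1) G(1) \<epsilon>(1) by (simp add: ennreal_mult distrib_left mult.assoc)
          then show "seq_qnorm s ?R ?R \<Omega> y \<le> ennreal (4 * B * C) * ?N + ennreal e" using est[OF \<epsilon>(1)] \<epsilon>(2) by simp
        qed
      qed
    qed
  qed
qed

section \<open>Interpolation of Besov spaces\<close>

lemma C_k_antimono: "C_k k f \<Longrightarrow> k' \<le> k \<Longrightarrow> C_k k' f"
proof (induction k' arbitrary: k f)
  case 0
  then show ?case by (simp add: C_k_imp_continuous)
next
  case (Suc k')
  then obtain k'' where "k = Suc k''" "k' \<le> k''" by (metis Suc_le_D Suc_le_mono)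
  then show ?case using Suc by auto
qed

lemma atom_mono:
  assumes "atom d K j m a" "d \<le> d'" "K' \<le> K"
  shows "atom d' K' j m a"
  using assms C_k_antimono[of K a K'] cube_mono[of d d' j m] unfolding atom_def by auto

lemma le_add_INF:
  fixes A :: "'a \<Rightarrow> ennreal" and B :: "'b \<Rightarrow> ennreal"
  assumes "\<And>c c'. X \<le> A c + B c'"
  shows "X \<le> (INF c. A c) + (INF c. B c)"
proof (rule ennreal_le_epsilon)
  fix e :: real assume e: "0 < e" and fin: "(INF c. A c) + (INF c. B c) < top"
  have gen: "a < a + ennreal (e / 2)" if "a < top" for a :: ennreal
    using that e ennreal_add_left_cancel_less[of a 0 "ennreal (e / 2)"] by simp
  have "(INF c. A c) < top" "(INF c. B c) < top" using fin by (auto simp: ennreal_add_less_top)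
  then have "(INF c. A c) < (INF c. A c) + ennreal (e / 2)" "(INF c. B c) < (INF c. B c) + ennreal (e / 2)" using gen by blast+
  then obtain c c' where c: "A c < (INF c. A c) + ennreal (e / 2)" "B c' < (INF c. B c) + ennreal (e / 2)"
    unfolding INF_less_iff by blast
  have "X \<le> ((INF c. A c) + ennreal (e / 2)) + ((INF c. B c) + ennreal (e / 2))"
    using assms[of c c'] c by (meson add_mono less_imp_le order_trans)
  also have "\<dots> = (INF c. A c) + (INF c. B c) + (ennreal (e / 2) + ennreal (e / 2))" by (simp add: add_ac)
  also have "ennreal (e / 2) + ennreal (e / 2) = ennreal e" using e by (simp flip: ennreal_plus)
  finally show "X \<le> (INF c. A c) + (INF c. B c) + ennreal e" .
qed

lemma osc_add_le:
  fixes f g :: "real ^ 'n \<Rightarrow> complex"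
  assumes u: "0 < u" "u \<le> 1" and [measurable]: "f \<in> borel_measurable (lebesgue_on \<Omega>)" "g \<in> borel_measurable (lebesgue_on \<Omega>)"
  shows "osc u \<Omega> (\<lambda>x. f x + g x) l m \<le> osc u \<Omega> f l m + osc u \<Omega> g l m"
proof -
  let ?L = "lebesgue_on \<Omega>"
  let ?W = "ennreal (2 ^ (l * CARD('n)))"
  have "osc u \<Omega> (\<lambda>x. f x + g x) l m \<le> ?W * (\<integral>\<^sup>+x. pw u (f x - c) * indicator (cube 3 l m) x \<partial>?L)
     + ?W * (\<integral>\<^sup>+x. pw u (g x - c') * indicator (cube 3 l m) x \<partial>?L)" for c c'
  proof -
    have [measurable]: "(\<lambda>x. indicator (cube 3 l m) x :: ennreal) \<in> borel_measurable ?L"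
      by (rule borel_measurable_lebesgue_on_borel) measurable
    have "osc u \<Omega> (\<lambda>x. f x + g x) l m \<le> ?W * (\<integral>\<^sup>+x. pw u (f x + g x - (c + c')) * indicator (cube 3 l m) x \<partial>?L)"
      unfolding osc_def by (rule INF_lower) simp
    also have "\<dots> \<le> ?W * (\<integral>\<^sup>+x. pw u (f x - c) * indicator (cube 3 l m) x + pw u (g x - c') * indicator (cube 3 l m) x \<partial>?L)"
    proof (intro mult_left_mono nn_integral_mono)
      fix x
      have "pw u (f x + g x - (c + c')) \<le> pw u (f x - c) + pw u (g x - c')"
        using pw_add_le[OF u, of "f x - c" "g x - c'"] by (simp add: algebra_simps)
      then show "pw u (f x + g x - (c + c')) * indicator (cube 3 l m) x \<le> pw u (f x - c) * indicator (cube 3 l m) x + pw u (g x - c') * indicator (cube 3 l m) x"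
        by (auto simp: indicator_def)
    qed simp
    also have "\<dots> = ?W * ((\<integral>\<^sup>+x. pw u (f x - c) * indicator (cube 3 l m) x \<partial>?L)
      + (\<integral>\<^sup>+x. pw u (g x - c') * indicator (cube 3 l m) x \<partial>?L))"
      by (subst nn_integral_add) auto
    finally show ?thesis by (simp add: distrib_left)
  qed
  then show ?thesis unfolding osc_def[of u \<Omega> f] osc_def[of u \<Omega> g] by (rule le_add_INF)
qed

lemma enn_powr_add_root_le:
  assumes "0 < u"
  shows "enn_powr (a + b) (1 / u) \<le> ennreal (2 powr (1 / u)) * (enn_powr a (1 / u) + enn_powr b (1 / u))"
proof -
  have "enn_powr (a + b) (1 / u) \<le> enn_powr (2 * max a b) (1 / u)"
    using assms by (intro enn_powr_mono) (auto simp: mult_2 intro!: add_mono)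
  also have "\<dots> = ennreal (2 powr (1 / u)) * enn_powr (max a b) (1 / u)"
    using enn_powr_ennreal[of 2 "1 / u"] by (simp add: enn_powr_mult)
  also have "\<dots> \<le> ennreal (2 powr (1 / u)) * (enn_powr a (1 / u) + enn_powr b (1 / u))"
    by (intro mult_left_mono) (auto simp: max_def add_increasing add_increasing2)
  finally show ?thesis .
qed

lemma osc_seq_add_le:
  assumes u: "0 < u" "u \<le> 1" and f: "f \<in> borel_measurable (lebesgue_on \<Omega>)" "g \<in> borel_measurable (lebesgue_on \<Omega>)"
  shows "osc_seq u \<Omega> (\<lambda>x. f x + g x) l m \<le> ennreal (2 powr (1 / u)) * (osc_seq u \<Omega> f l m + osc_seq u \<Omega> g l m)"
proof -
  have "osc_seq u \<Omega> (\<lambda>x. f x + g x) l m \<le> enn_powr (osc u \<Omega> f l m + osc u \<Omega> g l m) (1 / u)"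
    unfolding osc_seq_def using u by (intro enn_powr_mono osc_add_le f) auto
  also have "\<dots> \<le> ennreal (2 powr (1 / u)) * (osc_seq u \<Omega> f l m + osc_seq u \<Omega> g l m)"
    unfolding osc_seq_def by (rule enn_powr_add_root_le[OF u(1)])
  finally show ?thesis .
qed

lemma Lu_qnorm_add_le:
  assumes u: "0 < u" "u \<le> 1" and [measurable]: "f \<in> borel_measurable (lebesgue_on \<Omega>)" "g \<in> borel_measurable (lebesgue_on \<Omega>)"
  shows "Lu_qnorm u \<Omega> (\<lambda>x. f x + g x) \<le> ennreal (2 powr (1 / u)) * (Lu_qnorm u \<Omega> f + Lu_qnorm u \<Omega> g)"
proof -
  let ?L = "lebesgue_on \<Omega>"
  have "(\<integral>\<^sup>+x. pw u (f x + g x) \<partial>?L) \<le> (\<integral>\<^sup>+x. pw u (f x) + pw u (g x) \<partial>?L)"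
    by (intro nn_integral_mono pw_add_le u)
  also have "\<dots> = (\<integral>\<^sup>+x. pw u (f x) \<partial>?L) + (\<integral>\<^sup>+x. pw u (g x) \<partial>?L)" by (rule nn_integral_add) auto
  finally have "Lu_qnorm u \<Omega> (\<lambda>x. f x + g x) \<le> enn_powr ((\<integral>\<^sup>+x. pw u (f x) \<partial>?L) + (\<integral>\<^sup>+x. pw u (g x) \<partial>?L)) (1 / u)"
    unfolding Lu_qnorm_def using u by (intro enn_powr_mono) auto
  also have "\<dots> \<le> ennreal (2 powr (1 / u)) * (Lu_qnorm u \<Omega> f + Lu_qnorm u \<Omega> g)"
    unfolding Lu_qnorm_def by (rule enn_powr_add_root_le[OF u(1)])
  finally show ?thesis .
qed

lemma besov_measurable: "f \<in> vecs (besov d K s p q \<Omega>) \<Longrightarrow> f \<in> borel_measurable (lebesgue_on \<Omega>)"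
  by (simp add: besov_def Lp_fun_def)

lemma besov_qn_finite: "f \<in> vecs (besov d K s p q \<Omega>) \<Longrightarrow> qn (besov d K s p q \<Omega>) f < top"
  by (auto simp: besov_def INF_less_iff)

lemma b_qnorm_part:
  "b_qnorm s p q \<Omega> (part S \<mu>) = seq_qnorm s p q \<Omega> (part S (\<lambda>j m. ennreal (norm (\<mu> j m))))"
  unfolding b_qnorm_eq_seq_qnorm by (rule arg_cong[where f = "seq_qnorm s p q \<Omega>"]) (auto simp: part_def fun_eq_iff)

text \<open>
  Decompose \<open>f\<close> into atoms for both end point spaces and cut the coefficients. Both parts converge by
  synthesis and add up to \<open>f\<close>.
\<close>

lemma besov_le_interp:
  fixes \<Omega> :: "(real ^ 'n) set"
  assumes bd: "bounded \<Omega>" and meas: "\<Omega> \<in> sets lebesgue" and cork: "corkscrew c0 \<Omega>"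
    and u: "0 < u" "u \<le> 1" "ennreal u \<le> p" and p: "0 < p0" "0 < p1" and q: "0 < q" "0 < q0" "0 < q1" and th: "0 < \<theta>"
    and s: "0 < s0" "0 < s1" "0 < s" "s < 1" and d: "1 \<le> d0" "1 \<le> d1" "1 \<le> d" and K: "1 \<le> K"
    and C: "1 \<le> C" and sp: "splits_all C \<theta> q (seq_qnorm s0 p0 q0 \<Omega>) (seq_qnorm s1 p1 q1 \<Omega>) (seq_qnorm s p q \<Omega>)"
  obtains C' where "0 < C'" "\<And>f. f \<in> vecs (besov d K s p q \<Omega>) \<Longrightarrow>
      f \<in> vecs (interp \<theta> q (besov d0 K0 s0 p0 q0 \<Omega>) (besov d1 K1 s1 p1 q1 \<Omega>)) \<and>
      interp_qnorm \<theta> q (besov d0 K0 s0 p0 q0 \<Omega>) (besov d1 K1 s1 p1 q1 \<Omega>) f \<le> ennreal C' * qn (besov d K s p q \<Omega>) f"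
proof -
  let ?Q = "seq_qnorm s p q \<Omega>"
  let ?L = "lebesgue_on \<Omega>"
  let ?E = "besov d0 K0 s0 p0 q0 \<Omega>" and ?F = "besov d1 K1 s1 p1 q1 \<Omega>" and ?B = "besov d K s p q \<Omega>"
  \<comment> \<open>Atoms for the smallest support and the largest order of differentiability are atoms for both end point spaces.\<close>
  define d' where "d' = min d0 d1"
  define K' where "K' = max K0 K1"
  have d': "1 \<le> d'" using d by (simp add: d'_def)
  obtain Co where Co: "0 < Co"
    "\<And>f. f \<in> vecs ?B \<Longrightarrow> ?Q (osc_seq u \<Omega> f) \<le> ennreal Co * qn ?B f"
    "\<And>f. f \<in> vecs ?B \<Longrightarrow> Lu_qnorm u \<Omega> f \<le> ennreal Co * qn ?B f"
    using besov_osc_seq_le[OF bd meas _ K u q(1) s(3,4), of d] d by auto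
  obtain Ca where Ca: "0 < Ca" "\<And>f. f \<in> borel_measurable ?L \<Longrightarrow> ?Q (osc_seq u \<Omega> f) < top \<Longrightarrow>
     Lu_qnorm u \<Omega> f < top \<Longrightarrow> \<exists>\<mu> a. (\<forall>j. \<forall>m\<in>meeting_cubes \<Omega> j. atom d' K' j m (a j m)) \<and>
       (AE x in ?L. f x = (\<Sum>j. atom_sum \<Omega> \<mu> a j x)) \<and>
       b_qnorm s p q \<Omega> \<mu> \<le> ennreal Ca * (?Q (osc_seq u \<Omega> f) + Lu_qnorm u \<Omega> f)"
    by (rule atomic_analysis[OF bd meas cork u q(1) s(3,4) d', where K = K']) (rule that)
  obtain Ci where Ci: "0 < Ci" "\<And>(A0 :: (real ^ 'n \<Rightarrow> complex) qn_space) A1 f t \<beta>.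
    (\<And>k::int. 0 < t k) \<Longrightarrow> (\<And>\<tau>. 0 < \<tau> \<Longrightarrow> \<exists>k. t k / C \<le> \<tau> \<and> \<tau> \<le> C * t k) \<Longrightarrow>
    (\<And>k. K_functional A0 A1 (t k) f \<le> ennreal (t k powr \<theta>) * \<beta> k) \<Longrightarrow>
    interp_qnorm \<theta> q A0 A1 f \<le> ennreal Ci * ell_qnorm q UNIV \<beta>"
    using interp_qnorm_le_discrete[OF th q(1) C] by metis
  define P where "P = Ca * (Co + Co)"
  have P: "0 < P" using Ca(1) Co(1) by (simp add: P_def)
  define C' where "C' = Ci * (2 * C * P)"
  show ?thesis
  proof (rule that[of C'])
    show "0 < C'" using Ci(1) C P by (simp add: C'_def)
    fix f assume f: "f \<in> vecs ?B"
    have fm: "f \<in> borel_measurable ?L" using besov_measurable[OF f] .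
    have qf: "ennreal Co * qn ?B f < top" using besov_qn_finite[OF f] by (simp add: ennreal_mult_less_top)
    obtain \<mu> a where a: "\<And>j m. m \<in> meeting_cubes \<Omega> j \<Longrightarrow> atom d' K' j m (a j m)"
      and fa: "AE x in ?L. f x = (\<Sum>j. atom_sum \<Omega> \<mu> a j x)"
      and \<mu>: "b_qnorm s p q \<Omega> \<mu> \<le> ennreal Ca * (?Q (osc_seq u \<Omega> f) + Lu_qnorm u \<Omega> f)"
      using Ca(2)[OF fm le_less_trans[OF Co(2)[OF f] qf] le_less_trans[OF Co(3)[OF f] qf]] by blast
    have "b_qnorm s p q \<Omega> \<mu> \<le> ennreal Ca * (ennreal Co * qn ?B f + ennreal Co * qn ?B f)"
      by (rule order_trans[OF \<mu>]) (intro mult_left_mono add_mono Co f, simp)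
    also have "\<dots> = ennreal (Ca * (Co + Co)) * qn ?B f" using Ca(1) Co(1) by (simp add: ennreal_mult mult.assoc flip: mult_2)
    finally have \<mu>le: "b_qnorm s p q \<Omega> \<mu> \<le> ennreal P * qn ?B f" unfolding P_def .
    then have \<mu>fin: "b_qnorm s p q \<Omega> \<mu> < top"
      by (rule le_less_trans) (use besov_qn_finite[OF f] in \<open>simp add: ennreal_mult_less_top\<close>)
    let ?x = "\<lambda>j m. ennreal (norm (\<mu> j m))"
    have xfin: "?Q ?x < top" using \<mu>fin by (simp add: b_qnorm_eq_seq_qnorm)
    have "splits C \<theta> q (seq_qnorm s0 p0 q0 \<Omega>) (seq_qnorm s1 p1 q1 \<Omega>) ?x (?Q ?x)"
      using sp xfin by (simp add: splits_all_def)
    then obtain t :: "int \<Rightarrow> real" and \<beta> S where t: "\<And>k. 0 < t k" "\<And>\<tau>. 0 < \<tau> \<Longrightarrow> \<exists>k. t k / C \<le> \<tau> \<and> \<tau> \<le> C * t k"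
      and b0: "\<And>k. b_qnorm s0 p0 q0 \<Omega> (part (S k) \<mu>) \<le> ennreal (t k powr \<theta>) * \<beta> k"
      and b1: "\<And>k. ennreal (t k) * b_qnorm s1 p1 q1 \<Omega> (part (\<lambda>j. - S k j) \<mu>) \<le> ennreal (t k powr \<theta>) * \<beta> k"
      and \<beta>: "ell_qnorm q UNIV \<beta> \<le> ennreal C * b_qnorm s p q \<Omega> \<mu>"
      unfolding splits_def b_qnorm_part b_qnorm_eq_seq_qnorm[of s] by metis
    have \<beta>fin: "\<beta> k < top" for k
    proof -
      have "\<beta> k \<le> ell_qnorm q UNIV \<beta>" by (rule ell_qnorm_ge[OF q(1)]) simp
      also have "\<dots> \<le> ennreal C * b_qnorm s p q \<Omega> \<mu>" by (rule \<beta>)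
      also have "\<dots> < top" using \<mu>fin by (simp add: ennreal_mult_less_top)
      finally show ?thesis .
    qed
    have a0: "atom d0 K0 j m (a j m)" if "m \<in> meeting_cubes \<Omega> j" for j m
      by (rule atom_mono[OF a[OF that]]) (simp_all add: d'_def K'_def)
    have a1: "atom d1 K1 j m (a j m)" if "m \<in> meeting_cubes \<Omega> j" for j m
      by (rule atom_mono[OF a[OF that]]) (simp_all add: d'_def K'_def)
    have dec: "\<exists>f0\<in>vecs ?E. \<exists>f1\<in>vecs ?F. f = (\<lambda>x. f0 x + f1 x) \<and> qn ?E f0 + ennreal (t k) * qn ?F f1 \<le> ennreal (t k powr \<theta>) * (2 * \<beta> k)" for k
    proof -
      define \<mu>0 where "\<mu>0 = part (S k) \<mu>"
      define \<mu>1 where "\<mu>1 = part (\<lambda>j. - S k j) \<mu>"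
      have fin: "ennreal (t k powr \<theta>) * \<beta> k < top" using \<beta>fin by (simp add: ennreal_mult_less_top)
      have fin0: "b_qnorm s0 p0 q0 \<Omega> \<mu>0 < \<infinity>" using le_less_trans[OF b0 fin] by (simp add: \<mu>0_def)
      have fin1: "b_qnorm s1 p1 q1 \<Omega> \<mu>1 < \<infinity>" using le_less_trans[OF b1 fin] t(1)[of k] by (auto simp: \<mu>1_def ennreal_mult_less_top)
      have d01: "0 \<le> d0" "0 \<le> d1" "0 \<le> d'" using d d' by auto
      note syn0 = atomic_synthesis[OF bd meas d01(1) p(1) q(2) s(1) a0 fin0]
      note syn1 = atomic_synthesis[OF bd meas d01(2) p(2) q(3) s(2) a1 fin1]
      have sm0: "AE x in ?L. summable (\<lambda>j. norm (atom_sum \<Omega> \<mu>0 a j x))" by (rule syn0(1))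
      have sm1: "AE x in ?L. summable (\<lambda>j. norm (atom_sum \<Omega> \<mu>1 a j x))" by (rule syn1(1))
      have asum: "atom_sum \<Omega> \<mu> a j x = atom_sum \<Omega> \<mu>0 a j x + atom_sum \<Omega> \<mu>1 a j x" for j x
        unfolding atom_sum_def sum.distrib[symmetric] by (intro sum.cong refl) (auto simp: \<mu>0_def \<mu>1_def part_def)
      define f0 where "f0 x = (\<Sum>j. atom_sum \<Omega> \<mu>0 a j x)" for x
      define f1 where "f1 x = f x - f0 x" for x
      have f0m: "f0 \<in> borel_measurable ?L"
        unfolding f0_def[abs_def] by (intro borel_measurable_suminf atom_sum_measurable[OF a0])
      have f1m: "f1 \<in> borel_measurable ?L" unfolding f1_def[abs_def] using fm f0m by measurable
      have f0: "f0 \<in> vecs ?E \<and> qn ?E f0 \<le> b_qnorm s0 p0 q0 \<Omega> \<mu>0" by (rule syn0(2)[OF _ f0m]) (simp_all add: f0_def)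
      have f1: "f1 \<in> vecs ?F \<and> qn ?F f1 \<le> b_qnorm s1 p1 q1 \<Omega> \<mu>1"
      proof (rule syn1(2)[OF _ f1m])
        show "AE x in ?L. f1 x = (\<Sum>j. atom_sum \<Omega> \<mu>1 a j x)"
          using fa sm0 sm1
        proof eventually_elim
          case (elim x)
          have "f x = f0 x + (\<Sum>j. atom_sum \<Omega> \<mu>1 a j x)"
            unfolding elim(1) f0_def asum using elim(2,3) by (intro suminf_add[symmetric]) (auto intro: summable_norm_cancel)
          then show ?case by (simp add: f1_def)
        qed
      qed
      have "qn ?E f0 + ennreal (t k) * qn ?F f1 \<le> b_qnorm s0 p0 q0 \<Omega> \<mu>0 + ennreal (t k) * b_qnorm s1 p1 q1 \<Omega> \<mu>1"
        using f0 f1 by (intro add_mono mult_left_mono) auto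
      also have "\<dots> \<le> ennreal (t k powr \<theta>) * \<beta> k + ennreal (t k powr \<theta>) * \<beta> k"
        unfolding \<mu>0_def \<mu>1_def by (intro add_mono b0 b1)
      also have "\<dots> = ennreal (t k powr \<theta>) * (2 * \<beta> k)" by (simp add: mult_2 distrib_left)
      finally show ?thesis using f0 f1 by (intro bexI[of _ f0] bexI[of _ f1]) (auto simp: f1_def)
    qed
    have "interp_qnorm \<theta> q ?E ?F f \<le> ennreal Ci * ell_qnorm q UNIV (\<lambda>k. 2 * \<beta> k)"
    proof (rule Ci(2)[of t])
      show "K_functional ?E ?F (t k) f \<le> ennreal (t k powr \<theta>) * (2 * \<beta> k)" for k
        using dec[of k] K_functional_le order_trans by blast
    qed (use t in auto)
    also have "\<dots> = ennreal Ci * (2 * ell_qnorm q UNIV \<beta>)" unfolding ell_qnorm_cmult[OF q(1)] ..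
    also have "\<dots> \<le> ennreal Ci * (2 * (ennreal C * (ennreal P * qn ?B f)))"
      by (intro mult_left_mono order_trans[OF \<beta>] \<mu>le) auto
    also have "\<dots> = ennreal C' * qn ?B f" using Ci(1) C P by (simp add: C'_def ennreal_mult mult.assoc)
    finally have le: "interp_qnorm \<theta> q ?E ?F f \<le> ennreal C' * qn ?B f" .
    moreover have "f \<in> vecs (interp \<theta> q ?E ?F)"
    proof -
      have "interp_qnorm \<theta> q ?E ?F f < \<infinity>"
        using le_less_trans[OF le] besov_qn_finite[OF f] by (simp add: ennreal_mult_less_top)
      then show ?thesis using dec[of 0] by (auto simp: interp_def)
    qed
    ultimately show "f \<in> vecs (interp \<theta> q ?E ?F) \<and> interp_qnorm \<theta> q ?E ?F f \<le> ennreal C' * qn ?B f" by blast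
  qed
qed

text \<open>
  Because oscillations are subadditive up to constants, a decomposition of \<open>f\<close> splits its oscillation sequence. The bound on the
  oscillations turns into membership in the Besov space by atomic analysis and synthesis.
\<close>

lemma interp_le_besov:
  fixes \<Omega> :: "(real ^ 'n) set"
  assumes bd: "bounded \<Omega>" and meas: "\<Omega> \<in> sets lebesgue" and cork: "corkscrew c0 \<Omega>"
    and u: "0 < u" "u \<le> 1" "ennreal u \<le> p" "ennreal u \<le> p0" "ennreal u \<le> p1" and q: "0 < q" "0 < q0" "0 < q1" and th: "0 < \<theta>"
    and s: "0 < s0" "s0 < 1" "0 < s1" "s1 < 1" "0 < s" "s < 1" and d: "1 \<le> d0" "1 \<le> d1" "1 \<le> d" and K: "1 \<le> K0" "1 \<le> K1"
    and C: "0 < C" and sub: "sub_interp C \<theta> q (seq_qnorm s0 p0 q0 \<Omega>) (seq_qnorm s1 p1 q1 \<Omega>) (seq_qnorm s p q \<Omega>)"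
  obtains C' where "0 < C'" "\<And>f. f \<in> vecs (interp \<theta> q (besov d0 K0 s0 p0 q0 \<Omega>) (besov d1 K1 s1 p1 q1 \<Omega>)) \<Longrightarrow>
      f \<in> vecs (besov d K s p q \<Omega>) \<and>
      qn (besov d K s p q \<Omega>) f \<le> ennreal C' * interp_qnorm \<theta> q (besov d0 K0 s0 p0 q0 \<Omega>) (besov d1 K1 s1 p1 q1 \<Omega>) f"
proof -
  let ?Q = "seq_qnorm s p q \<Omega>"
  let ?L = "lebesgue_on \<Omega>"
  let ?E = "besov d0 K0 s0 p0 q0 \<Omega>" and ?F = "besov d1 K1 s1 p1 q1 \<Omega>" and ?B = "besov d K s p q \<Omega>"
  have p: "0 < p" "0 < p0" "0 < p1" using u by (metis ennreal_less_zero_iff less_le_trans)+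
  obtain C0 where C0: "0 < C0"
    "\<And>f. f \<in> vecs ?E \<Longrightarrow> seq_qnorm s0 p0 q0 \<Omega> (osc_seq u \<Omega> f) \<le> ennreal C0 * qn ?E f"
    "\<And>f. f \<in> vecs ?E \<Longrightarrow> Lu_qnorm u \<Omega> f \<le> ennreal C0 * qn ?E f"
    using besov_osc_seq_le[OF bd meas _ K(1) u(1,2,4) q(2) s(1,2), of d0] d by auto
  obtain C1 where C1: "0 < C1"
    "\<And>f. f \<in> vecs ?F \<Longrightarrow> seq_qnorm s1 p1 q1 \<Omega> (osc_seq u \<Omega> f) \<le> ennreal C1 * qn ?F f"
    "\<And>f. f \<in> vecs ?F \<Longrightarrow> Lu_qnorm u \<Omega> f \<le> ennreal C1 * qn ?F f"
    using besov_osc_seq_le[OF bd meas _ K(2) u(1,2,5) q(3) s(3,4), of d1] d by auto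
  define M where "M = max C0 C1"
  have M: "0 < M" "C0 \<le> M" "C1 \<le> M" using C0 C1 by (auto simp: M_def)
  have CM: "ennreal C0 * x \<le> ennreal M * x" "ennreal C1 * x \<le> ennreal M * x" for x
    using M by (auto intro!: mult_right_mono ennreal_leI)
  define A where "A = 2 powr (1 / u)"
  have A: "0 < A" by (simp add: A_def)
  obtain C2 where C2: "0 < C2" "\<And>(A0 :: (real ^ 'n \<Rightarrow> complex) qn_space) A1 f.
    ell_qnorm q (UNIV :: int set) (\<lambda>k. ennreal (2 powr (- real_of_int k * \<theta>)) * K_functional A0 A1 (2 powr real_of_int k) f)
      \<le> ennreal C2 * interp_qnorm \<theta> q A0 A1 f"
    using ell_qnorm_K_functional_le[of 2, OF _ th q(1)] by auto
  obtain Ca where Ca: "0 < Ca" "\<And>f. f \<in> borel_measurable ?L \<Longrightarrow> ?Q (osc_seq u \<Omega> f) < top \<Longrightarrow>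
     Lu_qnorm u \<Omega> f < top \<Longrightarrow> \<exists>\<mu> a. (\<forall>j. \<forall>m\<in>meeting_cubes \<Omega> j. atom d K j m (a j m)) \<and>
       (AE x in ?L. f x = (\<Sum>j. atom_sum \<Omega> \<mu> a j x)) \<and>
       b_qnorm s p q \<Omega> \<mu> \<le> ennreal Ca * (?Q (osc_seq u \<Omega> f) + Lu_qnorm u \<Omega> f)"
    by (rule atomic_analysis[OF bd meas cork u(1,2,3) q(1) s(5,6) d(3), where K = K]) (rule that)
  define C' where "C' = Ca * (A * M * C + A * M * C2)"
  show ?thesis
  proof (rule that[of C'])
    show "0 < C'" using A M C C2 Ca by (simp add: C'_def add_pos_pos)
    fix f assume f: "f \<in> vecs (interp \<theta> q ?E ?F)"
    let ?N = "interp_qnorm \<theta> q ?E ?F f"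
    have Nfin: "?N < top" using f by (simp add: interp_def)
    have fm: "f \<in> borel_measurable ?L"
    proof -
      obtain f0 f1 where f01: "f0 \<in> vecs ?E" "f1 \<in> vecs ?F" "f = (\<lambda>x. f0 x + f1 x)"
        using f by (auto simp: interp_def)
      have [measurable]: "f0 \<in> borel_measurable ?L" "f1 \<in> borel_measurable ?L"
        using besov_measurable f01 by blast+
      show ?thesis unfolding f01(3) by measurable
    qed
    define y where "y j m = ennreal (1 / (A * M)) * osc_seq u \<Omega> f j m" for j m
    have "\<exists>z0 z1. (\<forall>j m. y j m \<le> z0 j m + z1 j m) \<and> seq_qnorm s0 p0 q0 \<Omega> z0 \<le> qn ?E f0 \<and> seq_qnorm s1 p1 q1 \<Omega> z1 \<le> qn ?F f1"
      if f01: "f0 \<in> vecs ?E" "f1 \<in> vecs ?F" "f = (\<lambda>x. f0 x + f1 x)" for f0 f1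
    proof (rule exI[of _ "\<lambda>j m. ennreal (1 / M) * osc_seq u \<Omega> f0 j m"], rule exI[of _ "\<lambda>j m. ennreal (1 / M) * osc_seq u \<Omega> f1 j m"], intro conjI allI)
      fix j m
      have "y j m \<le> ennreal (1 / (A * M)) * (ennreal A * (osc_seq u \<Omega> f0 j m + osc_seq u \<Omega> f1 j m))"
        unfolding y_def f01(3) A_def using besov_measurable[OF f01(1)] besov_measurable[OF f01(2)] u
        by (intro mult_left_mono osc_seq_add_le) auto
      also have "\<dots> = ennreal (1 / (A * M) * A) * (osc_seq u \<Omega> f0 j m + osc_seq u \<Omega> f1 j m)"
        using A M by (subst ennreal_mult) (simp_all add: mult.assoc)
      also have "1 / (A * M) * A = 1 / M" using A by simp
      finally show "y j m \<le> ennreal (1 / M) * osc_seq u \<Omega> f0 j m + ennreal (1 / M) * osc_seq u \<Omega> f1 j m" by (simp add: distrib_left)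
    next
      have cancel: "ennreal (1 / M) * (ennreal M * x) = x" for x
        using M by (simp add: mult.assoc[symmetric] flip: ennreal_mult)
      have "seq_qnorm s0 p0 q0 \<Omega> (\<lambda>j m. ennreal (1 / M) * osc_seq u \<Omega> f0 j m) \<le> ennreal (1 / M) * (ennreal M * qn ?E f0)"
        unfolding seq_qnorm_cmult[OF p(2) q(2)] by (intro mult_left_mono order_trans[OF C0(2)[OF f01(1)] CM(1)]) simp
      then show "seq_qnorm s0 p0 q0 \<Omega> (\<lambda>j m. ennreal (1 / M) * osc_seq u \<Omega> f0 j m) \<le> qn ?E f0" by (simp only: cancel)
      have "seq_qnorm s1 p1 q1 \<Omega> (\<lambda>j m. ennreal (1 / M) * osc_seq u \<Omega> f1 j m) \<le> ennreal (1 / M) * (ennreal M * qn ?F f1)"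
        unfolding seq_qnorm_cmult[OF p(3) q(3)] by (intro mult_left_mono order_trans[OF C1(2)[OF f01(2)] CM(2)]) simp
      then show "seq_qnorm s1 p1 q1 \<Omega> (\<lambda>j m. ennreal (1 / M) * osc_seq u \<Omega> f1 j m) \<le> qn ?F f1" by (simp only: cancel)
    qed
    then have "?Q y \<le> ennreal C * ?N"
      using sub unfolding sub_interp_def by blast
    then have "ennreal (A * M) * ?Q y \<le> ennreal (A * M) * (ennreal C * ?N)" by (rule mult_left_mono) simp
    moreover have "ennreal (A * M) * ?Q y = ?Q (osc_seq u \<Omega> f)"
      unfolding y_def seq_qnorm_cmult[OF p(1) q(1)] using A M by (simp add: mult.assoc[symmetric] flip: ennreal_mult)
    ultimately have seq: "?Q (osc_seq u \<Omega> f) \<le> ennreal (A * M * C) * ?N"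
      using A M C by (simp add: ennreal_mult mult.assoc)
    \<comment> \<open>At \<open>t = 1\<close> the \<open>K\<close>-functional controls the \<open>L\<^sub>u\<close> quasi-norm.\<close>
    have Lu: "Lu_qnorm u \<Omega> f \<le> ennreal (A * M * C2) * ?N"
    proof -
      have "Lu_qnorm u \<Omega> f / ennreal (A * M) \<le> K_functional ?E ?F 1 f"
      proof (rule K_functional_greatest)
        fix f0 f1 assume f01: "f0 \<in> vecs ?E" "f1 \<in> vecs ?F" "f = (\<lambda>x. f0 x + f1 x)"
        have "Lu_qnorm u \<Omega> f \<le> ennreal A * (Lu_qnorm u \<Omega> f0 + Lu_qnorm u \<Omega> f1)"
          unfolding f01(3) A_def using besov_measurable[OF f01(1)] besov_measurable[OF f01(2)] u by (intro Lu_qnorm_add_le) auto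
        also have "\<dots> \<le> ennreal A * (ennreal M * qn ?E f0 + ennreal M * qn ?F f1)"
          by (intro mult_left_mono add_mono order_trans[OF C0(3)[OF f01(1)] CM(1)] order_trans[OF C1(3)[OF f01(2)] CM(2)]) simp
        also have "\<dots> = (qn ?E f0 + ennreal 1 * qn ?F f1) * ennreal (A * M)"
          using A M by (simp add: ennreal_mult algebra_simps)
        finally show "Lu_qnorm u \<Omega> f / ennreal (A * M) \<le> qn ?E f0 + ennreal 1 * qn ?F f1"
          using A M by (intro divide_le_posI_ennreal) (auto simp: mult.commute)
      qed
      also have "\<dots> \<le> ennreal C2 * ?N"
        using order_trans[OF ell_qnorm_ge[OF q(1), of 0 UNIV] C2(2)[of ?E ?F f]] by simp
      finally have "ennreal (A * M) * (Lu_qnorm u \<Omega> f / ennreal (A * M)) \<le> ennreal (A * M) * (ennreal C2 * ?N)" by (rule mult_left_mono) simp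
      then show ?thesis using A M C2(1)
        by (simp add: ennreal_times_divide mult.commute[of "ennreal (A * M)" "Lu_qnorm u \<Omega> f"] ennreal_mult_divide_eq) (simp add: ennreal_mult mult.assoc)
    qed
    have sum: "?Q (osc_seq u \<Omega> f) + Lu_qnorm u \<Omega> f \<le> ennreal (A * M * C + A * M * C2) * ?N"
      using add_mono[OF seq Lu] A M C C2(1) by (simp add: distrib_right)
    have top: "ennreal c * ?N < top" for c using Nfin by (simp add: ennreal_mult_less_top)
    obtain \<mu> a where a: "\<And>j m. m \<in> meeting_cubes \<Omega> j \<Longrightarrow> atom d K j m (a j m)"
      and fa: "AE x in ?L. f x = (\<Sum>j. atom_sum \<Omega> \<mu> a j x)"
      and \<mu>: "b_qnorm s p q \<Omega> \<mu> \<le> ennreal Ca * (?Q (osc_seq u \<Omega> f) + Lu_qnorm u \<Omega> f)"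
      using Ca(2)[OF fm le_less_trans[OF seq top] le_less_trans[OF Lu top]] by blast
    have "b_qnorm s p q \<Omega> \<mu> \<le> ennreal Ca * (ennreal (A * M * C + A * M * C2) * ?N)"
      by (rule order_trans[OF \<mu> mult_left_mono[OF sum]]) simp
    also have "\<dots> = ennreal C' * ?N" using A M C C2(1) Ca(1) by (simp add: C'_def ennreal_mult mult.assoc)
    finally have le: "b_qnorm s p q \<Omega> \<mu> \<le> ennreal C' * ?N" .
    then have fin: "b_qnorm s p q \<Omega> \<mu> < \<infinity>" using top le_less_trans by simp blast
    have "0 \<le> d" using d by simp
    then have "f \<in> vecs ?B \<and> qn ?B f \<le> b_qnorm s p q \<Omega> \<mu>"
      using atomic_synthesis(2)[OF bd meas _ p(1) q(1) s(5) a fin fm fa] by blast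
    then show "f \<in> vecs ?B \<and> qn ?B f \<le> ennreal C' * ?N" using le order_trans by blast
  qed
qed

lemma interp_besov_equal:
  fixes \<Omega> :: "(real ^ 'n) set"
  assumes bd: "bounded \<Omega>" and meas: "\<Omega> \<in> sets lebesgue" and cork: "corkscrew c0 \<Omega>"
    and p: "0 < p" "0 < p0" "0 < p1" and q: "0 < q" "0 < q0" "0 < q1" and th: "0 < \<theta>"
    and s: "0 < s0" "s0 < 1" "0 < s1" "s1 < 1" "0 < s" "s < 1" and d: "1 \<le> d0" "1 \<le> d1" "1 \<le> d"
    and K: "1 \<le> K0" "1 \<le> K1" "1 \<le> K"
    and C: "1 \<le> C" and sp: "splits_all C \<theta> q (seq_qnorm s0 p0 q0 \<Omega>) (seq_qnorm s1 p1 q1 \<Omega>) (seq_qnorm s p q \<Omega>)"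
    and C': "0 < C'" and sub: "sub_interp C' \<theta> q (seq_qnorm s0 p0 q0 \<Omega>) (seq_qnorm s1 p1 q1 \<Omega>) (seq_qnorm s p q \<Omega>)"
  shows "equal_spaces (interp \<theta> q (besov d0 K0 s0 p0 q0 \<Omega>) (besov d1 K1 s1 p1 q1 \<Omega>)) (besov d K s p q \<Omega>)"
proof -
  let ?I = "interp \<theta> q (besov d0 K0 s0 p0 q0 \<Omega>) (besov d1 K1 s1 p1 q1 \<Omega>)" and ?B = "besov d K s p q \<Omega>"
  obtain u where u: "0 < u" "u \<le> 1" "ennreal u \<le> p" "ennreal u \<le> p0" "ennreal u \<le> p1"
  proof -
    define x where "x = min 1 (min p (min p0 p1))"
    have xs: "x \<le> 1" "x \<le> p" "x \<le> p0" "x \<le> p1" by (simp_all add: x_def min_le_iff_disj)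
    have "0 < x" using p by (simp add: x_def)
    moreover have "x < top" by (rule le_less_trans[OF xs(1) ennreal_one_less_top])
    ultimately have x: "0 < enn2real x" "ennreal (enn2real x) = x" by (simp_all add: enn2real_positive_iff)
    then have "enn2real x \<le> 1" using xs(1) by (metis ennreal_1 ennreal_le_iff zero_le_one)
    then show ?thesis using that[of "enn2real x"] x xs by simp
  qed
  have qnI: "qn ?I f = interp_qnorm \<theta> q (besov d0 K0 s0 p0 q0 \<Omega>) (besov d1 K1 s1 p1 q1 \<Omega>) f" for f by (simp add: interp_def)
  obtain A where A: "0 < A" "\<And>f. f \<in> vecs ?B \<Longrightarrow> f \<in> vecs ?I \<and> qn ?I f \<le> ennreal A * qn ?B f"
    unfolding qnI by (rule besov_le_interp[OF bd meas cork u(1-3) p(2,3) q th s(1,3,5,6) d K(3) C sp, where ?K0.0 = K0 and ?K1.0 = K1]) (auto intro: that[unfolded qnI])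
  obtain D where D: "0 < D" "\<And>f. f \<in> vecs ?I \<Longrightarrow> f \<in> vecs ?B \<and> qn ?B f \<le> ennreal D * qn ?I f"
    unfolding qnI by (rule interp_le_besov[OF bd meas cork u q th s d K(1,2) C' sub, where K = K]) (auto intro: that[unfolded qnI])
  show ?thesis unfolding equal_spaces_def
  proof (intro conjI exI ballI)
    show eq: "vecs ?I = vecs ?B" using A(2) D(2) by blast
    show "0 < 1 / D" "0 < A" using A D by simp_all
    fix f assume f: "f \<in> vecs ?I"
    then show "qn ?I f \<le> ennreal A * qn ?B f" using A(2) eq by blast
    have "ennreal (1 / D) * qn ?B f \<le> ennreal (1 / D) * (ennreal D * qn ?I f)" using D(2)[OF f] by (intro mult_left_mono) auto
    also have "\<dots> = qn ?I f" using D(1) by (simp add: mult.assoc[symmetric] flip: ennreal_mult)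
    finally show "ennreal (1 / D) * qn ?B f \<le> qn ?I f" .
  qed
qed

lemma inv_exp_eqI:
  assumes "1 / p = ennreal (1 - \<theta>) / p0 + ennreal \<theta> / p1" "0 < p0" "0 < p1" "0 < \<theta>" "\<theta> < 1"
  shows "0 < p" "inv_exp p = (1 - \<theta>) * inv_exp p0 + \<theta> * inv_exp p1"
proof -
  have fin: "1 / p0 < top" "1 / p1 < top" unfolding less_top[symmetric] using assms(2,3) by (auto simp: ennreal_divide_eq_top_iff)
  have eq: "1 / p = ennreal (1 - \<theta>) * (1 / p0) + ennreal \<theta> * (1 / p1)" using assms(1) by (simp add: ennreal_times_divide)
  also have "\<dots> < top" using fin by (simp add: ennreal_mult_less_top)
  finally show "0 < p" by (cases "p = 0") (auto simp: zero_less_iff_neq_zero ennreal_divide_eq_top_iff)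
  show "inv_exp p = (1 - \<theta>) * inv_exp p0 + \<theta> * inv_exp p1"
    unfolding inv_exp_def eq using fin assms(4,5) by (simp add: enn2real_plus enn2real_mult ennreal_mult_less_top)
qed

lemma inv_exp_inj: "0 < p \<Longrightarrow> 0 < p' \<Longrightarrow> inv_exp p = inv_exp p' \<Longrightarrow> p = p'"
  by (erule exponent_cases; erule exponent_cases) (auto simp: infinity_ennreal_def)

theorem interp_besov_same_p:
  fixes \<Omega> :: "(real ^ 'n) set"
  assumes dom: "bounded \<Omega>" "\<Omega> \<in> sets lebesgue" "corkscrew c0 \<Omega>"
    and pq: "0 < p" "0 < q" "0 < q0" "0 < q1"
    and s: "s0 \<noteq> s1" "0 < s0" "s0 < 1" "0 < s1" "s1 < 1" and th: "0 < \<theta>" "\<theta> < 1" and ss: "s = (1 - \<theta>) * s0 + \<theta> * s1"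
    and d: "1 \<le> d0" "1 \<le> d1" "1 \<le> d" and K: "1 \<le> K0" "1 \<le> K1" "1 \<le> K"
  shows "equal_spaces (interp \<theta> q (besov d0 K0 s0 p q0 \<Omega>) (besov d1 K1 s1 p q1 \<Omega>)) (besov d K s p q \<Omega>)"
proof -
  obtain C where C: "1 \<le> C" "splits_all C \<theta> q (seq_qnorm s0 p q0 \<Omega>) (seq_qnorm s1 p q1 \<Omega>) (seq_qnorm s p q \<Omega>)"
    using splits_same_p[OF pq s(1) th ss] by blast
  obtain C' where C': "0 < C'" "sub_interp C' \<theta> q (seq_qnorm s0 p q0 \<Omega>) (seq_qnorm s1 p q1 \<Omega>) (seq_qnorm s p q \<Omega>)"
    using sub_interp_same_p[OF pq s(1) th ss] by blast
  have "0 < s" "s < 1"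
    using s th convex_bound_lt[of s0 1 s1 "1 - \<theta>" \<theta>] by (auto simp: ss add_pos_pos)
  then show ?thesis
    by (intro interp_besov_equal[OF dom pq(1,1,1) pq(2-4) th(1) s(2-5) _ _ d K C(1) C(2) C'])
qed

theorem interp_besov_diagonal:
  fixes \<Omega> :: "(real ^ 'n) set"
  assumes dom: "bounded \<Omega>" "\<Omega> \<in> sets lebesgue" "corkscrew c0 \<Omega>"
    and p: "0 < p0" "0 < p1" and q: "0 < q0" "0 < q1"
    and s: "s0 \<noteq> s1" "0 < s0" "s0 < 1" "0 < s1" "s1 < 1" and th: "0 < \<theta>" "\<theta> < 1" and ss: "s = (1 - \<theta>) * s0 + \<theta> * s1"
    and pp: "1 / p = ennreal (1 - \<theta>) / p0 + ennreal \<theta> / p1" and qq: "1 / p = ennreal (1 - \<theta>) / q0 + ennreal \<theta> / q1"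
    and d: "1 \<le> d0" "1 \<le> d1" "1 \<le> d" and K: "1 \<le> K0" "1 \<le> K1" "1 \<le> K"
  shows "equal_spaces (interp \<theta> p (besov d0 K0 s0 p0 q0 \<Omega>) (besov d1 K1 s1 p1 q1 \<Omega>)) (besov d K s p p \<Omega>)"
proof -
  have p0: "0 < p" and ip: "inv_exp p = (1 - \<theta>) * inv_exp p0 + \<theta> * inv_exp p1" using inv_exp_eqI[OF pp p th] by blast+
  have iq: "inv_exp p = (1 - \<theta>) * inv_exp q0 + \<theta> * inv_exp q1" using inv_exp_eqI[OF qq q th] by blast
  show ?thesis
  \<comment> \<open>A cut by heights requires different integrability exponents; equal ones are covered by the cut at a level.\<close>
  proof (cases "inv_exp p0 = inv_exp p1")
    case True
    then have "inv_exp p = inv_exp p0" using ip by (simp add: algebra_simps)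
    then have "p1 = p" "p0 = p" using inv_exp_inj p p0 True by metis+
    then show ?thesis using interp_besov_same_p[OF dom p0 p0 q s th ss d K] by simp
  next
    case False
    obtain r where r: "p = ennreal r" "0 < r"
      using p0
    proof (cases rule: exponent_cases)
      case 1
      then have "(1 - \<theta>) * inv_exp p0 = 0 \<and> \<theta> * inv_exp p1 = 0" using ip th by (auto simp: add_nonneg_eq_0_iff)
      then show ?thesis using th False by auto
    qed (use that in blast)
    have rp: "1 / r = (1 - \<theta>) * inv_exp p0 + \<theta> * inv_exp p1" and rq: "1 / r = (1 - \<theta>) * inv_exp q0 + \<theta> * inv_exp q1"
      using ip iq r by auto
    obtain C where C: "1 \<le> C" "splits_all C \<theta> (ennreal r) (seq_qnorm s0 p0 q0 \<Omega>) (seq_qnorm s1 p1 q1 \<Omega>) (seq_qnorm s (ennreal r) (ennreal r) \<Omega>)"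
      by (rule splits_diagonal[OF dom(1) r(2) p q th ss rp rq False]) (rule that)
    obtain C' where C': "0 < C'" "sub_interp C' \<theta> (ennreal r) (seq_qnorm s0 p0 q0 \<Omega>) (seq_qnorm s1 p1 q1 \<Omega>) (seq_qnorm s (ennreal r) (ennreal r) \<Omega>)"
      by (rule sub_interp_diagonal[OF r(2) p q th ss rp rq, where \<Omega> = \<Omega>]) (rule that)
    have "0 < s" "s < 1"
      using s th convex_bound_lt[of s0 1 s1 "1 - \<theta>" \<theta>] by (auto simp: ss add_pos_pos)
    then show ?thesis
      unfolding r(1) using p0 unfolding r(1)
      by (intro interp_besov_equal[OF dom _ p _ q th(1) s(2-5) _ _ d K C(1) C(2) C'])
  qed
qed

theorem theorem3p10:
  fixes \<Omega> :: "(real ^ 'n) set"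
  assumes "bounded_lipschitz_domain \<Omega>"
  shows
    "(\<forall>(p::ennreal) (q::ennreal) (q\<^sub>0::ennreal) (q\<^sub>1::ennreal) (s\<^sub>0::real) (s\<^sub>1::real) (s::real) (\<theta>::real)
        (d\<^sub>0::real) (d\<^sub>1::real) (d::real) (K\<^sub>0::nat) (K\<^sub>1::nat) (K::nat).
        0 < p \<and> 0 < q \<and> 0 < q\<^sub>0 \<and> 0 < q\<^sub>1 \<and>
        s\<^sub>0 \<noteq> s\<^sub>1 \<and> 0 < s\<^sub>0 \<and> s\<^sub>0 < 1 \<and> 0 < s\<^sub>1 \<and> s\<^sub>1 < 1 \<and>
        0 < \<theta> \<and> \<theta> < 1 \<and> s = (1 - \<theta>) * s\<^sub>0 + \<theta> * s\<^sub>1 \<and>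
        1 < d\<^sub>0 \<and> 1 < d\<^sub>1 \<and> 1 < d \<and>
        1 + \<lfloor>s\<^sub>0\<rfloor> \<le> int K\<^sub>0 \<and> 1 + \<lfloor>s\<^sub>1\<rfloor> \<le> int K\<^sub>1 \<and> 1 + \<lfloor>s\<rfloor> \<le> int K
        \<longrightarrow> equal_spaces
              (interp \<theta> q (besov d\<^sub>0 K\<^sub>0 s\<^sub>0 p q\<^sub>0 \<Omega>) (besov d\<^sub>1 K\<^sub>1 s\<^sub>1 p q\<^sub>1 \<Omega>))
              (besov d K s p q \<Omega>))
     \<and>
     (\<forall>(p\<^sub>0::ennreal) (p\<^sub>1::ennreal) (q\<^sub>0::ennreal) (q\<^sub>1::ennreal) (p::ennreal) (q::ennreal)
        (s\<^sub>0::real) (s\<^sub>1::real) (s::real) (\<theta>::real)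
        (d\<^sub>0::real) (d\<^sub>1::real) (d::real) (K\<^sub>0::nat) (K\<^sub>1::nat) (K::nat).
        0 < p\<^sub>0 \<and> 0 < p\<^sub>1 \<and> 0 < q\<^sub>0 \<and> 0 < q\<^sub>1 \<and>
        s\<^sub>0 \<noteq> s\<^sub>1 \<and> 0 < s\<^sub>0 \<and> s\<^sub>0 < 1 \<and> 0 < s\<^sub>1 \<and> s\<^sub>1 < 1 \<and>
        0 < \<theta> \<and> \<theta> < 1 \<and> s = (1 - \<theta>) * s\<^sub>0 + \<theta> * s\<^sub>1 \<and>
        1 / p = ennreal (1 - \<theta>) / p\<^sub>0 + ennreal \<theta> / p\<^sub>1 \<and>
        1 / q = ennreal (1 - \<theta>) / q\<^sub>0 + ennreal \<theta> / q\<^sub>1 \<and>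
        p = q \<and>
        1 < d\<^sub>0 \<and> 1 < d\<^sub>1 \<and> 1 < d \<and>
        1 + \<lfloor>s\<^sub>0\<rfloor> \<le> int K\<^sub>0 \<and> 1 + \<lfloor>s\<^sub>1\<rfloor> \<le> int K\<^sub>1 \<and> 1 + \<lfloor>s\<rfloor> \<le> int K
        \<longrightarrow> equal_spaces
              (interp \<theta> q (besov d\<^sub>0 K\<^sub>0 s\<^sub>0 p\<^sub>0 q\<^sub>0 \<Omega>) (besov d\<^sub>1 K\<^sub>1 s\<^sub>1 p\<^sub>1 q\<^sub>1 \<Omega>))
              (besov d K s p q \<Omega>))"
proof -
  obtain c where "corkscrew c \<Omega>" using bounded_lipschitz_domain_corkscrew[OF assms] by blast
  then have dom: "bounded \<Omega>" "\<Omega> \<in> sets lebesgue" "corkscrew c \<Omega>"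
    using assms by (auto simp: bounded_lipschitz_domain_def)
  have K1: "1 \<le> K" if "1 + \<lfloor>t\<rfloor> \<le> int K" "0 < t" for t :: real and K :: nat
  proof -
    have "0 \<le> \<lfloor>t\<rfloor>" using that(2) by simp
    then show ?thesis using that(1) by linarith
  qed
  have spos: "0 < (1 - \<theta>) * s0 + \<theta> * s1" if "0 < \<theta>" "\<theta> < 1" "0 < s0" "0 < s1" for \<theta> s0 s1 :: real
    using that by (simp add: add_pos_pos)
  show ?thesis
  proof (intro conjI allI impI; elim conjE)
    fix p q q0 q1 :: ennreal and s0 s1 s \<theta> d0 d1 d :: real and K0 K1 K :: nat
    assume *: "0 < p" "0 < q" "0 < q0" "0 < q1" "s0 \<noteq> s1" "0 < s0" "s0 < 1" "0 < s1" "s1 < 1" "0 < \<theta>" "\<theta> < 1"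
      "s = (1 - \<theta>) * s0 + \<theta> * s1" and d: "1 < d0" "1 < d1" "1 < d"
      and K: "1 + \<lfloor>s0\<rfloor> \<le> int K0" "1 + \<lfloor>s1\<rfloor> \<le> int K1" "1 + \<lfloor>s\<rfloor> \<le> int K"
    have s: "0 < s" using spos * by simp
    show "equal_spaces (interp \<theta> q (besov d0 K0 s0 p q0 \<Omega>) (besov d1 K1 s1 p q1 \<Omega>)) (besov d K s p q \<Omega>)"
      using d by (intro interp_besov_same_p[OF dom *] K1[OF K(1) *(6)] K1[OF K(2) *(8)] K1[OF K(3) s]) simp_all
  next
    fix p0 p1 q0 q1 p q :: ennreal and s0 s1 s \<theta> d0 d1 d :: real and K0 K1 K :: nat
    assume *: "0 < p0" "0 < p1" "0 < q0" "0 < q1" "s0 \<noteq> s1" "0 < s0" "s0 < 1" "0 < s1" "s1 < 1" "0 < \<theta>" "\<theta> < 1"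
      "s = (1 - \<theta>) * s0 + \<theta> * s1" and pq: "1 / p = ennreal (1 - \<theta>) / p0 + ennreal \<theta> / p1"
      "1 / q = ennreal (1 - \<theta>) / q0 + ennreal \<theta> / q1" "p = q" and d: "1 < d0" "1 < d1" "1 < d"
      and K: "1 + \<lfloor>s0\<rfloor> \<le> int K0" "1 + \<lfloor>s1\<rfloor> \<le> int K1" "1 + \<lfloor>s\<rfloor> \<le> int K"
    have s: "0 < s" using spos * by simp
    show "equal_spaces (interp \<theta> q (besov d0 K0 s0 p0 q0 \<Omega>) (besov d1 K1 s1 p1 q1 \<Omega>)) (besov d K s p q \<Omega>)"
      unfolding pq(3) using d pq(1,2)[unfolded pq(3)]
      by (intro interp_besov_diagonal[OF dom *] K1[OF K(1) *(6)] K1[OF K(2) *(8)] K1[OF K(3) s]) simp_all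
  qed
qed

end
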